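(* Let $R$ be a commutative noetherian ring, let $I$ be an ideal of $R$, and let $\boldsymbol{x}=x_1,\dots,x_n$ be a system of generators of $I$. (1) Let $M$ be a finitely generated $R$-module such that $I\,\mathrm{Ext}_R^1(M,\Omega_R M)=0$. Then there exists a finitely generated $R/I$-module $L$ such that $M$ belongs to $\left|\bigoplus_{i=0}^n\Omega_R^iL\right|_{n+1}$. (2) One has $$\begin{aligned} \mathrm{NF}^{-1}(V(I))&=\mathrm{ext}\left\{\Omega_R^i(R/\mathfrak p)\mid 0\le i\le n,\ \mathfrak p\in V(I)\right\}\\ &=\left|\bigoplus_{i=0}^n\mathrm{ext}\,\Omega_R^i\{R/\mathfrak p\}_{\mathfrak p\in V(I)}\right|_{n+1}\\ &=\left|\bigcup_{e>0,\,0\le i\le n}\Omega_R^i(\mathrm{mod}\,R/I^{[e]})\right|_{n+1}\\ &=\bigcup_{e>0}\ \bigcup_{X\in\bigoplus_{i=0}^n\Omega_R^i(\mathrm{mod}\,R/I^{[e]})}|X|_{n+1}, \end{aligned}$$ where $I^{[e]}$ is the ideal of $R$ generated by $\boldsymbol{x}^e=x_1^e,\dots,x_n^e$.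
   Context: All modules are finitely generated; $\mathrm{mod}\,R$ is the category of finitely generated $R$-modules. Subcategories are full and closed under isomorphism. $V(I)$ is the set of prime ideals of $R$ containing $I$. Modules over $R/I$ or $R/I^{[e]}$ are regarded as $R$-modules. Nonfree locus: $\mathrm{NF}(M)$ is the set of prime ideals $\mathfrak p$ of $R$ such that $M_{\mathfrak p}$ is not a free $R_{\mathfrak p}$-module. For $W\subseteq\mathrm{Spec}\,R$, $\mathrm{NF}^{-1}(W)$ is the subcategory of modules $M\in\mathrm{mod}\,R$ with $\mathrm{NF}(M)\subseteq W$. Syzygies: for a subcategory $\mathcal X$ of $\mathrm{mod}\,R$ and $i\ge0$, $\Omega_R^i\mathcal X$ is the subcategory of $i$-th syzygies of modules in $\mathcal X$, i.e. of those modules $M$ admitting an exact sequence $0\to M\to P_{i-1}\to\cdots\to P_0\to X\to0$ with each $P_j$ free over $R$ and $X\in\mathcal X$. For a single module $X$, $\Omega_R^iX$ denotes an $i$-th syzygy of $X$ in this sense, and $\Omega_RX=\Omega^1_RX$. $\bigoplus_{i=0}^n\mathcal X_i$ is the subcategory of modules of the form $\bigoplus_{i=0}^nX_i$ with $X_i\in\mathcal X_i$; $\bigcup_\lambda\mathcal X_\lambda$ is the subcategory of modules lying in $\mathcal X_\lambda$ for some $\lambda$. $\mathrm{add}\,\mathcal X$ is the smallest subcategory of $\mathrm{mod}\,R$ containing $\mathcal X$ and closed under finite direct sums and direct summands; $\mathrm{ext}\,\mathcal X$ is the smallest subcategory of $\mathrm{mod}\,R$ containing $\mathcal X$ and closed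 under direct summands and extensions. For $r\ge 0$, $|\mathcal X|_r$ is the subcategory of modules $M$ that are direct summands of a module $N$ having a filtration $0=N_0\subseteq N_1\subseteq\cdots\subseteq N_r=N$ by submodules with all subquotients $N_j/N_{j-1}$ in $\mathrm{add}\,\mathcal X$. For a single module $X$, $|X|_r=|\{X\}|_r$.
   Formalization: In (2), the first two descriptions of NF^{-1}(V(I)) (those by syzygies of R/p) are stated only for I ≠ R: if I = R ≠ 0, then V(I) is empty and the right-hand sides contain at most 0, while NF^{-1}(∅) contains R. *)

theory Defs
  imports "HOL-Algebra.Ring_Divisibility"
begin

section \<open>Modules, homomorphisms and basic constructions\<close>

text \<open>Modules are the records of \<^locale>\<open>module\<close>; the fields \<open>mult\<close> and \<open>one\<close>
  which they inherit from rings carry no meaning and are left unspecified.\<close>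

definition mod_hom ::
  "('a, 'r) ring_scheme \<Rightarrow> ('a, 'b, 'm) module_scheme \<Rightarrow> ('a, 'c, 'n) module_scheme \<Rightarrow> ('b \<Rightarrow> 'c) set"
  where "mod_hom R M N = {f \<in> carrier M \<rightarrow> carrier N.
     (\<forall>x\<in>carrier M. \<forall>y\<in>carrier M. f (x \<oplus>\<^bsub>M\<^esub> y) = f x \<oplus>\<^bsub>N\<^esub> f y) \<and>
     (\<forall>a\<in>carrier R. \<forall>x\<in>carrier M. f (a \<odot>\<^bsub>M\<^esub> x) = a \<odot>\<^bsub>N\<^esub> f x)}"

definition mod_iso ::
  "('a, 'r) ring_scheme \<Rightarrow> ('a, 'b, 'm) module_scheme \<Rightarrow> ('a, 'c, 'n) module_scheme \<Rightarrow> bool"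
  where "mod_iso R M N \<longleftrightarrow> (\<exists>f\<in>mod_hom R M N. bij_betw f (carrier M) (carrier N))"

definition fin_gen :: "('a, 'r) ring_scheme \<Rightarrow> ('a, 'b, 'm) module_scheme \<Rightarrow> bool"
  where "fin_gen R M \<longleftrightarrow> (\<exists>A. finite A \<and> A \<subseteq> carrier M \<and>
     (\<forall>m\<in>carrier M. \<exists>c\<in>A \<rightarrow> carrier R. m = (\<Oplus>\<^bsub>M\<^esub>b\<in>A. c b \<odot>\<^bsub>M\<^esub> b)))"

text \<open>A module is free if it has a basis \<open>B\<close>: every element is in a unique way a linear
  combination of elements of \<open>B\<close> with coefficients that are almost all zero.\<close>

definition free_module :: "('a, 'r) ring_scheme \<Rightarrow> ('a, 'b, 'm) module_scheme \<Rightarrow> bool"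
  where "free_module R M \<longleftrightarrow> (\<exists>B\<subseteq>carrier M. \<forall>m\<in>carrier M. \<exists>!c.
     c \<in> B \<rightarrow>\<^sub>E carrier R \<and> finite {b \<in> B. c b \<noteq> \<zero>\<^bsub>R\<^esub>} \<and>
     m = (\<Oplus>\<^bsub>M\<^esub>b\<in>{b \<in> B. c b \<noteq> \<zero>\<^bsub>R\<^esub>}. c b \<odot>\<^bsub>M\<^esub> b))"

definition ring_mod :: "('a, 'r) ring_scheme \<Rightarrow> ('a, 'a) module"
  where "ring_mod R = \<lparr>carrier = carrier R, monoid.mult = monoid.mult R, one = one R,
     ring.zero = ring.zero R, add = add R, smult = monoid.mult R\<rparr>"

definition quot_mod ::
  "('a, 'r) ring_scheme \<Rightarrow> ('a, 'b, 'm) module_scheme \<Rightarrow> 'b set \<Rightarrow> ('a, 'b set) module"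
  where "quot_mod R M N = \<lparr>carrier = a_rcosets\<^bsub>M\<^esub> N, monoid.mult = undefined, one = undefined,
     ring.zero = N, add = set_add M, smult = (\<lambda>a X. \<Union>x\<in>X. N +>\<^bsub>M\<^esub> (a \<odot>\<^bsub>M\<^esub> x))\<rparr>"

definition dir_sum :: "'i set \<Rightarrow> ('i \<Rightarrow> ('a, 'b, 'm) module_scheme) \<Rightarrow> ('a, 'i \<Rightarrow> 'b) module"
  where "dir_sum J Y = \<lparr>carrier = (\<Pi>\<^sub>E i\<in>J. carrier (Y i)), monoid.mult = undefined, one = undefined,
     ring.zero = (\<lambda>i\<in>J. \<zero>\<^bsub>Y i\<^esub>), add = (\<lambda>f g. \<lambda>i\<in>J. f i \<oplus>\<^bsub>Y i\<^esub> g i),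
     smult = (\<lambda>a f. \<lambda>i\<in>J. a \<odot>\<^bsub>Y i\<^esub> f i)\<rparr>"

definition restrict_scalars ::
  "('a, 'r) ring_scheme \<Rightarrow> 'a set \<Rightarrow> ('a set, 'b) module \<Rightarrow> ('a, 'b) module"
  where "restrict_scalars R I L = \<lparr>carrier = carrier L, monoid.mult = monoid.mult L, one = one L,
     ring.zero = ring.zero L, add = add L, smult = (\<lambda>a x. (I +>\<^bsub>R\<^esub> a) \<odot>\<^bsub>L\<^esub> x)\<rparr>"

section \<open>Localization and the nonfree locus\<close>

text \<open>\<open>fraction R S M m s\<close> is the class of \<open>m/s\<close>, i.e. the set of all \<open>(m', s')\<close> such that
  \<open>u (s' m - s m') = 0\<close> for some \<open>u\<close> in \<open>S\<close>.\<close>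

definition fraction ::
  "('a, 'r) ring_scheme \<Rightarrow> 'a set \<Rightarrow> ('a, 'b, 'm) module_scheme \<Rightarrow> 'b \<Rightarrow> 'a \<Rightarrow> ('b \<times> 'a) set"
  where "fraction R S M m s = {(m', s'). m' \<in> carrier M \<and> s' \<in> S \<and>
     (\<exists>u\<in>S. u \<odot>\<^bsub>M\<^esub> ((s' \<odot>\<^bsub>M\<^esub> m) \<ominus>\<^bsub>M\<^esub> (s \<odot>\<^bsub>M\<^esub> m')) = \<zero>\<^bsub>M\<^esub>)}"

definition loc_mod ::
  "('a, 'r) ring_scheme \<Rightarrow> 'a set \<Rightarrow> ('a, 'b, 'm) module_scheme \<Rightarrow> (('a \<times> 'a) set, ('b \<times> 'a) set) module"
  where "loc_mod R S M =
     \<lparr>carrier = {fraction R S M m s | m s. m \<in> carrier M \<and> s \<in> S},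
      monoid.mult = undefined, one = undefined, ring.zero = fraction R S M \<zero>\<^bsub>M\<^esub> \<one>\<^bsub>R\<^esub>,
      add = (\<lambda>X Y. \<Union>(m, s)\<in>X. \<Union>(n, t)\<in>Y.
        fraction R S M ((t \<odot>\<^bsub>M\<^esub> m) \<oplus>\<^bsub>M\<^esub> (s \<odot>\<^bsub>M\<^esub> n)) (s \<otimes>\<^bsub>R\<^esub> t)),
      smult = (\<lambda>A X. \<Union>(a, s)\<in>A. \<Union>(m, t)\<in>X. fraction R S M (a \<odot>\<^bsub>M\<^esub> m) (s \<otimes>\<^bsub>R\<^esub> t))\<rparr>"

definition loc_ring :: "('a, 'r) ring_scheme \<Rightarrow> 'a set \<Rightarrow> (('a \<times> 'a) set) ring"
  where "loc_ring R S =
     \<lparr>carrier = carrier (loc_mod R S (ring_mod R)), monoid.mult = smult (loc_mod R S (ring_mod R)),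
      one = fraction R S (ring_mod R) \<one>\<^bsub>R\<^esub> \<one>\<^bsub>R\<^esub>,
      ring.zero = ring.zero (loc_mod R S (ring_mod R)), add = add (loc_mod R S (ring_mod R))\<rparr>"

definition NF :: "('a, 'r) ring_scheme \<Rightarrow> ('a, 'b, 'm) module_scheme \<Rightarrow> 'a set set"
  where "NF R M = {p. primeideal p R \<and>
     \<not> free_module (loc_ring R (carrier R - p)) (loc_mod R (carrier R - p) M)}"

definition primes_over :: "('a, 'r) ring_scheme \<Rightarrow> 'a set \<Rightarrow> 'a set set"
  where "primes_over R I = {p. primeideal p R \<and> I \<subseteq> p}"

section \<open>The category of finitely generated modules and its subcategories\<close>

text \<open>Subcategories are full and closed under isomorphism, so they are sets of modules.  The
  modules in \<open>fgmod R\<close> have carriers of type \<open>'a list\<close>, where \<open>'a\<close> is the type of the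
  elements of \<open>R\<close>.  Every finitely generated module is isomorphic to one of those, see lemma
  \<open>fgmod_representative\<close> below.\<close>

type_synonym 'a lmodule = "('a, 'a list) module"

definition fgmod :: "('a, 'r) ring_scheme \<Rightarrow> 'a lmodule set"
  where "fgmod R = {M. module R M \<and> fin_gen R M}"

lemma fgmod_representative:
  fixes R :: "('a, 'r) ring_scheme" and M :: "('a, 'b, 'm) module_scheme"
  assumes "module R M" and "fin_gen R M"
  shows "\<exists>M'\<in>fgmod R. mod_iso R M M'"
proof -
  interpret module R M by fact
  obtain A where A: "finite A" "A \<subseteq> carrier M"
    and span: "\<forall>m\<in>carrier M. \<exists>c\<in>A \<rightarrow> carrier R. m = (\<Oplus>\<^bsub>M\<^esub>b\<in>A. c b \<odot>\<^bsub>M\<^esub> b)"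
    using assms(2) unfolding fin_gen_def by blast
  obtain c where c: "c m \<in> A \<rightarrow> carrier R" "m = (\<Oplus>\<^bsub>M\<^esub>b\<in>A. c m b \<odot>\<^bsub>M\<^esub> b)"
    if "m \<in> carrier M" for m
    using bchoice[of "carrier M" "\<lambda>m c. c \<in> A \<rightarrow> carrier R \<and> m = (\<Oplus>\<^bsub>M\<^esub>b\<in>A. c b \<odot>\<^bsub>M\<^esub> b)"]
      span by blast
  obtain bs where bs: "set bs = A" using finite_list[OF A(1)] by blast
  define g where "g = (\<lambda>m. map (c m) bs)"
  have inj: "inj_on g (carrier M)"
  proof (rule inj_onI)
    fix m m' assume m: "m \<in> carrier M" "m' \<in> carrier M" "g m = g m'"
    then have eq: "c m b = c m' b" if "b \<in> A" for b
      using that bs by (simp add: g_def)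
    have "(\<Oplus>\<^bsub>M\<^esub>b\<in>A. c m b \<odot>\<^bsub>M\<^esub> b) = (\<Oplus>\<^bsub>M\<^esub>b\<in>A. c m' b \<odot>\<^bsub>M\<^esub> b)"
      using A c(1)[OF m(1)] c(1)[OF m(2)] eq by (intro M.finsum_cong') auto
    then show "m = m'" using c(2)[OF m(1)] c(2)[OF m(2)] by simp
  qed
  define h where "h = inv_into (carrier M) g"
  have hg [simp]: "h (g m) = m" if "m \<in> carrier M" for m
    using that inj by (simp add: h_def)
  define M' :: "'a lmodule" where "M' = \<lparr>carrier = g ` carrier M, monoid.mult = undefined,
    one = undefined, ring.zero = g \<zero>\<^bsub>M\<^esub>, add = (\<lambda>u v. g (h u \<oplus>\<^bsub>M\<^esub> h v)),
    smult = (\<lambda>a u. g (a \<odot>\<^bsub>M\<^esub> h u))\<rparr>"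
  have sel [simp]: "carrier M' = g ` carrier M" "\<zero>\<^bsub>M'\<^esub> = g \<zero>\<^bsub>M\<^esub>"
    "u \<oplus>\<^bsub>M'\<^esub> v = g (h u \<oplus>\<^bsub>M\<^esub> h v)" "a \<odot>\<^bsub>M'\<^esub> u = g (a \<odot>\<^bsub>M\<^esub> h u)" for u v a
    by (simp_all add: M'_def)
  have "abelian_group M'"
  proof (rule abelian_groupI)
    fix u assume "u \<in> carrier M'"
    then obtain m where m: "m \<in> carrier M" "u = g m" by auto
    show "\<exists>v\<in>carrier M'. v \<oplus>\<^bsub>M'\<^esub> u = \<zero>\<^bsub>M'\<^esub>"
      by (rule bexI[of _ "g (\<ominus>\<^bsub>M\<^esub> m)"]) (use m in \<open>auto simp: M.l_neg\<close>)
  qed (auto simp: M.add.m_ac)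
  then interpret M': module R M'
    by (intro moduleI)
      (auto simp: smult_l_distr smult_r_distr smult_assoc1 intro: R.is_cring)
  have gsum: "g (\<Oplus>\<^bsub>M\<^esub>b\<in>B. f b) = (\<Oplus>\<^bsub>M'\<^esub>b\<in>B. g (f b))"
    if "finite B" "f \<in> B \<rightarrow> carrier M" for f and B :: "'b set"
    using that
  proof (induction B)
    case (insert b B)
    then have f: "f b \<in> carrier M" "f \<in> B \<rightarrow> carrier M" by auto
    have "(\<Oplus>\<^bsub>M'\<^esub>b\<in>insert b B. g (f b)) = g (f b) \<oplus>\<^bsub>M'\<^esub> (\<Oplus>\<^bsub>M'\<^esub>b\<in>B. g (f b))"
      using insert f by (intro M'.M.finsum_insert) auto
    also have "\<dots> = g (f b) \<oplus>\<^bsub>M'\<^esub> g (\<Oplus>\<^bsub>M\<^esub>b\<in>B. f b)" using insert f by simp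
    also have "\<dots> = g (f b \<oplus>\<^bsub>M\<^esub> (\<Oplus>\<^bsub>M\<^esub>b\<in>B. f b))" using f by simp
    also have "f b \<oplus>\<^bsub>M\<^esub> (\<Oplus>\<^bsub>M\<^esub>b\<in>B. f b) = (\<Oplus>\<^bsub>M\<^esub>b\<in>insert b B. f b)"
      using insert f by (intro M.finsum_insert[symmetric]) auto
    finally show ?case by simp
  qed simp
  have "fin_gen R M'"
    unfolding fin_gen_def
  proof (intro exI[of _ "g ` A"] conjI ballI)
    fix u assume "u \<in> carrier M'"
    then obtain m where m: "m \<in> carrier M" "u = g m" by auto
    have f: "(\<lambda>b. c m b \<odot>\<^bsub>M\<^esub> b) \<in> A \<rightarrow> carrier M" using c(1)[OF m(1)] A by auto
    have "u = (\<Oplus>\<^bsub>M'\<^esub>b\<in>A. g (c m b \<odot>\<^bsub>M\<^esub> b))"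
      using m c(2)[OF m(1)] gsum[OF A(1) f] by simp
    also have "\<dots> = (\<Oplus>\<^bsub>M'\<^esub>b\<in>A. c m (h (g b)) \<odot>\<^bsub>M'\<^esub> g b)"
      using A c(1)[OF m(1)] by (intro M'.M.finsum_cong') (auto simp: subset_eq Pi_iff)
    also have "\<dots> = (\<Oplus>\<^bsub>M'\<^esub>v\<in>g ` A. c m (h v) \<odot>\<^bsub>M'\<^esub> v)"
      using A inj c(1)[OF m(1)]
      by (intro M'.M.add.finprod_reindex[symmetric])
        (auto simp: subset_eq Pi_iff intro: inj_on_subset)
    finally show "\<exists>c\<in>g ` A \<rightarrow> carrier R. u = (\<Oplus>\<^bsub>M'\<^esub>v\<in>g ` A. c v \<odot>\<^bsub>M'\<^esub> v)"
      using A c(1)[OF m(1)]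
      by (intro bexI[of _ "\<lambda>v. c m (h v)"]) (auto simp: subset_eq Pi_iff)
  qed (use A in auto)
  moreover have "g \<in> mod_hom R M M'" by (auto simp: mod_hom_def)
  moreover have "bij_betw g (carrier M) (carrier M')" using inj by (auto simp: bij_betw_def)
  ultimately show ?thesis
    using M'.module_axioms unfolding fgmod_def mod_iso_def by blast
qed

definition NF_inv :: "('a, 'r) ring_scheme \<Rightarrow> 'a set set \<Rightarrow> 'a lmodule set"
  where "NF_inv R W = {M \<in> fgmod R. NF R M \<subseteq> W}"

text \<open>The modules in \<open>mod R/I\<close>, regarded as \<open>R\<close>-modules.\<close>

definition fgmod_quot :: "('a, 'r) ring_scheme \<Rightarrow> 'a set \<Rightarrow> 'a lmodule set"
  where "fgmod_quot R I = {M \<in> fgmod R. \<exists>L :: ('a set, 'a list) module.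
     module (R Quot I) L \<and> fin_gen (R Quot I) L \<and> mod_iso R M (restrict_scalars R I L)}"

text \<open>The modules isomorphic to \<open>R/p\<close> for some \<open>p\<close> in \<open>W\<close>.\<close>

definition cyclic_quots :: "('a, 'r) ring_scheme \<Rightarrow> 'a set set \<Rightarrow> 'a lmodule set"
  where "cyclic_quots R W = {M \<in> fgmod R. \<exists>p\<in>W. mod_iso R M (quot_mod R (ring_mod R) p)}"

text \<open>\<open>M\<close> is an \<open>i\<close>-th syzygy of \<open>X\<close>: with \<open>C 0 = X\<close>, \<open>C (j + 1) = P\<^sub>j\<close> for
  \<open>j < i\<close>, and \<open>C (i + 1) = M\<close>, the sequence
  \<open>0 \<rightarrow> C (i + 1) \<rightarrow> C i \<rightarrow> \<dots> \<rightarrow> C 1 \<rightarrow> C 0 \<rightarrow> 0\<close> is exact, where \<open>d j\<close> maps \<open>C (j + 1)\<close>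
  to \<open>C j\<close>.\<close>

definition is_syzygy :: "('a, 'r) ring_scheme \<Rightarrow> nat \<Rightarrow> 'a lmodule \<Rightarrow> 'a lmodule \<Rightarrow> bool"
  where "is_syzygy R i X M \<longleftrightarrow> (\<exists>C d. C 0 = X \<and> C (Suc i) = M \<and>
     (\<forall>j\<in>{1..i}. C j \<in> fgmod R \<and> free_module R (C j)) \<and>
     (\<forall>j\<le>i. d j \<in> mod_hom R (C (Suc j)) (C j)) \<and>
     d 0 ` carrier (C 1) = carrier (C 0) \<and>
     (\<forall>j<i. d (Suc j) ` carrier (C (Suc (Suc j))) = a_kernel (C (Suc j)) (C j) (d j)) \<and>
     inj_on (d i) (carrier (C (Suc i))))"

definition syz :: "('a, 'r) ring_scheme \<Rightarrow> nat \<Rightarrow> 'a lmodule set \<Rightarrow> 'a lmodule set"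
  where "syz R i \<X> = {M \<in> fgmod R. \<exists>X\<in>\<X>. is_syzygy R i X M}"

definition sum_cat ::
  "('a, 'r) ring_scheme \<Rightarrow> nat \<Rightarrow> (nat \<Rightarrow> 'a lmodule set) \<Rightarrow> 'a lmodule set"
  where "sum_cat R n \<X> = {M \<in> fgmod R. \<exists>Y. (\<forall>i\<le>n. Y i \<in> \<X> i) \<and> mod_iso R M (dir_sum {..n} Y)}"

definition summand :: "('a, 'r) ring_scheme \<Rightarrow> 'a lmodule \<Rightarrow> 'a lmodule \<Rightarrow> bool"
  where "summand R M N \<longleftrightarrow> M \<in> fgmod R \<and> N \<in> fgmod R \<and>
     (\<exists>C\<in>fgmod R. mod_iso R N (dir_sum {..<2} ((!) [M, C])))"

definition short_exact ::
  "('a, 'r) ring_scheme \<Rightarrow> 'a lmodule \<Rightarrow> 'a lmodule \<Rightarrow> 'a lmodule \<Rightarrow> bool"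
  where "short_exact R A B C \<longleftrightarrow> (\<exists>f\<in>mod_hom R A B. \<exists>g\<in>mod_hom R B C.
     inj_on f (carrier A) \<and> f ` carrier A = a_kernel B C g \<and> g ` carrier B = carrier C)"

inductive_set add_cat :: "('a, 'r) ring_scheme \<Rightarrow> 'a lmodule set \<Rightarrow> 'a lmodule set"
  for R :: "('a, 'r) ring_scheme" and \<X> :: "'a lmodule set"
  where
    base: "M \<in> \<X> \<Longrightarrow> M \<in> fgmod R \<Longrightarrow> M \<in> add_cat R \<X>"
  | dir_sum: "(\<And>i. i < k \<Longrightarrow> Y i \<in> add_cat R \<X>) \<Longrightarrow> M \<in> fgmod R \<Longrightarrow>
      mod_iso R M (dir_sum {..<k :: nat} Y) \<Longrightarrow> M \<in> add_cat R \<X>"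
  | summand: "N \<in> add_cat R \<X> \<Longrightarrow> summand R M N \<Longrightarrow> M \<in> add_cat R \<X>"

inductive_set ext_cat :: "('a, 'r) ring_scheme \<Rightarrow> 'a lmodule set \<Rightarrow> 'a lmodule set"
  for R :: "('a, 'r) ring_scheme" and \<X> :: "'a lmodule set"
  where
    base: "M \<in> \<X> \<Longrightarrow> M \<in> fgmod R \<Longrightarrow> M \<in> ext_cat R \<X>"
  | summand: "N \<in> ext_cat R \<X> \<Longrightarrow> summand R M N \<Longrightarrow> M \<in> ext_cat R \<X>"
  | extension: "A \<in> ext_cat R \<X> \<Longrightarrow> C \<in> ext_cat R \<X> \<Longrightarrow> B \<in> fgmod R \<Longrightarrow>
      short_exact R A B C \<Longrightarrow> B \<in> ext_cat R \<X>"

text \<open>\<open>filt_cat R \<X> r\<close> is \<open>|\<X>|\<^sub>r\<close>.\<close>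

definition filt_cat :: "('a, 'r) ring_scheme \<Rightarrow> 'a lmodule set \<Rightarrow> nat \<Rightarrow> 'a lmodule set"
  where "filt_cat R \<X> r = {M. \<exists>N F. summand R M N \<and>
     (\<forall>j\<le>r. submodule (F j) R N) \<and> F 0 = {\<zero>\<^bsub>N\<^esub>} \<and> F r = carrier N \<and>
     (\<forall>j<r. F j \<subseteq> F (Suc j) \<and>
       (\<exists>Q\<in>add_cat R \<X>. mod_iso R Q (quot_mod R (N\<lparr>carrier := F (Suc j)\<rparr>) (F j))))}"

section \<open>Ext\<close>

definition hom_mod ::
  "('a, 'r) ring_scheme \<Rightarrow> ('a, 'b, 'm) module_scheme \<Rightarrow> ('a, 'c, 'n) module_scheme \<Rightarrow> ('a, 'b \<Rightarrow> 'c) module"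
  where "hom_mod R M N = \<lparr>carrier = mod_hom R M N \<inter> extensional (carrier M),
     monoid.mult = undefined, one = undefined, ring.zero = (\<lambda>x\<in>carrier M. \<zero>\<^bsub>N\<^esub>),
     add = (\<lambda>f g. \<lambda>x\<in>carrier M. f x \<oplus>\<^bsub>N\<^esub> g x), smult = (\<lambda>a f. \<lambda>x\<in>carrier M. a \<odot>\<^bsub>N\<^esub> f x)\<rparr>"

text \<open>\<open>\<dots> \<rightarrow> P 1 \<rightarrow> P 0 \<rightarrow> M \<rightarrow> 0\<close> is exact, where \<open>d 0\<close> maps \<open>P 0\<close> to \<open>M\<close> and
  \<open>d (j + 1)\<close> maps \<open>P (j + 1)\<close> to \<open>P j\<close>.\<close>

definition free_resolution ::
  "('a, 'r) ring_scheme \<Rightarrow> 'a lmodule \<Rightarrow> (nat \<Rightarrow> 'a lmodule) \<Rightarrow> (nat \<Rightarrow> 'a list \<Rightarrow> 'a list) \<Rightarrow> bool"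
  where "free_resolution R M P d \<longleftrightarrow>
     (\<forall>j. P j \<in> fgmod R \<and> free_module R (P j)) \<and>
     d 0 \<in> mod_hom R (P 0) M \<and> (\<forall>j. d (Suc j) \<in> mod_hom R (P (Suc j)) (P j)) \<and>
     d 0 ` carrier (P 0) = carrier M \<and>
     d 1 ` carrier (P 1) = a_kernel (P 0) M (d 0) \<and>
     (\<forall>j. d (Suc (Suc j)) ` carrier (P (Suc (Suc j))) = a_kernel (P (Suc j)) (P j) (d (Suc j)))"

text \<open>The \<open>i\<close>-th cohomology of the complex
  \<open>0 \<rightarrow> Hom(P 0, N) \<rightarrow> Hom(P 1, N) \<rightarrow> \<dots>\<close>, as cocycles modulo coboundaries.\<close>

definition hom_cohomology ::
  "('a, 'r) ring_scheme \<Rightarrow> (nat \<Rightarrow> 'a lmodule) \<Rightarrow> (nat \<Rightarrow> 'a list \<Rightarrow> 'a list) \<Rightarrow> 'a lmodule \<Rightarrow> nat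
    \<Rightarrow> ('a, ('a list \<Rightarrow> 'a list) set) module"
  where "hom_cohomology R P d N i = quot_mod R
     ((hom_mod R (P i) N)\<lparr>carrier := a_kernel (hom_mod R (P i) N) (hom_mod R (P (Suc i)) N)
        (\<lambda>f. compose (carrier (P (Suc i))) f (d (Suc i)))\<rparr>)
     (case i of 0 \<Rightarrow> {\<zero>\<^bsub>hom_mod R (P 0) N\<^esub>}
      | Suc j \<Rightarrow> (\<lambda>f. compose (carrier (P i)) f (d i)) ` carrier (hom_mod R (P j) N))"

text \<open>Up to isomorphism \<open>Ext R i M N\<close> does not depend on the chosen resolution.\<close>

definition Ext ::
  "('a, 'r) ring_scheme \<Rightarrow> nat \<Rightarrow> 'a lmodule \<Rightarrow> 'a lmodule \<Rightarrow> ('a, ('a list \<Rightarrow> 'a list) set) module"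
  where "Ext R i M N =
     (let (P, d) = (SOME (P, d). free_resolution R M P d) in hom_cohomology R P d N i)"

definition annihilates :: "'a set \<Rightarrow> ('a, 'b, 'm) module_scheme \<Rightarrow> bool"
  where "annihilates I M \<longleftrightarrow> (\<forall>a\<in>I. \<forall>m\<in>carrier M. a \<odot>\<^bsub>M\<^esub> m = \<zero>\<^bsub>M\<^esub>)"

text \<open>The ideal generated by the powers of the generators, \<open>I\<^sup>[\<^sup>e\<^sup>]\<close>.\<close>

definition gen_power_ideal ::
  "('a, 'r) ring_scheme \<Rightarrow> nat \<Rightarrow> (nat \<Rightarrow> 'a) \<Rightarrow> nat \<Rightarrow> 'a set"
  where "gen_power_ideal R n x e = Idl\<^bsub>R\<^esub> ((\<lambda>i. x i [^]\<^bsub>R\<^esub> e) ` {1..n})"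

end

theory Submission
  imports Defs
begin

text \<open>Call an element \<open>u\<close> of the ring a free factor of \<open>M\<close> if multiplication by \<open>u\<close> on \<open>M\<close> factors through a
  finitely generated free module (\<open>free_factor\<close>). The free factors of \<open>M\<close> form an ideal, and this ideal
  carries both hypotheses of the theorem. If \<open>u\<close> annihilates \<open>Ext R 1 M \<Omega>\<close>, where
  \<open>0 \<rightarrow> \<Omega> \<rightarrow> F \<rightarrow> M \<rightarrow> 0\<close> is exact with \<open>F\<close> free, then \<open>u\<close> kills the class of this extension, so multiplication
  by \<open>u\<close> lifts along \<open>F \<rightarrow> M\<close> (\<open>Ext_annihilator_free_factor\<close>). And \<open>M\<close> is free at a prime \<open>p\<close> if and only if
  some free factor lies outside \<open>p\<close> (\<open>NF_iff\<close>). If the nonfree locus of \<open>M\<close> is contained in \<open>V(I)\<close>, then some power of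
  each generator \<open>x\<^sub>i\<close> of \<open>I\<close> is a free factor, because a prime that contains all free factors and avoids the
  powers of \<open>x\<^sub>i\<close> would be a point of the nonfree locus outside \<open>V(I)\<close> (\<open>NF_inv_powers\<close>).

  So it suffices to study a module \<open>M\<close> with free factors \<open>x\<^sub>1, \<dots>, x\<^sub>n\<close>. On a free resolution of \<open>M\<close> form the
  iterated cone of the multiplications by the \<open>x\<^sub>i\<close>, that is, a Koszul complex. It consists of free modules and each
  \<open>x\<^sub>i\<close> is null-homotopic on it, so its homology is annihilated by all \<open>x\<^sub>i\<close>. Let \<open>N\<close> be its cokernel in
  degree \<open>n\<close>. Each cone replaces the previous cokernel by the pullback, along \<open>x\<^sub>i\<close>, of a free cover
  of it; since \<open>x\<^sub>i\<close> is a free factor of \<open>M\<close>, an embedding of \<open>M\<close> as a direct summand lifts to this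
  pullback, and by induction \<open>M\<close> is a direct summand of \<open>N\<close> (\<open>koszul\<close>). On the other hand the cokernel in degree
  \<open>k + 1\<close> is an extension of a first syzygy of the cokernel in degree \<open>k\<close> by the homology in degree
  \<open>k + 1\<close>. Syzygies of summands and of extensions are summands of syzygies and of extensions of syzygies
  (\<open>syz1_retr\<close>, \<open>syz1_extension\<close>), so by induction \<open>N\<close> is built from \<open>n + 1\<close> pieces, the \<open>i\<close>-th of which is
  an \<open>i\<close>-th syzygy of the homology in degree \<open>n - i\<close> (\<open>coker_built\<close>).

  Pulling extensions back along retractions turns such a construction into a filtration of a single
  module (\<open>built_filtered\<close>), which yields the first part and the filtrations by syzygies of modules over
  \<open>R/I\<^sup>[\<^sup>e\<^sup>]\<close>. A module annihilated by powers of the \<open>x\<^sub>i\<close> has a filtration with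
  quotients \<open>R/p\<close> for primes \<open>p\<close> containing \<open>I\<close> (\<open>prime_filtration\<close>), which yields the descriptions by
  syzygies of the \<open>R/p\<close>. The reverse inclusions hold because annihilators are free factors and
  because having a free factor outside a fixed prime is inherited by summands, extensions and syzygies.\<close>

section \<open>Modules and homomorphisms\<close>

context cring
begin

abbreviation Hom where "Hom A B \<equiv> mod_hom R A B"

lemma
  assumes "module R M"
  shows mzero: "\<zero>\<^bsub>M\<^esub> \<in> carrier M"
    and madd: "\<lbrakk>x \<in> carrier M; y \<in> carrier M\<rbrakk> \<Longrightarrow> x \<oplus>\<^bsub>M\<^esub> y \<in> carrier M"
    and mneg: "x \<in> carrier M \<Longrightarrow> \<ominus>\<^bsub>M\<^esub> x \<in> carrier M"
    and msmult: "\<lbrakk>a \<in> carrier R; x \<in> carrier M\<rbrakk> \<Longrightarrow> a \<odot>\<^bsub>M\<^esub> x \<in> carrier M"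
    and madd_assoc: "\<lbrakk>x \<in> carrier M; y \<in> carrier M; z \<in> carrier M\<rbrakk>
      \<Longrightarrow> (x \<oplus>\<^bsub>M\<^esub> y) \<oplus>\<^bsub>M\<^esub> z = x \<oplus>\<^bsub>M\<^esub> (y \<oplus>\<^bsub>M\<^esub> z)"
    and madd_comm: "\<lbrakk>x \<in> carrier M; y \<in> carrier M\<rbrakk> \<Longrightarrow> x \<oplus>\<^bsub>M\<^esub> y = y \<oplus>\<^bsub>M\<^esub> x"
    and madd_lcomm: "\<lbrakk>x \<in> carrier M; y \<in> carrier M; z \<in> carrier M\<rbrakk>
      \<Longrightarrow> x \<oplus>\<^bsub>M\<^esub> (y \<oplus>\<^bsub>M\<^esub> z) = y \<oplus>\<^bsub>M\<^esub> (x \<oplus>\<^bsub>M\<^esub> z)"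
    and mzero_l: "x \<in> carrier M \<Longrightarrow> \<zero>\<^bsub>M\<^esub> \<oplus>\<^bsub>M\<^esub> x = x"
    and mzero_r: "x \<in> carrier M \<Longrightarrow> x \<oplus>\<^bsub>M\<^esub> \<zero>\<^bsub>M\<^esub> = x"
    and mneg_l: "x \<in> carrier M \<Longrightarrow> \<ominus>\<^bsub>M\<^esub> x \<oplus>\<^bsub>M\<^esub> x = \<zero>\<^bsub>M\<^esub>"
    and mneg_r: "x \<in> carrier M \<Longrightarrow> x \<oplus>\<^bsub>M\<^esub> \<ominus>\<^bsub>M\<^esub> x = \<zero>\<^bsub>M\<^esub>"
    and mneg_l2: "\<lbrakk>x \<in> carrier M; y \<in> carrier M\<rbrakk> \<Longrightarrow> \<ominus>\<^bsub>M\<^esub> x \<oplus>\<^bsub>M\<^esub> (x \<oplus>\<^bsub>M\<^esub> y) = y"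
    and mneg_r2: "\<lbrakk>x \<in> carrier M; y \<in> carrier M\<rbrakk> \<Longrightarrow> x \<oplus>\<^bsub>M\<^esub> (\<ominus>\<^bsub>M\<^esub> x \<oplus>\<^bsub>M\<^esub> y) = y"
    and mneg_neg: "x \<in> carrier M \<Longrightarrow> \<ominus>\<^bsub>M\<^esub> (\<ominus>\<^bsub>M\<^esub> x) = x"
    and mneg_zero: "\<ominus>\<^bsub>M\<^esub> \<zero>\<^bsub>M\<^esub> = \<zero>\<^bsub>M\<^esub>"
    and mneg_add: "\<lbrakk>x \<in> carrier M; y \<in> carrier M\<rbrakk> \<Longrightarrow> \<ominus>\<^bsub>M\<^esub> (x \<oplus>\<^bsub>M\<^esub> y) = \<ominus>\<^bsub>M\<^esub> x \<oplus>\<^bsub>M\<^esub> \<ominus>\<^bsub>M\<^esub> y"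
    and msmult_add: "\<lbrakk>a \<in> carrier R; x \<in> carrier M; y \<in> carrier M\<rbrakk>
      \<Longrightarrow> a \<odot>\<^bsub>M\<^esub> (x \<oplus>\<^bsub>M\<^esub> y) = a \<odot>\<^bsub>M\<^esub> x \<oplus>\<^bsub>M\<^esub> a \<odot>\<^bsub>M\<^esub> y"
    and msmult_neg: "\<lbrakk>a \<in> carrier R; x \<in> carrier M\<rbrakk> \<Longrightarrow> a \<odot>\<^bsub>M\<^esub> (\<ominus>\<^bsub>M\<^esub> x) = \<ominus>\<^bsub>M\<^esub> (a \<odot>\<^bsub>M\<^esub> x)"
    and msmult_zero: "a \<in> carrier R \<Longrightarrow> a \<odot>\<^bsub>M\<^esub> \<zero>\<^bsub>M\<^esub> = \<zero>\<^bsub>M\<^esub>"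
    and mzero_smult: "x \<in> carrier M \<Longrightarrow> \<zero> \<odot>\<^bsub>M\<^esub> x = \<zero>\<^bsub>M\<^esub>"
    and mone_smult: "x \<in> carrier M \<Longrightarrow> \<one> \<odot>\<^bsub>M\<^esub> x = x"
    and madd_smult: "\<lbrakk>a \<in> carrier R; b \<in> carrier R; x \<in> carrier M\<rbrakk>
      \<Longrightarrow> (a \<oplus> b) \<odot>\<^bsub>M\<^esub> x = a \<odot>\<^bsub>M\<^esub> x \<oplus>\<^bsub>M\<^esub> b \<odot>\<^bsub>M\<^esub> x"
    and mneg_smult: "\<lbrakk>a \<in> carrier R; x \<in> carrier M\<rbrakk> \<Longrightarrow> (\<ominus> a) \<odot>\<^bsub>M\<^esub> x = \<ominus>\<^bsub>M\<^esub> (a \<odot>\<^bsub>M\<^esub> x)"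
    and msmult_smult: "\<lbrakk>a \<in> carrier R; b \<in> carrier R; x \<in> carrier M\<rbrakk>
      \<Longrightarrow> (a \<otimes> b) \<odot>\<^bsub>M\<^esub> x = a \<odot>\<^bsub>M\<^esub> (b \<odot>\<^bsub>M\<^esub> x)"
    and msmult_comm: "\<lbrakk>a \<in> carrier R; b \<in> carrier R; x \<in> carrier M\<rbrakk>
      \<Longrightarrow> a \<odot>\<^bsub>M\<^esub> (b \<odot>\<^bsub>M\<^esub> x) = b \<odot>\<^bsub>M\<^esub> (a \<odot>\<^bsub>M\<^esub> x)"
    and mdiff_zero: "\<lbrakk>x \<in> carrier M; y \<in> carrier M\<rbrakk> \<Longrightarrow> x \<oplus>\<^bsub>M\<^esub> \<ominus>\<^bsub>M\<^esub> y = \<zero>\<^bsub>M\<^esub> \<longleftrightarrow> x = y"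
    and madd_zero: "\<lbrakk>x \<in> carrier M; y \<in> carrier M\<rbrakk> \<Longrightarrow> x \<oplus>\<^bsub>M\<^esub> y = \<zero>\<^bsub>M\<^esub> \<longleftrightarrow> x = \<ominus>\<^bsub>M\<^esub> y"
proof -
  interpret M: module R M by fact
  show zc: "\<zero>\<^bsub>M\<^esub> \<in> carrier M" by simp
  show "\<lbrakk>x \<in> carrier M; y \<in> carrier M\<rbrakk> \<Longrightarrow> x \<oplus>\<^bsub>M\<^esub> y \<in> carrier M" by simp
  show "x \<in> carrier M \<Longrightarrow> \<ominus>\<^bsub>M\<^esub> x \<in> carrier M" by simp
  show "\<lbrakk>a \<in> carrier R; x \<in> carrier M\<rbrakk> \<Longrightarrow> a \<odot>\<^bsub>M\<^esub> x \<in> carrier M" by simp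
  show "\<lbrakk>x \<in> carrier M; y \<in> carrier M; z \<in> carrier M\<rbrakk>
      \<Longrightarrow> (x \<oplus>\<^bsub>M\<^esub> y) \<oplus>\<^bsub>M\<^esub> z = x \<oplus>\<^bsub>M\<^esub> (y \<oplus>\<^bsub>M\<^esub> z)" by (rule M.M.a_assoc)
  show "\<lbrakk>x \<in> carrier M; y \<in> carrier M\<rbrakk> \<Longrightarrow> x \<oplus>\<^bsub>M\<^esub> y = y \<oplus>\<^bsub>M\<^esub> x" by (rule M.M.a_comm)
  show "\<lbrakk>x \<in> carrier M; y \<in> carrier M; z \<in> carrier M\<rbrakk>
      \<Longrightarrow> x \<oplus>\<^bsub>M\<^esub> (y \<oplus>\<^bsub>M\<^esub> z) = y \<oplus>\<^bsub>M\<^esub> (x \<oplus>\<^bsub>M\<^esub> z)" by (rule M.M.a_lcomm)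
  show "x \<in> carrier M \<Longrightarrow> \<zero>\<^bsub>M\<^esub> \<oplus>\<^bsub>M\<^esub> x = x" by simp
  show "x \<in> carrier M \<Longrightarrow> x \<oplus>\<^bsub>M\<^esub> \<zero>\<^bsub>M\<^esub> = x" by simp
  show "x \<in> carrier M \<Longrightarrow> \<ominus>\<^bsub>M\<^esub> x \<oplus>\<^bsub>M\<^esub> x = \<zero>\<^bsub>M\<^esub>" by (rule M.M.l_neg)
  show "x \<in> carrier M \<Longrightarrow> x \<oplus>\<^bsub>M\<^esub> \<ominus>\<^bsub>M\<^esub> x = \<zero>\<^bsub>M\<^esub>" by (rule M.M.r_neg)
  show "\<lbrakk>x \<in> carrier M; y \<in> carrier M\<rbrakk> \<Longrightarrow> \<ominus>\<^bsub>M\<^esub> x \<oplus>\<^bsub>M\<^esub> (x \<oplus>\<^bsub>M\<^esub> y) = y" by (rule M.M.r_neg1)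
  show "\<lbrakk>x \<in> carrier M; y \<in> carrier M\<rbrakk> \<Longrightarrow> x \<oplus>\<^bsub>M\<^esub> (\<ominus>\<^bsub>M\<^esub> x \<oplus>\<^bsub>M\<^esub> y) = y" by (rule M.M.r_neg2)
  show "x \<in> carrier M \<Longrightarrow> \<ominus>\<^bsub>M\<^esub> (\<ominus>\<^bsub>M\<^esub> x) = x" by simp
  show "\<ominus>\<^bsub>M\<^esub> \<zero>\<^bsub>M\<^esub> = \<zero>\<^bsub>M\<^esub>" by simp
  show "\<lbrakk>x \<in> carrier M; y \<in> carrier M\<rbrakk> \<Longrightarrow> \<ominus>\<^bsub>M\<^esub> (x \<oplus>\<^bsub>M\<^esub> y) = \<ominus>\<^bsub>M\<^esub> x \<oplus>\<^bsub>M\<^esub> \<ominus>\<^bsub>M\<^esub> y"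
    by (rule M.M.minus_add)
  show "\<lbrakk>a \<in> carrier R; x \<in> carrier M; y \<in> carrier M\<rbrakk>
      \<Longrightarrow> a \<odot>\<^bsub>M\<^esub> (x \<oplus>\<^bsub>M\<^esub> y) = a \<odot>\<^bsub>M\<^esub> x \<oplus>\<^bsub>M\<^esub> a \<odot>\<^bsub>M\<^esub> y" by (rule M.smult_r_distr)
  show "\<lbrakk>a \<in> carrier R; x \<in> carrier M\<rbrakk> \<Longrightarrow> a \<odot>\<^bsub>M\<^esub> (\<ominus>\<^bsub>M\<^esub> x) = \<ominus>\<^bsub>M\<^esub> (a \<odot>\<^bsub>M\<^esub> x)"
    by (rule M.smult_r_minus)
  show "a \<in> carrier R \<Longrightarrow> a \<odot>\<^bsub>M\<^esub> \<zero>\<^bsub>M\<^esub> = \<zero>\<^bsub>M\<^esub>" by (rule M.smult_r_null)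
  show "x \<in> carrier M \<Longrightarrow> \<zero> \<odot>\<^bsub>M\<^esub> x = \<zero>\<^bsub>M\<^esub>" by (rule M.smult_l_null)
  show "x \<in> carrier M \<Longrightarrow> \<one> \<odot>\<^bsub>M\<^esub> x = x" by (rule M.smult_one)
  show "\<lbrakk>a \<in> carrier R; b \<in> carrier R; x \<in> carrier M\<rbrakk>
      \<Longrightarrow> (a \<oplus> b) \<odot>\<^bsub>M\<^esub> x = a \<odot>\<^bsub>M\<^esub> x \<oplus>\<^bsub>M\<^esub> b \<odot>\<^bsub>M\<^esub> x" by (rule M.smult_l_distr)
  show "\<lbrakk>a \<in> carrier R; x \<in> carrier M\<rbrakk> \<Longrightarrow> (\<ominus> a) \<odot>\<^bsub>M\<^esub> x = \<ominus>\<^bsub>M\<^esub> (a \<odot>\<^bsub>M\<^esub> x)" by (rule M.smult_l_minus)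
  show "\<lbrakk>a \<in> carrier R; b \<in> carrier R; x \<in> carrier M\<rbrakk>
      \<Longrightarrow> (a \<otimes> b) \<odot>\<^bsub>M\<^esub> x = a \<odot>\<^bsub>M\<^esub> (b \<odot>\<^bsub>M\<^esub> x)" by (rule M.smult_assoc1)
  show "\<lbrakk>a \<in> carrier R; b \<in> carrier R; x \<in> carrier M\<rbrakk>
      \<Longrightarrow> a \<odot>\<^bsub>M\<^esub> (b \<odot>\<^bsub>M\<^esub> x) = b \<odot>\<^bsub>M\<^esub> (a \<odot>\<^bsub>M\<^esub> x)"
    by (simp add: M.smult_assoc1 [symmetric] m_comm)
  show "x \<oplus>\<^bsub>M\<^esub> \<ominus>\<^bsub>M\<^esub> y = \<zero>\<^bsub>M\<^esub> \<longleftrightarrow> x = y" if "x \<in> carrier M" "y \<in> carrier M"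
    using that by (metis M.M.r_neg M.M.minus_equality M.M.minus_minus M.M.a_inv_closed)
  show "x \<oplus>\<^bsub>M\<^esub> y = \<zero>\<^bsub>M\<^esub> \<longleftrightarrow> x = \<ominus>\<^bsub>M\<^esub> y" if "x \<in> carrier M" "y \<in> carrier M"
    using that by (metis M.M.l_neg M.M.minus_equality)
qed

lemmas mclosed = mzero madd mneg msmult

text \<open>Rewriting modulo associativity and commutativity sorts the summands, which may put one summand between
  \<^term>\<open>x\<close> and its negative; these rules cancel the pair across it.\<close>

lemma
  assumes M: "module R M"
  shows mcancel_1: "\<lbrakk>x \<in> carrier M; a \<in> carrier M\<rbrakk> \<Longrightarrow> x \<oplus>\<^bsub>M\<^esub> (a \<oplus>\<^bsub>M\<^esub> (\<ominus>\<^bsub>M\<^esub> x)) = a"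
    and mcancel_2: "\<lbrakk>x \<in> carrier M; a \<in> carrier M; z \<in> carrier M\<rbrakk>
      \<Longrightarrow> x \<oplus>\<^bsub>M\<^esub> (a \<oplus>\<^bsub>M\<^esub> (\<ominus>\<^bsub>M\<^esub> x \<oplus>\<^bsub>M\<^esub> z)) = a \<oplus>\<^bsub>M\<^esub> z"
    and mcancel_3: "\<lbrakk>x \<in> carrier M; a \<in> carrier M\<rbrakk> \<Longrightarrow> \<ominus>\<^bsub>M\<^esub> x \<oplus>\<^bsub>M\<^esub> (a \<oplus>\<^bsub>M\<^esub> x) = a"
    and mcancel_4: "\<lbrakk>x \<in> carrier M; a \<in> carrier M; z \<in> carrier M\<rbrakk>
      \<Longrightarrow> \<ominus>\<^bsub>M\<^esub> x \<oplus>\<^bsub>M\<^esub> (a \<oplus>\<^bsub>M\<^esub> (x \<oplus>\<^bsub>M\<^esub> z)) = a \<oplus>\<^bsub>M\<^esub> z"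
  by (subst madd_lcomm[OF M]; simp add: mclosed[OF M] mneg_r[OF M] mneg_l[OF M] mneg_r2[OF M]
      mneg_l2[OF M] mzero_r[OF M])+

lemmas mcancel = mcancel_1 mcancel_2 mcancel_3 mcancel_4

text \<open>Simplification with these rules settles the additive and, with the scalar rules, the linear identities
  that occur in diagram chases.\<close>

lemmas mgroup = mclosed madd_assoc madd_comm madd_lcomm mzero_l mzero_r mneg_l mneg_r mneg_l2
  mneg_r2 mneg_neg mneg_zero mneg_add mcancel

lemmas mlin = mgroup msmult_add msmult_neg msmult_zero mzero_smult mone_smult

lemma module_fgmod: "M \<in> fgmod R \<Longrightarrow> module R M"
  by (simp add: fgmod_def)

lemma HomI:
  assumes "\<And>x. x \<in> carrier A \<Longrightarrow> f x \<in> carrier B"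
    and "\<And>x y. \<lbrakk>x \<in> carrier A; y \<in> carrier A\<rbrakk> \<Longrightarrow> f (x \<oplus>\<^bsub>A\<^esub> y) = f x \<oplus>\<^bsub>B\<^esub> f y"
    and "\<And>a x. \<lbrakk>a \<in> carrier R; x \<in> carrier A\<rbrakk> \<Longrightarrow> f (a \<odot>\<^bsub>A\<^esub> x) = a \<odot>\<^bsub>B\<^esub> f x"
  shows "f \<in> Hom A B"
  using assms by (auto simp: mod_hom_def)

lemma Hom_closed: "\<lbrakk>f \<in> Hom A B; x \<in> carrier A\<rbrakk> \<Longrightarrow> f x \<in> carrier B"
  and Hom_add: "\<lbrakk>f \<in> Hom A B; x \<in> carrier A; y \<in> carrier A\<rbrakk> \<Longrightarrow> f (x \<oplus>\<^bsub>A\<^esub> y) = f x \<oplus>\<^bsub>B\<^esub> f y"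
  and Hom_smult: "\<lbrakk>f \<in> Hom A B; a \<in> carrier R; x \<in> carrier A\<rbrakk> \<Longrightarrow> f (a \<odot>\<^bsub>A\<^esub> x) = a \<odot>\<^bsub>B\<^esub> f x"
  by (auto simp: mod_hom_def)

lemma Hom_zero: "\<lbrakk>f \<in> Hom A B; module R A; module R B\<rbrakk> \<Longrightarrow> f \<zero>\<^bsub>A\<^esub> = \<zero>\<^bsub>B\<^esub>"
  by (metis Hom_closed Hom_smult mzero_smult mzero zero_closed)

lemma Hom_neg:
  assumes "f \<in> Hom A B" "module R A" "module R B" "x \<in> carrier A"
  shows "f (\<ominus>\<^bsub>A\<^esub> x) = \<ominus>\<^bsub>B\<^esub> f x"
proof -
  have "f x \<oplus>\<^bsub>B\<^esub> f (\<ominus>\<^bsub>A\<^esub> x) = \<zero>\<^bsub>B\<^esub>"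
    using assms by (metis Hom_add Hom_zero mneg mneg_r)
  then show ?thesis
    using assms by (metis Hom_closed madd_zero mneg mneg_neg)
qed

lemmas Hom_simps = Hom_closed Hom_add Hom_smult Hom_zero Hom_neg

lemma Hom_id: "(\<lambda>x. x) \<in> Hom A A"
  by (auto simp: mod_hom_def)

lemma Hom_comp: "\<lbrakk>f \<in> Hom A B; g \<in> Hom B C\<rbrakk> \<Longrightarrow> (\<lambda>x. g (f x)) \<in> Hom A C"
  by (auto simp: mod_hom_def Pi_iff)

lemma Hom_zero_map: "module R B \<Longrightarrow> (\<lambda>x. \<zero>\<^bsub>B\<^esub>) \<in> Hom A B"
  by (rule HomI) (simp_all add: mlin)

lemma Hom_plus: "\<lbrakk>f \<in> Hom A B; g \<in> Hom A B; module R B\<rbrakk> \<Longrightarrow> (\<lambda>x. f x \<oplus>\<^bsub>B\<^esub> g x) \<in> Hom A B"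
  by (rule HomI) (simp_all add: Hom_simps mlin)

lemma Hom_uminus: "\<lbrakk>f \<in> Hom A B; module R B\<rbrakk> \<Longrightarrow> (\<lambda>x. \<ominus>\<^bsub>B\<^esub> f x) \<in> Hom A B"
  by (rule HomI) (simp_all add: Hom_simps mlin)

lemma Hom_scale: "\<lbrakk>f \<in> Hom A B; module R B; u \<in> carrier R\<rbrakk> \<Longrightarrow> (\<lambda>x. u \<odot>\<^bsub>B\<^esub> f x) \<in> Hom A B"
  by (rule HomI) (simp_all add: Hom_simps mlin msmult_comm)

lemma Hom_cong: "\<lbrakk>f \<in> Hom A B; module R A; \<And>x. x \<in> carrier A \<Longrightarrow> g x = f x\<rbrakk> \<Longrightarrow> g \<in> Hom A B"
  by (rule HomI) (simp_all add: mlin Hom_simps)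

lemma a_kernel_eq: "a_kernel A B f = {x \<in> carrier A. f x = \<zero>\<^bsub>B\<^esub>}"
  by (simp add: a_kernel_def kernel_def)

definition epi where "epi A B q \<longleftrightarrow> q \<in> Hom A B \<and> q ` carrier A = carrier B"

lemma epi_Hom: "epi A B q \<Longrightarrow> q \<in> Hom A B"
  by (simp add: epi_def)

lemma epiE: "epi A B q \<Longrightarrow> y \<in> carrier B \<Longrightarrow> (\<And>x. x \<in> carrier A \<Longrightarrow> q x = y \<Longrightarrow> thesis) \<Longrightarrow> thesis"
  by (force simp: epi_def image_iff)

lemma epiI: "\<lbrakk>q \<in> Hom A B; \<And>y. y \<in> carrier B \<Longrightarrow> \<exists>x\<in>carrier A. q x = y\<rbrakk> \<Longrightarrow> epi A B q"
  by (auto simp: epi_def Hom_closed)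

lemma epi_comp: "epi A B f \<Longrightarrow> epi B C g \<Longrightarrow> epi A C (\<lambda>x. g (f x))"
  using Hom_comp[of f A B g C] image_comp[of g f "carrier A"] by (simp add: epi_def comp_def)



lemma Hom_descend:
  assumes q: "epi A Q q" and f: "f \<in> Hom A B" and mods: "module R A" "module R B" "module R Q"
    and ker: "\<And>x. \<lbrakk>x \<in> carrier A; q x = \<zero>\<^bsub>Q\<^esub>\<rbrakk> \<Longrightarrow> f x = \<zero>\<^bsub>B\<^esub>"
  obtains g where "g \<in> Hom Q B" "\<And>x. x \<in> carrier A \<Longrightarrow> g (q x) = f x"
proof -
  note qH = epi_Hom[OF q]
  have eq: "f x = f y" if "x \<in> carrier A" "y \<in> carrier A" "q x = q y" for x y
  proof -
    have "q (x \<oplus>\<^bsub>A\<^esub> \<ominus>\<^bsub>A\<^esub> y) = \<zero>\<^bsub>Q\<^esub>" using that qH mods by (simp add: Hom_simps mlin)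
    then have "f (x \<oplus>\<^bsub>A\<^esub> \<ominus>\<^bsub>A\<^esub> y) = \<zero>\<^bsub>B\<^esub>" using that mods by (intro ker) (simp_all add: mlin)
    then show ?thesis using that f mods by (simp add: Hom_simps mlin mdiff_zero)
  qed
  define g where "g y = f (SOME x. x \<in> carrier A \<and> q x = y)" for y
  have g: "g (q x) = f x" if "x \<in> carrier A" for x
    unfolding g_def using someI[of "\<lambda>z. z \<in> carrier A \<and> q z = q x" x] that by (intro eq) auto
  have "g \<in> Hom Q B"
  proof (rule HomI)
    fix y assume "y \<in> carrier Q"
    then obtain x where x: "x \<in> carrier A" "q x = y" using epiE[OF q] by blast
    then show "g y \<in> carrier B" using f g Hom_closed by metis
    show "g (a \<odot>\<^bsub>Q\<^esub> y) = a \<odot>\<^bsub>B\<^esub> g y" if "a \<in> carrier R" for a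
      using that x f qH g mods by (metis Hom_smult msmult)
    fix z assume "z \<in> carrier Q"
    then obtain w where w: "w \<in> carrier A" "q w = z" using epiE[OF q] by blast
    show "g (y \<oplus>\<^bsub>Q\<^esub> z) = g y \<oplus>\<^bsub>B\<^esub> g z" using x w f qH g mods by (metis Hom_add madd)
  qed
  then show ?thesis using that g by blast
qed



lemma Hom_corestrict:
  assumes i: "i \<in> Hom K B" "inj_on i (carrier K)" and f: "f \<in> Hom A B"
    and mods: "module R A" "module R B" "module R K"
    and img: "\<And>x. x \<in> carrier A \<Longrightarrow> f x \<in> i ` carrier K"
  obtains g where "g \<in> Hom A K" "\<And>x. x \<in> carrier A \<Longrightarrow> i (g x) = f x"
proof -
  define g where "g x = inv_into (carrier K) i (f x)" for x
  have g: "g x \<in> carrier K" "i (g x) = f x" if "x \<in> carrier A" for x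
    unfolding g_def using img[OF that] by (auto intro: inv_into_into f_inv_into_f)
  have "g \<in> Hom A K"
  proof (rule HomI)
    show "g (x \<oplus>\<^bsub>A\<^esub> y) = g x \<oplus>\<^bsub>K\<^esub> g y" if "x \<in> carrier A" "y \<in> carrier A" for x y
      using that g mods i f by (intro inj_onD[OF i(2)]) (simp_all add: mlin Hom_simps)
    show "g (a \<odot>\<^bsub>A\<^esub> x) = a \<odot>\<^bsub>K\<^esub> g x" if "a \<in> carrier R" "x \<in> carrier A" for a x
      using that g mods i f by (intro inj_onD[OF i(2)]) (simp_all add: mlin Hom_simps)
  qed (rule g)
  then show ?thesis using that g by blast
qed

lemma inj_onI_ker:
  assumes "f \<in> Hom A B" "module R A" "module R B"
    and "\<And>x. \<lbrakk>x \<in> carrier A; f x = \<zero>\<^bsub>B\<^esub>\<rbrakk> \<Longrightarrow> x = \<zero>\<^bsub>A\<^esub>"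
  shows "inj_on f (carrier A)"
proof (rule inj_onI)
  fix x y assume xy: "x \<in> carrier A" "y \<in> carrier A" "f x = f y"
  then have "f (x \<oplus>\<^bsub>A\<^esub> \<ominus>\<^bsub>A\<^esub> y) = \<zero>\<^bsub>B\<^esub>" using assms(1-3) by (simp add: Hom_simps mlin)
  then have "x \<oplus>\<^bsub>A\<^esub> \<ominus>\<^bsub>A\<^esub> y = \<zero>\<^bsub>A\<^esub>" using assms xy by (simp add: mlin)
  then show "x = y" using assms xy by (simp add: mdiff_zero)
qed

lemma inj_on_ker: "\<lbrakk>inj_on f (carrier A); f \<in> Hom A B; module R A; module R B; x \<in> carrier A; f x = \<zero>\<^bsub>B\<^esub>\<rbrakk>
   \<Longrightarrow> x = \<zero>\<^bsub>A\<^esub>"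
  by (metis Hom_zero inj_onD mzero)

section \<open>Submodules and finite generation\<close>

abbreviation sub where "sub M N \<equiv> M\<lparr>carrier := N\<rparr>"

lemma submodI:
  assumes "module R M" "N \<subseteq> carrier M" "\<zero>\<^bsub>M\<^esub> \<in> N"
    and "\<And>x y. \<lbrakk>x \<in> N; y \<in> N\<rbrakk> \<Longrightarrow> x \<oplus>\<^bsub>M\<^esub> y \<in> N"
    and "\<And>a x. \<lbrakk>a \<in> carrier R; x \<in> N\<rbrakk> \<Longrightarrow> a \<odot>\<^bsub>M\<^esub> x \<in> N"
  shows "submodule N R M"
proof (rule module.submoduleI)
  fix x assume "x \<in> N"
  then have "\<ominus>\<^bsub>M\<^esub> x = (\<ominus> \<one>) \<odot>\<^bsub>M\<^esub> x" using assms by (simp add: mneg_smult mone_smult subset_eq)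
  then show "\<ominus>\<^bsub>M\<^esub> x \<in> N" using assms \<open>x \<in> N\<close> by simp
qed (use assms in auto)

lemma submod_sub: "\<lbrakk>submodule N R M; module R M\<rbrakk> \<Longrightarrow> N \<subseteq> carrier M"
  and submod_zero: "\<lbrakk>submodule N R M; module R M\<rbrakk> \<Longrightarrow> \<zero>\<^bsub>M\<^esub> \<in> N"
  and submod_add: "\<lbrakk>submodule N R M; module R M; x \<in> N; y \<in> N\<rbrakk> \<Longrightarrow> x \<oplus>\<^bsub>M\<^esub> y \<in> N"
  and submod_neg: "\<lbrakk>submodule N R M; module R M; x \<in> N\<rbrakk> \<Longrightarrow> \<ominus>\<^bsub>M\<^esub> x \<in> N"
  and submod_smult: "\<lbrakk>submodule N R M; module R M; a \<in> carrier R; x \<in> N\<rbrakk> \<Longrightarrow> a \<odot>\<^bsub>M\<^esub> x \<in> N"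
  by (auto dest: module.submoduleE submodule.axioms(1) submodule.smult_closed)
    (auto dest!: submodule.axioms(1) subgroup.one_closed)

lemmas submod = submod_sub submod_zero submod_add submod_neg submod_smult

lemma module_sub: "\<lbrakk>submodule N R M; module R M\<rbrakk> \<Longrightarrow> module R (sub M N)"
  by (rule submodule.submodule_is_module)

lemma Hom_incl: "N \<subseteq> carrier M \<Longrightarrow> (\<lambda>x. x) \<in> Hom (sub M N) M"
  by (auto simp: mod_hom_def)

lemma Hom_restrict: "\<lbrakk>f \<in> Hom A B; N \<subseteq> carrier A\<rbrakk> \<Longrightarrow> f \<in> Hom (sub A N) B"
  by (rule HomI) (auto simp: subset_iff Hom_simps)

lemma submod_carrier: "module R M \<Longrightarrow> submodule (carrier M) R M"
  by (rule module.carrier_is_submodule)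

lemma submod_ker:
  "\<lbrakk>f \<in> Hom A B; module R A; module R B\<rbrakk> \<Longrightarrow> submodule {x \<in> carrier A. f x = \<zero>\<^bsub>B\<^esub>} R A"
  by (rule submodI) (auto simp: mlin Hom_simps)

lemma submod_image:
  assumes f: "f \<in> Hom A B" and A: "module R A" and B: "module R B" and N: "submodule N R A"
  shows "submodule (f ` N) R B"
proof (rule submodI[OF B])
  have NA: "x \<in> carrier A" if "x \<in> N" for x using submod(1)[OF N A] that by auto
  show "f ` N \<subseteq> carrier B" using f NA by (auto simp: Hom_closed)
  show "\<zero>\<^bsub>B\<^esub> \<in> f ` N" using submod(2)[OF N A] f A B by (metis Hom_zero image_eqI)
  fix x y assume "x \<in> f ` N" "y \<in> f ` N"
  then obtain x' y' where "x' \<in> N" "y' \<in> N" "x = f x'" "y = f y'" by auto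
  then show "x \<oplus>\<^bsub>B\<^esub> y \<in> f ` N" using submod(3)[OF N A] NA f
    by (intro image_eqI[of _ _ "x' \<oplus>\<^bsub>A\<^esub> y'"]) (auto simp: Hom_simps)
next
  have NA: "x \<in> carrier A" if "x \<in> N" for x using submod(1)[OF N A] that by auto
  fix a x assume "a \<in> carrier R" "x \<in> f ` N"
  then obtain x' where "x' \<in> N" "x = f x'" by auto
  then show "a \<odot>\<^bsub>B\<^esub> x \<in> f ` N" using submod(5)[OF N A \<open>a \<in> carrier R\<close>] NA f \<open>a \<in> carrier R\<close>
    by (intro image_eqI[of _ _ "a \<odot>\<^bsub>A\<^esub> x'"]) (auto simp: Hom_simps)
qed

lemma submod_vimage:
  assumes f: "f \<in> Hom A B" and A: "module R A" and B: "module R B" and N: "submodule N R B"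
  shows "submodule {x \<in> carrier A. f x \<in> N} R A"
  using submod[OF N B] f A B by (intro submodI[OF A]) (auto simp: Hom_simps mclosed)

lemma submod_Inter:
  "\<lbrakk>module R M; submodule K R M; submodule N R M\<rbrakk> \<Longrightarrow> submodule (K \<inter> N) R M"
  by (rule submodI) (auto simp: submod subset_eq dest: submod_sub)

lemma submod_trans: "\<lbrakk>module R M; submodule N R M; submodule K R (sub M N)\<rbrakk> \<Longrightarrow> submodule K R M"
  using submod[of K "sub M N"] module_sub[of N M] submod[of N M] by (intro submodI) auto

lemma submod_restrict: "\<lbrakk>module R M; submodule N R M; submodule K R M; K \<subseteq> N\<rbrakk> \<Longrightarrow> submodule K R (sub M N)"
  using submod[of K M] module_sub[of N M] by (intro submodI) auto



definition span where "span M A = {m \<in> carrier M. \<forall>N. submodule N R M \<and> A \<subseteq> N \<longrightarrow> m \<in> N}"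

lemma span_submodule: "module R M \<Longrightarrow> submodule (span M A) R M"
  by (rule submodI) (auto simp: span_def mclosed submod)

lemma span_incl: "A \<subseteq> carrier M \<Longrightarrow> A \<subseteq> span M A"
  by (auto simp: span_def)

lemma span_minimal: "\<lbrakk>submodule N R M; A \<subseteq> N\<rbrakk> \<Longrightarrow> span M A \<subseteq> N"
  by (auto simp: span_def)

lemma span_mono: "A \<subseteq> B \<Longrightarrow> span M A \<subseteq> span M B"
  by (auto simp: span_def)

lemma finsum_submod:
  assumes "module R M" "submodule N R M" "finite B" "f \<in> B \<rightarrow> N"
  shows "finsum M f B \<in> N"
  using assms(3,4)
proof (induction B)
  case empty
  interpret M: module R M by fact
  show ?case using submod_zero[OF assms(2,1)] by simp
next
  case (insert b B)
  interpret M: module R M by fact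
  have "f \<in> B \<rightarrow> carrier M" "f b \<in> carrier M" using insert submod_sub[OF assms(2,1)] by auto
  then show ?case using insert submod_add[OF assms(2,1)] by simp
qed

lemma span_finite:
  assumes M: "module R M" and A: "finite A" "A \<subseteq> carrier M"
  shows "span M A = {m. \<exists>c\<in>A \<rightarrow> carrier R. m = (\<Oplus>\<^bsub>M\<^esub>b\<in>A. c b \<odot>\<^bsub>M\<^esub> b)}" (is "_ = ?L")
proof
  interpret M: module R M by fact
  have c: "(\<lambda>b. c b \<odot>\<^bsub>M\<^esub> b) \<in> A \<rightarrow> carrier M" if "c \<in> A \<rightarrow> carrier R" for c
    using that A by auto
  have "submodule ?L R M"
  proof (rule submodI[OF M])
    show "?L \<subseteq> carrier M" using c by auto
    have "(\<Oplus>\<^bsub>M\<^esub>b\<in>A. \<zero> \<odot>\<^bsub>M\<^esub> b) = \<zero>\<^bsub>M\<^esub>"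
      using A by (intro M.M.add.finprod_one_eqI) auto
    then show "\<zero>\<^bsub>M\<^esub> \<in> ?L" by (intro CollectI bexI[of _ "\<lambda>b. \<zero>"]) auto
    fix x y assume "x \<in> ?L" "y \<in> ?L"
    then obtain c e where ce: "c \<in> A \<rightarrow> carrier R" "x = (\<Oplus>\<^bsub>M\<^esub>b\<in>A. c b \<odot>\<^bsub>M\<^esub> b)"
      "e \<in> A \<rightarrow> carrier R" "y = (\<Oplus>\<^bsub>M\<^esub>b\<in>A. e b \<odot>\<^bsub>M\<^esub> b)" by blast
    then have "x \<oplus>\<^bsub>M\<^esub> y = (\<Oplus>\<^bsub>M\<^esub>b\<in>A. c b \<odot>\<^bsub>M\<^esub> b \<oplus>\<^bsub>M\<^esub> e b \<odot>\<^bsub>M\<^esub> b)"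
      using c by (simp add: M.M.finsum_addf)
    also have "\<dots> = (\<Oplus>\<^bsub>M\<^esub>b\<in>A. (c b \<oplus> e b) \<odot>\<^bsub>M\<^esub> b)"
      using ce A by (intro M.M.finsum_cong') (auto simp: M.smult_l_distr Pi_iff subset_eq)
    finally show "x \<oplus>\<^bsub>M\<^esub> y \<in> ?L" using ce by (intro CollectI bexI[of _ "\<lambda>b. c b \<oplus> e b"]) auto
  next
    fix a x assume a: "a \<in> carrier R" and "x \<in> ?L"
    then obtain c where ce: "c \<in> A \<rightarrow> carrier R" "x = (\<Oplus>\<^bsub>M\<^esub>b\<in>A. c b \<odot>\<^bsub>M\<^esub> b)" by blast
    then have "a \<odot>\<^bsub>M\<^esub> x = (\<Oplus>\<^bsub>M\<^esub>b\<in>A. a \<odot>\<^bsub>M\<^esub> (c b \<odot>\<^bsub>M\<^esub> b))"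
      using a c A by (simp add: M.finsum_smult_ldistr)
    also have "\<dots> = (\<Oplus>\<^bsub>M\<^esub>b\<in>A. (a \<otimes> c b) \<odot>\<^bsub>M\<^esub> b)"
      using ce A a by (intro M.M.finsum_cong') (auto simp: M.smult_assoc1 Pi_iff subset_eq)
    finally show "a \<odot>\<^bsub>M\<^esub> x \<in> ?L" using ce a by (intro CollectI bexI[of _ "\<lambda>b. a \<otimes> c b"]) auto
  qed
  moreover have "A \<subseteq> ?L"
  proof
    fix a assume a: "a \<in> A"
    have "(\<Oplus>\<^bsub>M\<^esub>b\<in>A. (if b = a then \<one> else \<zero>) \<odot>\<^bsub>M\<^esub> b) = (\<Oplus>\<^bsub>M\<^esub>b\<in>A. if a = b then b else \<zero>\<^bsub>M\<^esub>)"
      using A by (intro M.M.finsum_cong') auto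
    also have "\<dots> = a" using a A by (subst M.M.add.finprod_singleton[where f="\<lambda>b. b"]) auto
    finally show "a \<in> ?L" by (intro CollectI bexI[of _ "\<lambda>b. if b = a then \<one> else \<zero>"]) auto
  qed
  ultimately show "span M A \<subseteq> ?L" by (rule span_minimal)
  show "?L \<subseteq> span M A"
    using span_submodule[OF M] span_incl[OF A(2)] A(1)
    by (auto intro!: finsum_submod[OF M] submod_smult[OF _ M] simp: Pi_iff)
qed

lemma fin_gen_span: "module R M \<Longrightarrow> fin_gen R M \<longleftrightarrow> (\<exists>A. finite A \<and> A \<subseteq> carrier M \<and> span M A = carrier M)"
proof
  assume M: "module R M"
  show "fin_gen R M \<Longrightarrow> \<exists>A. finite A \<and> A \<subseteq> carrier M \<and> span M A = carrier M"
  proof -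
    assume "fin_gen R M"
    then obtain A where A: "finite A" "A \<subseteq> carrier M"
      "\<forall>m\<in>carrier M. \<exists>c\<in>A \<rightarrow> carrier R. m = (\<Oplus>\<^bsub>M\<^esub>b\<in>A. c b \<odot>\<^bsub>M\<^esub> b)"
      unfolding fin_gen_def by blast
    then have "carrier M \<subseteq> span M A" by (subst span_finite[OF M]) auto
    then show ?thesis using A by (auto simp: span_def)
  qed
  show "\<exists>A. finite A \<and> A \<subseteq> carrier M \<and> span M A = carrier M \<Longrightarrow> fin_gen R M"
  proof -
    assume "\<exists>A. finite A \<and> A \<subseteq> carrier M \<and> span M A = carrier M"
    then obtain A where A: "finite A" "A \<subseteq> carrier M" "span M A = carrier M" by blast
    then show ?thesis unfolding fin_gen_def using span_finite[OF M A(1,2)] by (intro exI[of _ A]) auto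
  qed
qed

lemma fin_gen_image:
  assumes A: "module R A" and B: "module R B" and f: "epi A B f" and fg: "fin_gen R A"
  shows "fin_gen R B"
proof -
  obtain S where S: "finite S" "S \<subseteq> carrier A" "span A S = carrier A"
    using fg fin_gen_span[OF A] by blast
  have "f ` S \<subseteq> span B (f ` S)"
    using S(2) by (intro span_incl) (auto simp: Hom_closed[OF epi_Hom[OF f]])
  then have "span A S \<subseteq> {x \<in> carrier A. f x \<in> span B (f ` S)}"
    using S(2) by (intro span_minimal submod_vimage[OF epi_Hom[OF f] A B span_submodule[OF B]]) auto
  then have "carrier A \<subseteq> {x \<in> carrier A. f x \<in> span B (f ` S)}" by (simp only: S(3))
  then have "span B (f ` S) = carrier B"
    using submod_sub[OF span_submodule B, OF B] by (fastforce elim!: epiE[OF f])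
  then show ?thesis
    using S fin_gen_span[OF B] Hom_closed[OF epi_Hom[OF f]]
    by (metis (no_types, lifting) finite_imageI image_subset_iff subsetD)
qed

text \<open>The possible coefficients of \<^term>\<open>a\<close> in elements of \<^term>\<open>K\<close> modulo \<^term>\<open>T\<close>.\<close>

lemma ideal_colon:
  assumes M: "module R M" and a: "a \<in> carrier M" and T: "submodule T R M" and K: "submodule K R M"
  shows "ideal {r \<in> carrier R. \<exists>t\<in>T. r \<odot>\<^bsub>M\<^esub> a \<oplus>\<^bsub>M\<^esub> t \<in> K} R" (is "ideal ?J R")
proof -
  define J where "J = ?J"
  note Ts = submod[OF T M] and K = submod[OF K M]
  have TM: "t \<in> carrier M" if "t \<in> T" for t using Ts(1) that by auto
  have "ideal J R"
  proof (rule idealI[OF ring_axioms])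
    show "subgroup J (add_monoid R)"
    proof (rule add.subgroupI)
      show "J \<subseteq> carrier R" by (auto simp: J_def)
      have "\<zero> \<in> J" unfolding J_def using Ts(2) K(2) M a by (auto intro!: bexI[of _ "\<zero>\<^bsub>M\<^esub>"] simp: mlin)
      then show "J \<noteq> {}" by auto
      fix r assume "r \<in> J"
      then obtain t where r: "r \<in> carrier R" "t \<in> T" "r \<odot>\<^bsub>M\<^esub> a \<oplus>\<^bsub>M\<^esub> t \<in> K" unfolding J_def by auto
      then have "(\<ominus> r) \<odot>\<^bsub>M\<^esub> a \<oplus>\<^bsub>M\<^esub> \<ominus>\<^bsub>M\<^esub> t = \<ominus>\<^bsub>M\<^esub> (r \<odot>\<^bsub>M\<^esub> a \<oplus>\<^bsub>M\<^esub> t)"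
        using M a TM by (simp add: mlin mneg_smult)
      then have "(\<ominus> r) \<odot>\<^bsub>M\<^esub> a \<oplus>\<^bsub>M\<^esub> \<ominus>\<^bsub>M\<^esub> t \<in> K" using K(4)[OF r(3)] by simp
      then show "\<ominus> r \<in> J" unfolding J_def using r Ts(4) by blast
      fix r' assume "r' \<in> J"
      then obtain t' where r': "r' \<in> carrier R" "t' \<in> T" "r' \<odot>\<^bsub>M\<^esub> a \<oplus>\<^bsub>M\<^esub> t' \<in> K" unfolding J_def by auto
      have "(r \<oplus> r') \<odot>\<^bsub>M\<^esub> a \<oplus>\<^bsub>M\<^esub> (t \<oplus>\<^bsub>M\<^esub> t') = (r \<odot>\<^bsub>M\<^esub> a \<oplus>\<^bsub>M\<^esub> t) \<oplus>\<^bsub>M\<^esub> (r' \<odot>\<^bsub>M\<^esub> a \<oplus>\<^bsub>M\<^esub> t')"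
        using r r' M a TM by (simp add: mlin madd_smult)
      also have "\<dots> \<in> K" using K(3) r r' by blast
      finally show "r \<oplus> r' \<in> J" unfolding J_def using r r' Ts(3)[OF r(2) r'(2)] by blast
    qed
    fix r b assume "r \<in> J" and b: "b \<in> carrier R"
    then obtain t where r: "r \<in> carrier R" "t \<in> T" "r \<odot>\<^bsub>M\<^esub> a \<oplus>\<^bsub>M\<^esub> t \<in> K" unfolding J_def by auto
    have "(b \<otimes> r) \<odot>\<^bsub>M\<^esub> a \<oplus>\<^bsub>M\<^esub> b \<odot>\<^bsub>M\<^esub> t = b \<odot>\<^bsub>M\<^esub> (r \<odot>\<^bsub>M\<^esub> a \<oplus>\<^bsub>M\<^esub> t)"
      using r b M a TM by (simp add: mlin msmult_smult)
    also have "\<dots> \<in> K" using K(5) r b by blast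
    finally show "b \<otimes> r \<in> J" unfolding J_def using r b Ts(5)[OF b r(2)] by blast
    then show "r \<otimes> b \<in> J" using r b by (simp add: m_comm)
  qed
  then show ?thesis by (simp add: J_def)
qed

end

locale noetherian_cring = cring R + noetherian_ring R for R (structure)
begin

text \<open>Induction on the number of generators: the coefficients of the new generator \<^term>\<open>a\<close> in elements of
  the submodule \<^term>\<open>K\<close> form an ideal; lift finitely many generators of it to \<^term>\<open>K\<close>, and what remains
  lies in the span of the old generators.\<close>

lemma submod_fin_gen:
  assumes M: "module R M"
    and "finite A" "A \<subseteq> carrier M" "submodule K R M" "K \<subseteq> span M A"
  shows "\<exists>S. finite S \<and> S \<subseteq> K \<and> K \<subseteq> span M S"
  using assms(2-)
proof (induction A arbitrary: K)
  case empty
  have "submodule {\<zero>\<^bsub>M\<^esub>} R M" by (rule submodI[OF M]) (simp_all add: mlin[OF M])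
  then have "span M {} \<subseteq> {\<zero>\<^bsub>M\<^esub>}" by (rule span_minimal) simp
  then show ?case using empty submod_zero[OF span_submodule M, OF M] by (intro exI[of _ "{}"]) auto
next
  case (insert a A)
  note K = submod[OF insert.prems(2) M]
  have a: "a \<in> carrier M" and A: "A \<subseteq> carrier M" using insert by auto
  define T where "T = span M A"
  have T: "submodule T R M" unfolding T_def by (rule span_submodule[OF M])
  note Ts = submod[OF T M]
  have TM: "t \<in> carrier M" if "t \<in> T" for t using Ts(1) that by auto
  define J where "J = {r \<in> carrier R. \<exists>t\<in>T. r \<odot>\<^bsub>M\<^esub> a \<oplus>\<^bsub>M\<^esub> t \<in> K}"
  have "ideal J R" unfolding J_def by (rule ideal_colon[OF M a T insert.prems(2)])
  then obtain G where G: "G \<subseteq> carrier R" "finite G" "J = Idl G" using finetely_gen by blast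
  have GJ: "G \<subseteq> J" using G genideal_self by blast
  then have "\<forall>r\<in>G. \<exists>t\<in>T. r \<odot>\<^bsub>M\<^esub> a \<oplus>\<^bsub>M\<^esub> t \<in> K" unfolding J_def by blast
  then obtain t where t: "\<And>r. r \<in> G \<Longrightarrow> t r \<in> T \<and> r \<odot>\<^bsub>M\<^esub> a \<oplus>\<^bsub>M\<^esub> t r \<in> K" by metis
  have "submodule (K \<inter> T) R M" using T insert by (intro submod_Inter[OF M])
  then obtain S where S: "finite S" "S \<subseteq> K \<inter> T" "K \<inter> T \<subseteq> span M S"
    using insert.IH[of "K \<inter> T"] A by (auto simp: T_def)
  define S' where "S' = S \<union> (\<lambda>r. r \<odot>\<^bsub>M\<^esub> a \<oplus>\<^bsub>M\<^esub> t r) ` G"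
  have S': "finite S'" "S' \<subseteq> K" using S G t by (auto simp: S'_def)
  have sp: "submodule (span M S') R M" by (rule span_submodule[OF M])
  note sps = submod[OF sp M]
  have S'i: "S' \<subseteq> span M S'" using S' K(1) by (intro span_incl) auto
  have "span M S \<subseteq> span M S'" by (rule span_mono) (auto simp: S'_def)
  then have KT: "K \<inter> T \<subseteq> span M S'" using S by auto
  have spK: "span M S' \<subseteq> K" using S' insert.prems(2) by (intro span_minimal)
  \<comment> \<open>The coefficients of \<^term>\<open>a\<close> that occur in the span of the lifted generators: an ideal containing
    \<^term>\<open>G\<close>, hence all of \<^term>\<open>J\<close>.\<close>
  define J' where "J' = {r \<in> carrier R. \<exists>t\<in>T. r \<odot>\<^bsub>M\<^esub> a \<oplus>\<^bsub>M\<^esub> t \<in> span M S'}"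
  have "ideal J' R" unfolding J'_def by (rule ideal_colon[OF M a T sp])
  moreover have "G \<subseteq> J'"
  proof
    fix r assume r: "r \<in> G"
    then have "r \<odot>\<^bsub>M\<^esub> a \<oplus>\<^bsub>M\<^esub> t r \<in> span M S'" using S'i by (auto simp: S'_def)
    then show "r \<in> J'" using r t G by (auto simp: J'_def)
  qed
  ultimately have JJ: "J \<subseteq> J'" using G genideal_minimal by blast
  have "submodule {x \<in> carrier M. \<exists>r\<in>carrier R. \<exists>t\<in>T. x = r \<odot>\<^bsub>M\<^esub> a \<oplus>\<^bsub>M\<^esub> t} R M" (is "submodule ?X R M")
  proof (rule submodI[OF M])
    show "\<zero>\<^bsub>M\<^esub> \<in> ?X" using M a Ts(2) by (auto intro!: bexI[of _ "\<zero>"] bexI[of _ "\<zero>\<^bsub>M\<^esub>"] simp: mlin)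
    fix x y assume "x \<in> ?X" "y \<in> ?X"
    then obtain r t r' t' where r: "r \<in> carrier R" "t \<in> T" "x = r \<odot>\<^bsub>M\<^esub> a \<oplus>\<^bsub>M\<^esub> t"
      "r' \<in> carrier R" "t' \<in> T" "y = r' \<odot>\<^bsub>M\<^esub> a \<oplus>\<^bsub>M\<^esub> t'" by blast
    then have "x \<oplus>\<^bsub>M\<^esub> y = (r \<oplus> r') \<odot>\<^bsub>M\<^esub> a \<oplus>\<^bsub>M\<^esub> (t \<oplus>\<^bsub>M\<^esub> t')"
      using r M a TM by (simp add: mlin madd_smult)
    moreover have "t \<oplus>\<^bsub>M\<^esub> t' \<in> T" "r \<oplus> r' \<in> carrier R" using r Ts(3) by auto
    ultimately show "x \<oplus>\<^bsub>M\<^esub> y \<in> ?X" using M a TM by (auto simp: mclosed)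
  next
    fix b x assume b: "b \<in> carrier R" and "x \<in> ?X"
    then obtain r t where r: "r \<in> carrier R" "t \<in> T" "x = r \<odot>\<^bsub>M\<^esub> a \<oplus>\<^bsub>M\<^esub> t" by blast
    then have "b \<odot>\<^bsub>M\<^esub> x = (b \<otimes> r) \<odot>\<^bsub>M\<^esub> a \<oplus>\<^bsub>M\<^esub> b \<odot>\<^bsub>M\<^esub> t"
      using b M a TM by (simp add: mlin msmult_smult)
    moreover have "b \<odot>\<^bsub>M\<^esub> t \<in> T" "b \<otimes> r \<in> carrier R" using r b Ts(5) by auto
    ultimately show "b \<odot>\<^bsub>M\<^esub> x \<in> ?X" using M a TM by (auto simp: mclosed)
  qed auto
  moreover have "insert a A \<subseteq> ?X"
  proof
    fix x assume "x \<in> insert a A"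
    then consider "x = a" | "x \<in> A" by auto
    then show "x \<in> ?X"
    proof cases
      case 1
      then show ?thesis using a M Ts(2) by (auto intro!: bexI[of _ "\<one>"] bexI[of _ "\<zero>\<^bsub>M\<^esub>"] simp: mlin)
    next
      case 2
      then have "x \<in> T" using span_incl[OF A] by (auto simp: T_def)
      then show ?thesis using a M TM by (auto intro!: bexI[of _ "\<zero>"] bexI[of _ "x"] simp: mlin)
    qed
  qed
  ultimately have X: "span M (insert a A) \<subseteq> ?X" by (rule span_minimal)
  have "K \<subseteq> span M S'"
  proof
    fix x assume x: "x \<in> K"
    then obtain r u where r: "r \<in> carrier R" "u \<in> T" "x = r \<odot>\<^bsub>M\<^esub> a \<oplus>\<^bsub>M\<^esub> u"
      using insert.prems X by blast
    then have "r \<in> J" using x by (auto simp: J_def)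
    then obtain v where v: "v \<in> T" "r \<odot>\<^bsub>M\<^esub> a \<oplus>\<^bsub>M\<^esub> v \<in> span M S'" using JJ by (auto simp: J'_def)
    have rv: "r \<odot>\<^bsub>M\<^esub> a \<oplus>\<^bsub>M\<^esub> v \<in> K" using v spK by auto
    have eq: "x \<oplus>\<^bsub>M\<^esub> \<ominus>\<^bsub>M\<^esub> (r \<odot>\<^bsub>M\<^esub> a \<oplus>\<^bsub>M\<^esub> v) = u \<oplus>\<^bsub>M\<^esub> \<ominus>\<^bsub>M\<^esub> v"
      using r v M a TM by (simp add: mlin)
    have "x \<oplus>\<^bsub>M\<^esub> \<ominus>\<^bsub>M\<^esub> (r \<odot>\<^bsub>M\<^esub> a \<oplus>\<^bsub>M\<^esub> v) \<in> K" using x rv K(3,4) by blast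
    moreover have "u \<oplus>\<^bsub>M\<^esub> \<ominus>\<^bsub>M\<^esub> v \<in> T" using r v Ts(3,4) by blast
    ultimately have "u \<oplus>\<^bsub>M\<^esub> \<ominus>\<^bsub>M\<^esub> v \<in> span M S'" using eq KT by auto
    then have "(u \<oplus>\<^bsub>M\<^esub> \<ominus>\<^bsub>M\<^esub> v) \<oplus>\<^bsub>M\<^esub> (r \<odot>\<^bsub>M\<^esub> a \<oplus>\<^bsub>M\<^esub> v) \<in> span M S'" using v sps(3) by blast
    then show "x \<in> span M S'" using r v M a TM by (simp add: mlin)
  qed
  then show ?case using S' by blast
qed

lemma fin_gen_submodule:
  assumes M: "module R M" and fg: "fin_gen R M" and K: "submodule K R M"
  shows "\<exists>S. finite S \<and> S \<subseteq> K \<and> span M S = K"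
proof -
  obtain A where "finite A" "A \<subseteq> carrier M" "span M A = carrier M"
    using fg fin_gen_span[OF M] by blast
  then obtain S where "finite S" "S \<subseteq> K" "K \<subseteq> span M S"
    using submod_fin_gen[OF M _ _ K, of A] submod_sub[OF K M] by auto
  then show ?thesis using span_minimal[OF K, of S] by blast
qed

lemma fgmod_sub: "\<lbrakk>M \<in> fgmod R; submodule K R M\<rbrakk> \<Longrightarrow> sub M K \<in> fgmod R"
proof -
  assume M: "M \<in> fgmod R" and K: "submodule K R M"
  note mM = module_fgmod[OF M]
  obtain S where S: "finite S" "S \<subseteq> K" "span M S = K"
    using fin_gen_submodule[OF mM _ K] M by (auto simp: fgmod_def)
  have "K \<subseteq> span (sub M K) S"
    using submod_trans[OF mM K] S(3) K by (auto simp: span_def)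
  moreover have "span (sub M K) S \<subseteq> K" by (auto simp: span_def)
  ultimately show "sub M K \<in> fgmod R"
    unfolding fgmod_def using module_sub[OF K mM] fin_gen_span[of "sub M K"] S by auto
qed

end

section \<open>Direct sums, quotients and isomorphisms\<close>

text \<open>All modules of the category have carriers inside one type \<open>'a list\<close>, and so must their direct sums. This type is
  infinite whatever \<open>'a\<close> is, hence it admits an injective coding of pairs.\<close>

definition code_pair :: "'a list \<times> 'a list \<Rightarrow> 'a list" where
  "code_pair = (SOME f. inj f)"

lemma inj_code_pair: "inj (code_pair :: 'a list \<times> 'a list \<Rightarrow> 'a list)"
proof -
  have "infinite (UNIV :: 'a list set)" by (rule infinite_UNIV_listI)
  then have "(card_of (UNIV \<times> UNIV :: ('a list \<times> 'a list) set), card_of (UNIV :: 'a list set)) \<in> ordLeq"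
    using card_of_Times_same_infinite ordIso_iff_ordLeq by blast
  then obtain f :: "'a list \<times> 'a list \<Rightarrow> 'a list" where "inj f"
    by (auto simp: card_of_ordLeq[symmetric])
  then show ?thesis unfolding code_pair_def by (rule someI[of inj])
qed

definition pair where "pair a b = code_pair (a, b)"
definition pfst where "pfst u = fst (inv_into UNIV code_pair u)"
definition psnd where "psnd u = snd (inv_into UNIV code_pair u)"

lemma pair_simps [simp]: "pfst (pair a b) = a" "psnd (pair a b) = b"
  "pair a b = pair c d \<longleftrightarrow> a = c \<and> b = d"
  by (simp_all add: pair_def pfst_def psnd_def inj_code_pair inj_eq)

definition bsum :: "'a lmodule \<Rightarrow> 'a lmodule \<Rightarrow> 'a lmodule" where
  "bsum A B = \<lparr>carrier = {pair a b |a b. a \<in> carrier A \<and> b \<in> carrier B},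
     monoid.mult = undefined, one = undefined, ring.zero = pair \<zero>\<^bsub>A\<^esub> \<zero>\<^bsub>B\<^esub>,
     add = (\<lambda>u v. pair (pfst u \<oplus>\<^bsub>A\<^esub> pfst v) (psnd u \<oplus>\<^bsub>B\<^esub> psnd v)),
     smult = (\<lambda>a u. pair (a \<odot>\<^bsub>A\<^esub> pfst u) (a \<odot>\<^bsub>B\<^esub> psnd u))\<rparr>"

lemma bsum_simps [simp]:
  "pair a b \<in> carrier (bsum A B) \<longleftrightarrow> a \<in> carrier A \<and> b \<in> carrier B"
  "\<zero>\<^bsub>bsum A B\<^esub> = pair \<zero>\<^bsub>A\<^esub> \<zero>\<^bsub>B\<^esub>"
  "u \<oplus>\<^bsub>bsum A B\<^esub> v = pair (pfst u \<oplus>\<^bsub>A\<^esub> pfst v) (psnd u \<oplus>\<^bsub>B\<^esub> psnd v)"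
  "c \<odot>\<^bsub>bsum A B\<^esub> u = pair (c \<odot>\<^bsub>A\<^esub> pfst u) (c \<odot>\<^bsub>B\<^esub> psnd u)"
  by (auto simp: bsum_def)

lemma bsumE: "u \<in> carrier (bsum A B) \<Longrightarrow>
    (\<And>a b. \<lbrakk>a \<in> carrier A; b \<in> carrier B; u = pair a b\<rbrakk> \<Longrightarrow> thesis) \<Longrightarrow> thesis"
  by (auto simp: bsum_def)

lemma bsum_proj: "u \<in> carrier (bsum A B) \<Longrightarrow> pfst u \<in> carrier A"
  "u \<in> carrier (bsum A B) \<Longrightarrow> psnd u \<in> carrier B"
  "u \<in> carrier (bsum A B) \<Longrightarrow> pair (pfst u) (psnd u) = u"
  by (auto elim!: bsumE)

context cring
begin

lemma module_bsum: assumes "module R A" "module R B" shows "module R (bsum A B)"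
proof (rule moduleI)
  show "abelian_group (bsum A B)"
  proof (rule abelian_groupI)
    fix u assume "u \<in> carrier (bsum A B)"
    then show "\<exists>v\<in>carrier (bsum A B). v \<oplus>\<^bsub>bsum A B\<^esub> u = \<zero>\<^bsub>bsum A B\<^esub>"
      using assms by (intro bexI[of _ "pair (\<ominus>\<^bsub>A\<^esub> pfst u) (\<ominus>\<^bsub>B\<^esub> psnd u)"]) (auto simp: mlin elim!: bsumE)
  qed (use assms in \<open>auto simp: mlin elim!: bsumE\<close>)
qed (use assms in \<open>auto simp: mlin madd_smult msmult_smult elim!: bsumE intro: is_cring\<close>)

lemma Hom_pfst: "pfst \<in> Hom (bsum A B) A" and Hom_psnd: "psnd \<in> Hom (bsum A B) B"
  by (auto simp: mod_hom_def elim!: bsumE)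

lemma Hom_pair: "\<lbrakk>f \<in> Hom C A; g \<in> Hom C B\<rbrakk> \<Longrightarrow> (\<lambda>x. pair (f x) (g x)) \<in> Hom C (bsum A B)"
  by (rule HomI) (auto simp: Hom_simps)

lemma Hom_inl: "module R B \<Longrightarrow> (\<lambda>x. pair x \<zero>\<^bsub>B\<^esub>) \<in> Hom A (bsum A B)"
  and Hom_inr: "module R A \<Longrightarrow> (\<lambda>x. pair \<zero>\<^bsub>A\<^esub> x) \<in> Hom B (bsum A B)"
  by (auto intro!: Hom_pair Hom_id Hom_zero_map)

lemma Hom_copair:
  "\<lbrakk>f \<in> Hom A C; g \<in> Hom B C; module R C\<rbrakk> \<Longrightarrow> (\<lambda>u. f (pfst u) \<oplus>\<^bsub>C\<^esub> g (psnd u)) \<in> Hom (bsum A B) C"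
  by (intro Hom_plus Hom_comp[OF Hom_pfst] Hom_comp[OF Hom_psnd])

lemma bsum_fgmod:
  assumes A: "A \<in> fgmod R" and B: "B \<in> fgmod R" shows "bsum A B \<in> fgmod R"
proof -
  note mA = module_fgmod[OF A] and mB = module_fgmod[OF B]
  note mS = module_bsum[OF mA mB]
  obtain S where S: "finite S" "S \<subseteq> carrier A" "span A S = carrier A"
    using A fin_gen_span[OF mA] by (auto simp: fgmod_def)
  obtain T where T: "finite T" "T \<subseteq> carrier B" "span B T = carrier B"
    using B fin_gen_span[OF mB] by (auto simp: fgmod_def)
  let ?X = "(\<lambda>x. pair x \<zero>\<^bsub>B\<^esub>) ` S \<union> (\<lambda>x. pair \<zero>\<^bsub>A\<^esub> x) ` T"
  have X: "?X \<subseteq> carrier (bsum A B)" using S T mA mB by (auto simp: mlin)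
  note sub = span_submodule[OF mS, of ?X]
  have "span A S \<subseteq> {a \<in> carrier A. pair a \<zero>\<^bsub>B\<^esub> \<in> span (bsum A B) ?X}"
    using span_incl[OF X] S(2) by (intro span_minimal submod_vimage[OF Hom_inl[OF mB] mA mS sub]) auto
  then have a: "pair a \<zero>\<^bsub>B\<^esub> \<in> span (bsum A B) ?X" if "a \<in> carrier A" for a using that S(3) by auto
  have "span B T \<subseteq> {a \<in> carrier B. pair \<zero>\<^bsub>A\<^esub> a \<in> span (bsum A B) ?X}"
    using span_incl[OF X] T(2) by (intro span_minimal submod_vimage[OF Hom_inr[OF mA] mB mS sub]) auto
  then have b: "pair \<zero>\<^bsub>A\<^esub> b \<in> span (bsum A B) ?X" if "b \<in> carrier B" for b using that T(3) by auto
  have "u \<in> span (bsum A B) ?X" if u: "u \<in> carrier (bsum A B)" for u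
  proof -
    obtain x y where xy: "x \<in> carrier A" "y \<in> carrier B" "u = pair x y" using u by (rule bsumE)
    have "pair x \<zero>\<^bsub>B\<^esub> \<oplus>\<^bsub>bsum A B\<^esub> pair \<zero>\<^bsub>A\<^esub> y \<in> span (bsum A B) ?X"
      using submod_add[OF sub mS a b] xy by blast
    then show ?thesis using xy mA mB by (simp add: mlin)
  qed
  then have "span (bsum A B) ?X = carrier (bsum A B)" by (auto simp: span_def)
  then have "fin_gen R (bsum A B)"
    using X S T by (subst fin_gen_span[OF mS]) (intro exI[of _ ?X], simp)
  then show ?thesis using mS by (simp add: fgmod_def)
qed

text \<open>The module axioms are equations, so they pass to the image of a surjection that respects the
  operations.\<close>

lemma module_image:
  assumes A: "module R A" and q: "q ` carrier A = carrier Q" "q \<zero>\<^bsub>A\<^esub> = \<zero>\<^bsub>Q\<^esub>"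
    and add: "\<And>x y. \<lbrakk>x \<in> carrier A; y \<in> carrier A\<rbrakk> \<Longrightarrow> q x \<oplus>\<^bsub>Q\<^esub> q y = q (x \<oplus>\<^bsub>A\<^esub> y)"
    and smult: "\<And>a x. \<lbrakk>a \<in> carrier R; x \<in> carrier A\<rbrakk> \<Longrightarrow> a \<odot>\<^bsub>Q\<^esub> q x = q (a \<odot>\<^bsub>A\<^esub> x)"
  shows "module R Q" and "epi A Q q"
proof -
  show "epi A Q q" using q add smult unfolding epi_def by (auto intro!: HomI)
  show "module R Q"
  proof (rule moduleI)
    show "abelian_group Q"
    proof (rule abelian_groupI)
      fix u assume "u \<in> carrier Q"
      then obtain x where x: "x \<in> carrier A" "u = q x" using q by auto
      show "\<exists>v\<in>carrier Q. v \<oplus>\<^bsub>Q\<^esub> u = \<zero>\<^bsub>Q\<^esub>"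
        using x A q add[of "\<ominus>\<^bsub>A\<^esub> x" x] by (intro bexI[of _ "q (\<ominus>\<^bsub>A\<^esub> x)"]) (auto simp: mlin)
    qed (use A q(2) in \<open>auto simp: q(1)[symmetric] add q(2)[symmetric] mlin simp del: q(2)\<close>)
  qed (use A in \<open>auto simp: q(1)[symmetric] add smult mlin madd_smult msmult_smult intro: is_cring\<close>)
qed

text \<open>The quotient by cosets has elements of a larger type. Choosing a representative in each coset gives a
  copy whose carrier is a subset of \<^term>\<open>carrier A\<close>.\<close>

lemma quotient_exists:
  assumes A: "A \<in> fgmod R" and K: "submodule K R A"
  obtains Q q where "Q \<in> fgmod R" "epi A Q q" "\<And>x. x \<in> carrier A \<Longrightarrow> q x = \<zero>\<^bsub>Q\<^esub> \<longleftrightarrow> x \<in> K"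
proof -
  note mA = module_fgmod[OF A]
  note Ks = submod[OF K mA]
  have KA: "x \<in> carrier A" if "x \<in> K" for x using Ks(1) that by auto
  define q where "q x = (SOME y. y \<in> carrier A \<and> x \<oplus>\<^bsub>A\<^esub> \<ominus>\<^bsub>A\<^esub> y \<in> K)" for x
  have q: "q x \<in> carrier A" "x \<oplus>\<^bsub>A\<^esub> \<ominus>\<^bsub>A\<^esub> q x \<in> K" if "x \<in> carrier A" for x
    using someI[of "\<lambda>y. y \<in> carrier A \<and> x \<oplus>\<^bsub>A\<^esub> \<ominus>\<^bsub>A\<^esub> y \<in> K" x] that mA Ks
    unfolding q_def by (auto simp: mlin)
  have cong: "q x = q y" if "x \<in> carrier A" "y \<in> carrier A" "x \<oplus>\<^bsub>A\<^esub> \<ominus>\<^bsub>A\<^esub> y \<in> K" for x y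
  proof -
    have "x \<oplus>\<^bsub>A\<^esub> \<ominus>\<^bsub>A\<^esub> z \<in> K \<longleftrightarrow> y \<oplus>\<^bsub>A\<^esub> \<ominus>\<^bsub>A\<^esub> z \<in> K" if z: "z \<in> carrier A" for z
    proof -
      have "y \<oplus>\<^bsub>A\<^esub> \<ominus>\<^bsub>A\<^esub> z = \<ominus>\<^bsub>A\<^esub> (x \<oplus>\<^bsub>A\<^esub> \<ominus>\<^bsub>A\<^esub> y) \<oplus>\<^bsub>A\<^esub> (x \<oplus>\<^bsub>A\<^esub> \<ominus>\<^bsub>A\<^esub> z)"
        "x \<oplus>\<^bsub>A\<^esub> \<ominus>\<^bsub>A\<^esub> z = (x \<oplus>\<^bsub>A\<^esub> \<ominus>\<^bsub>A\<^esub> y) \<oplus>\<^bsub>A\<^esub> (y \<oplus>\<^bsub>A\<^esub> \<ominus>\<^bsub>A\<^esub> z)"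
        using mA z \<open>x \<in> carrier A\<close> \<open>y \<in> carrier A\<close> by (simp_all add: mlin)
      then show ?thesis using Ks(3,4) \<open>x \<oplus>\<^bsub>A\<^esub> \<ominus>\<^bsub>A\<^esub> y \<in> K\<close> by metis
    qed
    then show ?thesis unfolding q_def by (intro arg_cong[where f=Eps] ext) blast
  qed
  define Q :: "'a lmodule" where "Q = \<lparr>carrier = q ` carrier A, monoid.mult = undefined,
    one = undefined, ring.zero = q \<zero>\<^bsub>A\<^esub>, add = (\<lambda>u v. q (u \<oplus>\<^bsub>A\<^esub> v)), smult = (\<lambda>a u. q (a \<odot>\<^bsub>A\<^esub> u))\<rparr>"
  have add: "q (q x \<oplus>\<^bsub>A\<^esub> q y) = q (x \<oplus>\<^bsub>A\<^esub> y)" if xy: "x \<in> carrier A" "y \<in> carrier A" for x y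
  proof -
    note qq = q(1)[OF xy(1)] q(1)[OF xy(2)]
    have "(x \<oplus>\<^bsub>A\<^esub> y) \<oplus>\<^bsub>A\<^esub> \<ominus>\<^bsub>A\<^esub> (q x \<oplus>\<^bsub>A\<^esub> q y) = (x \<oplus>\<^bsub>A\<^esub> \<ominus>\<^bsub>A\<^esub> q x) \<oplus>\<^bsub>A\<^esub> (y \<oplus>\<^bsub>A\<^esub> \<ominus>\<^bsub>A\<^esub> q y)"
      using qq xy mA by (simp add: mlin)
    also have "\<dots> \<in> K" using Ks(3) q(2) xy by simp
    finally show ?thesis
      using qq xy mA by (intro cong[symmetric]) (simp_all add: mclosed)
  qed
  have smult: "q (a \<odot>\<^bsub>A\<^esub> q x) = q (a \<odot>\<^bsub>A\<^esub> x)" if xy: "a \<in> carrier R" "x \<in> carrier A" for a x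
  proof -
    note qq = q(1)[OF xy(2)]
    have "a \<odot>\<^bsub>A\<^esub> x \<oplus>\<^bsub>A\<^esub> \<ominus>\<^bsub>A\<^esub> (a \<odot>\<^bsub>A\<^esub> q x) = a \<odot>\<^bsub>A\<^esub> (x \<oplus>\<^bsub>A\<^esub> \<ominus>\<^bsub>A\<^esub> q x)"
      using qq xy mA by (simp add: mlin)
    also have "\<dots> \<in> K" using Ks(5) q(2) xy by simp
    finally show ?thesis
      using qq xy mA by (intro cong[symmetric]) (simp_all add: mclosed)
  qed
  have *: "module R Q" "epi A Q q"
    by (rule module_image[OF mA, of q Q]; simp add: Q_def add smult)+
  have "q x = \<zero>\<^bsub>Q\<^esub> \<longleftrightarrow> x \<in> K" if x: "x \<in> carrier A" for x
  proof
    assume "x \<in> K"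
    then have "q x = q \<zero>\<^bsub>A\<^esub>" using mA x by (intro cong) (auto simp: mlin)
    then show "q x = \<zero>\<^bsub>Q\<^esub>" by (simp add: Q_def)
  next
    assume "q x = \<zero>\<^bsub>Q\<^esub>"
    then have "q x = q \<zero>\<^bsub>A\<^esub>" by (simp add: Q_def)
    then have "x \<oplus>\<^bsub>A\<^esub> \<ominus>\<^bsub>A\<^esub> q \<zero>\<^bsub>A\<^esub> \<in> K" "\<zero>\<^bsub>A\<^esub> \<oplus>\<^bsub>A\<^esub> \<ominus>\<^bsub>A\<^esub> q \<zero>\<^bsub>A\<^esub> \<in> K" using q[OF x] q[OF mzero[OF mA]] by auto
    then have "(x \<oplus>\<^bsub>A\<^esub> \<ominus>\<^bsub>A\<^esub> q \<zero>\<^bsub>A\<^esub>) \<oplus>\<^bsub>A\<^esub> \<ominus>\<^bsub>A\<^esub> (\<zero>\<^bsub>A\<^esub> \<oplus>\<^bsub>A\<^esub> \<ominus>\<^bsub>A\<^esub> q \<zero>\<^bsub>A\<^esub>) \<in> K" using Ks by blast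
    then show "x \<in> K" using x q[OF mzero[OF mA]] mA by (simp add: mlin)
  qed
  moreover have "Q \<in> fgmod R"
    using * A fin_gen_image[OF mA *] by (auto simp: fgmod_def)
  ultimately show ?thesis using that * by blast
qed

lemma mod_iso_maps:
  assumes "mod_iso R A B" "module R A"
  obtains f g where "f \<in> Hom A B" "g \<in> Hom B A" "\<And>x. x \<in> carrier A \<Longrightarrow> g (f x) = x"
    "\<And>y. y \<in> carrier B \<Longrightarrow> f (g y) = y"
proof -
  obtain f where f: "f \<in> Hom A B" "bij_betw f (carrier A) (carrier B)"
    using assms by (auto simp: mod_iso_def)
  let ?g = "inv_into (carrier A) f"
  have inj: "inj_on f (carrier A)" using f by (simp add: bij_betw_def)
  have g: "?g y \<in> carrier A" "f (?g y) = y" if "y \<in> carrier B" for y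
    using f(2) that by (auto simp: bij_betw_def intro: inv_into_into f_inv_into_f)
  have fg: "?g (f x) = x" if "x \<in> carrier A" for x using inj that by simp
  have "?g \<in> Hom B A"
  proof (rule HomI)
    fix y z assume y: "y \<in> carrier B" and z: "z \<in> carrier B"
    have "f (?g y \<oplus>\<^bsub>A\<^esub> ?g z) = y \<oplus>\<^bsub>B\<^esub> z" using f g y z by (simp add: Hom_simps)
    then show "?g (y \<oplus>\<^bsub>B\<^esub> z) = ?g y \<oplus>\<^bsub>A\<^esub> ?g z" using fg g y z assms by (metis madd)
  next
    fix a y assume y: "a \<in> carrier R" "y \<in> carrier B"
    have "f (a \<odot>\<^bsub>A\<^esub> ?g y) = a \<odot>\<^bsub>B\<^esub> y" using f g y by (simp add: Hom_simps)
    then show "?g (a \<odot>\<^bsub>B\<^esub> y) = a \<odot>\<^bsub>A\<^esub> ?g y" using fg g y assms by (metis msmult)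
  qed (rule g)
  then show ?thesis using that f(1) fg g by blast
qed

lemma mod_isoI:
  assumes "f \<in> Hom A B" "g \<in> Hom B A" "\<And>x. x \<in> carrier A \<Longrightarrow> g (f x) = x"
    "\<And>y. y \<in> carrier B \<Longrightarrow> f (g y) = y"
  shows "mod_iso R A B"
proof -
  have "bij_betw f (carrier A) (carrier B)"
    using assms by (intro bij_betw_byWitness[of _ g]) (auto simp: Hom_closed)
  then show ?thesis using assms(1) by (auto simp: mod_iso_def)
qed

lemma mod_iso_sym: "\<lbrakk>mod_iso R A B; module R A\<rbrakk> \<Longrightarrow> mod_iso R B A"
  by (erule mod_iso_maps, assumption) (rule mod_isoI)

lemma mod_iso_refl: "mod_iso R A A"
  unfolding mod_iso_def by (rule bexI[OF _ Hom_id]) (simp add: bij_betw_def)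

lemma coset_mem:
  assumes "module R A" "submodule K R A" "x \<in> carrier A"
  shows "K +>\<^bsub>A\<^esub> x = {z \<in> carrier A. z \<oplus>\<^bsub>A\<^esub> \<ominus>\<^bsub>A\<^esub> x \<in> K}"
proof -
  note Ks = submod[OF assms(2,1)]
  have KA: "x \<in> carrier A" if "x \<in> K" for x using Ks(1) that by auto
  have "z \<in> K +>\<^bsub>A\<^esub> x" if "z \<in> carrier A" "z \<oplus>\<^bsub>A\<^esub> \<ominus>\<^bsub>A\<^esub> x \<in> K" for z
    unfolding a_r_coset_def' using that assms(1,3) by (auto intro!: bexI[OF _ that(2)] simp: mlin)
  moreover have "h \<oplus>\<^bsub>A\<^esub> x \<in> carrier A \<and> (h \<oplus>\<^bsub>A\<^esub> x) \<oplus>\<^bsub>A\<^esub> \<ominus>\<^bsub>A\<^esub> x \<in> K" if "h \<in> K" for h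
    using that KA assms by (simp add: mlin)
  ultimately show ?thesis by (auto simp: a_r_coset_def')
qed

lemma coset_eq_iff:
  assumes "module R A" "submodule K R A" "x \<in> carrier A" "y \<in> carrier A"
  shows "K +>\<^bsub>A\<^esub> x = K +>\<^bsub>A\<^esub> y \<longleftrightarrow> x \<oplus>\<^bsub>A\<^esub> \<ominus>\<^bsub>A\<^esub> y \<in> K"
proof
  note Ks = submod[OF assms(2,1)]
  have "x \<in> K +>\<^bsub>A\<^esub> x" using assms Ks by (simp add: coset_mem mlin)
  then show "K +>\<^bsub>A\<^esub> x = K +>\<^bsub>A\<^esub> y \<Longrightarrow> x \<oplus>\<^bsub>A\<^esub> \<ominus>\<^bsub>A\<^esub> y \<in> K" using assms by (simp add: coset_mem)
next
  note Ks = submod[OF assms(2,1)]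
  assume xy: "x \<oplus>\<^bsub>A\<^esub> \<ominus>\<^bsub>A\<^esub> y \<in> K"
  have "z \<oplus>\<^bsub>A\<^esub> \<ominus>\<^bsub>A\<^esub> x \<in> K \<longleftrightarrow> z \<oplus>\<^bsub>A\<^esub> \<ominus>\<^bsub>A\<^esub> y \<in> K" if "z \<in> carrier A" for z
  proof -
    have "z \<oplus>\<^bsub>A\<^esub> \<ominus>\<^bsub>A\<^esub> y = (z \<oplus>\<^bsub>A\<^esub> \<ominus>\<^bsub>A\<^esub> x) \<oplus>\<^bsub>A\<^esub> (x \<oplus>\<^bsub>A\<^esub> \<ominus>\<^bsub>A\<^esub> y)"
      "z \<oplus>\<^bsub>A\<^esub> \<ominus>\<^bsub>A\<^esub> x = (z \<oplus>\<^bsub>A\<^esub> \<ominus>\<^bsub>A\<^esub> y) \<oplus>\<^bsub>A\<^esub> \<ominus>\<^bsub>A\<^esub> (x \<oplus>\<^bsub>A\<^esub> \<ominus>\<^bsub>A\<^esub> y)"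
      using assms that by (simp_all add: mlin)
    then show ?thesis using Ks(3,4) xy by metis
  qed
  then show "K +>\<^bsub>A\<^esub> x = K +>\<^bsub>A\<^esub> y" using assms by (auto simp: coset_mem)
qed

lemma quot_proj:
  assumes A: "module R A" and K: "submodule K R A"
  shows "module R (quot_mod R A K)" "epi A (quot_mod R A K) (\<lambda>x. K +>\<^bsub>A\<^esub> x)"
    "\<And>x. x \<in> carrier A \<Longrightarrow> K +>\<^bsub>A\<^esub> x = \<zero>\<^bsub>quot_mod R A K\<^esub> \<longleftrightarrow> x \<in> K"
proof -
  note Ks = submod[OF K A]
  have KA: "x \<in> carrier A" if "x \<in> K" for x using Ks(1) that by auto
  have K0: "K +>\<^bsub>A\<^esub> \<zero>\<^bsub>A\<^esub> = K" using A K KA by (auto simp: coset_mem mlin)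
  have a: "set_add A (K +>\<^bsub>A\<^esub> x) (K +>\<^bsub>A\<^esub> y) = K +>\<^bsub>A\<^esub> (x \<oplus>\<^bsub>A\<^esub> y)"
    if xy: "x \<in> carrier A" "y \<in> carrier A" for x y
  proof -
    have "u \<oplus>\<^bsub>A\<^esub> v \<in> K +>\<^bsub>A\<^esub> (x \<oplus>\<^bsub>A\<^esub> y)" if "u \<in> K +>\<^bsub>A\<^esub> x" "v \<in> K +>\<^bsub>A\<^esub> y" for u v
    proof -
      have uv: "u \<in> carrier A" "v \<in> carrier A" "u \<oplus>\<^bsub>A\<^esub> \<ominus>\<^bsub>A\<^esub> x \<in> K" "v \<oplus>\<^bsub>A\<^esub> \<ominus>\<^bsub>A\<^esub> y \<in> K"
        using that xy A K by (auto simp: coset_mem)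
      have "(u \<oplus>\<^bsub>A\<^esub> v) \<oplus>\<^bsub>A\<^esub> \<ominus>\<^bsub>A\<^esub> (x \<oplus>\<^bsub>A\<^esub> y) = (u \<oplus>\<^bsub>A\<^esub> \<ominus>\<^bsub>A\<^esub> x) \<oplus>\<^bsub>A\<^esub> (v \<oplus>\<^bsub>A\<^esub> \<ominus>\<^bsub>A\<^esub> y)"
        using uv xy A by (simp add: mlin)
      then show ?thesis using uv Ks(3) xy A K by (simp add: coset_mem mclosed)
    qed
    moreover have "\<exists>u\<in>K +>\<^bsub>A\<^esub> x. \<exists>v\<in>K +>\<^bsub>A\<^esub> y. w = u \<oplus>\<^bsub>A\<^esub> v" if "w \<in> K +>\<^bsub>A\<^esub> (x \<oplus>\<^bsub>A\<^esub> y)" for w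
    proof (intro bexI)
      have w: "w \<in> carrier A" "w \<oplus>\<^bsub>A\<^esub> \<ominus>\<^bsub>A\<^esub> (x \<oplus>\<^bsub>A\<^esub> y) \<in> K"
        using that xy A K by (auto simp: coset_mem mclosed)
      have "(w \<oplus>\<^bsub>A\<^esub> \<ominus>\<^bsub>A\<^esub> y) \<oplus>\<^bsub>A\<^esub> \<ominus>\<^bsub>A\<^esub> x = w \<oplus>\<^bsub>A\<^esub> \<ominus>\<^bsub>A\<^esub> (x \<oplus>\<^bsub>A\<^esub> y)"
        using w xy A by (simp add: mlin)
      then show "w \<oplus>\<^bsub>A\<^esub> \<ominus>\<^bsub>A\<^esub> y \<in> K +>\<^bsub>A\<^esub> x" using w A K xy by (simp add: coset_mem mclosed)
      show "y \<in> K +>\<^bsub>A\<^esub> y" using A K xy Ks by (simp add: coset_mem mlin)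
      show "w = w \<oplus>\<^bsub>A\<^esub> \<ominus>\<^bsub>A\<^esub> y \<oplus>\<^bsub>A\<^esub> y" using w xy A by (simp add: mlin)
    qed
    ultimately show ?thesis by (fastforce simp: set_add_def')
  qed
  have s: "(\<Union>z\<in>K +>\<^bsub>A\<^esub> x. K +>\<^bsub>A\<^esub> (c \<odot>\<^bsub>A\<^esub> z)) = K +>\<^bsub>A\<^esub> (c \<odot>\<^bsub>A\<^esub> x)"
    if xy: "x \<in> carrier A" "c \<in> carrier R" for x c
  proof -
    have "K +>\<^bsub>A\<^esub> (c \<odot>\<^bsub>A\<^esub> z) = K +>\<^bsub>A\<^esub> (c \<odot>\<^bsub>A\<^esub> x)" if "z \<in> K +>\<^bsub>A\<^esub> x" for z
    proof -
      have z: "z \<in> carrier A" "z \<oplus>\<^bsub>A\<^esub> \<ominus>\<^bsub>A\<^esub> x \<in> K" using that xy A K by (auto simp: coset_mem)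
      have "c \<odot>\<^bsub>A\<^esub> z \<oplus>\<^bsub>A\<^esub> \<ominus>\<^bsub>A\<^esub> (c \<odot>\<^bsub>A\<^esub> x) = c \<odot>\<^bsub>A\<^esub> (z \<oplus>\<^bsub>A\<^esub> \<ominus>\<^bsub>A\<^esub> x)" using z xy A by (simp add: mlin)
      then show ?thesis using z xy A K Ks(5) by (subst coset_eq_iff) (auto simp: mclosed)
    qed
    moreover have "x \<in> K +>\<^bsub>A\<^esub> x" using A K xy Ks by (simp add: coset_mem mlin)
    ultimately show ?thesis by blast
  qed
  have c: "(\<lambda>x. K +>\<^bsub>A\<^esub> x) ` carrier A = carrier (quot_mod R A K)"
    by (auto simp: quot_mod_def A_RCOSETS_def')
  show "module R (quot_mod R A K)" "epi A (quot_mod R A K) (\<lambda>x. K +>\<^bsub>A\<^esub> x)"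
    using module_image[OF A c] a s K0 by (simp_all add: quot_mod_def)
  show "K +>\<^bsub>A\<^esub> x = \<zero>\<^bsub>quot_mod R A K\<^esub> \<longleftrightarrow> x \<in> K" if "x \<in> carrier A" for x
    using coset_eq_iff[OF A K that mzero[OF A]] K0 that A by (simp add: quot_mod_def mlin)
qed



lemma iso_of_same_kernel:
  assumes q: "epi A B q" and q': "epi A C q'" and mods: "module R A" "module R B" "module R C"
    and ker: "\<And>x. x \<in> carrier A \<Longrightarrow> q x = \<zero>\<^bsub>B\<^esub> \<longleftrightarrow> q' x = \<zero>\<^bsub>C\<^esub>"
  shows "mod_iso R B C"
proof -
  obtain g where g: "g \<in> Hom B C" "\<And>x. x \<in> carrier A \<Longrightarrow> g (q x) = q' x"
    using Hom_descend[OF q epi_Hom[OF q'] mods(1,3,2)] ker by auto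
  have "y = \<zero>\<^bsub>B\<^esub>" if "y \<in> carrier B" "g y = \<zero>\<^bsub>C\<^esub>" for y
    using that g ker by (metis epiE[OF q])
  then have "inj_on g (carrier B)" using g mods by (intro inj_onI_ker) auto
  moreover have "g ` carrier B = carrier C"
  proof
    show "g ` carrier B \<subseteq> carrier C" using g by (auto simp: Hom_closed)
    show "carrier C \<subseteq> g ` carrier B"
    proof
      fix y assume "y \<in> carrier C"
      then obtain x where "x \<in> carrier A" "q' x = y" by (rule epiE[OF q'])
      then show "y \<in> g ` carrier B" using g Hom_closed[OF epi_Hom[OF q]] by (metis image_eqI)
    qed
  qed
  ultimately show ?thesis using g by (auto simp: mod_iso_def bij_betw_def)
qed

text \<open>This eliminates coset quotients: being isomorphic to one is the existence of a surjection with the given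
  kernel.\<close>

lemma iso_quot_iff:
  assumes A: "module R A" and B: "module R B" and K: "submodule K R A"
  shows "mod_iso R B (quot_mod R A K) \<longleftrightarrow>
    (\<exists>q. epi A B q \<and> (\<forall>x\<in>carrier A. q x = \<zero>\<^bsub>B\<^esub> \<longleftrightarrow> x \<in> K))"
proof
  assume "mod_iso R B (quot_mod R A K)"
  then have "mod_iso R (quot_mod R A K) B" using B mod_iso_sym by blast
  then obtain f where f: "f \<in> Hom (quot_mod R A K) B" "bij_betw f (carrier (quot_mod R A K)) (carrier B)"
    by (auto simp: mod_iso_def)
  have e: "epi (quot_mod R A K) B f" using f by (auto simp: epi_def bij_betw_def)
  have i: "inj_on f (carrier (quot_mod R A K))" using f by (auto simp: bij_betw_def)
  have "f (K +>\<^bsub>A\<^esub> x) = \<zero>\<^bsub>B\<^esub> \<longleftrightarrow> x \<in> K" if x: "x \<in> carrier A" for x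
  proof -
    have "f (K +>\<^bsub>A\<^esub> x) = \<zero>\<^bsub>B\<^esub> \<longleftrightarrow> K +>\<^bsub>A\<^esub> x = \<zero>\<^bsub>quot_mod R A K\<^esub>"
      using inj_on_ker[OF i f(1)] quot_proj[OF A K] B x Hom_closed[OF epi_Hom[OF quot_proj(2)[OF A K]] x]
        Hom_zero[OF f(1)] by metis
    then show ?thesis using quot_proj(3)[OF A K x] by simp
  qed
  then show "\<exists>q. epi A B q \<and> (\<forall>x\<in>carrier A. q x = \<zero>\<^bsub>B\<^esub> \<longleftrightarrow> x \<in> K)"
    using epi_comp[OF quot_proj(2)[OF A K] e] by blast
next
  assume "\<exists>q. epi A B q \<and> (\<forall>x\<in>carrier A. q x = \<zero>\<^bsub>B\<^esub> \<longleftrightarrow> x \<in> K)"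
  then obtain q where "epi A B q" "\<forall>x\<in>carrier A. q x = \<zero>\<^bsub>B\<^esub> \<longleftrightarrow> x \<in> K" by blast
  then show "mod_iso R B (quot_mod R A K)"
    using iso_of_same_kernel[of A B q _ "\<lambda>x. K +>\<^bsub>A\<^esub> x"] quot_proj[OF A K] A B by auto
qed

end

section \<open>Linear combinations and free modules\<close>

text \<open>Linear combinations are defined by recursion on their length, because elimination arguments remove the last
  vector.\<close>

primrec lc :: "('a, 'b, 'm) module_scheme \<Rightarrow> nat \<Rightarrow> (nat \<Rightarrow> 'a) \<Rightarrow> (nat \<Rightarrow> 'b) \<Rightarrow> 'b" where
  "lc M 0 c y = \<zero>\<^bsub>M\<^esub>"
| "lc M (Suc r) c y = lc M r c y \<oplus>\<^bsub>M\<^esub> c r \<odot>\<^bsub>M\<^esub> y r"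

context cring
begin

lemma lc_closed: "\<lbrakk>module R M; \<And>i. i < r \<Longrightarrow> c i \<in> carrier R; \<And>i. i < r \<Longrightarrow> y i \<in> carrier M\<rbrakk>
   \<Longrightarrow> lc M r c y \<in> carrier M"
  by (induction r) (simp_all add: mclosed)

lemma lc_cong: "\<lbrakk>\<And>i. i < r \<Longrightarrow> c i = d i; \<And>i. i < r \<Longrightarrow> y i = z i\<rbrakk> \<Longrightarrow> lc M r c y = lc M r d z"
  by (induction r) simp_all

lemma lc_plus:
  assumes "module R M" "\<And>i. i < r \<Longrightarrow> c i \<in> carrier R" "\<And>i. i < r \<Longrightarrow> d i \<in> carrier R"
    "\<And>i. i < r \<Longrightarrow> y i \<in> carrier M"
  shows "lc M r (\<lambda>i. c i \<oplus> d i) y = lc M r c y \<oplus>\<^bsub>M\<^esub> lc M r d y"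
  using assms(2-)
proof (induction r)
  case (Suc r)
  then have "lc M r c y \<in> carrier M" "lc M r d y \<in> carrier M" by (auto intro!: lc_closed assms(1))
  then show ?case using Suc assms(1) by (simp add: mlin madd_smult)
qed (use assms(1) in \<open>simp add: mlin\<close>)

lemma lc_smult:
  assumes "module R M" "a \<in> carrier R" "\<And>i. i < r \<Longrightarrow> c i \<in> carrier R"
    "\<And>i. i < r \<Longrightarrow> y i \<in> carrier M"
  shows "lc M r (\<lambda>i. a \<otimes> c i) y = a \<odot>\<^bsub>M\<^esub> lc M r c y"
  using assms(3-)
proof (induction r)
  case (Suc r)
  then have "lc M r c y \<in> carrier M" by (auto intro!: lc_closed assms(1))
  then show ?case using Suc assms(1,2) by (simp add: mlin msmult_smult)
qed (use assms(1,2) in \<open>simp add: mlin\<close>)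

lemma lc_uminus:
  assumes "module R M" "\<And>i. i < r \<Longrightarrow> c i \<in> carrier R"
    "\<And>i. i < r \<Longrightarrow> y i \<in> carrier M"
  shows "lc M r (\<lambda>i. \<ominus> c i) y = \<ominus>\<^bsub>M\<^esub> lc M r c y"
  using assms(2-)
proof (induction r)
  case (Suc r)
  then have "lc M r c y \<in> carrier M" by (auto intro!: lc_closed assms(1))
  then show ?case using Suc assms(1) by (simp add: mlin mneg_smult)
qed (use assms(1) in \<open>simp add: mlin\<close>)

lemma lc_null: "\<lbrakk>module R M; \<And>i. i < r \<Longrightarrow> c i = \<zero>; \<And>i. i < r \<Longrightarrow> y i \<in> carrier M\<rbrakk> \<Longrightarrow> lc M r c y = \<zero>\<^bsub>M\<^esub>"
  by (induction r) (simp_all add: mlin)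

lemma lc_delta:
  assumes "module R M" "j < r" "\<And>i. i < r \<Longrightarrow> y i \<in> carrier M"
  shows "lc M r (\<lambda>i. if i = j then \<one> else \<zero>) y = y j"
  using assms(2-)
proof (induction r)
  case (Suc r)
  have "lc M r (\<lambda>i. if i = j then \<one> else \<zero>) y = \<zero>\<^bsub>M\<^esub>" if "j = r"
    using that Suc.prems assms(1) by (intro lc_null) auto
  moreover have "j = r \<or> j < r" using Suc.prems by auto
  ultimately show ?case using Suc assms(1) by (auto simp: mlin)
qed simp

lemma lc_Hom:
  assumes "f \<in> Hom A B" "module R A" "module R B" "\<And>i. i < r \<Longrightarrow> c i \<in> carrier R"
    "\<And>i. i < r \<Longrightarrow> y i \<in> carrier A"
  shows "f (lc A r c y) = lc B r c (\<lambda>i. f (y i))"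
  using assms(4-)
proof (induction r)
  case (Suc r)
  then have "lc A r c y \<in> carrier A" by (auto intro!: lc_closed assms(2))
  then show ?case using Suc assms(1-3) by (simp add: Hom_simps mlin)
qed (use assms(1-3) in \<open>simp add: Hom_zero\<close>)

lemma lc_append:
  assumes "module R M" "\<And>i. i < r + r' \<Longrightarrow> c i \<in> carrier R" "\<And>i. i < r + r' \<Longrightarrow> y i \<in> carrier M"
  shows "lc M (r + r') c y = lc M r c y \<oplus>\<^bsub>M\<^esub> lc M r' (\<lambda>i. c (r + i)) (\<lambda>i. y (r + i))"
  using assms(2-)
proof (induction r')
  case 0
  then show ?case using assms(1) lc_closed[OF assms(1), of r c y] by (simp add: mlin)
next
  case (Suc k)
  have "lc M r c y \<in> carrier M" "lc M k (\<lambda>i. c (r + i)) (\<lambda>i. y (r + i)) \<in> carrier M"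
    using Suc.prems by (auto intro!: lc_closed assms(1))
  then show ?case using Suc assms(1) by (simp add: mlin)
qed

lemma lc_finsum:
  assumes "module R M" "\<And>i. i < r \<Longrightarrow> c i \<in> carrier R" "\<And>i. i < r \<Longrightarrow> y i \<in> carrier M"
  shows "lc M r c y = (\<Oplus>\<^bsub>M\<^esub>i\<in>{..<r}. c i \<odot>\<^bsub>M\<^esub> y i)"
  using assms(2-)
proof (induction r)
  case 0
  interpret M: module R M by fact
  show ?case by simp
next
  case (Suc r)
  interpret M: module R M by fact
  have "(\<Oplus>\<^bsub>M\<^esub>i\<in>{..<Suc r}. c i \<odot>\<^bsub>M\<^esub> y i) = c r \<odot>\<^bsub>M\<^esub> y r \<oplus>\<^bsub>M\<^esub> (\<Oplus>\<^bsub>M\<^esub>i\<in>{..<r}. c i \<odot>\<^bsub>M\<^esub> y i)"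
    unfolding lessThan_Suc using Suc.prems by (intro M.finsum_insert) auto
  moreover have "(\<Oplus>\<^bsub>M\<^esub>i\<in>{..<r}. c i \<odot>\<^bsub>M\<^esub> y i) \<in> carrier M"
    using Suc.prems by (intro M.finsum_closed) auto
  ultimately show ?case using Suc by (simp add: M.M.a_comm)
qed

lemma lc_permute:
  assumes M: "module R M" and c: "\<And>i. i < r \<Longrightarrow> c i \<in> carrier R" "\<And>i. i < r \<Longrightarrow> y i \<in> carrier M"
    and t: "bij_betw t {..<r} {..<r}"
  shows "lc M r (\<lambda>i. c (t i)) (\<lambda>i. y (t i)) = lc M r c y"
proof -
  interpret M: module R M by fact
  have ti: "t i < r" if "i < r" for i using t that by (auto simp: bij_betw_def)
  have "(\<Oplus>\<^bsub>M\<^esub>i\<in>t ` {..<r}. c i \<odot>\<^bsub>M\<^esub> y i) = (\<Oplus>\<^bsub>M\<^esub>i\<in>{..<r}. c (t i) \<odot>\<^bsub>M\<^esub> y (t i))"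
    using c t ti by (intro M.M.add.finprod_reindex) (auto simp: bij_betw_def)
  then show ?thesis using t c ti by (simp add: lc_finsum[OF M] bij_betw_def)
qed

lemma module_ring_mod: "module R (ring_mod R)"
proof (rule moduleI)
  show "abelian_group (ring_mod R)"
  proof (rule abelian_groupI)
    fix x assume "x \<in> carrier (ring_mod R)"
    then show "\<exists>y\<in>carrier (ring_mod R). y \<oplus>\<^bsub>ring_mod R\<^esub> x = \<zero>\<^bsub>ring_mod R\<^esub>"
      by (intro bexI[of _ "\<ominus> x"]) (auto simp: ring_mod_def l_neg)
  qed (auto simp: ring_mod_def a_ac)
qed (auto simp: ring_mod_def l_distr r_distr m_assoc intro: is_cring)

lemma ring_mod_simps [simp]: "carrier (ring_mod R) = carrier R" "x \<oplus>\<^bsub>ring_mod R\<^esub> y = x \<oplus> y"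
  "x \<odot>\<^bsub>ring_mod R\<^esub> y = x \<otimes> y" "\<zero>\<^bsub>ring_mod R\<^esub> = \<zero>"
  by (simp_all add: ring_mod_def)

lemma ring_mod_neg [simp]: "\<ominus>\<^bsub>ring_mod R\<^esub> x = \<ominus> x"
  by (simp add: ring_mod_def a_inv_def m_inv_def)

abbreviation Dual where "Dual M \<equiv> Hom M (ring_mod R)"

lemma Hom_lc:
  assumes "module R M" "module R B" "\<And>i. i < r \<Longrightarrow> s i \<in> Dual M" "\<And>i. i < r \<Longrightarrow> y i \<in> carrier B"
  shows "(\<lambda>m. lc B r (\<lambda>i. s i m) y) \<in> Hom M B"
proof (rule HomI)
  have s: "s i m \<in> carrier R" if "i < r" "m \<in> carrier M" for i m
    using Hom_closed[OF assms(3)[OF that(1)] that(2)] by simp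
  show "lc B r (\<lambda>i. s i m) y \<in> carrier B" if "m \<in> carrier M" for m
    using assms s that by (intro lc_closed) auto
  show "lc B r (\<lambda>i. s i (m \<oplus>\<^bsub>M\<^esub> m')) y = lc B r (\<lambda>i. s i m) y \<oplus>\<^bsub>B\<^esub> lc B r (\<lambda>i. s i m') y"
    if "m \<in> carrier M" "m' \<in> carrier M" for m m'
  proof -
    have "lc B r (\<lambda>i. s i (m \<oplus>\<^bsub>M\<^esub> m')) y = lc B r (\<lambda>i. s i m \<oplus> s i m') y"
      using Hom_add[OF assms(3) that] by (intro lc_cong) simp_all
    then show ?thesis using s that assms by (simp add: lc_plus)
  qed
  show "lc B r (\<lambda>i. s i (a \<odot>\<^bsub>M\<^esub> m)) y = a \<odot>\<^bsub>B\<^esub> lc B r (\<lambda>i. s i m) y"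
    if "a \<in> carrier R" "m \<in> carrier M" for a m
  proof -
    have "lc B r (\<lambda>i. s i (a \<odot>\<^bsub>M\<^esub> m)) y = lc B r (\<lambda>i. a \<otimes> s i m) y"
      using Hom_smult[OF assms(3) that] by (intro lc_cong) simp_all
    then show ?thesis using s that assms by (simp add: lc_smult)
  qed
qed

text \<open>A basis is recorded together with the coordinate functionals \<^term>\<open>s\<close>: with them, a homomorphism out of a
  free module is an explicit linear combination.\<close>

definition basis where "basis M r s y \<longleftrightarrow>
  (\<forall>i<(r::nat). s i \<in> Dual M \<and> y i \<in> carrier M) \<and>
  (\<forall>m\<in>carrier M. lc M r (\<lambda>i. s i m) y = m) \<and>
  (\<forall>i<r. \<forall>j<r. s i (y j) = (if i = j then \<one> else \<zero>))"

text \<open>Linear independence makes \<^term>\<open>y\<close> injective, and so its range a basis, unless \<open>1 = 0\<close>; over the zero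
  ring all modules are zero and the empty set is a basis.\<close>

lemma free_moduleI:
  assumes M: "module R M" and y: "\<And>i. i < r \<Longrightarrow> y i \<in> carrier M"
    and span: "\<And>m. m \<in> carrier M \<Longrightarrow> \<exists>c. (\<forall>i<r. c i \<in> carrier R) \<and> m = lc M r c y"
    and indep: "\<And>c i. \<lbrakk>\<And>j. j < r \<Longrightarrow> c j \<in> carrier R; lc M r c y = \<zero>\<^bsub>M\<^esub>; i < r\<rbrakk> \<Longrightarrow> c i = \<zero>"
  shows "free_module R M"
proof (cases "\<one> = \<zero>")
  case True
  interpret M: module R M by fact
  have "m = \<zero>\<^bsub>M\<^esub>" if "m \<in> carrier M" for m using that True M mone_smult mzero_smult by metis
  then show ?thesis unfolding free_module_def using M
    by (intro exI[of _ "{}"]) auto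
next
  case False
  interpret M: module R M by fact
  have inj: "inj_on y {..<r}"
  proof (rule inj_onI)
    fix i j assume ij: "i \<in> {..<r}" "j \<in> {..<r}" "y i = y j"
    define e where "e j i = (if i = j then \<one> else \<zero>)" for i j :: nat
    have e: "e j i \<in> carrier R" for i j by (simp add: e_def)
    show "i = j"
    proof (rule ccontr)
      assume n: "i \<noteq> j"
      have "lc M r (\<lambda>k. e i k \<oplus> \<ominus> e j k) y = \<zero>\<^bsub>M\<^esub>"
        using ij y e M lc_delta[OF M _ y, of i r] lc_delta[OF M _ y, of j r]
        by (simp add: lc_plus lc_uminus mlin e_def[symmetric])
      then have "e i i \<oplus> \<ominus> e j i = \<zero>" using e ij by (intro indep[of "\<lambda>k. e i k \<oplus> \<ominus> e j k"]) auto
      then show False using n False by (simp add: e_def)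
    qed
  qed
  let ?B = "y ` {..<r}"
  have sum: "(\<Oplus>\<^bsub>M\<^esub>b\<in>{b \<in> ?B. c b \<noteq> \<zero>}. c b \<odot>\<^bsub>M\<^esub> b) = lc M r (\<lambda>i. c (y i)) y" if c: "c \<in> ?B \<rightarrow> carrier R" for c
  proof -
    have "(\<Oplus>\<^bsub>M\<^esub>b\<in>{b \<in> ?B. c b \<noteq> \<zero>}. c b \<odot>\<^bsub>M\<^esub> b) = (\<Oplus>\<^bsub>M\<^esub>b\<in>?B. c b \<odot>\<^bsub>M\<^esub> b)"
      using c y by (intro M.M.add.finprod_mono_neutral_cong_left) auto
    also have "\<dots> = (\<Oplus>\<^bsub>M\<^esub>i\<in>{..<r}. c (y i) \<odot>\<^bsub>M\<^esub> y i)"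
      using c y inj by (intro M.M.add.finprod_reindex) auto
    also have "\<dots> = lc M r (\<lambda>i. c (y i)) y"
      using c y by (intro lc_finsum[OF M, symmetric]) auto
    finally show ?thesis .
  qed
  show ?thesis unfolding free_module_def
  proof (intro exI[of _ ?B] conjI ballI)
    show "?B \<subseteq> carrier M" using y by auto
    fix m assume m: "m \<in> carrier M"
    show "\<exists>!c. c \<in> ?B \<rightarrow>\<^sub>E carrier R \<and> finite {b \<in> ?B. c b \<noteq> \<zero>} \<and>
         m = (\<Oplus>\<^bsub>M\<^esub>b\<in>{b \<in> ?B. c b \<noteq> \<zero>}. c b \<odot>\<^bsub>M\<^esub> b)"
    proof (rule ex_ex1I)
      obtain c where c: "\<forall>i<r. c i \<in> carrier R" "m = lc M r c y" using span[OF m] by blast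
      define c' where "c' = (\<lambda>b\<in>?B. c (inv_into {..<r} y b))"
      have c'y: "c' (y i) = c i" if "i < r" for i using inj that by (simp add: c'_def)
      then have "c' \<in> ?B \<rightarrow>\<^sub>E carrier R" using c by (auto simp: PiE_iff c'_def)
      moreover have "m = lc M r (\<lambda>i. c' (y i)) y" using c'y c(2) by (simp cong: lc_cong)
      ultimately show "\<exists>c. c \<in> ?B \<rightarrow>\<^sub>E carrier R \<and> finite {b \<in> ?B. c b \<noteq> \<zero>} \<and>
         m = (\<Oplus>\<^bsub>M\<^esub>b\<in>{b \<in> ?B. c b \<noteq> \<zero>}. c b \<odot>\<^bsub>M\<^esub> b)"
        using sum[of c'] by (intro exI[of _ c']) (simp add: PiE_def)
    next
      fix c d assume c: "c \<in> ?B \<rightarrow>\<^sub>E carrier R \<and> finite {b \<in> ?B. c b \<noteq> \<zero>} \<and>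
         m = (\<Oplus>\<^bsub>M\<^esub>b\<in>{b \<in> ?B. c b \<noteq> \<zero>}. c b \<odot>\<^bsub>M\<^esub> b)" and d: "d \<in> ?B \<rightarrow>\<^sub>E carrier R \<and> finite {b \<in> ?B. d b \<noteq> \<zero>} \<and>
         m = (\<Oplus>\<^bsub>M\<^esub>b\<in>{b \<in> ?B. d b \<noteq> \<zero>}. d b \<odot>\<^bsub>M\<^esub> b)"
      then have cd: "c \<in> ?B \<rightarrow> carrier R" "d \<in> ?B \<rightarrow> carrier R" by (auto simp: PiE_iff)
      then have C: "c (y i) \<in> carrier R" "d (y i) \<in> carrier R" if "i < r" for i using that by auto
      have "lc M r (\<lambda>i. c (y i)) y = m" "lc M r (\<lambda>i. d (y i)) y = m"
        using sum[OF cd(1)] sum[OF cd(2)] c d by metis+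
      then have "lc M r (\<lambda>i. c (y i) \<oplus> \<ominus> d (y i)) y = \<zero>\<^bsub>M\<^esub>"
        using C y M m by (simp add: lc_plus lc_uminus mlin)
      then have "c (y i) \<oplus> \<ominus> d (y i) = \<zero>" if "i < r" for i
        using that C by (intro indep[of "\<lambda>i. c (y i) \<oplus> \<ominus> d (y i)"]) auto
      then have "c (y i) = d (y i)" if "i < r" for i
        using that C mdiff_zero[OF module_ring_mod, of "c (y i)" "d (y i)"] by simp
      then show "c = d" using c d by (intro PiE_ext[of c ?B "\<lambda>_. carrier R" d]) auto
    qed
  qed
qed

lemma lc_ring_comm: "\<lbrakk>\<And>i. i < r \<Longrightarrow> c i \<in> carrier R; \<And>i. i < r \<Longrightarrow> d i \<in> carrier R\<rbrakk>
  \<Longrightarrow> lc (ring_mod R) r c d = lc (ring_mod R) r d c"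
  by (induction r) (simp_all add: m_comm)

lemma basis_free:
  assumes M: "module R M" and b: "basis M r s y"
  shows "free_module R M"
proof (rule free_moduleI[OF M])
  show "y i \<in> carrier M" if "i < r" for i using b that by (auto simp: basis_def)
  have s: "s i m \<in> carrier R" if "i < r" "m \<in> carrier M" for i m
    using b that by (auto simp: basis_def mod_hom_def Pi_iff)
  show "\<exists>c. (\<forall>i<r. c i \<in> carrier R) \<and> m = lc M r c y" if "m \<in> carrier M" for m
    using b s that by (intro exI[of _ "\<lambda>i. s i m"]) (auto simp: basis_def)
  fix c i assume c: "\<And>j. j < r \<Longrightarrow> c j \<in> carrier R" "lc M r c y = \<zero>\<^bsub>M\<^esub>" and i: "i < r"
  have si: "s i \<in> Dual M" "\<And>j. j < r \<Longrightarrow> y j \<in> carrier M" using b i by (auto simp: basis_def)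
  have "\<zero> = s i (lc M r c y)" using si c M module_ring_mod Hom_zero[of "s i" M "ring_mod R"] by simp
  also have "\<dots> = lc (ring_mod R) r c (\<lambda>j. s i (y j))"
    using si M module_ring_mod c by (intro lc_Hom[of _ M]) auto
  also have "\<dots> = lc (ring_mod R) r c (\<lambda>j. if j = i then \<one> else \<zero>)"
    using b i by (intro lc_cong) (auto simp: basis_def)
  also have "\<dots> = lc (ring_mod R) r (\<lambda>j. if j = i then \<one> else \<zero>) c"
    using c by (intro lc_ring_comm) auto
  also have "\<dots> = c i" using c i by (intro lc_delta module_ring_mod) auto
  finally show "c i = \<zero>" by simp
qed

text \<open>Coordinates with respect to an arbitrary basis are linear by uniqueness. Only finitely many basis
  elements occur in the coordinates of a finite generating set, so the basis is finite.\<close>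

lemma free_fg_basis:
  assumes M: "module R M" and fg: "fin_gen R M" and free: "free_module R M"
  shows "\<exists>r s y. basis M r s y"
proof -
  interpret M: module R M by fact
  obtain B where B: "B \<subseteq> carrier M" and ex1: "\<forall>m\<in>carrier M. \<exists>!c.
     c \<in> B \<rightarrow>\<^sub>E carrier R \<and> finite {b \<in> B. c b \<noteq> \<zero>} \<and> m = (\<Oplus>\<^bsub>M\<^esub>b\<in>{b \<in> B. c b \<noteq> \<zero>}. c b \<odot>\<^bsub>M\<^esub> b)"
    using free unfolding free_module_def by (elim exE conjE)
  define P where "P c m \<longleftrightarrow> c \<in> B \<rightarrow>\<^sub>E carrier R \<and> finite {b \<in> B. c b \<noteq> \<zero>} \<and>
     m = (\<Oplus>\<^bsub>M\<^esub>b\<in>{b \<in> B. c b \<noteq> \<zero>}. c b \<odot>\<^bsub>M\<^esub> b)" for c m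
  have ex1: "\<exists>!c. P c m" if "m \<in> carrier M" for m using bspec[OF ex1 that] unfolding P_def .
  define co where "co m = (THE c. P c m)" for m
  have co: "P (co m) m" if "m \<in> carrier M" for m unfolding co_def by (rule theI'[OF ex1[OF that]])
  have uniq: "co m = c" if "m \<in> carrier M" "P c m" for c m using ex1 co that by blast
  have coR: "co m b \<in> carrier R" if "m \<in> carrier M" "b \<in> B" for m b using co that by (auto simp: P_def PiE_iff)
  have PI: "P c (\<Oplus>\<^bsub>M\<^esub>b\<in>T. c b \<odot>\<^bsub>M\<^esub> b)"
    if "c \<in> B \<rightarrow>\<^sub>E carrier R" "finite T" "T \<subseteq> B" "\<And>b. b \<in> B - T \<Longrightarrow> c b = \<zero>" for c T
  proof -
    have supp: "{b \<in> B. c b \<noteq> \<zero>} \<subseteq> T" using that(4) by auto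
    have cM: "c b \<in> carrier R" "b \<in> carrier M" if "b \<in> T" for b
      using that \<open>c \<in> _\<close> \<open>T \<subseteq> B\<close> B by (auto simp: PiE_iff)
    have "(\<Oplus>\<^bsub>M\<^esub>b\<in>{b \<in> B. c b \<noteq> \<zero>}. c b \<odot>\<^bsub>M\<^esub> b) = (\<Oplus>\<^bsub>M\<^esub>b\<in>T. c b \<odot>\<^bsub>M\<^esub> b)"
      by (rule M.M.add.finprod_mono_neutral_cong_left[OF that(2) supp]) (use cM that(3) in auto)
    then show ?thesis using that(1) finite_subset[OF supp that(2)] by (simp add: P_def)
  qed
  have sumT: "(\<Oplus>\<^bsub>M\<^esub>b\<in>T. co m b \<odot>\<^bsub>M\<^esub> b) = m"
    if "m \<in> carrier M" "finite T" "T \<subseteq> B" "{b \<in> B. co m b \<noteq> \<zero>} \<subseteq> T" for m T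
  proof -
    have "co m \<in> B \<rightarrow>\<^sub>E carrier R" using co that by (auto simp: P_def)
    then have "P (co m) (\<Oplus>\<^bsub>M\<^esub>b\<in>T. co m b \<odot>\<^bsub>M\<^esub> b)" using that by (intro PI) auto
    then show ?thesis using co[OF that(1)] unfolding P_def by metis
  qed
  have fin: "finite {b \<in> B. co m b \<noteq> \<zero>}" if "m \<in> carrier M" for m using co[OF that] by (simp add: P_def)
  have add: "co (m \<oplus>\<^bsub>M\<^esub> m') b = co m b \<oplus> co m' b"
    if m: "m \<in> carrier M" "m' \<in> carrier M" and b: "b \<in> B" for m m' b
  proof -
    let ?T = "{b \<in> B. co m b \<noteq> \<zero>} \<union> {b \<in> B. co m' b \<noteq> \<zero>}"
    let ?c = "\<lambda>b\<in>B. co m b \<oplus> co m' b"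
    have T: "finite ?T" "?T \<subseteq> B" using fin m by auto
    have "P ?c (\<Oplus>\<^bsub>M\<^esub>b\<in>?T. ?c b \<odot>\<^bsub>M\<^esub> b)" using T coR m by (intro PI) auto
    also have "(\<Oplus>\<^bsub>M\<^esub>b\<in>?T. ?c b \<odot>\<^bsub>M\<^esub> b) = (\<Oplus>\<^bsub>M\<^esub>b\<in>?T. co m b \<odot>\<^bsub>M\<^esub> b \<oplus>\<^bsub>M\<^esub> co m' b \<odot>\<^bsub>M\<^esub> b)"
      using B coR m by (intro M.M.finsum_cong') (auto simp: M.smult_l_distr subset_eq)
    also have "\<dots> = (\<Oplus>\<^bsub>M\<^esub>b\<in>?T. co m b \<odot>\<^bsub>M\<^esub> b) \<oplus>\<^bsub>M\<^esub> (\<Oplus>\<^bsub>M\<^esub>b\<in>?T. co m' b \<odot>\<^bsub>M\<^esub> b)"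
      using B coR m by (intro M.M.finsum_addf) (auto simp: subset_eq)
    also have "\<dots> = m \<oplus>\<^bsub>M\<^esub> m'" using m T by (subst (1 2) sumT) auto
    finally have "co (m \<oplus>\<^bsub>M\<^esub> m') = ?c" by (rule uniq[rotated]) (use m in simp)
    then show ?thesis using b by simp
  qed
  have smult: "co (a \<odot>\<^bsub>M\<^esub> m) b = a \<otimes> co m b"
    if m: "a \<in> carrier R" "m \<in> carrier M" and b: "b \<in> B" for m a b
  proof -
    let ?T = "{b \<in> B. co m b \<noteq> \<zero>}"
    let ?c = "\<lambda>b\<in>B. a \<otimes> co m b"
    have T: "finite ?T" "?T \<subseteq> B" using fin m by auto
    have "P ?c (\<Oplus>\<^bsub>M\<^esub>b\<in>?T. ?c b \<odot>\<^bsub>M\<^esub> b)" using T coR m by (intro PI) auto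
    also have "(\<Oplus>\<^bsub>M\<^esub>b\<in>?T. ?c b \<odot>\<^bsub>M\<^esub> b) = (\<Oplus>\<^bsub>M\<^esub>b\<in>?T. a \<odot>\<^bsub>M\<^esub> (co m b \<odot>\<^bsub>M\<^esub> b))"
      using B coR m by (intro M.M.finsum_cong') (auto simp: M.smult_assoc1 subset_eq)
    also have "\<dots> = a \<odot>\<^bsub>M\<^esub> (\<Oplus>\<^bsub>M\<^esub>b\<in>?T. co m b \<odot>\<^bsub>M\<^esub> b)"
      using B coR m T by (intro M.finsum_smult_ldistr[symmetric]) (auto simp: subset_eq)
    also have "\<dots> = a \<odot>\<^bsub>M\<^esub> m" using m T by (subst sumT) auto
    finally have "co (a \<odot>\<^bsub>M\<^esub> m) = ?c" by (rule uniq[rotated]) (use m in simp)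
    then show ?thesis using b by simp
  qed
  have dual: "(\<lambda>m. co m b) \<in> Dual M" if "b \<in> B" for b
    using that coR add smult by (intro HomI) auto
  have delta: "co b b' = (if b' = b then \<one> else \<zero>)" if b: "b \<in> B" "b' \<in> B" for b b'
  proof -
    let ?c = "\<lambda>b'\<in>B. if b' = b then \<one> else \<zero>"
    have "P ?c (\<Oplus>\<^bsub>M\<^esub>b\<in>{b}. ?c b \<odot>\<^bsub>M\<^esub> b)" using b by (intro PI) auto
    also have "(\<Oplus>\<^bsub>M\<^esub>b\<in>{b}. ?c b \<odot>\<^bsub>M\<^esub> b) = b" using b B by (subst M.finsum_insert) (auto simp: mlin[OF M])
    finally have "co b = ?c" by (rule uniq[rotated]) (use b B in auto)
    then show ?thesis using b by simp
  qed
  obtain A where A: "finite A" "A \<subseteq> carrier M" "span M A = carrier M"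
    using fg fin_gen_span[OF M] by blast
  define B0 where "B0 = (\<Union>a\<in>A. {b \<in> B. co a b \<noteq> \<zero>})"
  have B0: "finite B0" "B0 \<subseteq> B" using A fin by (auto simp: B0_def)
  have "submodule {m \<in> carrier M. \<forall>b\<in>B - B0. co m b = \<zero>} R M"
    using M dual Hom_zero[OF dual M module_ring_mod]
    by (intro submodI[OF M]) (auto simp: add smult mlin)
  then have "span M A \<subseteq> {m \<in> carrier M. \<forall>b\<in>B - B0. co m b = \<zero>}"
    using A by (intro span_minimal) (auto simp: B0_def)
  then have supp: "co m b = \<zero>" if "m \<in> carrier M" "b \<in> B - B0" for m b using that A(3) by auto
  obtain y where y: "bij_betw y {0..<card B0} B0" using ex_bij_betw_nat_finite[OF B0(1)] by blast
  define r where "r = card B0"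
  have y: "bij_betw y {..<r} B0" using y by (simp add: r_def atLeast0LessThan)
  have yB: "y i \<in> B" if "i < r" for i using y B0 that by (auto simp: bij_betw_def)
  have yM: "y i \<in> carrier M" if "i < r" for i using yB B that by auto
  have "lc M r (\<lambda>i. co m (y i)) y = m" if m: "m \<in> carrier M" for m
  proof -
    have "lc M r (\<lambda>i. co m (y i)) y = (\<Oplus>\<^bsub>M\<^esub>i\<in>{..<r}. co m (y i) \<odot>\<^bsub>M\<^esub> y i)"
      using yB yM coR m by (intro lc_finsum[OF M]) auto
    also have "\<dots> = (\<Oplus>\<^bsub>M\<^esub>b\<in>y ` {..<r}. co m b \<odot>\<^bsub>M\<^esub> b)"
      using y yB yM coR m by (intro M.M.add.finprod_reindex[symmetric]) (auto simp: bij_betw_def)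
    also have "\<dots> = (\<Oplus>\<^bsub>M\<^esub>b\<in>B0. co m b \<odot>\<^bsub>M\<^esub> b)" using y by (simp add: bij_betw_def)
    also have "\<dots> = m" using m B0 supp by (intro sumT) auto
    finally show ?thesis .
  qed
  moreover have "co (y j) (y i) = (if i = j then \<one> else \<zero>)" if "i < r" "j < r" for i j
    using delta[of "y j" "y i"] yB that inj_onD[OF bij_betw_imp_inj_on[OF y], of i j] by auto
  ultimately have "basis M r (\<lambda>i m. co m (y i)) y"
    using dual yB yM by (auto simp: basis_def)
  then show ?thesis by blast
qed

end

section \<open>Free covers and multiplications that factor through a free module\<close>

context cring
begin

lemma basis_bsum:
  assumes A: "module R A" and B: "module R B" and bA: "basis A r s y" and bB: "basis B r' s' y'"
  shows "basis (bsum A B) (r + r') (\<lambda>i u. if i < r then s i (pfst u) else s' (i - r) (psnd u))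
    (\<lambda>i. if i < r then pair (y i) \<zero>\<^bsub>B\<^esub> else pair \<zero>\<^bsub>A\<^esub> (y' (i - r)))" (is "basis _ _ ?s ?y")
proof -
  have S: "module R (bsum A B)" using A B by (rule module_bsum)
  have sy: "s i \<in> Dual A" "y i \<in> carrier A" if "i < r" for i using bA that by (auto simp: basis_def)
  have sy': "s' i \<in> Dual B" "y' i \<in> carrier B" if "i < r'" for i using bB that by (auto simp: basis_def)
  have s: "?s i \<in> Dual (bsum A B)" "?y i \<in> carrier (bsum A B)" if "i < r + r'" for i
    using that sy sy' A B
    by (cases "i < r"; simp add: mlin Hom_comp[OF Hom_pfst] Hom_comp[OF Hom_psnd])+
  have sR: "?s i u \<in> carrier R" if "i < r + r'" "u \<in> carrier (bsum A B)" for i u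
    using Hom_closed[OF s(1)] that by auto
  have "lc (bsum A B) (r + r') (\<lambda>i. ?s i u) ?y = u" if u: "u \<in> carrier (bsum A B)" for u
  proof -
    have sc: "s i (pfst u) \<in> carrier R" if "i < r" for i
      using Hom_closed[OF sy(1)[OF that] bsum_proj(1)[OF u]] by simp
    have sc': "s' i (psnd u) \<in> carrier R" if "i < r'" for i
      using Hom_closed[OF sy'(1)[OF that] bsum_proj(2)[OF u]] by simp
    have "lc (bsum A B) (r + r') (\<lambda>i. ?s i u) ?y =
      lc (bsum A B) r (\<lambda>i. s i (pfst u)) (\<lambda>i. pair (y i) \<zero>\<^bsub>B\<^esub>) \<oplus>\<^bsub>bsum A B\<^esub>
      lc (bsum A B) r' (\<lambda>i. s' i (psnd u)) (\<lambda>i. pair \<zero>\<^bsub>A\<^esub> (y' i))"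
      using sR s(2) u by (subst lc_append[OF S]) (auto cong: lc_cong intro!: arg_cong2[where f="add (bsum A B)"])
    also have "lc (bsum A B) r (\<lambda>i. s i (pfst u)) (\<lambda>i. pair (y i) \<zero>\<^bsub>B\<^esub>) = pair (lc A r (\<lambda>i. s i (pfst u)) y) \<zero>\<^bsub>B\<^esub>"
      using sc sy A S by (intro lc_Hom[OF Hom_inl[OF B], symmetric]) auto
    also have "lc (bsum A B) r' (\<lambda>i. s' i (psnd u)) (\<lambda>i. pair \<zero>\<^bsub>A\<^esub> (y' i)) = pair \<zero>\<^bsub>A\<^esub> (lc B r' (\<lambda>i. s' i (psnd u)) y')"
      using sc' sy' B S by (intro lc_Hom[OF Hom_inr[OF A], symmetric]) auto
    also have "lc A r (\<lambda>i. s i (pfst u)) y = pfst u" using bA bsum_proj(1)[OF u] by (simp add: basis_def)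
    also have "lc B r' (\<lambda>i. s' i (psnd u)) y' = psnd u" using bB bsum_proj(2)[OF u] by (simp add: basis_def)
    finally show ?thesis using bsum_proj[OF u] A B by (simp add: mlin)
  qed
  moreover have "?s i (?y j) = (if i = j then \<one> else \<zero>)" if "i < r + r'" "j < r + r'" for i j
  proof -
    have 1: "i < r \<Longrightarrow> j < r \<Longrightarrow> s i (y j) = (if i = j then \<one> else \<zero>)"
      using bA by (simp add: basis_def)
    have 2: "i - r < r' \<Longrightarrow> j - r < r' \<Longrightarrow> s' (i - r) (y' (j - r)) = (if i - r = j - r then \<one> else \<zero>)"
      using bB by (simp add: basis_def)
    have 3: "i < r \<Longrightarrow> s i \<zero>\<^bsub>A\<^esub> = \<zero>" using Hom_zero[OF sy(1) A module_ring_mod] by simp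
    have 4: "i - r < r' \<Longrightarrow> s' (i - r) \<zero>\<^bsub>B\<^esub> = \<zero>" using Hom_zero[OF sy'(1) B module_ring_mod] by simp
    show ?thesis using that 1 2 3 4 by (cases "i < r"; cases "j < r") auto
  qed
  ultimately show ?thesis using s by (auto simp: basis_def)
qed

definition ffree :: "'a lmodule \<Rightarrow> bool" where
  "ffree P \<longleftrightarrow> P \<in> fgmod R \<and> free_module R P"

lemma ffreeD: "ffree P \<Longrightarrow> P \<in> fgmod R" "ffree P \<Longrightarrow> module R P"
  by (auto simp: ffree_def fgmod_def)

lemma ffree_basis: "ffree P \<Longrightarrow> \<exists>r s y. basis P r s y"
  using free_fg_basis[of P] by (auto simp: ffree_def fgmod_def)

lemma ffree_bsum: assumes "ffree P" "ffree Q" shows "ffree (bsum P Q)"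
proof -
  obtain r s y r' s' y' where "basis P r s y" "basis Q r' s' y'"
    using ffree_basis[OF assms(1)] ffree_basis[OF assms(2)] by blast
  note b = basis_bsum[OF ffreeD(2)[OF assms(1)] ffreeD(2)[OF assms(2)] this]
  show ?thesis unfolding ffree_def
    using bsum_fgmod[OF ffreeD(1)[OF assms(1)] ffreeD(1)[OF assms(2)]]
      basis_free[OF module_bsum[OF ffreeD(2)[OF assms(1)] ffreeD(2)[OF assms(2)]] b] by blast
qed

text \<open>Iterated direct sums of the ring, whose elements are coded as lists of length one.\<close>

lemma ex_free_rank: "\<exists>F s y. F \<in> fgmod R \<and> basis F r s y"
proof (induction r)
  case 0
  define Z :: "'a lmodule" where "Z = \<lparr>carrier = {[]}, monoid.mult = undefined, one = undefined,
    ring.zero = [], add = (\<lambda>_ _. []), smult = (\<lambda>_ _. [])\<rparr>"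
  have Zs: "carrier Z = {[]}" "\<zero>\<^bsub>Z\<^esub> = []" "u \<oplus>\<^bsub>Z\<^esub> v = []" "a \<odot>\<^bsub>Z\<^esub> u = []" for u v a by (simp_all add: Z_def)
  have "abelian_group Z" by (rule abelian_groupI) (auto simp: Zs)
  then have Z: "module R Z" by (intro moduleI) (auto simp: Zs intro: is_cring)
  have "span Z {} = carrier Z" using submod_zero[OF span_submodule Z, OF Z] by (auto simp: Zs span_def)
  then have "Z \<in> fgmod R" unfolding fgmod_def using Z fin_gen_span[OF Z] by auto
  moreover have "basis Z 0 (\<lambda>_ _. \<zero>) (\<lambda>_. [])" by (simp add: basis_def Zs)
  ultimately show ?case by blast
next
  case (Suc r)
  then obtain F s y where F: "F \<in> fgmod R" "basis F r s y" by blast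
  define U :: "'a lmodule" where "U = \<lparr>carrier = {[a] |a. a \<in> carrier R}, monoid.mult = undefined,
    one = undefined, ring.zero = [\<zero>], add = (\<lambda>u v. [hd u \<oplus> hd v]), smult = (\<lambda>a u. [a \<otimes> hd u])\<rparr>"
  have Us: "carrier U = {[a] |a. a \<in> carrier R}" "\<zero>\<^bsub>U\<^esub> = [\<zero>]" "u \<oplus>\<^bsub>U\<^esub> v = [hd u \<oplus> hd v]" "a \<odot>\<^bsub>U\<^esub> u = [a \<otimes> hd u]"
    for u v a by (simp_all add: U_def)
  have U: "module R U" and e: "epi (ring_mod R) U (\<lambda>a. [a])"
    by (rule module_image[OF module_ring_mod, of "\<lambda>a. [a]" U]; auto simp: Us)+
  have hd: "hd \<in> Dual U" by (rule HomI) (auto simp: Us)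
  have b: "basis U 1 (\<lambda>_. hd) (\<lambda>_. [\<one>])" using hd by (auto simp: basis_def Us)
  have "[a] \<in> span U {[\<one>]}" if "a \<in> carrier R" for a
  proof -
    have "a \<odot>\<^bsub>U\<^esub> [\<one>] \<in> span U {[\<one>]}"
      using submod_smult[OF span_submodule[OF U, of "{[\<one>]}"] U that, of "[\<one>]"] span_incl[of "{[\<one>]}" U] by (auto simp: Us)
    then show ?thesis using that by (simp add: Us)
  qed
  then have "span U {[\<one>]} = carrier U" by (auto simp: Us span_def)
  then have "U \<in> fgmod R" unfolding fgmod_def using U fin_gen_span[OF U] by (auto simp: Us intro!: exI[of _ "{[\<one>]}"])
  then have "bsum F U \<in> fgmod R" by (rule bsum_fgmod[OF F(1)])
  moreover note basis_bsum[OF module_fgmod[OF F(1)] U F(2) b, unfolded Suc_eq_plus1[symmetric]]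
  ultimately show ?case by blast
qed

lemma free_cover:
  assumes M: "M \<in> fgmod R"
  shows "\<exists>P q. ffree P \<and> epi P M q"
proof -
  note mM = module_fgmod[OF M]
  obtain A where A: "finite A" "A \<subseteq> carrier M" "span M A = carrier M"
    using M fin_gen_span[OF mM] by (auto simp: fgmod_def)
  obtain as where as: "set as = A" using finite_list[OF A(1)] by blast
  define r where "r = length as"
  have asM: "as ! i \<in> carrier M" if "i < r" for i using that as A by (auto simp: r_def)
  obtain F s y where F: "F \<in> fgmod R" "basis F r s y" using ex_free_rank by blast
  note mF = module_fgmod[OF F(1)]
  define q where "q m = lc M r (\<lambda>i. s i m) (\<lambda>i. as ! i)" for m
  have s: "s i \<in> Dual F" "y i \<in> carrier F" if "i < r" for i using F that by (auto simp: basis_def)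
  have q: "q \<in> Hom F M" unfolding q_def using asM s by (intro Hom_lc mF mM) auto
  have "q (y j) = as ! j" if "j < r" for j
  proof -
    have "q (y j) = lc M r (\<lambda>i. if i = j then \<one> else \<zero>) (\<lambda>i. as ! i)"
      unfolding q_def using F that by (intro lc_cong) (auto simp: basis_def)
    then show ?thesis using lc_delta[OF mM that] asM by simp
  qed
  then have "A \<subseteq> q ` carrier F" using as s by (auto simp: in_set_conv_nth r_def) (metis image_eqI)
  then have "span M A \<subseteq> q ` carrier F" using q
    by (intro span_minimal submod_image[OF q mF mM] submod_carrier mF)
  then have "epi F M q" using q A(3) by (auto simp: epi_def Hom_closed)
  moreover have "ffree F" using F basis_free[OF mF] by (auto simp: ffree_def)
  ultimately show ?thesis by blast
qed

text \<open>The functionals \<^term>\<open>s\<close> define a homomorphism from \<^term>\<open>M\<close> to \<open>R\<^sup>r\<close> and the elements \<^term>\<open>y\<close> one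
  from \<open>R\<^sup>r\<close> to \<^term>\<open>M\<close>, whose composite is multiplication by \<^term>\<open>u\<close>. For \<open>u = 1\<close> this is the dual basis
  characterization of projective modules.\<close>

definition dual_family where "dual_family M u r s y \<longleftrightarrow>
  (\<forall>i<(r::nat). s i \<in> Dual M \<and> y i \<in> carrier M) \<and>
  (\<forall>m\<in>carrier M. lc M r (\<lambda>i. s i m) y = u \<odot>\<^bsub>M\<^esub> m)"

definition free_factor where "free_factor M u \<longleftrightarrow> u \<in> carrier R \<and> (\<exists>r s y. dual_family M u r s y)"

lemma free_factor_carrier: "free_factor M u \<Longrightarrow> u \<in> carrier R"
  by (simp add: free_factor_def)

lemma free_factorE:
  assumes "free_factor M u"
  obtains r s y where "\<And>i. i < r \<Longrightarrow> s i \<in> Dual M" "\<And>i. i < r \<Longrightarrow> y i \<in> carrier M"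
    "\<And>m. m \<in> carrier M \<Longrightarrow> lc M r (\<lambda>i. s i m) y = u \<odot>\<^bsub>M\<^esub> m"
proof -
  obtain r s y where "dual_family M u r s y" using assms by (auto simp: free_factor_def)
  then show ?thesis using that[of r s y] unfolding dual_family_def by blast
qed

text \<open>The lifting property of projective modules, up to the factor \<^term>\<open>u\<close>: lift the images of the \<^term>\<open>y i\<close>
  and recombine them with the functionals.\<close>

lemma free_factor_lift:
  assumes u: "free_factor M u" and q: "epi A B q" and f: "f \<in> Hom M B"
    and mods: "module R M" "module R A" "module R B"
  shows "\<exists>g\<in>Hom M A. \<forall>m\<in>carrier M. q (g m) = u \<odot>\<^bsub>B\<^esub> f m"
proof -
  obtain r s y where s: "\<And>i. i < r \<Longrightarrow> s i \<in> Dual M" "\<And>i. i < r \<Longrightarrow> y i \<in> carrier M"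
    and sum: "\<And>m. m \<in> carrier M \<Longrightarrow> lc M r (\<lambda>i. s i m) y = u \<odot>\<^bsub>M\<^esub> m"
    using u by (rule free_factorE) blast
  have "\<exists>x\<in>carrier A. q x = f (y i)" if "i < r" for i
    using epiE[OF q Hom_closed[OF f s(2)[OF that]]] by metis
  then obtain x where x: "\<And>i. i < r \<Longrightarrow> x i \<in> carrier A" "\<And>i. i < r \<Longrightarrow> q (x i) = f (y i)" by metis
  have sR: "s i m \<in> carrier R" if "i < r" "m \<in> carrier M" for i m using Hom_closed[OF s(1)] that by simp
  show ?thesis
  proof (rule bexI[of _ "\<lambda>m. lc A r (\<lambda>i. s i m) x"], rule ballI)
    fix m assume m: "m \<in> carrier M"
    have "q (lc A r (\<lambda>i. s i m) x) = lc B r (\<lambda>i. s i m) (\<lambda>i. q (x i))"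
      using sR m x mods by (intro lc_Hom[OF epi_Hom[OF q]]) auto
    also have "\<dots> = lc B r (\<lambda>i. s i m) (\<lambda>i. f (y i))" using x by (intro lc_cong) auto
    also have "\<dots> = f (lc M r (\<lambda>i. s i m) y)"
      using sR m s mods by (intro lc_Hom[OF f, symmetric]) auto
    finally show "q (lc A r (\<lambda>i. s i m) x) = u \<odot>\<^bsub>B\<^esub> f m"
      using sum[OF m] Hom_smult[OF f free_factor_carrier[OF u] m] by simp
  qed (use s x mods in \<open>auto intro!: Hom_lc\<close>)
qed

text \<open>The common source of the closure properties: a factorization of \<^term>\<open>u\<close> through \<^term>\<open>P\<close> composes with
  one of \<^term>\<open>v\<close> on \<^term>\<open>P\<close>. For \<^term>\<open>P\<close> free and \<open>v = 1\<close> it produces free factors, and for \<open>u = 1\<close> it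
  shows that free factors are inherited by direct summands.\<close>

lemma free_factor_comp:
  assumes P: "free_factor P v" and a: "a \<in> Hom M P" and b: "b \<in> Hom P M"
    and u: "u \<in> carrier R" "\<And>m. m \<in> carrier M \<Longrightarrow> b (a m) = u \<odot>\<^bsub>M\<^esub> m"
    and mods: "module R M" "module R P"
  shows "free_factor M (v \<otimes> u)"
proof -
  obtain r s y where s: "\<And>i. i < r \<Longrightarrow> s i \<in> Dual P" "\<And>i. i < r \<Longrightarrow> y i \<in> carrier P"
    and sum: "\<And>m. m \<in> carrier P \<Longrightarrow> lc P r (\<lambda>i. s i m) y = v \<odot>\<^bsub>P\<^esub> m"
    using P by (rule free_factorE) blast
  note v = free_factor_carrier[OF P]
  have "lc M r (\<lambda>i. s i (a m)) (\<lambda>i. b (y i)) = (v \<otimes> u) \<odot>\<^bsub>M\<^esub> m" if m: "m \<in> carrier M" for m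
  proof -
    note am = Hom_closed[OF a m]
    have "lc M r (\<lambda>i. s i (a m)) (\<lambda>i. b (y i)) = b (lc P r (\<lambda>i. s i (a m)) y)"
      using Hom_closed[OF s(1) am] s(2) mods by (intro lc_Hom[OF b, symmetric]) auto
    then show ?thesis using sum[OF am] Hom_smult[OF b v am] u m mods v by (simp add: msmult_smult)
  qed
  then have "dual_family M (v \<otimes> u) r (\<lambda>i m. s i (a m)) (\<lambda>i. b (y i))"
    unfolding dual_family_def using s a b by (auto intro: Hom_comp[OF a] Hom_closed)
  then show ?thesis using u v unfolding free_factor_def by blast
qed

lemma ffree_factor: "ffree P \<Longrightarrow> free_factor P \<one>"
proof -
  assume P: "ffree P"
  then obtain r s y where "basis P r s y" using ffree_basis by blast
  then have "dual_family P \<one> r s y" using ffreeD(2)[OF P] by (simp add: basis_def dual_family_def mlin)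
  then show ?thesis by (auto simp: free_factor_def)
qed

lemma ffree_lift:
  assumes "ffree P" "epi A B q" "f \<in> Hom P B" "module R A" "module R B"
  shows "\<exists>g\<in>Hom P A. \<forall>m\<in>carrier P. q (g m) = f m"
  using free_factor_lift[OF ffree_factor assms(2,3) ffreeD(2) assms(4,5)] assms(1,5)
    Hom_closed[OF assms(3)] by (simp add: mlin)

lemma free_factorI:
  assumes "ffree P" "a \<in> Hom M P" "b \<in> Hom P M" "u \<in> carrier R" "module R M"
    and "\<And>m. m \<in> carrier M \<Longrightarrow> b (a m) = u \<odot>\<^bsub>M\<^esub> m"
  shows "free_factor M u"
  using free_factor_comp[OF ffree_factor assms(2,3,4,6,5) ffreeD(2)] assms by simp

text \<open>If multiplication by \<^term>\<open>u\<close> factors through some free module, it already factors through any given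
  free cover.\<close>

lemma free_factor_cover:
  assumes P: "ffree P" "epi P M q" and M: "module R M"
  shows "free_factor M u \<longleftrightarrow> u \<in> carrier R \<and> (\<exists>g\<in>Hom M P. \<forall>m\<in>carrier M. q (g m) = u \<odot>\<^bsub>M\<^esub> m)"
  using free_factorI[OF P(1) _ epi_Hom[OF P(2)] _ M, of _ u] free_factor_lift[OF _ P(2) Hom_id M ffreeD(2)[OF P(1)] M, of u]
    free_factor_carrier[of M u] by auto

lemma free_factor_plus:
  assumes M: "M \<in> fgmod R" and "free_factor M u" "free_factor M v"
  shows "free_factor M (u \<oplus> v)"
proof -
  note mM = module_fgmod[OF M]
  obtain P q where P: "ffree P" "epi P M q" using free_cover[OF M] by blast
  note q = epi_Hom[OF P(2)] and mP = ffreeD(2)[OF P(1)]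
  obtain g h where "g \<in> Hom M P" "\<forall>m\<in>carrier M. q (g m) = u \<odot>\<^bsub>M\<^esub> m" "h \<in> Hom M P" "\<forall>m\<in>carrier M. q (h m) = v \<odot>\<^bsub>M\<^esub> m"
    and "u \<in> carrier R" "v \<in> carrier R"
    using assms free_factor_cover[OF P mM] by blast
  then show ?thesis using q mP mM
    by (subst free_factor_cover[OF P mM])
      (auto intro!: bexI[of _ "\<lambda>m. g m \<oplus>\<^bsub>P\<^esub> h m"] Hom_plus simp: Hom_simps madd_smult)
qed

lemma free_factor_times:
  assumes M: "module R M" and "free_factor M u" and "a \<in> carrier R"
  shows "free_factor M (a \<otimes> u)"
  using free_factor_comp[OF assms(2) Hom_id Hom_scale[OF Hom_id M assms(3)] assms(3) _ M M] assms
    free_factor_carrier[OF assms(2)] by (simp add: m_comm)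

lemma free_factor_ideal:
  assumes M: "M \<in> fgmod R" shows "ideal {u. free_factor M u} R"
proof (rule idealI[OF ring_axioms])
  note mM = module_fgmod[OF M]
  have zero: "free_factor M \<zero>"
    unfolding free_factor_def dual_family_def using mM
    by (auto intro!: exI[of _ 0] simp: mlin)
  have neg: "free_factor M (\<ominus> u)" if "free_factor M u" for u
    using free_factor_times[OF mM that, of "\<ominus> \<one>"] free_factor_carrier[OF that] by (simp add: l_minus)
  show "subgroup {u. free_factor M u} (add_monoid R)"
    using zero neg free_factor_plus[OF M] free_factor_carrier by (intro add.subgroupI) auto
  fix a x assume "a \<in> {u. free_factor M u}" and x: "x \<in> carrier R"
  then show "x \<otimes> a \<in> {u. free_factor M u}" "a \<otimes> x \<in> {u. free_factor M u}"
    using free_factor_times[OF mM _ x, of a] free_factor_carrier[of M a] by (auto simp: m_comm)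
qed

text \<open>Direct summands in terms of maps, along which factorizations and lifts are transported by
  composition.\<close>

definition retr where "retr M N \<longleftrightarrow> (\<exists>i\<in>Hom M N. \<exists>r\<in>Hom N M. \<forall>m\<in>carrier M. r (i m) = m)"

lemma retrI: "\<lbrakk>i \<in> Hom M N; r \<in> Hom N M; \<And>m. m \<in> carrier M \<Longrightarrow> r (i m) = m\<rbrakk> \<Longrightarrow> retr M N"
  by (auto simp: retr_def)

lemma retr_refl: "retr M M"
  by (rule retrI[OF Hom_id Hom_id]) simp

lemma retr_trans: "\<lbrakk>retr L M; retr M N\<rbrakk> \<Longrightarrow> retr L N"
proof -
  assume "retr L M" "retr M N"
  then obtain i r i' r' where ir: "i \<in> Hom L M" "r \<in> Hom M L" "\<forall>m\<in>carrier L. r (i m) = m"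
    "i' \<in> Hom M N" "r' \<in> Hom N M" "\<forall>m\<in>carrier M. r' (i' m) = m" by (auto simp: retr_def)
  then show ?thesis
    by (intro retrI[OF Hom_comp[OF ir(1,4)] Hom_comp[OF ir(5,2)]]) (simp add: Hom_closed[OF ir(1)])
qed

lemma retr_iso: "\<lbrakk>mod_iso R M N; module R M\<rbrakk> \<Longrightarrow> retr M N"
  by (erule mod_iso_maps, assumption) (rule retrI)

lemma free_factor_retr:
  assumes N: "free_factor N u" and r: "retr M N" and mods: "module R M" "module R N"
  shows "free_factor M u"
proof -
  obtain i r where ir: "i \<in> Hom M N" "r \<in> Hom N M" "\<forall>m\<in>carrier M. r (i m) = m" using r by (auto simp: retr_def)
  show ?thesis using free_factor_comp[OF N ir(1,2) one_closed _ mods] ir mods free_factor_carrier[OF N] by (simp add: mlin)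
qed

section \<open>Exact sequences and syzygies\<close>

definition exact3 where "exact3 A B C f g \<longleftrightarrow> f \<in> Hom A B \<and> inj_on f (carrier A) \<and> epi B C g \<and>
  (\<forall>b\<in>carrier B. g b = \<zero>\<^bsub>C\<^esub> \<longleftrightarrow> b \<in> f ` carrier A)"

lemma short_exact_iff: "short_exact R A B C \<longleftrightarrow> (\<exists>f g. exact3 A B C f g)"
proof -
  have *: "f ` carrier A = a_kernel B C g \<longleftrightarrow> (\<forall>b\<in>carrier B. g b = \<zero>\<^bsub>C\<^esub> \<longleftrightarrow> b \<in> f ` carrier A)" if "f \<in> Hom A B" for f g
    using Hom_closed[OF that] by (fastforce simp: a_kernel_eq)
  show ?thesis
  proof
    assume "short_exact R A B C"
    then obtain f g where "f \<in> Hom A B" "g \<in> Hom B C" "inj_on f (carrier A)"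
      "f ` carrier A = a_kernel B C g" "g ` carrier B = carrier C" unfolding short_exact_def by blast
    then show "\<exists>f g. exact3 A B C f g" using *[of f g] unfolding exact3_def epi_def by blast
  next
    assume "\<exists>f g. exact3 A B C f g"
    then obtain f g where "f \<in> Hom A B" "g \<in> Hom B C" "inj_on f (carrier A)"
      "\<forall>b\<in>carrier B. g b = \<zero>\<^bsub>C\<^esub> \<longleftrightarrow> b \<in> f ` carrier A" "g ` carrier B = carrier C"
      unfolding exact3_def epi_def by blast
    then show "short_exact R A B C" using *[of f g] unfolding short_exact_def by blast
  qed
qed

lemma exact3D:
  assumes "exact3 A B C f g"
  shows "f \<in> Hom A B" "inj_on f (carrier A)" "epi B C g" "g \<in> Hom B C"
    "\<And>b. \<lbrakk>b \<in> carrier B; g b = \<zero>\<^bsub>C\<^esub>\<rbrakk> \<Longrightarrow> b \<in> f ` carrier A" "\<And>a. a \<in> carrier A \<Longrightarrow> g (f a) = \<zero>\<^bsub>C\<^esub>"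
  using assms by (auto simp: exact3_def epi_Hom Hom_closed)

lemma exact3_kernel:
  assumes "epi B C g" "module R B" "module R C"
  shows "exact3 (sub B {b \<in> carrier B. g b = \<zero>\<^bsub>C\<^esub>}) B C (\<lambda>x. x) g"
  using assms Hom_incl[of "{b \<in> carrier B. g b = \<zero>\<^bsub>C\<^esub>}" B] by (auto simp: exact3_def)

text \<open>Lift \<^term>\<open>v\<close> on \<^term>\<open>C\<close> to a free cover \<^term>\<open>P\<close> of \<^term>\<open>B\<close>. The difference between \<^term>\<open>v\<close> and this
  composite is a map from \<^term>\<open>B\<close> to \<^term>\<open>A\<close>, and \<^term>\<open>u\<close> times that lifts to \<^term>\<open>P\<close> as well.\<close>

lemma free_factor_extension:
  assumes e: "exact3 A B C f g" and fg: "A \<in> fgmod R" "B \<in> fgmod R" "C \<in> fgmod R"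
    and u: "free_factor A u" and v: "free_factor C v"
  shows "free_factor B (u \<otimes> v)"
proof -
  note m = fg[THEN module_fgmod] and e' = exact3D[OF e]
  note uR = free_factor_carrier[OF u] and vR = free_factor_carrier[OF v]
  obtain P q where P: "ffree P" "epi P B q" using free_cover[OF fg(2)] by blast
  note mP = ffreeD(2)[OF P(1)] and qH = epi_Hom[OF P(2)]
  obtain h where h: "h \<in> Hom C P" "\<forall>c\<in>carrier C. g (q (h c)) = v \<odot>\<^bsub>C\<^esub> c"
    using free_factor_lift[OF v epi_comp[OF P(2) e'(3)] Hom_id m(3) mP m(3)] by blast
  note H = Hom_comp[OF Hom_comp[OF e'(4) h(1)] qH]
  have d: "(\<lambda>b. v \<odot>\<^bsub>B\<^esub> b \<oplus>\<^bsub>B\<^esub> \<ominus>\<^bsub>B\<^esub> q (h (g b))) \<in> Hom B B"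
    using H m vR by (intro Hom_plus Hom_uminus Hom_scale Hom_id)
  have "v \<odot>\<^bsub>B\<^esub> b \<oplus>\<^bsub>B\<^esub> \<ominus>\<^bsub>B\<^esub> q (h (g b)) \<in> f ` carrier A" if b: "b \<in> carrier B" for b
  proof (rule e'(5))
    note gb = Hom_closed[OF e'(4) b] and qb = Hom_closed[OF H b]
    show "v \<odot>\<^bsub>B\<^esub> b \<oplus>\<^bsub>B\<^esub> \<ominus>\<^bsub>B\<^esub> q (h (g b)) \<in> carrier B" using b qb m vR by (simp add: mclosed)
    show "g (v \<odot>\<^bsub>B\<^esub> b \<oplus>\<^bsub>B\<^esub> \<ominus>\<^bsub>B\<^esub> q (h (g b))) = \<zero>\<^bsub>C\<^esub>"
      using bspec[OF h(2) gb] b gb qb m vR by (simp add: mlin Hom_simps[OF e'(4)])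
  qed
  then obtain k where k: "k \<in> Hom B A" "\<And>b. b \<in> carrier B \<Longrightarrow> f (k b) = v \<odot>\<^bsub>B\<^esub> b \<oplus>\<^bsub>B\<^esub> \<ominus>\<^bsub>B\<^esub> q (h (g b))"
    using Hom_corestrict[OF e'(1,2) d m(2,2,1)] by blast
  obtain t where t: "t \<in> Hom A P" "\<forall>a\<in>carrier A. q (t a) = u \<odot>\<^bsub>B\<^esub> f a"
    using free_factor_lift[OF u P(2) e'(1) m(1) mP m(2)] by blast
  have G: "(\<lambda>b. t (k b) \<oplus>\<^bsub>P\<^esub> u \<odot>\<^bsub>P\<^esub> h (g b)) \<in> Hom B P"
    using Hom_comp[OF k(1) t(1)] Hom_comp[OF e'(4) h(1)] mP uR by (intro Hom_plus Hom_scale)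
  have "q (t (k b) \<oplus>\<^bsub>P\<^esub> u \<odot>\<^bsub>P\<^esub> h (g b)) = (u \<otimes> v) \<odot>\<^bsub>B\<^esub> b" if b: "b \<in> carrier B" for b
  proof -
    note kb = Hom_closed[OF k(1) b] and hb = Hom_closed[OF Hom_comp[OF e'(4) h(1)] b]
    note tb = Hom_closed[OF t(1) kb] and qb = Hom_closed[OF H b]
    have "q (t (k b) \<oplus>\<^bsub>P\<^esub> u \<odot>\<^bsub>P\<^esub> h (g b)) = u \<odot>\<^bsub>B\<^esub> f (k b) \<oplus>\<^bsub>B\<^esub> u \<odot>\<^bsub>B\<^esub> q (h (g b))"
      using bspec[OF t(2) kb] tb hb mP uR by (simp add: Hom_simps[OF qH] mclosed)
    also have "\<dots> = (u \<otimes> v) \<odot>\<^bsub>B\<^esub> b"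
      unfolding k(2)[OF b] using b qb m uR vR by (simp add: mlin msmult_smult)
    finally show ?thesis .
  qed
  then show ?thesis unfolding free_factor_cover[OF P m(2)] using G uR vR by (intro conjI bexI[OF _ G]) auto
qed

definition syz1 where "syz1 S X \<longleftrightarrow> S \<in> fgmod R \<and> X \<in> fgmod R \<and> (\<exists>P i q. ffree P \<and> exact3 S P X i q)"

lemma syz1D: "syz1 S X \<Longrightarrow> S \<in> fgmod R" "syz1 S X \<Longrightarrow> X \<in> fgmod R"
  by (auto simp: syz1_def)

text \<open>If \<^term>\<open>h\<close> lifts \<^term>\<open>v\<close> on \<^term>\<open>X\<close> to the cover \<^term>\<open>P\<close>, then \<^term>\<open>v\<close> minus \<^term>\<open>h\<close> maps
  \<^term>\<open>P\<close> into \<^term>\<open>S\<close> and restricts to \<^term>\<open>v\<close> on \<^term>\<open>S\<close>.\<close>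

lemma free_factor_syz1:
  assumes S: "syz1 S X" and v: "free_factor X v"
  shows "free_factor S v"
proof -
  obtain P i q where P: "ffree P" "exact3 S P X i q" using S by (auto simp: syz1_def)
  note m = syz1D[OF S, THEN module_fgmod] and mP = ffreeD(2)[OF P(1)] and e = exact3D[OF P(2)]
  note vR = free_factor_carrier[OF v]
  obtain h where h: "h \<in> Hom X P" "\<forall>x\<in>carrier X. q (h x) = v \<odot>\<^bsub>X\<^esub> x"
    using free_factor_lift[OF v e(3) Hom_id m(2) mP m(2)] by blast
  have d: "(\<lambda>p. v \<odot>\<^bsub>P\<^esub> p \<oplus>\<^bsub>P\<^esub> \<ominus>\<^bsub>P\<^esub> h (q p)) \<in> Hom P P"
    using Hom_comp[OF e(4) h(1)] mP vR by (intro Hom_plus Hom_uminus Hom_scale Hom_id)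
  have "v \<odot>\<^bsub>P\<^esub> p \<oplus>\<^bsub>P\<^esub> \<ominus>\<^bsub>P\<^esub> h (q p) \<in> i ` carrier S" if p: "p \<in> carrier P" for p
  proof (rule e(5))
    note qp = Hom_closed[OF e(4) p] and hp = Hom_closed[OF Hom_comp[OF e(4) h(1)] p]
    show "v \<odot>\<^bsub>P\<^esub> p \<oplus>\<^bsub>P\<^esub> \<ominus>\<^bsub>P\<^esub> h (q p) \<in> carrier P" using p hp mP vR by (simp add: mclosed)
    show "q (v \<odot>\<^bsub>P\<^esub> p \<oplus>\<^bsub>P\<^esub> \<ominus>\<^bsub>P\<^esub> h (q p)) = \<zero>\<^bsub>X\<^esub>"
      using bspec[OF h(2) qp] p qp hp m mP vR by (simp add: mlin Hom_simps[OF e(4)])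
  qed
  then obtain k where k: "k \<in> Hom P S" "\<And>p. p \<in> carrier P \<Longrightarrow> i (k p) = v \<odot>\<^bsub>P\<^esub> p \<oplus>\<^bsub>P\<^esub> \<ominus>\<^bsub>P\<^esub> h (q p)"
    using Hom_corestrict[OF e(1,2) d mP mP m(1)] by blast
  have "k (i s) = v \<odot>\<^bsub>S\<^esub> s" if s: "s \<in> carrier S" for s
  proof (rule inj_onD[OF e(2)])
    note iS = Hom_closed[OF e(1) s]
    show "i (k (i s)) = i (v \<odot>\<^bsub>S\<^esub> s)"
      using k(2)[OF iS] e(6)[OF s] Hom_zero[OF h(1) m(2) mP] mP iS vR s by (simp add: mlin Hom_smult[OF e(1)])
  qed (use s vR m Hom_closed[OF k(1) Hom_closed[OF e(1) s]] in \<open>simp_all add: mclosed\<close>)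
  then show ?thesis using free_factorI[OF P(1) e(1) k(1) vR m(1)] by blast
qed

end

lemma dir_sum_simps [simp]:
  "carrier (dir_sum J Y) = (\<Pi>\<^sub>E i\<in>J. carrier (Y i))"
  "\<zero>\<^bsub>dir_sum J Y\<^esub> = (\<lambda>i\<in>J. \<zero>\<^bsub>Y i\<^esub>)"
  "f \<oplus>\<^bsub>dir_sum J Y\<^esub> g = (\<lambda>i\<in>J. f i \<oplus>\<^bsub>Y i\<^esub> g i)"
  "a \<odot>\<^bsub>dir_sum J Y\<^esub> f = (\<lambda>i\<in>J. a \<odot>\<^bsub>Y i\<^esub> f i)"
  by (simp_all add: dir_sum_def)

context cring
begin

lemma Hom_dir_sum: "(\<And>i. i \<in> J \<Longrightarrow> h i \<in> Hom A (Y i)) \<Longrightarrow> (\<lambda>x. \<lambda>i\<in>J. h i x) \<in> Hom A (dir_sum J Y)"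
proof (rule HomI)
  assume h: "\<And>i. i \<in> J \<Longrightarrow> h i \<in> Hom A (Y i)"
  show "(\<lambda>i\<in>J. h i x) \<in> carrier (dir_sum J Y)" if "x \<in> carrier A" for x
    using Hom_closed[OF h that] by auto
  show "(\<lambda>i\<in>J. h i (x \<oplus>\<^bsub>A\<^esub> y)) = (\<lambda>i\<in>J. h i x) \<oplus>\<^bsub>dir_sum J Y\<^esub> (\<lambda>i\<in>J. h i y)"
    if "x \<in> carrier A" "y \<in> carrier A" for x y
    using Hom_add[OF h that] by (intro ext) auto
  show "(\<lambda>i\<in>J. h i (a \<odot>\<^bsub>A\<^esub> x)) = a \<odot>\<^bsub>dir_sum J Y\<^esub> (\<lambda>i\<in>J. h i x)"
    if "a \<in> carrier R" "x \<in> carrier A" for a x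
    using Hom_smult[OF h that] by (intro ext) auto
qed

lemma Hom_dir_sum_proj: "i \<in> J \<Longrightarrow> (\<lambda>f. f i) \<in> Hom (dir_sum J Y) (Y i)"
  by (rule HomI) auto

lemma dir_sum_retr:
  assumes iso: "mod_iso R M (dir_sum J Y)" and M: "module R M" and Y: "\<And>i. i \<in> J \<Longrightarrow> module R (Y i)"
    and k: "k \<in> J"
  shows "retr (Y k) M"
proof -
  obtain f g where fg: "f \<in> Hom M (dir_sum J Y)" "g \<in> Hom (dir_sum J Y) M"
    "\<And>y. y \<in> carrier (dir_sum J Y) \<Longrightarrow> f (g y) = y"
    using mod_iso_maps[OF iso M] by metis
  let ?h = "\<lambda>i x. if i = k then x else \<zero>\<^bsub>Y i\<^esub>"
  have h: "(\<lambda>x. \<lambda>i\<in>J. ?h i x) \<in> Hom (Y k) (dir_sum J Y)"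
  proof (rule Hom_dir_sum)
    show "(\<lambda>x. ?h i x) \<in> Hom (Y k) (Y i)" if "i \<in> J" for i
      using Hom_zero_map[OF Y[OF that]] Hom_id by (cases "i = k") simp_all
  qed
  show ?thesis
  proof (rule retrI[OF Hom_comp[OF h fg(2)] Hom_comp[OF fg(1) Hom_dir_sum_proj[OF k]]])
    show "f (g (\<lambda>i\<in>J. ?h i x)) k = x" if "x \<in> carrier (Y k)" for x
      using fg(3)[OF Hom_closed[OF h that]] k by simp
  qed
qed

lemma ex_dir_sum:
  assumes "\<And>i. i < (n::nat) \<Longrightarrow> Y i \<in> fgmod R"
  shows "\<exists>L\<in>fgmod R. mod_iso R L (dir_sum {..<n} Y)"
  using assms
proof (induction n)
  case 0
  obtain F s y where F: "F \<in> fgmod R" "basis F 0 s y" using ex_free_rank by blast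
  have 0: "x = \<zero>\<^bsub>F\<^esub>" if "x \<in> carrier F" for x using F(2) that by (auto simp: basis_def)
  have "mod_iso R F (dir_sum {..<0} Y)"
    by (rule mod_isoI[of "\<lambda>_. \<lambda>_. undefined" _ _ "\<lambda>_. \<zero>\<^bsub>F\<^esub>"])
      (use 0 module_fgmod[OF F(1)] in \<open>auto simp: mlin intro!: HomI ext\<close>)
  then show ?case using F by blast
next
  case (Suc n)
  then obtain L where L: "L \<in> fgmod R" "mod_iso R L (dir_sum {..<n} Y)" by auto
  note mL = module_fgmod[OF L(1)] and Yn = Suc.prems[of n]
  obtain f g where fg: "f \<in> Hom L (dir_sum {..<n} Y)" "g \<in> Hom (dir_sum {..<n} Y) L"
    "\<And>x. x \<in> carrier L \<Longrightarrow> g (f x) = x" "\<And>y. y \<in> carrier (dir_sum {..<n} Y) \<Longrightarrow> f (g y) = y"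
    using mod_iso_maps[OF L(2) mL] by metis
  let ?h = "\<lambda>i u. if i < n then f (pfst u) i else psnd u"
  have h: "(\<lambda>u. \<lambda>i\<in>{..<Suc n}. ?h i u) \<in> Hom (bsum L (Y n)) (dir_sum {..<Suc n} Y)"
  proof (rule Hom_dir_sum)
    fix i assume "i \<in> {..<Suc n}"
    then consider "i < n" | "i = n" by fastforce
    then show "(\<lambda>u. ?h i u) \<in> Hom (bsum L (Y n)) (Y i)"
    proof cases
      case 1
      then show ?thesis
        using Hom_comp[OF Hom_comp[OF Hom_pfst fg(1)] Hom_dir_sum_proj[of i "{..<n}" Y]] by simp
    qed (simp add: Hom_psnd)
  qed
  have r: "(\<lambda>v. \<lambda>i\<in>{..<n}. v i) \<in> Hom (dir_sum {..<Suc n} Y) (dir_sum {..<n} Y)"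
    by (intro Hom_dir_sum Hom_dir_sum_proj) auto
  have k: "(\<lambda>v. pair (g (\<lambda>i\<in>{..<n}. v i)) (v n)) \<in> Hom (dir_sum {..<Suc n} Y) (bsum L (Y n))"
    by (intro Hom_pair Hom_comp[OF r fg(2)] Hom_dir_sum_proj) auto
  have "mod_iso R (bsum L (Y n)) (dir_sum {..<Suc n} Y)"
  proof (rule mod_isoI[OF h k])
    fix u assume u: "u \<in> carrier (bsum L (Y n))"
    have "(\<lambda>i\<in>{..<n}. (\<lambda>i\<in>{..<Suc n}. ?h i u) i) = f (pfst u)"
      using Hom_closed[OF fg(1) bsum_proj(1)[OF u]] by (intro ext) (auto simp: PiE_iff extensional_def)
    then show "pair (g (\<lambda>i\<in>{..<n}. (\<lambda>i\<in>{..<Suc n}. ?h i u) i)) ((\<lambda>i\<in>{..<Suc n}. ?h i u) n) = u"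
      using fg(3)[OF bsum_proj(1)[OF u]] bsum_proj(3)[OF u] by simp
  next
    fix v assume v: "v \<in> carrier (dir_sum {..<Suc n} Y)"
    have "f (g (\<lambda>i\<in>{..<n}. v i)) = (\<lambda>i\<in>{..<n}. v i)" by (rule fg(4)[OF Hom_closed[OF r v]])
    then show "(\<lambda>i\<in>{..<Suc n}. ?h i (pair (g (\<lambda>i\<in>{..<n}. v i)) (v n))) = v"
      using v by (intro ext) (auto simp: PiE_iff extensional_def less_Suc_eq)
  qed
  then show ?case using bsum_fgmod[OF L(1)] Yn by auto
qed

lemma annihilates_dir_sum:
  assumes iso: "mod_iso R L (dir_sum J Y)" and L: "module R L" and Y: "\<And>i. i \<in> J \<Longrightarrow> module R (Y i)"
    and I: "I \<subseteq> carrier R" and a: "\<And>i. i \<in> J \<Longrightarrow> annihilates I (Y i)"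
  shows "annihilates I L"
proof -
  obtain f g where fg: "f \<in> Hom L (dir_sum J Y)" "g \<in> Hom (dir_sum J Y) L" "\<And>x. x \<in> carrier L \<Longrightarrow> g (f x) = x"
    using mod_iso_maps[OF iso L] by metis
  have "c \<odot>\<^bsub>L\<^esub> m = \<zero>\<^bsub>L\<^esub>" if c: "c \<in> I" and m: "m \<in> carrier L" for c m
  proof -
    have cR: "c \<in> carrier R" using c I by auto
    have 0: "f x = (\<lambda>i\<in>J. \<zero>\<^bsub>Y i\<^esub>)" if "x \<in> carrier L" "\<And>i. i \<in> J \<Longrightarrow> f x i = \<zero>\<^bsub>Y i\<^esub>" for x
      using Hom_closed[OF fg(1) that(1)] that(2) by (intro ext) (auto simp: PiE_iff extensional_def)
    have fm: "f m i \<in> carrier (Y i)" if "i \<in> J" for i using Hom_closed[OF fg(1) m] that by auto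
    have z: "f \<zero>\<^bsub>L\<^esub> i = \<zero>\<^bsub>Y i\<^esub>" if "i \<in> J" for i
      using Hom_zero[OF Hom_comp[OF fg(1) Hom_dir_sum_proj[OF that]] L Y[OF that]] .
    have "f (c \<odot>\<^bsub>L\<^esub> m) = (\<lambda>i\<in>J. \<zero>\<^bsub>Y i\<^esub>)"
      using a[unfolded annihilates_def] c fm Hom_smult[OF fg(1) cR m] msmult[OF L cR m] by (intro 0) auto
    moreover have "f \<zero>\<^bsub>L\<^esub> = (\<lambda>i\<in>J. \<zero>\<^bsub>Y i\<^esub>)" using z mzero[OF L] by (intro 0) auto
    ultimately show ?thesis using fg(3)[OF msmult[OF L cR m]] fg(3)[OF mzero[OF L]] by metis
  qed
  then show ?thesis by (simp add: annihilates_def)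
qed

text \<open>A lift to a free cover is assembled from lifts on the summands, by induction on the number of summands
  that have been treated.\<close>

lemma free_factor_dir_sum:
  assumes iso: "mod_iso R M (dir_sum {..<n::nat} Y)" and M: "M \<in> fgmod R"
    and Y: "\<And>i. i < n \<Longrightarrow> Y i \<in> fgmod R" and u: "\<And>i. i < n \<Longrightarrow> free_factor (Y i) u" and uR: "u \<in> carrier R"
  shows "free_factor M u"
proof -
  note mM = module_fgmod[OF M] and mY = Y[THEN module_fgmod]
  obtain f g where fg: "f \<in> Hom M (dir_sum {..<n} Y)" "g \<in> Hom (dir_sum {..<n} Y) M"
    "\<And>x. x \<in> carrier M \<Longrightarrow> g (f x) = x" "\<And>y. y \<in> carrier (dir_sum {..<n} Y) \<Longrightarrow> f (g y) = y"
    using mod_iso_maps[OF iso mM] by metis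
  obtain P q where P: "ffree P" "epi P M q" using free_cover[OF M] by blast
  note mP = ffreeD(2)[OF P(1)] and q = epi_Hom[OF P(2)]
  have fm: "(\<lambda>m. f m i) \<in> Hom M (Y i)" if "i < n" for i
    using Hom_comp[OF fg(1) Hom_dir_sum_proj[of i "{..<n}" Y]] that by simp
  have fmc: "f m i \<in> carrier (Y i)" if "i < n" "m \<in> carrier M" for i m using Hom_closed[OF fm] that by blast
  define tr where "tr k m = (\<lambda>i\<in>{..<n}. if i < k then u \<odot>\<^bsub>Y i\<^esub> f m i else \<zero>\<^bsub>Y i\<^esub>)" for k m
  have "\<exists>t\<in>Hom M P. \<forall>m\<in>carrier M. f (q (t m)) = tr k m" if "k \<le> n" for k
    using that
  proof (induction k)
    case 0
    have "f (q \<zero>\<^bsub>P\<^esub>) i = \<zero>\<^bsub>Y i\<^esub>" if "i < n" for i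
      using Hom_zero[OF Hom_comp[OF q fm[OF that]] mP mY[OF that]] .
    moreover have "f (q \<zero>\<^bsub>P\<^esub>) \<in> extensional {..<n}"
      using Hom_closed[OF Hom_comp[OF q fg(1)] mzero[OF mP]] by (auto simp: PiE_iff)
    ultimately have "f (q \<zero>\<^bsub>P\<^esub>) = tr 0 m" for m
      by (intro ext) (auto simp: tr_def extensional_def)
    then show ?case using Hom_zero_map[OF mP] by (intro bexI[of _ "\<lambda>_. \<zero>\<^bsub>P\<^esub>"]) auto
  next
    case (Suc k)
    then obtain t where t: "t \<in> Hom M P" "\<forall>m\<in>carrier M. f (q (t m)) = tr k m" by auto
    have k: "k < n" using Suc by auto
    let ?h = "\<lambda>i x. if i = k then x else \<zero>\<^bsub>Y i\<^esub>"
    have h: "(\<lambda>x. \<lambda>i\<in>{..<n}. ?h i x) \<in> Hom (Y k) (dir_sum {..<n} Y)"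
    proof (rule Hom_dir_sum)
      show "(\<lambda>x. ?h i x) \<in> Hom (Y k) (Y i)" if "i \<in> {..<n}" for i
        using Hom_zero_map[OF mY[of i]] Hom_id that by (cases "i = k") simp_all
    qed
    obtain s where s: "s \<in> Hom (Y k) P" "\<forall>x\<in>carrier (Y k). q (s x) = u \<odot>\<^bsub>M\<^esub> g (\<lambda>i\<in>{..<n}. ?h i x)"
      using free_factor_lift[OF u[OF k] P(2) Hom_comp[OF h fg(2)] mY[OF k] mP mM] by blast
    have "f (q (t m \<oplus>\<^bsub>P\<^esub> s (f m k))) = tr (Suc k) m" if m: "m \<in> carrier M" for m
    proof -
      note tm = Hom_closed[OF t(1) m] and sm = Hom_closed[OF Hom_comp[OF fm[OF k] s(1)] m]
      note hc = Hom_closed[OF h fmc[OF k m]]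
      have "f (q (t m \<oplus>\<^bsub>P\<^esub> s (f m k))) = f (q (t m)) \<oplus>\<^bsub>dir_sum {..<n} Y\<^esub> f (q (s (f m k)))"
        using Hom_add[OF q tm sm] Hom_add[OF fg(1) Hom_closed[OF q tm] Hom_closed[OF q sm]] by simp
      also have "f (q (t m)) = tr k m" using t(2) m by blast
      also have "f (q (s (f m k))) = u \<odot>\<^bsub>dir_sum {..<n} Y\<^esub> (\<lambda>i\<in>{..<n}. ?h i (f m k))"
        using bspec[OF s(2) fmc[OF k m]] Hom_smult[OF fg(1) uR Hom_closed[OF fg(2) hc]] fg(4)[OF hc] by simp
      also have "tr k m \<oplus>\<^bsub>dir_sum {..<n} Y\<^esub> (u \<odot>\<^bsub>dir_sum {..<n} Y\<^esub> (\<lambda>i\<in>{..<n}. ?h i (f m k))) = tr (Suc k) m"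
      proof (rule ext)
        fix i
        show "(tr k m \<oplus>\<^bsub>dir_sum {..<n} Y\<^esub> (u \<odot>\<^bsub>dir_sum {..<n} Y\<^esub> (\<lambda>i\<in>{..<n}. ?h i (f m k)))) i = tr (Suc k) m i"
        proof (cases "i < n")
          case True
          then show ?thesis
            using msmult[OF mY[OF True] uR fmc[OF True m]] mY[OF True] uR by (auto simp: tr_def less_Suc_eq mlin)
        qed (simp add: tr_def)
      qed
      finally show ?thesis .
    qed
    then show ?case using Hom_plus[OF t(1) Hom_comp[OF fm[OF k] s(1)] mP] by (intro bexI) auto
  qed
  then obtain t where t: "t \<in> Hom M P" "\<And>m. m \<in> carrier M \<Longrightarrow> f (q (t m)) = tr n m" by blast
  have "q (t m) = u \<odot>\<^bsub>M\<^esub> m" if m: "m \<in> carrier M" for m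
  proof -
    have "f (q (t m)) = u \<odot>\<^bsub>dir_sum {..<n} Y\<^esub> f m" using t(2)[OF m] by (auto simp: tr_def)
    then have "f (q (t m)) = f (u \<odot>\<^bsub>M\<^esub> m)" using Hom_smult[OF fg(1) uR m] by simp
    then show ?thesis using fg(3)[OF Hom_closed[OF Hom_comp[OF t(1) q] m]] fg(3)[OF msmult[OF mM uR m]] by metis
  qed
  then show ?thesis unfolding free_factor_cover[OF P mM] using uR t(1) by blast
qed

text \<open>An \<^term>\<open>R\<close>-module annihilated by \<^term>\<open>I\<close> is the same as a module over \<open>R/I\<close>; cosets act through chosen
  representatives.\<close>

lemma fgmod_quot_iff:
  assumes I: "ideal I R"
  shows "M \<in> fgmod_quot R I \<longleftrightarrow> M \<in> fgmod R \<and> annihilates I M"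
proof
  interpret I: ideal I R by fact
  have IR: "I \<subseteq> carrier R" by (rule I.a_subset)
  have rep: "(\<Union>a\<in>I. {a \<oplus> b}) = I +> b" for b by (simp add: a_r_coset_def')
  assume "M \<in> fgmod_quot R I"
  then obtain L :: "('a set, 'a list) module" where M: "M \<in> fgmod R" and L: "module (R Quot I) L"
    and iso: "mod_iso R M (restrict_scalars R I L)" by (auto simp: fgmod_quot_def)
  obtain f where f: "f \<in> Hom M (restrict_scalars R I L)" "inj_on f (carrier M)"
    using iso by (auto simp: mod_iso_def bij_betw_def)
  note mM = module_fgmod[OF M]
  have fL: "f m \<in> carrier L" if "m \<in> carrier M" for m
    using Hom_closed[OF f(1) that] by (simp add: restrict_scalars_def)
  have sm: "f (a \<odot>\<^bsub>M\<^esub> m) = (I +> a) \<odot>\<^bsub>L\<^esub> f m" if "a \<in> carrier R" "m \<in> carrier M" for a m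
    using Hom_smult[OF f(1) that] by (simp add: restrict_scalars_def)
  have z: "I +> a = I" if "a \<in> I" for a using that by (rule I.a_rcos_const)
  have "a \<odot>\<^bsub>M\<^esub> m = \<zero>\<^bsub>M\<^esub>" if "a \<in> I" "m \<in> carrier M" for a m
  proof -
    have "f (a \<odot>\<^bsub>M\<^esub> m) = (I +> \<zero>) \<odot>\<^bsub>L\<^esub> f m" using sm[of a m] that IR z[of a] z[of \<zero>] I.zero_closed by auto
    also have "\<dots> = f \<zero>\<^bsub>M\<^esub>" using sm[of \<zero> m] that mM by (simp add: mlin)
    finally show ?thesis using inj_onD[OF f(2)] that IR mM by (auto simp: mclosed)
  qed
  then show "M \<in> fgmod R \<and> annihilates I M" using M by (simp add: annihilates_def)
next
  interpret I: ideal I R by fact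
  have IR: "I \<subseteq> carrier R" by (rule I.a_subset)
  assume "M \<in> fgmod R \<and> annihilates I M"
  then have M: "M \<in> fgmod R" and ann: "\<And>a m. \<lbrakk>a \<in> I; m \<in> carrier M\<rbrakk> \<Longrightarrow> a \<odot>\<^bsub>M\<^esub> m = \<zero>\<^bsub>M\<^esub>" by (auto simp: annihilates_def)
  note mM = module_fgmod[OF M]
  define rep where "rep X = (SOME a. a \<in> carrier R \<and> I +> a = X)" for X
  define L :: "('a set, 'a list) module" where "L = \<lparr>carrier = carrier M, monoid.mult = monoid.mult M,
    one = one M, ring.zero = ring.zero M, add = add M, smult = (\<lambda>X m. rep X \<odot>\<^bsub>M\<^esub> m)\<rparr>"
  have Ls: "carrier L = carrier M" "\<zero>\<^bsub>L\<^esub> = \<zero>\<^bsub>M\<^esub>" "u \<oplus>\<^bsub>L\<^esub> v = u \<oplus>\<^bsub>M\<^esub> v" "X \<odot>\<^bsub>L\<^esub> u = rep X \<odot>\<^bsub>M\<^esub> u" for u v X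
    by (simp_all add: L_def)
  have sm: "(I +> a) \<odot>\<^bsub>L\<^esub> m = a \<odot>\<^bsub>M\<^esub> m" if "a \<in> carrier R" "m \<in> carrier M" for a m
  proof -
    have r: "rep (I +> a) \<in> carrier R \<and> I +> rep (I +> a) = I +> a"
      unfolding rep_def by (rule someI[of _ a]) (use that in simp)
    have "rep (I +> a) \<in> I +> a" using r I.a_rcos_self by metis
    then obtain b where b: "b \<in> I" "rep (I +> a) = b \<oplus> a" by (auto simp: a_r_coset_def')
    then show ?thesis using that mM ann[OF b(1) that(2)] IR by (auto simp: Ls madd_smult mlin)
  qed
  have "abelian_group L"
  proof (rule abelian_groupI)
    fix x assume "x \<in> carrier L"
    then show "\<exists>y\<in>carrier L. y \<oplus>\<^bsub>L\<^esub> x = \<zero>\<^bsub>L\<^esub>"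
      using mM by (intro bexI[of _ "\<ominus>\<^bsub>M\<^esub> x"]) (simp_all add: Ls mlin)
  qed (use mM in \<open>simp_all add: Ls mlin\<close>)
  moreover have Q: "cring (R Quot I)" using I.quotient_is_cring is_cring by blast
  moreover have qc: "\<exists>a\<in>carrier R. X = I +> a" if "X \<in> carrier (R Quot I)" for X
    using that by (auto simp: FactRing_def A_RCOSETS_def')
  have "module (R Quot I) L"
  proof (rule moduleI[OF Q \<open>abelian_group L\<close>])
    fix X m assume X: "X \<in> carrier (R Quot I)" and m: "m \<in> carrier L"
    then obtain a where a: "a \<in> carrier R" "X = I +> a" using qc by blast
    show "X \<odot>\<^bsub>L\<^esub> m \<in> carrier L" using a m mM by (simp add: sm Ls(1) mclosed)
    show "X \<odot>\<^bsub>L\<^esub> (m \<oplus>\<^bsub>L\<^esub> m') = X \<odot>\<^bsub>L\<^esub> m \<oplus>\<^bsub>L\<^esub> X \<odot>\<^bsub>L\<^esub> m'" if "m' \<in> carrier L" for m'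
      using a m that mM by (simp add: sm Ls(1,3) mclosed msmult_add)
    fix Y assume Y: "Y \<in> carrier (R Quot I)"
    then obtain b where b: "b \<in> carrier R" "Y = I +> b" using qc by blast
    show "(X \<oplus>\<^bsub>R Quot I\<^esub> Y) \<odot>\<^bsub>L\<^esub> m = X \<odot>\<^bsub>L\<^esub> m \<oplus>\<^bsub>L\<^esub> Y \<odot>\<^bsub>L\<^esub> m"
      using a b m mM by (simp add: FactRing_def I.a_rcos_sum sm Ls(1,3) madd_smult)
    show "(X \<otimes>\<^bsub>R Quot I\<^esub> Y) \<odot>\<^bsub>L\<^esub> m = X \<odot>\<^bsub>L\<^esub> (Y \<odot>\<^bsub>L\<^esub> m)"
      using a b m mM by (simp add: FactRing_def I.rcoset_mult_add sm Ls(1) msmult_smult mclosed)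
  next
    fix m assume "m \<in> carrier L"
    then show "\<one>\<^bsub>R Quot I\<^esub> \<odot>\<^bsub>L\<^esub> m = m" using mM by (simp add: FactRing_def sm Ls(1) mone_smult)
  qed
  moreover have "fin_gen (R Quot I) L"
  proof -
    obtain A where A: "finite A" "A \<subseteq> carrier M"
      "\<forall>m\<in>carrier M. \<exists>c\<in>A \<rightarrow> carrier R. m = (\<Oplus>\<^bsub>M\<^esub>b\<in>A. c b \<odot>\<^bsub>M\<^esub> b)"
      using M by (auto simp: fgmod_def fin_gen_def)
    interpret L: abelian_group L by fact
    interpret M: module R M by fact
    have fs: "finsum L h B = finsum M h B" if "finite B" "h \<in> B \<rightarrow> carrier M" for h and B :: "'a list set"
      using that by (induction B) (auto simp: Ls Pi_iff)
    show ?thesis unfolding fin_gen_def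
    proof (intro exI[of _ A] conjI ballI)
      fix m assume "m \<in> carrier L"
      then obtain c where c: "c \<in> A \<rightarrow> carrier R" "m = (\<Oplus>\<^bsub>M\<^esub>b\<in>A. c b \<odot>\<^bsub>M\<^esub> b)" using A(3) by (auto simp: Ls(1))
      have "m = (\<Oplus>\<^bsub>M\<^esub>b\<in>A. (I +> c b) \<odot>\<^bsub>L\<^esub> b)"
        unfolding c(2) using c A by (intro M.M.finsum_cong') (auto simp: sm Pi_iff subset_eq)
      also have "\<dots> = (\<Oplus>\<^bsub>L\<^esub>b\<in>A. (I +> c b) \<odot>\<^bsub>L\<^esub> b)"
        using c A by (intro fs[symmetric]) (auto simp: sm Pi_iff subset_eq)
      finally show "\<exists>c\<in>A \<rightarrow> carrier (R Quot I). m = (\<Oplus>\<^bsub>L\<^esub>b\<in>A. c b \<odot>\<^bsub>L\<^esub> b)"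
        using c by (intro bexI[of _ "\<lambda>b. I +> c b"]) (auto simp: FactRing_def A_RCOSETS_def')
    qed (use A in \<open>auto simp: Ls\<close>)
  qed
  moreover have "mod_iso R M (restrict_scalars R I L)"
    unfolding mod_iso_def
    by (rule bexI[of _ "\<lambda>x. x"])
      (auto simp: restrict_scalars_def Ls(1,3) sm bij_betw_def mod_hom_def)
  ultimately show "M \<in> fgmod_quot R I" using M by (auto simp: fgmod_quot_def)
qed

lemma submodule_ring_mod: "ideal I R \<Longrightarrow> submodule I R (ring_mod R)"
proof -
  assume "ideal I R"
  then interpret I: ideal I R .
  show ?thesis by (rule submodI[OF module_ring_mod]) (auto simp: I.I_l_closed I.a_subset[THEN subsetD])
qed

lemma cyclic_quots_iff:
  assumes "\<And>p. p \<in> W \<Longrightarrow> ideal p R"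
  shows "M \<in> cyclic_quots R W \<longleftrightarrow> M \<in> fgmod R \<and>
    (\<exists>p\<in>W. \<exists>q. epi (ring_mod R) M q \<and> (\<forall>a\<in>carrier R. q a = \<zero>\<^bsub>M\<^esub> \<longleftrightarrow> a \<in> p))"
  unfolding cyclic_quots_def
  using iso_quot_iff[OF module_ring_mod module_fgmod submodule_ring_mod[OF assms]] by auto

section \<open>Syzygies in several steps\<close>

lemma syz_0: "X \<in> fgmod R \<Longrightarrow> M \<in> syz R 0 {X} \<longleftrightarrow> M \<in> fgmod R \<and> mod_iso R M X"
proof
  assume "M \<in> syz R 0 {X}"
  then have M: "M \<in> fgmod R" and "is_syzygy R 0 X M" by (auto simp: syz_def)
  then obtain C d where "C 0 = X" "C (Suc 0) = M" "\<forall>j\<le>0. d j \<in> Hom (C (Suc j)) (C j)"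
    "d 0 ` carrier (C 1) = carrier (C 0)" "inj_on (d 0) (carrier (C (Suc 0)))"
    unfolding is_syzygy_def by (elim exE conjE) (rule that; assumption)
  with M show "M \<in> fgmod R \<and> mod_iso R M X" by (auto simp: mod_iso_def bij_betw_def)
next
  assume "M \<in> fgmod R \<and> mod_iso R M X"
  then obtain f where "M \<in> fgmod R" "f \<in> Hom M X" "bij_betw f (carrier M) (carrier X)" by (auto simp: mod_iso_def)
  then have "is_syzygy R 0 X M" unfolding is_syzygy_def
    by (intro exI[of _ "\<lambda>j. if j = 0 then X else M"] exI[of _ "\<lambda>_. f"]) (auto simp: bij_betw_def)
  then show "M \<in> syz R 0 {X}" using \<open>M \<in> fgmod R\<close> by (auto simp: syz_def)
qed

lemma syz_fgmod: "M \<in> syz R i \<X> \<Longrightarrow> M \<in> fgmod R"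
  by (simp add: syz_def)

text \<open>Splicing exact sequences. Together with the converse \<open>syz_SucD\<close>, which cuts a sequence at the image of a
  differential, this says that \<open>\<Omega>\<^sup>i\<^sup>+\<^sup>1 X = \<Omega> (\<Omega>\<^sup>i X)\<close> and reduces statements on \<open>i\<close>-th syzygies to first syzygies.\<close>

lemma syz_SucI:
  assumes X: "X \<in> fgmod R" and X1: "X1 \<in> syz R i {X}" and S: "syz1 S X1"
  shows "S \<in> syz R (Suc i) {X}"
proof -
  obtain P \<pi> \<iota> where P: "ffree P" and e: "exact3 S P X1 \<iota> \<pi>" using S by (auto simp: syz1_def)
  note e' = exact3D[OF e]
  obtain C d where C: "C 0 = X" "C (Suc i) = X1"
    and fr: "\<forall>j\<in>{1..i}. C j \<in> fgmod R \<and> free_module R (C j)"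
    and h: "\<forall>j\<le>i. d j \<in> Hom (C (Suc j)) (C j)" and s: "d 0 ` carrier (C 1) = carrier (C 0)"
    and ex: "\<forall>j<i. d (Suc j) ` carrier (C (Suc (Suc j))) = a_kernel (C (Suc j)) (C j) (d j)"
    and inj: "inj_on (d i) (carrier (C (Suc i)))"
    using X1 by (auto simp: syz_def is_syzygy_def)
  define C' where "C' j = (if j \<le> i then C j else if j = Suc i then P else S)" for j
  define d' where "d' j = (if j < i then d j else if j = i then (\<lambda>p. d i (\<pi> p)) else \<iota>)" for j
  have img: "(\<lambda>p. d i (\<pi> p)) ` carrier P = d i ` carrier X1"
    using e'(3) by (auto simp: epi_def image_image[symmetric])
  have fr': "\<forall>j\<in>{1..Suc i}. C' j \<in> fgmod R \<and> free_module R (C' j)"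
    using fr P by (auto simp: C'_def ffree_def)
  have h': "\<forall>j\<le>Suc i. d' j \<in> Hom (C' (Suc j)) (C' j)"
  proof (intro allI impI)
    fix j assume "j \<le> Suc i"
    then consider "j < i" | "j = i" | "j = Suc i" by linarith
    then show "d' j \<in> Hom (C' (Suc j)) (C' j)"
      using h C e'(1) Hom_comp[OF e'(4), of "d i" "C i"] by cases (auto simp: C'_def d'_def)
  qed
  have s': "d' 0 ` carrier (C' 1) = carrier (C' 0)"
    using s img C by (cases i) (auto simp: C'_def d'_def)
  have ex': "\<forall>j<Suc i. d' (Suc j) ` carrier (C' (Suc (Suc j))) = a_kernel (C' (Suc j)) (C' j) (d' j)"
  proof (intro allI impI)
    fix j assume "j < Suc i"
    then consider "Suc j < i" | "Suc j = i" | "j = i" by linarith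
    then show "d' (Suc j) ` carrier (C' (Suc (Suc j))) = a_kernel (C' (Suc j)) (C' j) (d' j)"
    proof cases
      case 1 then show ?thesis using ex by (simp add: C'_def d'_def)
    next
      case 2
      then have "a_kernel (C' (Suc j)) (C' j) (d' j) = a_kernel (C (Suc j)) (C j) (d j)" by (simp add: C'_def d'_def)
      moreover have "d' (Suc j) ` carrier (C' (Suc (Suc j))) = d (Suc j) ` carrier (C (Suc (Suc j)))"
        using 2 img C(2) by (auto simp: C'_def d'_def)
      moreover have "j < i" using 2 by simp
      ultimately show ?thesis using ex by simp
    next
      case 3
      have X1m: "module R X1" using syz1D(2)[OF S] module_fgmod by blast
      have Cim: "d i \<zero>\<^bsub>X1\<^esub> = \<zero>\<^bsub>C i\<^esub>"
      proof -
        have di: "d i \<in> Hom X1 (C i)" using h C by auto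
        have "module R (C i)"
          using fr C(1) X module_fgmod by (cases i) auto
        then show ?thesis using Hom_zero[OF di X1m] by blast
      qed
      have "d i (\<pi> p) = \<zero>\<^bsub>C i\<^esub> \<longleftrightarrow> \<pi> p = \<zero>\<^bsub>X1\<^esub>" if "p \<in> carrier P" for p
        using inj C(2) Cim inj_onD[OF inj, of "\<pi> p" "\<zero>\<^bsub>X1\<^esub>"] Hom_closed[OF e'(4) that] mzero[OF X1m] by auto
      then show ?thesis using 3 e'(5,6) Hom_closed[OF e'(1)] by (auto simp: C'_def d'_def a_kernel_eq)
    qed
  qed
  have "inj_on (d' (Suc i)) (carrier (C' (Suc (Suc i))))" using e'(2) by (simp add: C'_def d'_def)
  then have "is_syzygy R (Suc i) X S" unfolding is_syzygy_def
    using fr' h' s' ex' C(1) by (intro exI[of _ C'] exI[of _ d'] conjI) (auto simp: C'_def)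
  then show ?thesis using syz1D(1)[OF S] by (auto simp: syz_def)
qed

end

context noetherian_cring
begin

lemma syz_SucD:
  assumes S: "S \<in> syz R (Suc i) {X}" and X: "X \<in> fgmod R"
  shows "\<exists>X1\<in>syz R i {X}. syz1 S X1"
proof -
  have Sf: "S \<in> fgmod R" and "is_syzygy R (Suc i) X S" using S by (auto simp: syz_def)
  then obtain C d where C: "C 0 = X" "C (Suc (Suc i)) = S"
    and fr: "\<forall>j\<in>{1..Suc i}. C j \<in> fgmod R \<and> free_module R (C j)"
    and h: "\<forall>j\<le>Suc i. d j \<in> Hom (C (Suc j)) (C j)" and s: "d 0 ` carrier (C 1) = carrier (C 0)"
    and ex: "\<forall>j<Suc i. d (Suc j) ` carrier (C (Suc (Suc j))) = a_kernel (C (Suc j)) (C j) (d j)"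
    and inj: "inj_on (d (Suc i)) (carrier (C (Suc (Suc i))))"
    unfolding is_syzygy_def by (elim exE conjE) (rule that; assumption)
  have Cf: "C j \<in> fgmod R" if "j \<le> Suc i" for j using fr C(1) X that by (cases j) auto
  note mC = Cf[THEN module_fgmod]
  have di: "d i \<in> Hom (C (Suc i)) (C i)" using h by auto
  define Z where "Z = d i ` carrier (C (Suc i))"
  have Z: "submodule Z R (C i)" unfolding Z_def by (intro submod_image[OF di] mC submod_carrier) auto
  define X1 where "X1 = sub (C i) Z"
  have X1: "X1 \<in> fgmod R" unfolding X1_def by (intro fgmod_sub Cf Z) auto
  have X1c: "carrier X1 = Z" "\<zero>\<^bsub>X1\<^esub> = \<zero>\<^bsub>C i\<^esub>" by (simp_all add: X1_def)
  have ZC: "Z \<subseteq> carrier (C i)" using submod_sub[OF Z mC] by auto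
  have q: "epi (C (Suc i)) X1 (d i)"
    using di unfolding epi_def by (auto simp: mod_hom_def X1_def Z_def)
  have e: "exact3 S (C (Suc i)) X1 (d (Suc i)) (d i)"
    using q h inj ex[rule_format, of i] C(2) by (auto simp: exact3_def a_kernel_eq X1c)
  moreover have "ffree (C (Suc i))" using fr by (simp add: ffree_def)
  ultimately have "syz1 S X1" using Sf X1 unfolding syz1_def by blast
  moreover have "is_syzygy R i X X1"
  proof -
    define C' where "C' j = (if j \<le> i then C j else X1)" for j
    define d' where "d' j = (if j < i then d j else (\<lambda>x. x))" for j
    have fr': "\<forall>j\<in>{1..i}. C' j \<in> fgmod R \<and> free_module R (C' j)" using fr by (auto simp: C'_def)
    have h': "\<forall>j\<le>i. d' j \<in> Hom (C' (Suc j)) (C' j)"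
      using h Hom_incl[OF ZC] by (auto simp: C'_def d'_def X1_def)
    have s': "d' 0 ` carrier (C' 1) = carrier (C' 0)"
      using s by (cases i) (auto simp: C'_def d'_def X1_def Z_def)
    have ex': "\<forall>j<i. d' (Suc j) ` carrier (C' (Suc (Suc j))) = a_kernel (C' (Suc j)) (C' j) (d' j)"
    proof (intro allI impI)
      fix j assume j: "j < i"
      have e: "d (Suc j) ` carrier (C (Suc (Suc j))) = a_kernel (C (Suc j)) (C j) (d j)" using ex j by simp
      show "d' (Suc j) ` carrier (C' (Suc (Suc j))) = a_kernel (C' (Suc j)) (C' j) (d' j)"
      proof (cases "Suc j = i")
        case True
        then show ?thesis using e by (auto simp: C'_def d'_def X1_def Z_def)
      next
        case False
        then have "Suc j < i" using j by simp
        then show ?thesis using e j by (simp add: C'_def d'_def)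
      qed
    qed
    show ?thesis unfolding is_syzygy_def using fr' h' s' ex'
      by (intro exI[of _ C'] exI[of _ d'] conjI) (auto simp: C'_def d'_def C(1))
  qed
  ultimately show ?thesis using X1 unfolding syz_def by blast
qed

text \<open>The kernel of the retraction is the complement; it is finitely generated because the ring is
  noetherian.\<close>

lemma summand_iff: "summand R M N \<longleftrightarrow> M \<in> fgmod R \<and> N \<in> fgmod R \<and> retr M N"
proof
  have two: "{..<2::nat} = {0, 1}" by auto
  assume "summand R M N"
  then obtain C where M: "M \<in> fgmod R" and N: "N \<in> fgmod R" and C: "C \<in> fgmod R"
    and iso: "mod_iso R N (dir_sum {..<2} ((!) [M, C]))" by (auto simp: summand_def)
  have "module R ([M, C] ! i)" if "i \<in> {..<2}" for i
    using that M C module_fgmod by (auto simp: two)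
  from dir_sum_retr[OF iso module_fgmod[OF N] this, of 0] M N
  show "M \<in> fgmod R \<and> N \<in> fgmod R \<and> retr M N" by auto
next
  have two: "{..<2::nat} = {0, 1}" by auto
  assume "M \<in> fgmod R \<and> N \<in> fgmod R \<and> retr M N"
  then obtain i r where M: "M \<in> fgmod R" and N: "N \<in> fgmod R"
    and i: "i \<in> Hom M N" and r: "r \<in> Hom N M" and ri: "\<And>m. m \<in> carrier M \<Longrightarrow> r (i m) = m"
    by (auto simp: retr_def)
  note mM = module_fgmod[OF M] and mN = module_fgmod[OF N]
  define K where "K = {x \<in> carrier N. r x = \<zero>\<^bsub>M\<^esub>}"
  have K: "submodule K R N" unfolding K_def by (rule submod_ker[OF r mN mM])
  define C where "C = sub N K"
  have C: "C \<in> fgmod R" unfolding C_def by (rule fgmod_sub[OF N K])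
  have KN: "K \<subseteq> carrier N" by (auto simp: K_def)
  have p: "(\<lambda>n. n \<oplus>\<^bsub>N\<^esub> \<ominus>\<^bsub>N\<^esub> i (r n)) \<in> Hom N N"
    by (intro Hom_plus Hom_uminus Hom_id Hom_comp[OF r i] mN)
  have pK: "n \<oplus>\<^bsub>N\<^esub> \<ominus>\<^bsub>N\<^esub> i (r n) \<in> K" if n: "n \<in> carrier N" for n
    using n Hom_closed[OF r n] Hom_closed[OF Hom_comp[OF r i] n] ri[OF Hom_closed[OF r n]] mM mN
    by (simp add: K_def Hom_simps[OF r] mlin)
  have p': "(\<lambda>n. n \<oplus>\<^bsub>N\<^esub> \<ominus>\<^bsub>N\<^esub> i (r n)) \<in> Hom N C"
    using p pK by (auto simp: C_def mod_hom_def)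
  have f: "(\<lambda>n. \<lambda>k\<in>{..<2}. if k = (0::nat) then r n else n \<oplus>\<^bsub>N\<^esub> \<ominus>\<^bsub>N\<^esub> i (r n)) \<in> Hom N (dir_sum {..<2} ((!) [M, C]))"
    by (rule Hom_dir_sum) (use p' r in \<open>auto simp: two\<close>)
  have g: "(\<lambda>v. i (v 0) \<oplus>\<^bsub>N\<^esub> v 1) \<in> Hom (dir_sum {..<2} ((!) [M, C])) N"
  proof (intro Hom_plus mN)
    show "(\<lambda>v. i (v 0)) \<in> Hom (dir_sum {..<2} ((!) [M, C])) N"
      using Hom_comp[OF Hom_dir_sum_proj[of 0 "{..<2::nat}" "(!) [M, C]"], of i N] i by simp
    show "(\<lambda>v. v 1) \<in> Hom (dir_sum {..<2} ((!) [M, C])) N"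
      using Hom_comp[OF Hom_dir_sum_proj[of 1 "{..<2::nat}" "(!) [M, C]"], of "\<lambda>x. x" N] Hom_incl[OF KN] by (simp add: C_def)
  qed
  have "mod_iso R N (dir_sum {..<2} ((!) [M, C]))"
  proof (rule mod_isoI[OF f g])
    fix n assume n: "n \<in> carrier N"
    show "i ((\<lambda>k\<in>{..<2}. if k = (0::nat) then r n else n \<oplus>\<^bsub>N\<^esub> \<ominus>\<^bsub>N\<^esub> i (r n)) 0) \<oplus>\<^bsub>N\<^esub>
        (\<lambda>k\<in>{..<2}. if k = (0::nat) then r n else n \<oplus>\<^bsub>N\<^esub> \<ominus>\<^bsub>N\<^esub> i (r n)) 1 = n"
      using n Hom_closed[OF Hom_comp[OF r i] n] mN by (simp add: mlin)
  next
    fix v assume v: "v \<in> carrier (dir_sum {..<2} ((!) [M, C]))"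
    have v0: "v 0 \<in> carrier M" "v 1 \<in> K" and ve: "v \<in> extensional {..<2}"
      using v by (auto simp: PiE_iff two C_def)
    have v1: "v 1 \<in> carrier N" "r (v 1) = \<zero>\<^bsub>M\<^esub>" using v0 by (auto simp: K_def)
    note iv = Hom_closed[OF i v0(1)]
    have rv: "r (i (v 0) \<oplus>\<^bsub>N\<^esub> v 1) = v 0"
      using v0 v1 iv ri[OF v0(1)] mM by (simp add: Hom_add[OF r] mlin)
    show "(\<lambda>k\<in>{..<2}. if k = 0 then r (i (v 0) \<oplus>\<^bsub>N\<^esub> v 1) else (i (v 0) \<oplus>\<^bsub>N\<^esub> v 1) \<oplus>\<^bsub>N\<^esub> \<ominus>\<^bsub>N\<^esub> i (r (i (v 0) \<oplus>\<^bsub>N\<^esub> v 1))) = v"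
    proof (rule extensionalityI[OF _ ve])
      fix k :: nat assume "k \<in> {..<2}"
      then consider "k = 0" | "k = 1" by fastforce
      then show "(\<lambda>k\<in>{..<2}. if k = 0 then r (i (v 0) \<oplus>\<^bsub>N\<^esub> v 1) else (i (v 0) \<oplus>\<^bsub>N\<^esub> v 1) \<oplus>\<^bsub>N\<^esub> \<ominus>\<^bsub>N\<^esub> i (r (i (v 0) \<oplus>\<^bsub>N\<^esub> v 1))) k = v k"
        using rv v1 iv mN by cases (simp_all add: mlin)
    qed simp
  qed
  then show "summand R M N" using M N C by (auto simp: summand_def)
qed

text \<open>Cover \<^term>\<open>E\<close> by the given cover \<^term>\<open>P\<close> of \<^term>\<open>M\<close> together with a cover \<^term>\<open>G\<close> of
  \<^term>\<open>E\<close>. The kernel contains \<^term>\<open>S\<close>, and a lift of \<open>G \<rightarrow> E \<rightarrow> M\<close> to \<^term>\<open>P\<close> retracts it onto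
  \<^term>\<open>S\<close>.\<close>

lemma syz1_retr:
  assumes r: "retr M E" and E: "E \<in> fgmod R" and S: "syz1 S M"
  shows "\<exists>K. syz1 K E \<and> retr S K"
proof -
  note fS = syz1D[OF S] and mE = module_fgmod[OF E]
  note mS = fS[THEN module_fgmod]
  obtain P i q where P: "ffree P" and e: "exact3 S P M i q" using S by (auto simp: syz1_def)
  note e' = exact3D[OF e] and mP = ffreeD(2)[OF P]
  obtain j r where j: "j \<in> Hom M E" and r: "r \<in> Hom E M" and rj: "\<And>m. m \<in> carrier M \<Longrightarrow> r (j m) = m"
    using r by (auto simp: retr_def)
  obtain G g where G: "ffree G" "epi G E g" using free_cover[OF E] by blast
  note mG = ffreeD(2)[OF G(1)] and gH = epi_Hom[OF G(2)]
  note PG = ffree_bsum[OF P G(1)]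
  note mPG = ffreeD(2)[OF PG]
  define c where "c u = j (q (pfst u)) \<oplus>\<^bsub>E\<^esub> g (psnd u)" for u
  have c: "c \<in> Hom (bsum P G) E" unfolding c_def by (intro Hom_copair Hom_comp[OF e'(4) j] gH mE)
  have j0: "j (q \<zero>\<^bsub>P\<^esub>) = \<zero>\<^bsub>E\<^esub>" by (rule Hom_zero[OF Hom_comp[OF e'(4) j] mP mE])
  have "epi (bsum P G) E c"
  proof (rule epiI[OF c])
    fix y assume y: "y \<in> carrier E"
    obtain x where x: "x \<in> carrier G" "g x = y" using epiE[OF G(2) y] .
    then show "\<exists>u\<in>carrier (bsum P G). c u = y"
      using mP mE y j0 by (intro bexI[of _ "pair \<zero>\<^bsub>P\<^esub> x"]) (simp_all add: c_def mlin)
  qed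
  note cK = exact3_kernel[OF this mPG mE]
  define K where "K = sub (bsum P G) {u \<in> carrier (bsum P G). c u = \<zero>\<^bsub>E\<^esub>}"
  have Ks: "submodule {u \<in> carrier (bsum P G). c u = \<zero>\<^bsub>E\<^esub>} R (bsum P G)" by (rule submod_ker[OF c mPG mE])
  have Kf: "K \<in> fgmod R" unfolding K_def by (rule fgmod_sub[OF ffreeD(1)[OF PG] Ks])
  have "syz1 K E" unfolding syz1_def using Kf E PG cK by (auto simp: K_def)
  moreover have "retr S K"
  proof -
    obtain l where l: "l \<in> Hom G P" "\<forall>x\<in>carrier G. q (l x) = r (g x)"
      using ffree_lift[OF G(1) e'(3) Hom_comp[OF gH r] mP mS(2)] by blast
    have "pair (i s) \<zero>\<^bsub>G\<^esub> \<in> carrier K" if s: "s \<in> carrier S" for s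
      using Hom_closed[OF e'(1) s] e'(6)[OF s] Hom_zero[OF j mS(2) mE] Hom_zero[OF gH mG mE] mG mE
      by (simp add: K_def c_def mlin)
    then have inH: "(\<lambda>s. pair (i s) \<zero>\<^bsub>G\<^esub>) \<in> Hom S K"
      using Hom_comp[OF e'(1) Hom_inl[OF mG]] by (auto simp: mod_hom_def K_def)
    define h where "h u = pfst u \<oplus>\<^bsub>P\<^esub> l (psnd u)" for u
    have h: "h \<in> Hom (bsum P G) P" unfolding h_def by (rule Hom_copair[OF Hom_id l(1) mP])
    have hK: "h \<in> Hom K P" using h by (auto simp: mod_hom_def K_def)
    have "h u \<in> i ` carrier S" if "u \<in> carrier K" for u
    proof (rule e'(5))
      have u: "u \<in> carrier (bsum P G)" "c u = \<zero>\<^bsub>E\<^esub>" using that by (auto simp: K_def)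
      show "h u \<in> carrier P" using Hom_closed[OF h u(1)] .
      note u1 = bsum_proj(1)[OF u(1)] and u2 = bsum_proj(2)[OF u(1)]
      have "q (h u) = q (pfst u) \<oplus>\<^bsub>M\<^esub> r (g (psnd u))"
        using Hom_add[OF e'(4) u1 Hom_closed[OF l(1) u2]] bspec[OF l(2) u2] by (simp add: h_def)
      also have "\<dots> = r (c u)"
        using Hom_add[OF r Hom_closed[OF Hom_comp[OF e'(4) j] u1] Hom_closed[OF gH u2]] rj[OF Hom_closed[OF e'(4) u1]]
        by (simp add: c_def)
      also have "\<dots> = \<zero>\<^bsub>M\<^esub>" using u(2) Hom_zero[OF r mE mS(2)] by simp
      finally show "q (h u) = \<zero>\<^bsub>M\<^esub>" .
    qed
    then obtain k where k: "k \<in> Hom K S" "\<And>u. u \<in> carrier K \<Longrightarrow> i (k u) = h u"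
      using Hom_corestrict[OF e'(1,2) hK module_fgmod[OF Kf] mP mS(1)] by blast
    have "k (pair (i s) \<zero>\<^bsub>G\<^esub>) = s" if s: "s \<in> carrier S" for s
    proof (rule inj_onD[OF e'(2)])
      note iK = Hom_closed[OF inH s]
      show "i (k (pair (i s) \<zero>\<^bsub>G\<^esub>)) = i s"
        unfolding k(2)[OF iK] using Hom_closed[OF e'(1) s] Hom_zero[OF l(1) mG mP] mP by (simp add: h_def mlin)
      show "k (pair (i s) \<zero>\<^bsub>G\<^esub>) \<in> carrier S" using Hom_closed[OF k(1) iK] .
    qed (rule s)
    then show ?thesis by (rule retrI[OF inH k(1)])
  qed
  ultimately show ?thesis by blast
qed

text \<open>Let \<^term>\<open>G\<close> be the given cover of \<^term>\<open>E\<close> with kernel \<^term>\<open>K\<close>, and \<^term>\<open>F\<close> a cover of \<^term>\<open>A\<close>.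
  Then \<^term>\<open>G\<close> also covers \<^term>\<open>B\<close>, with a kernel \<^term>\<open>U\<close> that is an extension of \<^term>\<open>A\<close> by
  \<^term>\<open>K\<close>. Hence \<^term>\<open>K\<close> plus \<^term>\<open>F\<close> maps onto \<^term>\<open>U\<close>, and the kernel is the kernel of
  the cover of \<^term>\<open>A\<close>.\<close>

lemma syz1_extension:
  assumes ex: "short_exact R A E B" and fg: "A \<in> fgmod R" "B \<in> fgmod R" and S: "syz1 K E"
  shows "\<exists>A' U S'. syz1 A' A \<and> syz1 U B \<and> short_exact R A' S' U \<and> S' \<in> fgmod R \<and> retr K S'"
proof -
  obtain f g where "exact3 A E B f g" using ex by (auto simp: short_exact_iff)
  note f = exact3D[OF this]
  obtain G i q where G: "ffree G" and "exact3 K G E i q" using S by (auto simp: syz1_def)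
  note i = exact3D[OF this(2)]
  note fK = syz1D[OF S]
  note m = fg[THEN module_fgmod] fK[THEN module_fgmod] ffreeD(2)[OF G]
  obtain F a where F: "ffree F" "epi F A a" using free_cover[OF fg(1)] by blast
  note mF = ffreeD(2)[OF F(1)] and aH = epi_Hom[OF F(2)]
  define U where "U = sub G {p \<in> carrier G. g (q p) = \<zero>\<^bsub>B\<^esub>}"
  note gq = epi_comp[OF i(3) f(3)]
  have Us: "submodule {p \<in> carrier G. g (q p) = \<zero>\<^bsub>B\<^esub>} R G" by (rule submod_ker[OF epi_Hom[OF gq] m(5,2)])
  have Uf: "U \<in> fgmod R" unfolding U_def by (rule fgmod_sub[OF ffreeD(1)[OF G] Us])
  have U: "syz1 U B" unfolding syz1_def using exact3_kernel[OF gq m(5,2)] Uf fg G by (auto simp: U_def)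
  define A' where "A' = sub F {p \<in> carrier F. a p = \<zero>\<^bsub>A\<^esub>}"
  have A's: "submodule {p \<in> carrier F. a p = \<zero>\<^bsub>A\<^esub>} R F" by (rule submod_ker[OF aH mF m(1)])
  have A'f: "A' \<in> fgmod R" unfolding A'_def by (rule fgmod_sub[OF ffreeD(1)[OF F(1)] A's])
  have A': "syz1 A' A" unfolding syz1_def using exact3_kernel[OF F(2) mF m(1)] A'f fg F by (auto simp: A'_def)
  note mU = module_fgmod[OF Uf] and mA' = module_fgmod[OF A'f]
  obtain l where l: "l \<in> Hom F G" "\<forall>x\<in>carrier F. q (l x) = f (a x)"
    using ffree_lift[OF F(1) i(3) Hom_comp[OF aH f(1)] m(5,4)] by blast
  define S' where "S' = bsum K F"
  have S'f: "S' \<in> fgmod R" unfolding S'_def by (rule bsum_fgmod[OF fK(1) ffreeD(1)[OF F(1)]])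
  note mS' = module_fgmod[OF S'f]
  define h where "h u = i (pfst u) \<oplus>\<^bsub>G\<^esub> l (psnd u)" for u
  have h: "h \<in> Hom S' G" unfolding h_def S'_def by (rule Hom_copair[OF i(1) l(1) m(5)])
  have qh: "q (h u) = f (a (psnd u))" if u: "u \<in> carrier S'" for u
  proof -
    have u1: "pfst u \<in> carrier K" and u2: "psnd u \<in> carrier F" using u bsum_proj by (auto simp: S'_def)
    show ?thesis unfolding h_def
      using Hom_add[OF i(4) Hom_closed[OF i(1) u1] Hom_closed[OF l(1) u2]] i(6)[OF u1] bspec[OF l(2) u2]
        Hom_closed[OF Hom_comp[OF aH f(1)] u2] m by (simp add: mlin)
  qed
  have hU: "h u \<in> carrier U" if u: "u \<in> carrier S'" for u
  proof -
    have u2: "psnd u \<in> carrier F" using u bsum_proj by (auto simp: S'_def)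
    show ?thesis using qh[OF u] f(6)[OF Hom_closed[OF aH u2]] Hom_closed[OF h u] by (simp add: U_def)
  qed
  have hH: "h \<in> Hom S' U" using h hU by (auto simp: mod_hom_def U_def)
  have hepi: "epi S' U h"
  proof (rule epiI[OF hH])
    fix p assume "p \<in> carrier U"
    then have p: "p \<in> carrier G" "g (q p) = \<zero>\<^bsub>B\<^esub>" by (auto simp: U_def)
    obtain y where y: "y \<in> carrier A" "q p = f y" using f(5)[OF Hom_closed[OF i(4) p(1)] p(2)] by auto
    obtain x where x: "x \<in> carrier F" "a x = y" using epiE[OF F(2) y(1)] .
    note lx = Hom_closed[OF l(1) x(1)]
    have "q (p \<oplus>\<^bsub>G\<^esub> \<ominus>\<^bsub>G\<^esub> l x) = \<zero>\<^bsub>E\<^esub>"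
      using p lx bspec[OF l(2) x(1)] x(2) y Hom_closed[OF f(1) y(1)] m by (simp add: Hom_simps[OF i(4)] mlin)
    then obtain s where s: "s \<in> carrier K" "p \<oplus>\<^bsub>G\<^esub> \<ominus>\<^bsub>G\<^esub> l x = i s" using i(5)[of "p \<oplus>\<^bsub>G\<^esub> \<ominus>\<^bsub>G\<^esub> l x"] p lx m by (auto simp: mclosed)
    have "h (pair s x) = p" using p lx m by (simp add: h_def s(2)[symmetric] mlin)
    then show "\<exists>u\<in>carrier S'. h u = p" using s x by (intro bexI[of _ "pair s x"]) (auto simp: S'_def)
  qed
  have li: "l x \<in> i ` carrier K" if "x \<in> carrier A'" for x
  proof (rule i(5))
    have x: "x \<in> carrier F" "a x = \<zero>\<^bsub>A\<^esub>" using that by (auto simp: A'_def)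
    show "l x \<in> carrier G" using Hom_closed[OF l(1) x(1)] .
    show "q (l x) = \<zero>\<^bsub>E\<^esub>" using bspec[OF l(2) x(1)] x(2) Hom_zero[OF f(1) m(1,4)] by simp
  qed
  have lA': "l \<in> Hom A' G" using l(1) by (auto simp: mod_hom_def A'_def)
  obtain k where k: "k \<in> Hom A' K" "\<And>x. x \<in> carrier A' \<Longrightarrow> i (k x) = l x"
    using Hom_corestrict[OF i(1,2) lA' mA' m(5,3) li] by blast
  have incl: "(\<lambda>x. x) \<in> Hom A' F" unfolding A'_def by (rule Hom_incl) auto
  have jH: "(\<lambda>x. pair (\<ominus>\<^bsub>K\<^esub> k x) x) \<in> Hom A' S'"
    unfolding S'_def by (intro Hom_pair Hom_uminus k(1) m(3) incl)
  have "exact3 A' S' U (\<lambda>x. pair (\<ominus>\<^bsub>K\<^esub> k x) x) h"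
    unfolding exact3_def
  proof (intro conjI ballI jH hepi)
    show "inj_on (\<lambda>x. pair (\<ominus>\<^bsub>K\<^esub> k x) x) (carrier A')" by (rule inj_onI) simp
    fix u assume u: "u \<in> carrier S'"
    obtain s x where sx: "s \<in> carrier K" "x \<in> carrier F" "u = pair s x" using u unfolding S'_def by (rule bsumE)
    show "h u = \<zero>\<^bsub>U\<^esub> \<longleftrightarrow> u \<in> (\<lambda>x. pair (\<ominus>\<^bsub>K\<^esub> k x) x) ` carrier A'"
    proof
      assume h0: "h u = \<zero>\<^bsub>U\<^esub>"
      then have isx: "i s \<oplus>\<^bsub>G\<^esub> l x = \<zero>\<^bsub>G\<^esub>" by (simp add: h_def sx U_def)
      have "f (a x) = \<zero>\<^bsub>E\<^esub>" using qh[OF u] h0 Hom_zero[OF i(4) m(5,4)] by (simp add: sx U_def)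
      then have ax: "a x = \<zero>\<^bsub>A\<^esub>" using inj_on_ker[OF f(2,1) m(1,4)] Hom_closed[OF aH sx(2)] by blast
      then have x: "x \<in> carrier A'" using sx by (simp add: A'_def)
      note kx = Hom_closed[OF k(1) x]
      have "i s = i (\<ominus>\<^bsub>K\<^esub> k x)"
        using isx Hom_neg[OF i(1) m(3,5) kx] k(2)[OF x] madd_zero[OF m(5) Hom_closed[OF i(1) sx(1)] Hom_closed[OF l(1) sx(2)]] by simp
      then have "s = \<ominus>\<^bsub>K\<^esub> k x" using inj_onD[OF i(2)] sx(1) mneg[OF m(3) kx] by blast
      then show "u \<in> (\<lambda>x. pair (\<ominus>\<^bsub>K\<^esub> k x) x) ` carrier A'" using x sx(3) by blast
    next
      assume "u \<in> (\<lambda>x. pair (\<ominus>\<^bsub>K\<^esub> k x) x) ` carrier A'"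
      then have x: "x \<in> carrier A'" and s: "s = \<ominus>\<^bsub>K\<^esub> k x" using sx by auto
      note kx = Hom_closed[OF k(1) x]
      show "h u = \<zero>\<^bsub>U\<^esub>"
        using Hom_neg[OF i(1) m(3,5) kx] k(2)[OF x] Hom_closed[OF l(1) sx(2)] m
        by (simp add: h_def sx s U_def mlin)
    qed
  qed
  then have "short_exact R A' S' U" by (auto simp: short_exact_iff)
  moreover have "retr K S'"
    by (rule retrI[OF Hom_inl[OF mF, of K, folded S'_def] Hom_pfst[of K F, folded S'_def]]) simp
  ultimately show ?thesis using A' U S'f by blast
qed

section \<open>Modules built from a list of pieces\<close>

text \<open>The class of modules obtained from a list of pieces by successive extensions, where one may pass to a direct
  summand after every step. The summands are what taking syzygies of an extension costs, and a list records
  how many pieces are used and which syzygy each of them is.\<close>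

fun built :: "'a lmodule list \<Rightarrow> 'a lmodule \<Rightarrow> bool" where
  "built [] M \<longleftrightarrow> False"
| "built [Z] M \<longleftrightarrow> retr M Z"
| "built (Z # Z' # Zs) M \<longleftrightarrow> (\<exists>E B. E \<in> fgmod R \<and> B \<in> fgmod R \<and> retr M E \<and> short_exact R Z E B \<and> built (Z' # Zs) B)"

lemma built_retr: "\<lbrakk>built Zs N; retr M N\<rbrakk> \<Longrightarrow> built Zs M"
  by (induction Zs N rule: built.induct) (auto intro: retr_trans)

lemma built_syz1:
  "\<lbrakk>built Zs M; set Zs \<subseteq> fgmod R; syz1 S M\<rbrakk>
    \<Longrightarrow> \<exists>Zs'. list_all2 syz1 Zs' Zs \<and> built Zs' S"
proof (induction Zs M arbitrary: S rule: built.induct)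
  case (2 Z M)
  then obtain K where "syz1 K Z" "retr S K" using syz1_retr[of M Z S] by auto
  then show ?case by (intro exI[of _ "[K]"]) simp
next
  case (3 Z Z' Zs M)
  then obtain E B where E: "E \<in> fgmod R" "B \<in> fgmod R" "retr M E" "short_exact R Z E B" "built (Z' # Zs) B"
    by auto
  obtain K where K: "syz1 K E" "retr S K" using syz1_retr[OF E(3,1) 3(4)] by blast
  obtain A' U S' where A': "syz1 A' Z" "syz1 U B" "short_exact R A' S' U" "S' \<in> fgmod R" "retr K S'"
    using syz1_extension[OF E(4) _ E(2) K(1)] 3 by auto
  obtain Zs' where Zs': "list_all2 syz1 Zs' (Z' # Zs)" "built Zs' U"
    using "3.IH"[OF E(5) _ A'(2)] 3 by auto
  then obtain W Ws where "Zs' = W # Ws" by (cases Zs') auto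
  then show ?case using Zs' A' syz1D[OF A'(2)] retr_trans[OF K(2) A'(5)]
    by (intro exI[of _ "A' # Zs'"]) auto
qed auto

section \<open>Filtrations\<close>

text \<open>The filtrations in \<^const>\<open>filt_cat\<close>, with quotients described by surjections with a given kernel.\<close>

definition filtered :: "'a lmodule set \<Rightarrow> nat \<Rightarrow> 'a lmodule \<Rightarrow> bool" where
  "filtered \<X> r N \<longleftrightarrow> (\<exists>F. (\<forall>j\<le>r. submodule (F j) R N) \<and> F 0 = {\<zero>\<^bsub>N\<^esub>} \<and> F r = carrier N \<and>
     (\<forall>j<r. F j \<subseteq> F (Suc j) \<and> (\<exists>Q\<in>add_cat R \<X>. \<exists>q. epi (sub N (F (Suc j))) Q q \<and>
        (\<forall>x\<in>F (Suc j). q x = \<zero>\<^bsub>Q\<^esub> \<longleftrightarrow> x \<in> F j))))"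

lemma add_cat_fgmod: "M \<in> add_cat R \<X> \<Longrightarrow> M \<in> fgmod R"
  by (induction rule: add_cat.induct) (auto simp: summand_def)

lemma add_cat_retr: "\<lbrakk>N \<in> add_cat R \<X>; retr M N; M \<in> fgmod R\<rbrakk> \<Longrightarrow> M \<in> add_cat R \<X>"
  using add_cat.summand[of N R \<X> M] add_cat_fgmod[of N \<X>] by (simp add: summand_iff)

lemma filt_cat_iff: "M \<in> filt_cat R \<X> r \<longleftrightarrow> (\<exists>N. summand R M N \<and> filtered \<X> r N)"
proof -
  have *: "mod_iso R Q (quot_mod R (sub N (F (Suc j))) (F j)) \<longleftrightarrow> (\<exists>q. epi (sub N (F (Suc j))) Q q \<and>
        (\<forall>x\<in>F (Suc j). q x = \<zero>\<^bsub>Q\<^esub> \<longleftrightarrow> x \<in> F j))"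
    if "N \<in> fgmod R" "Q \<in> fgmod R" "\<forall>j\<le>r. submodule (F j) R N" "j < r" "F j \<subseteq> F (Suc j)" for N Q F j
  proof -
    have s: "submodule (F j) R N" "submodule (F (Suc j)) R N" using that by auto
    show ?thesis
      using iso_quot_iff[OF module_sub[OF s(2) module_fgmod[OF that(1)]] module_fgmod[OF that(2)]
        submod_restrict[OF module_fgmod[OF that(1)] s(2,1) that(5)]] by simp
  qed
  show ?thesis
  proof
    assume "M \<in> filt_cat R \<X> r"
    then obtain N F where N: "summand R M N" and F: "\<forall>j\<le>r. submodule (F j) R N" "F 0 = {\<zero>\<^bsub>N\<^esub>}" "F r = carrier N"
      "\<forall>j<r. F j \<subseteq> F (Suc j) \<and> (\<exists>Q\<in>add_cat R \<X>. mod_iso R Q (quot_mod R (sub N (F (Suc j))) (F j)))"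
      unfolding filt_cat_def by blast
    have Nf: "N \<in> fgmod R" using N by (simp add: summand_def)
    have "\<forall>j<r. F j \<subseteq> F (Suc j) \<and> (\<exists>Q\<in>add_cat R \<X>. \<exists>q. epi (sub N (F (Suc j))) Q q \<and>
        (\<forall>x\<in>F (Suc j). q x = \<zero>\<^bsub>Q\<^esub> \<longleftrightarrow> x \<in> F j))"
      using F(4) *[OF Nf add_cat_fgmod F(1)] by meson
    then show "\<exists>N. summand R M N \<and> filtered \<X> r N" using N F(1-3) unfolding filtered_def by blast
  next
    assume "\<exists>N. summand R M N \<and> filtered \<X> r N"
    then obtain N F where N: "summand R M N" and F: "\<forall>j\<le>r. submodule (F j) R N" "F 0 = {\<zero>\<^bsub>N\<^esub>}" "F r = carrier N"
      "\<forall>j<r. F j \<subseteq> F (Suc j) \<and> (\<exists>Q\<in>add_cat R \<X>. \<exists>q. epi (sub N (F (Suc j))) Q q \<and>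
        (\<forall>x\<in>F (Suc j). q x = \<zero>\<^bsub>Q\<^esub> \<longleftrightarrow> x \<in> F j))"
      unfolding filtered_def by blast
    have Nf: "N \<in> fgmod R" using N by (simp add: summand_def)
    have "\<forall>j<r. F j \<subseteq> F (Suc j) \<and> (\<exists>Q\<in>add_cat R \<X>. mod_iso R Q (quot_mod R (sub N (F (Suc j))) (F j)))"
      using F(4) *[OF Nf add_cat_fgmod F(1)] by meson
    then show "M \<in> filt_cat R \<X> r" using N F(1-3) unfolding filt_cat_def by blast
  qed
qed

text \<open>A filtration must not pass to summands between its steps. If \<^term>\<open>B\<close> is a summand of a filtered module
  \<^term>\<open>N'\<close>, pull the extension \<^term>\<open>E\<close> of \<^term>\<open>B\<close> back along the retraction \<open>N' \<rightarrow> B\<close>. The pullback \<^term>\<open>N\<close> contains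
  \<^term>\<open>E\<close> as a summand, and the filtration of \<^term>\<open>N'\<close> pulls back to one of \<^term>\<open>N\<close> above the kernel \<^term>\<open>Z\<close>.\<close>

lemma built_filtered:
  "\<lbrakk>built Zs M; set Zs \<subseteq> add_cat R \<X>; M \<in> fgmod R\<rbrakk>
    \<Longrightarrow> \<exists>N\<in>fgmod R. retr M N \<and> filtered \<X> (length Zs) N"
proof (induction Zs M rule: built.induct)
  case (2 Z M)
  then have Z: "Z \<in> add_cat R \<X>" and r: "retr M Z" by auto
  have Zf: "Z \<in> fgmod R" using add_cat_fgmod[OF Z] .
  note mZ = module_fgmod[OF Zf]
  have "submodule {\<zero>\<^bsub>Z\<^esub>} R Z" by (rule submodI[OF mZ]) (simp_all add: mlin[OF mZ])
  moreover have "epi Z Z (\<lambda>x. x)" by (rule epiI[OF Hom_id]) simp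
  ultimately have "filtered \<X> 1 Z" unfolding filtered_def
    using Z submod_carrier[OF mZ] mzero[OF mZ]
    by (intro exI[of _ "\<lambda>j. if j = 0 then {\<zero>\<^bsub>Z\<^esub>} else carrier Z"]) auto
  then show ?case using r Zf by auto
next
  case (3 Z Z' Zs M)
  then obtain E B where E: "E \<in> fgmod R" "B \<in> fgmod R" "retr M E" "short_exact R Z E B" "built (Z' # Zs) B"
    by auto
  have Z: "Z \<in> add_cat R \<X>" using 3 by simp
  have Zf: "Z \<in> fgmod R" using add_cat_fgmod[OF Z] .
  obtain N' where N': "N' \<in> fgmod R" "retr B N'" "filtered \<X> (length (Z' # Zs)) N'"
    using "3.IH"[OF E(5) _ E(2)] 3 by auto
  let ?r = "length (Z' # Zs)"
  obtain F where F: "\<forall>j\<le>?r. submodule (F j) R N'" "F 0 = {\<zero>\<^bsub>N'\<^esub>}" "F ?r = carrier N'"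
      "\<forall>j<?r. F j \<subseteq> F (Suc j) \<and> (\<exists>Q\<in>add_cat R \<X>. \<exists>q. epi (sub N' (F (Suc j))) Q q \<and>
        (\<forall>x\<in>F (Suc j). q x = \<zero>\<^bsub>Q\<^esub> \<longleftrightarrow> x \<in> F j))"
    using N'(3) unfolding filtered_def by blast
  obtain f g where "exact3 Z E B f g" using E by (auto simp: short_exact_iff)
  note f = exact3D[OF this]
  obtain i r where i: "i \<in> Hom B N'" and r: "r \<in> Hom N' B" and ri: "\<And>b. b \<in> carrier B \<Longrightarrow> r (i b) = b"
    using N'(2) by (auto simp: retr_def)
  note mZ = module_fgmod[OF Zf] and mE = module_fgmod[OF E(1)] and mB = module_fgmod[OF E(2)] and mN' = module_fgmod[OF N'(1)]
  define W where "W = {u \<in> carrier (bsum E N'). g (pfst u) \<oplus>\<^bsub>B\<^esub> \<ominus>\<^bsub>B\<^esub> r (psnd u) = \<zero>\<^bsub>B\<^esub>}"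
  have mEN: "module R (bsum E N')" by (rule module_bsum[OF mE mN'])
  have W: "submodule W R (bsum E N')" unfolding W_def
    by (intro submod_ker mEN mB Hom_copair[of g _ _ "\<lambda>x. \<ominus>\<^bsub>B\<^esub> r x"] Hom_uminus f(4) r)
  have Wiff: "u \<in> W \<longleftrightarrow> u \<in> carrier (bsum E N') \<and> g (pfst u) = r (psnd u)" for u
    using mdiff_zero[OF mB] Hom_closed[OF f(4) bsum_proj(1)] Hom_closed[OF r bsum_proj(2)] by (auto simp: W_def)
  define N where "N = sub (bsum E N') W"
  have Nf: "N \<in> fgmod R" unfolding N_def by (rule fgmod_sub[OF bsum_fgmod[OF E(1) N'(1)] W])
  note mN = module_fgmod[OF Nf]
  have Nc: "carrier N = W" by (simp add: N_def)
  have p2: "psnd \<in> Hom N N'" and p1: "pfst \<in> Hom N E"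
    using Hom_pfst[of E N'] Hom_psnd[of E N'] submod_sub[OF W mEN] by (auto simp: N_def mod_hom_def)
  have "retr E N"
  proof (rule retrI[OF _ p1])
    have "pair e (i (g e)) \<in> W" if e: "e \<in> carrier E" for e
      using e Hom_closed[OF Hom_comp[OF f(4) i] e] ri[OF Hom_closed[OF f(4) e]] by (simp add: Wiff)
    then show "(\<lambda>e. pair e (i (g e))) \<in> Hom E N"
      using Hom_pair[OF Hom_id Hom_comp[OF f(4) i]] by (auto simp: mod_hom_def N_def)
  qed simp
  define F' where "F' j = (if j = 0 then {\<zero>\<^bsub>N\<^esub>} else {u \<in> carrier N. psnd u \<in> F (j - 1)})" for j
  have sF': "submodule (F' j) R N" if "j \<le> Suc ?r" for j
  proof (cases j)
    case 0
    have "submodule {\<zero>\<^bsub>N\<^esub>} R N" by (rule submodI[OF mN]) (simp_all add: mlin[OF mN])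
    then show ?thesis using 0 by (simp add: F'_def)
  next
    case (Suc k)
    then show ?thesis using that F(1) submod_vimage[OF p2 mN mN', of "F k"] by (simp add: F'_def)
  qed
  have steps: "F' j \<subseteq> F' (Suc j) \<and> (\<exists>Q\<in>add_cat R \<X>. \<exists>q. epi (sub N (F' (Suc j))) Q q \<and>
        (\<forall>x\<in>F' (Suc j). q x = \<zero>\<^bsub>Q\<^esub> \<longleftrightarrow> x \<in> F' j))" if j: "j < Suc ?r" for j
  proof (cases j)
    case 0
    have F1: "F' 1 = {u \<in> W. psnd u = \<zero>\<^bsub>N'\<^esub>}" by (auto simp: F'_def F(2) Nc)
    have s: "submodule (F' 1) R N" using sF' by auto
    have m1: "module R (sub N (F' 1))" by (rule module_sub[OF s mN])
    have h: "pfst \<in> Hom (sub N (F' 1)) E" by (rule Hom_restrict[OF p1 submod_sub[OF s mN]])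
    have im: "pfst u \<in> f ` carrier Z" if "u \<in> carrier (sub N (F' 1))" for u
    proof (rule f(5))
      have u: "u \<in> W" "psnd u = \<zero>\<^bsub>N'\<^esub>" using that F1 by auto
      then show "pfst u \<in> carrier E" using bsum_proj by (auto simp: Wiff)
      show "g (pfst u) = \<zero>\<^bsub>B\<^esub>" using u Hom_zero[OF r mN' mB] by (simp add: Wiff)
    qed
    obtain q where q: "q \<in> Hom (sub N (F' 1)) Z" "\<And>u. u \<in> carrier (sub N (F' 1)) \<Longrightarrow> f (q u) = pfst u"
      using Hom_corestrict[OF f(1,2) h m1 mE mZ im] by blast
    have "epi (sub N (F' 1)) Z q"
    proof (rule epiI[OF q(1)])
      fix z assume z: "z \<in> carrier Z"
      note fz = Hom_closed[OF f(1) z]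
      have u: "pair (f z) \<zero>\<^bsub>N'\<^esub> \<in> carrier (sub N (F' 1))"
        using fz f(6)[OF z] Hom_zero[OF r mN' mB] mzero[OF mN'] by (simp add: F1[unfolded One_nat_def] Wiff)
      have "f (q (pair (f z) \<zero>\<^bsub>N'\<^esub>)) = f z" using q(2)[OF u] by simp
      then have "q (pair (f z) \<zero>\<^bsub>N'\<^esub>) = z" using inj_onD[OF f(2)] Hom_closed[OF q(1) u] z by blast
      then show "\<exists>u\<in>carrier (sub N (F' 1)). q u = z" using u by blast
    qed
    moreover have "q u = \<zero>\<^bsub>Z\<^esub> \<longleftrightarrow> u = \<zero>\<^bsub>N\<^esub>" if u: "u \<in> F' 1" for u
    proof
      assume "q u = \<zero>\<^bsub>Z\<^esub>"
      then have "pfst u = \<zero>\<^bsub>E\<^esub>" using q(2)[of u] u Hom_zero[OF f(1) mZ mE] by simp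
      then show "u = \<zero>\<^bsub>N\<^esub>" using u bsum_proj(3)[of u E N'] F1 by (simp add: N_def Wiff)
    next
      assume "u = \<zero>\<^bsub>N\<^esub>"
      then show "q u = \<zero>\<^bsub>Z\<^esub>" using Hom_zero[OF q(1) m1 mZ] by simp
    qed
    moreover have "F' 0 \<subseteq> F' 1" using submod_zero[OF s mN] by (simp add: F'_def)
    ultimately show ?thesis using 0 Z by (auto simp: F'_def)
  next
    case (Suc k)
    then have k: "k < ?r" using j by simp
    then obtain Q q where Q: "F k \<subseteq> F (Suc k)" "Q \<in> add_cat R \<X>" "epi (sub N' (F (Suc k))) Q q"
      "\<forall>x\<in>F (Suc k). q x = \<zero>\<^bsub>Q\<^esub> \<longleftrightarrow> x \<in> F k" using F(4) by blast
    have Fk: "F' j = {u \<in> W. psnd u \<in> F k}" "F' (Suc j) = {u \<in> W. psnd u \<in> F (Suc k)}"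
      by (auto simp: F'_def Suc Nc)
    have FkN: "F (Suc k) \<subseteq> carrier N'" using F(1) k submod_sub[OF _ mN', of "F (Suc k)"] by auto
    have "epi (sub N (F' (Suc j))) Q (\<lambda>u. q (psnd u))"
    proof (rule epi_comp[OF epiI Q(3)])
      show "psnd \<in> Hom (sub N (F' (Suc j))) (sub N' (F (Suc k)))"
        using p2 Fk by (auto simp: mod_hom_def Nc)
      fix y assume "y \<in> carrier (sub N' (F (Suc k)))"
      then have y: "y \<in> F (Suc k)" "y \<in> carrier N'" using FkN by auto
      obtain e where e: "e \<in> carrier E" "g e = r y" using epiE[OF f(3) Hom_closed[OF r y(2)]] .
      show "\<exists>u\<in>carrier (sub N (F' (Suc j))). psnd u = y"
        using y e by (intro bexI[of _ "pair e y"]) (auto simp: Fk Wiff)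
    qed
    then show ?thesis using Q Fk by (intro conjI bexI[of _ Q] exI[of _ "\<lambda>u. q (psnd u)"]) auto
  qed
  have "filtered \<X> (Suc ?r) N" unfolding filtered_def
    using sF' steps F(3) by (intro exI[of _ F'] conjI allI impI) (auto simp: F'_def Nc Wiff bsum_proj)
  moreover have "retr M N" using retr_trans[OF E(3) \<open>retr E N\<close>] .
  ultimately show ?case using Nf by auto
qed auto

lemma built_filt_cat: "\<lbrakk>built Zs M; set Zs \<subseteq> add_cat R \<X>; M \<in> fgmod R\<rbrakk> \<Longrightarrow> M \<in> filt_cat R \<X> (length Zs)"
  using built_filtered[of Zs M \<X>] unfolding filt_cat_iff by (auto simp: summand_iff)

lemma built_ext_cat: "\<lbrakk>built Zs M; set Zs \<subseteq> ext_cat R \<X>; set Zs \<subseteq> fgmod R; M \<in> fgmod R\<rbrakk> \<Longrightarrow> M \<in> ext_cat R \<X>"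
proof (induction Zs M rule: built.induct)
  case (2 Z M)
  then show ?case using ext_cat.summand[of Z R \<X> M] by (auto simp: summand_iff)
next
  case (3 Z Z' Zs M)
  then obtain E B where E: "E \<in> fgmod R" "B \<in> fgmod R" "retr M E" "short_exact R Z E B" "built (Z' # Zs) B"
    by auto
  then have B: "B \<in> ext_cat R \<X>" using 3 by auto
  have Z: "Z \<in> ext_cat R \<X>" using 3 by auto
  have "E \<in> ext_cat R \<X>" by (rule ext_cat.extension[OF Z B E(1) E(4)])
  then show ?case using ext_cat.summand[of E R \<X> M] 3 E by (auto simp: summand_iff)
qed auto

section \<open>Modules that are free at a prime\<close>

text \<open>For finitely generated modules over a noetherian ring this is equivalent to the freeness of
  \<open>M\<^sub>p\<close> (\<open>NF_iff\<close>). It speaks of maps between modules over the original ring, so the closure properties of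
  free factors apply to it.\<close>

definition free_off where "free_off p M \<longleftrightarrow> (\<exists>u\<in>carrier R - p. free_factor M u)"

context
  fixes p assumes p: "primeideal p R"
begin

lemma prime_times: "\<lbrakk>u \<in> carrier R - p; v \<in> carrier R - p\<rbrakk> \<Longrightarrow> u \<otimes> v \<in> carrier R - p"
  using primeideal.I_prime[OF p, of u v] by auto

lemma free_off_retr: "\<lbrakk>free_off p N; retr M N; M \<in> fgmod R; N \<in> fgmod R\<rbrakk> \<Longrightarrow> free_off p M"
  unfolding free_off_def using free_factor_retr module_fgmod by blast

lemma free_off_extension:
  assumes "free_off p A" "free_off p C" "short_exact R A B C" "A \<in> fgmod R" "B \<in> fgmod R" "C \<in> fgmod R"
  shows "free_off p B"
proof -
  obtain f g where e: "exact3 A B C f g" using assms by (auto simp: short_exact_iff)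
  obtain u v where "u \<in> carrier R - p" "v \<in> carrier R - p" "free_factor A u" "free_factor C v"
    using assms by (auto simp: free_off_def)
  then show ?thesis unfolding free_off_def using free_factor_extension[OF e assms(4-6)] prime_times by blast
qed

lemma free_off_syz1: "\<lbrakk>syz1 S X; free_off p X\<rbrakk> \<Longrightarrow> free_off p S"
  unfolding free_off_def using free_factor_syz1 by blast

lemma free_off_iso: "\<lbrakk>mod_iso R M N; free_off p N; M \<in> fgmod R; N \<in> fgmod R\<rbrakk> \<Longrightarrow> free_off p M"
  using free_off_retr retr_iso module_fgmod by blast

lemma free_off_syz: "\<lbrakk>S \<in> syz R i {X}; X \<in> fgmod R; free_off p X\<rbrakk> \<Longrightarrow> free_off p S"
proof (induction i arbitrary: S)
  case 0
  then show ?case using syz_0[OF 0(2)] free_off_iso by blast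
next
  case (Suc i)
  then obtain X1 where "X1 \<in> syz R i {X}" "syz1 S X1" using syz_SucD by blast
  then show ?case using Suc free_off_syz1 by blast
qed

lemma free_off_dir_sum:
  assumes iso: "mod_iso R M (dir_sum {..<n::nat} Y)" and M: "M \<in> fgmod R"
    and Y: "\<And>i. i < n \<Longrightarrow> Y i \<in> fgmod R" and off: "\<And>i. i < n \<Longrightarrow> free_off p (Y i)"
  shows "free_off p M"
proof -
  have "\<exists>u\<in>carrier R - p. \<forall>i<k. free_factor (Y i) u" if "k \<le> n" for k
    using that
  proof (induction k)
    case 0
    interpret p: primeideal p R by (rule p)
    have "\<one> \<notin> p" using p.I_notcarr p.one_imp_carrier by auto
    then show ?case by auto
  next
    case (Suc k)
    then obtain u where u: "u \<in> carrier R - p" "\<forall>i<k. free_factor (Y i) u" by auto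
    obtain v where v: "v \<in> carrier R - p" "free_factor (Y k) v" using off[of k] Suc by (auto simp: free_off_def)
    have "free_factor (Y i) (u \<otimes> v)" if "i < Suc k" for i
    proof (cases "i = k")
      case True
      then show ?thesis using free_factor_times[OF module_fgmod[OF Y] v(2)] u Suc by auto
    next
      case False
      then have "free_factor (Y i) (v \<otimes> u)" using free_factor_times[OF module_fgmod[OF Y], of i u v] u v Suc that by auto
      then show ?thesis using u v by (simp add: m_comm)
    qed
    then show ?case using prime_times[OF u(1) v(1)] by blast
  qed
  then obtain u where "u \<in> carrier R - p" "\<forall>i<n. free_factor (Y i) u" by blast
  then show ?thesis using free_factor_dir_sum[OF iso M Y] by (auto simp: free_off_def)
qed

lemma free_off_add_cat: "\<lbrakk>M \<in> add_cat R \<X>; \<And>X. X \<in> \<X> \<Longrightarrow> X \<in> fgmod R \<Longrightarrow> free_off p X\<rbrakk> \<Longrightarrow> free_off p M"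
proof (induction rule: add_cat.induct)
  case (dir_sum k Y M)
  then show ?case using add_cat_fgmod[OF dir_sum(1)] by (intro free_off_dir_sum[of M k Y]) auto
next
  case (summand N M)
  then show ?case using free_off_retr by (auto simp: summand_iff)
qed auto

lemma free_off_ext_cat: "\<lbrakk>M \<in> ext_cat R \<X>; \<And>X. X \<in> \<X> \<Longrightarrow> X \<in> fgmod R \<Longrightarrow> free_off p X\<rbrakk> \<Longrightarrow> M \<in> fgmod R \<and> free_off p M"
proof (induction rule: ext_cat.induct)
  case (summand N M)
  then show ?case using free_off_retr by (auto simp: summand_iff)
next
  case (extension A C B)
  then show ?case using free_off_extension by blast
qed auto

lemma free_off_filt_cat:
  assumes M: "M \<in> filt_cat R \<X> (Suc r)" and X: "\<And>X. X \<in> \<X> \<Longrightarrow> X \<in> fgmod R \<Longrightarrow> free_off p X"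
  shows "free_off p M"
proof -
  obtain N F where N: "summand R M N" and F: "\<forall>j\<le>Suc r. submodule (F j) R N" "F 0 = {\<zero>\<^bsub>N\<^esub>}" "F (Suc r) = carrier N"
      "\<forall>j<Suc r. F j \<subseteq> F (Suc j) \<and> (\<exists>Q\<in>add_cat R \<X>. \<exists>q. epi (sub N (F (Suc j))) Q q \<and>
        (\<forall>x\<in>F (Suc j). q x = \<zero>\<^bsub>Q\<^esub> \<longleftrightarrow> x \<in> F j))"
    using M unfolding filt_cat_iff filtered_def by blast
  have MN: "M \<in> fgmod R" "N \<in> fgmod R" "retr M N" using N by (auto simp: summand_iff)
  note mN = module_fgmod[OF MN(2)]
  have Ff: "sub N (F j) \<in> fgmod R" if "j \<le> Suc r" for j using fgmod_sub[OF MN(2)] F(1) that by auto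
  have "free_off p (sub N (F j))" if "j \<le> Suc r" for j
    using that
  proof (induction j)
    case 0
    obtain u where u: "u \<in> carrier R - p" using primeideal.I_notcarr[OF p] ideal.axioms(1)[OF primeideal.axioms(1)[OF p]]
      by (auto simp: additive_subgroup.a_subset subset_antisym) (metis additive_subgroup.a_subset subsetI subset_antisym)
    have "free_factor (sub N (F 0)) u"
      unfolding free_factor_def dual_family_def using u module_fgmod[OF Ff[of 0]] msmult_zero[OF mN, of u]
      by (intro conjI exI[of _ 0]) (auto simp: F(2))
    then show ?case using u by (auto simp: free_off_def)
  next
    case (Suc j)
    then obtain Q q where Q: "F j \<subseteq> F (Suc j)" "Q \<in> add_cat R \<X>" "epi (sub N (F (Suc j))) Q q"
      "\<forall>x\<in>F (Suc j). q x = \<zero>\<^bsub>Q\<^esub> \<longleftrightarrow> x \<in> F j" using F(4) by (meson Suc_le_lessD)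
    have "exact3 (sub N (F j)) (sub N (F (Suc j))) Q (\<lambda>x. x) q"
      using Q by (auto simp: exact3_def mod_hom_def)
    then have se: "short_exact R (sub N (F j)) (sub N (F (Suc j))) Q" by (auto simp: short_exact_iff)
    have j: "j \<le> Suc r" and IH: "free_off p (sub N (F j))" using Suc by auto
    show ?case
      by (rule free_off_extension[OF IH free_off_add_cat[OF Q(2) X] se Ff[OF j] Ff[OF Suc.prems] add_cat_fgmod[OF Q(2)]])
  qed
  from this[of "Suc r"] have "free_off p N" by (simp add: F(3))
  then show ?thesis using MN free_off_retr by blast
qed

end

section \<open>Free resolutions\<close>

lemma ex_free_resolution:
  assumes M: "M \<in> fgmod R"
  shows "\<exists>P d. free_resolution R M P d"
proof -
  define cov where "cov X = (SOME Pq. ffree (fst Pq) \<and> epi (fst Pq) X (snd Pq))" for X :: "'a lmodule"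
  have cov: "ffree (fst (cov X)) \<and> epi (fst (cov X)) X (snd (cov X))" if X: "X \<in> fgmod R" for X
  proof -
    obtain P q where "ffree P" "epi P X q" using free_cover[OF X] by blast
    then show ?thesis unfolding cov_def
      by (intro someI[where P="\<lambda>Pq. ffree (fst Pq) \<and> epi (fst Pq) X (snd Pq)" and x="(P, q)"]) simp
  qed
  define ker where "ker X = sub (fst (cov X)) {p \<in> carrier (fst (cov X)). snd (cov X) p = \<zero>\<^bsub>X\<^esub>}" for X
  have kerf: "ker X \<in> fgmod R" if X: "X \<in> fgmod R" for X
  proof -
    have P: "ffree (fst (cov X))" and e: "epi (fst (cov X)) X (snd (cov X))" using cov[OF X] by auto
    show ?thesis unfolding ker_def
      by (rule fgmod_sub[OF ffreeD(1)[OF P] submod_ker[OF epi_Hom[OF e] ffreeD(2)[OF P] module_fgmod[OF X]]])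
  qed
  define X where "X j = (ker ^^ j) M" for j
  have Xf: "X j \<in> fgmod R" for j unfolding X_def by (induction j) (auto simp: M kerf)
  have XS: "X (Suc j) = ker (X j)" for j by (simp add: X_def)
  define P where "P j = fst (cov (X j))" for j
  define d where "d j = snd (cov (X j))" for j
  have Pd: "ffree (P j)" "epi (P j) (X j) (d j)" for j using cov[OF Xf[of j]] by (auto simp: P_def d_def)
  have XP: "X (Suc j) = sub (P j) {p \<in> carrier (P j). d j p = \<zero>\<^bsub>X j\<^esub>}" for j
    by (simp add: XS ker_def P_def d_def)
  have XPc: "carrier (X (Suc j)) = {p \<in> carrier (P j). d j p = \<zero>\<^bsub>X j\<^esub>}" "\<zero>\<^bsub>X (Suc j)\<^esub> = \<zero>\<^bsub>P j\<^esub>" for j by (simp_all add: XP)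
  have img: "d (Suc j) ` carrier (P (Suc j)) = {p \<in> carrier (P j). d j p = \<zero>\<^bsub>X j\<^esub>}" for j
    using Pd(2)[of "Suc j"] XPc by (simp add: epi_def)
  have dH: "d (Suc j) \<in> Hom (P (Suc j)) (P j)" for j
    using epi_Hom[OF Pd(2)[of "Suc j"]] unfolding mod_hom_def XP by auto
  have "free_resolution R M P d" unfolding free_resolution_def
  proof (intro conjI allI)
    show "P j \<in> fgmod R" "free_module R (P j)" for j using Pd(1)[of j] by (auto simp: ffree_def)
    have X0: "X 0 = M" by (simp add: X_def)
    show "d 0 \<in> Hom (P 0) M" "d 0 ` carrier (P 0) = carrier M" using Pd(2)[of 0] by (auto simp: epi_def X0)
    show "d 1 ` carrier (P 1) = a_kernel (P 0) M (d 0)" using img[of 0] by (simp add: a_kernel_eq X0)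
    show "d (Suc (Suc j)) ` carrier (P (Suc (Suc j))) = a_kernel (P (Suc j)) (P j) (d (Suc j))" for j
      using img[of "Suc j"] by (simp add: a_kernel_eq XPc)
  qed (rule dH)
  then show ?thesis by blast
qed

section \<open>Complexes of free modules\<close>

text \<open>The module \<^term>\<open>G (Suc j)\<close> sits in degree \<^term>\<open>j\<close>, and the trivial module \<^term>\<open>G 0\<close> in degree
  -1 spares a case distinction at the right end.\<close>

definition cplx :: "(nat \<Rightarrow> 'a lmodule) \<Rightarrow> (nat \<Rightarrow> 'a list \<Rightarrow> 'a list) \<Rightarrow> bool" where
  "cplx G d \<longleftrightarrow> (\<forall>j. ffree (G j)) \<and> (\<forall>j. d j \<in> Hom (G (Suc j)) (G j)) \<and>
     (\<forall>j. \<forall>g\<in>carrier (G (Suc (Suc j))). d j (d (Suc j) g) = \<zero>\<^bsub>G j\<^esub>) \<and> carrier (G 0) = {\<zero>\<^bsub>G 0\<^esub>}"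

definition nullhomotopic :: "'a \<Rightarrow> (nat \<Rightarrow> 'a lmodule) \<Rightarrow> (nat \<Rightarrow> 'a list \<Rightarrow> 'a list) \<Rightarrow> bool" where
  "nullhomotopic x G d \<longleftrightarrow> (\<exists>h. \<forall>j. h j \<in> Hom (G j) (G (Suc j)) \<and>
     (\<forall>g\<in>carrier (G (Suc j)). d (Suc j) (h (Suc j) g) \<oplus>\<^bsub>G (Suc j)\<^esub> h j (d j g) = x \<odot>\<^bsub>G (Suc j)\<^esub> g))"

definition coker where "coker G d j N q \<longleftrightarrow> N \<in> fgmod R \<and> epi (G j) N q \<and>
   (\<forall>g\<in>carrier (G j). q g = \<zero>\<^bsub>N\<^esub> \<longleftrightarrow> g \<in> d j ` carrier (G (Suc j)))"

lemma cplxD: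
  assumes "cplx G d"
  shows "ffree (G j)" "module R (G j)" "d j \<in> Hom (G (Suc j)) (G j)"
    "g \<in> carrier (G (Suc (Suc j))) \<Longrightarrow> d j (d (Suc j) g) = \<zero>\<^bsub>G j\<^esub>" "g \<in> carrier (G 0) \<Longrightarrow> g = \<zero>\<^bsub>G 0\<^esub>"
  using assms ffreeD by (auto simp: cplx_def)

text \<open>Each cokernel of a complex of free modules is built from syzygies of the homology modules: with
  \<^term>\<open>C j\<close> the cokernel in degree \<^term>\<open>j\<close>, there is an extension of the image of \<^term>\<open>d (Suc j)\<close>, a syzygy of
  \<^term>\<open>C j\<close>, by the homology in degree \<^term>\<open>Suc j\<close>. In degree 0 the cokernel is the homology. A homotopy for
  \<^term>\<open>x\<close> turns \<^term>\<open>x\<close> times a cycle into a boundary, so \<^term>\<open>x\<close> annihilates all \<^term>\<open>H j\<close>.\<close>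

lemma coker_built:
  assumes G: "cplx G d" and C: "\<And>j. coker G d (Suc j) (C j) (q j)"
  shows "\<exists>H. (\<forall>j. H j \<in> fgmod R) \<and>
     (\<forall>j x. x \<in> carrier R \<longrightarrow> nullhomotopic x G d \<longrightarrow> (\<forall>m\<in>carrier (H j). x \<odot>\<^bsub>H j\<^esub> m = \<zero>\<^bsub>H j\<^esub>)) \<and>
     (\<forall>k. \<exists>Zs. length Zs = Suc k \<and> (\<forall>i\<le>k. Zs ! i \<in> syz R i {H (k - i)}) \<and> built Zs (C k))"
proof -
  note mG = cplxD(2)[OF G] and dH = cplxD(3)[OF G] and dd = cplxD(4)[OF G] and G0 = cplxD(5)[OF G]
  have Cf: "C j \<in> fgmod R" and q: "epi (G (Suc j)) (C j) (q j)"
    and qker: "\<And>g. g \<in> carrier (G (Suc j)) \<Longrightarrow> q j g = \<zero>\<^bsub>C j\<^esub> \<longleftrightarrow> g \<in> d (Suc j) ` carrier (G (Suc (Suc j)))" for j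
    using C[of j] by (auto simp: coker_def)
  note mC = module_fgmod[OF Cf] and qH = epi_Hom[OF q]
  have "\<exists>e\<in>Hom (C j) (G j). \<forall>g\<in>carrier (G (Suc j)). e (q j g) = d j g" for j
  proof -
    have "d j g = \<zero>\<^bsub>G j\<^esub>" if "g \<in> carrier (G (Suc j))" "q j g = \<zero>\<^bsub>C j\<^esub>" for g
      using qker[OF that(1)] that(2) dd by auto
    then show ?thesis using Hom_descend[OF q[of j] dH[of j] mG mG mC] by metis
  qed
  then obtain e where e: "\<And>j. e j \<in> Hom (C j) (G j)" "\<And>j g. g \<in> carrier (G (Suc j)) \<Longrightarrow> e j (q j g) = d j g" by metis
  define H where "H j = sub (C j) {c \<in> carrier (C j). e j c = \<zero>\<^bsub>G j\<^esub>}" for j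
  have Hs: "submodule {c \<in> carrier (C j). e j c = \<zero>\<^bsub>G j\<^esub>} R (C j)" for j by (rule submod_ker[OF e(1) mC mG])
  have Hf: "H j \<in> fgmod R" for j unfolding H_def by (rule fgmod_sub[OF Cf Hs])
  have ann: "x \<odot>\<^bsub>H j\<^esub> m = \<zero>\<^bsub>H j\<^esub>" if x: "x \<in> carrier R" "nullhomotopic x G d" and m: "m \<in> carrier (H j)" for j x m
  proof -
    obtain h where h: "\<And>j. h j \<in> Hom (G j) (G (Suc j))"
      "\<And>j g. g \<in> carrier (G (Suc j)) \<Longrightarrow> d (Suc j) (h (Suc j) g) \<oplus>\<^bsub>G (Suc j)\<^esub> h j (d j g) = x \<odot>\<^bsub>G (Suc j)\<^esub> g"
      using x(2) unfolding nullhomotopic_def by blast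
    have mc: "m \<in> carrier (C j)" "e j m = \<zero>\<^bsub>G j\<^esub>" using m by (auto simp: H_def)
    obtain g where g: "g \<in> carrier (G (Suc j))" "q j g = m" using epiE[OF q mc(1)] .
    have "d j g = \<zero>\<^bsub>G j\<^esub>" using e(2)[OF g(1)] mc(2) g(2) by simp
    then have "x \<odot>\<^bsub>G (Suc j)\<^esub> g = d (Suc j) (h (Suc j) g)"
      using h(2)[OF g(1)] Hom_zero[OF h(1) mG mG] Hom_closed[OF dH Hom_closed[OF h(1) g(1)]] mzero_r[OF mG] by simp
    then have "q j (x \<odot>\<^bsub>G (Suc j)\<^esub> g) = \<zero>\<^bsub>C j\<^esub>"
      using qker[of "x \<odot>\<^bsub>G (Suc j)\<^esub> g"] msmult[OF mG x(1) g(1)] Hom_closed[OF h(1) g(1)] by blast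
    then show ?thesis using Hom_smult[OF qH x(1) g(1)] g(2) by (simp add: H_def)
  qed
  have "\<exists>Zs. length Zs = Suc k \<and> (\<forall>i\<le>k. Zs ! i \<in> syz R i {H (k - i)}) \<and> built Zs (C k)" for k
  proof (induction k)
    case 0
    have "e 0 c = \<zero>\<^bsub>G 0\<^esub>" if "c \<in> carrier (C 0)" for c using G0[OF Hom_closed[OF e(1) that]] .
    then have "{c \<in> carrier (C 0). e 0 c = \<zero>\<^bsub>G 0\<^esub>} = carrier (C 0)" by blast
    then have "H 0 = C 0" by (simp add: H_def)
    then show ?case using syz_0[OF Cf] Cf mod_iso_refl retr_refl
      by (intro exI[of _ "[C 0]"]) auto
  next
    case (Suc k)
    then obtain Zs where Zs: "length Zs = Suc k" "\<forall>i\<le>k. Zs ! i \<in> syz R i {H (k - i)}" "built Zs (C k)" by blast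
    have Zf: "set Zs \<subseteq> fgmod R"
      using Zs(1) syz_fgmod[OF Zs(2)[rule_format]] by (auto simp: in_set_conv_nth less_Suc_eq_le)
    define D where "D = d (Suc k) ` carrier (G (Suc (Suc k)))"
    have Ds: "submodule D R (G (Suc k))" unfolding D_def by (rule submod_image[OF dH mG mG submod_carrier[OF mG]])
    have DG: "D \<subseteq> carrier (G (Suc k))" by (rule submod_sub[OF Ds mG])
    define B where "B = sub (G (Suc k)) D"
    have Bf: "B \<in> fgmod R" unfolding B_def by (rule fgmod_sub[OF ffreeD(1)[OF cplxD(1)[OF G]] Ds])
    have "exact3 B (G (Suc k)) (C k) (\<lambda>x. x) (q k)"
      using q qker Hom_incl[OF DG] by (auto simp: exact3_def B_def D_def)
    then have "syz1 B (C k)" unfolding syz1_def using Bf Cf cplxD(1)[OF G] by blast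
    then obtain Ws where Ws: "list_all2 syz1 Ws Zs" "built Ws B" using built_syz1[OF Zs(3) Zf] by blast
    have "q (Suc k) ` carrier (G (Suc (Suc k))) = carrier (C (Suc k))" using q[of "Suc k"] by (simp add: epi_def)
    then have "e (Suc k) ` carrier (C (Suc k)) = (\<lambda>g. e (Suc k) (q (Suc k) g)) ` carrier (G (Suc (Suc k)))"
      by (metis image_image)
    also have "\<dots> = D" unfolding D_def by (rule image_cong) (simp_all add: e(2))
    finally have eD: "e (Suc k) ` carrier (C (Suc k)) = D" .
    have eH: "e (Suc k) \<in> Hom (C (Suc k)) B"
      using e(1)[of "Suc k"] eD by (auto simp: mod_hom_def B_def)
    have "epi (C (Suc k)) B (e (Suc k))" using eH eD by (simp add: epi_def B_def)
    from exact3_kernel[OF this mC module_fgmod[OF Bf]]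
    have "short_exact R (H (Suc k)) (C (Suc k)) B" by (auto simp: short_exact_iff H_def B_def)
    moreover obtain W Ws' where "Ws = W # Ws'" using Ws(1) Zs(1) by (cases Ws) auto
    ultimately have b: "built (H (Suc k) # Ws) (C (Suc k))"
      using Ws(2) Cf Bf retr_refl by auto
    have "(H (Suc k) # Ws) ! i \<in> syz R i {H (Suc k - i)}" if "i \<le> Suc k" for i
    proof (cases i)
      case 0
      then show ?thesis using syz_0[OF Hf] Hf mod_iso_refl by auto
    next
      case (Suc i')
      then have s: "syz1 (Ws ! i') (Zs ! i')" using Ws(1) that Zs(1) by (auto simp: list_all2_conv_all_nth)
      have "Zs ! i' \<in> syz R i' {H (k - i')}" using Zs(2) Suc that by simp
      then show ?thesis using syz_SucI[OF Hf _ s] Suc by simp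
    qed
    then show ?case using b Ws(1) Zs(1) by (intro exI[of _ "H (Suc k) # Ws"]) (auto dest: list_all2_lengthD)
  qed
  then show ?thesis using Hf ann by blast
qed

section \<open>The Koszul complex on a free resolution\<close>

text \<open>The cone of multiplication by \<^term>\<open>x\<close> on a complex; in degree -1 its term is a sum of two copies of the
  trivial module, which is again trivial.\<close>

definition cone :: "(nat \<Rightarrow> 'a lmodule) \<Rightarrow> nat \<Rightarrow> 'a lmodule" where
  "cone G j = bsum (G j) (G (j - 1))"

definition cone_d :: "'a \<Rightarrow> (nat \<Rightarrow> 'a lmodule) \<Rightarrow> (nat \<Rightarrow> 'a list \<Rightarrow> 'a list) \<Rightarrow> nat \<Rightarrow> 'a list \<Rightarrow> 'a list" where
  "cone_d x G d j u = (case j of 0 \<Rightarrow> pair \<zero>\<^bsub>G 0\<^esub> \<zero>\<^bsub>G 0\<^esub>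
     | Suc k \<Rightarrow> pair (d j (pfst u) \<oplus>\<^bsub>G j\<^esub> x \<odot>\<^bsub>G j\<^esub> psnd u) (\<ominus>\<^bsub>G k\<^esub> d k (psnd u)))"

context
  fixes G d x assumes G: "cplx G d" and x: "x \<in> carrier R"
begin

lemmas module_G = cplxD(2)[OF G] and d_Hom = cplxD(3)[OF G] and d_d = cplxD(4)[OF G] and G0_trivial = cplxD(5)[OF G]

lemma cone_SucE:
  assumes "u \<in> carrier (cone G (Suc j))"
  obtains a b where "a \<in> carrier (G (Suc j))" "b \<in> carrier (G j)" "u = pair a b"
  using assms by (auto simp: cone_def elim: bsumE)

lemma cone_d_Hom: "cone_d x G d j \<in> Hom (cone G (Suc j)) (cone G j)"
proof (cases j)
  case 0
  then show ?thesis using Hom_zero_map[OF module_bsum[OF module_G[of 0] module_G[of 0]]] by (simp add: cone_d_def[abs_def] cone_def)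
next
  case (Suc k)
  have 1: "(\<lambda>u. d (Suc k) (pfst u) \<oplus>\<^bsub>G (Suc k)\<^esub> x \<odot>\<^bsub>G (Suc k)\<^esub> psnd u) \<in> Hom (cone G (Suc j)) (G (Suc k))"
    unfolding cone_def using Suc Hom_comp[OF Hom_pfst d_Hom[of "Suc k"]] Hom_psnd[of _ "G (Suc k)"]
    by (intro Hom_plus Hom_scale module_G x) auto
  have 2: "(\<lambda>u. \<ominus>\<^bsub>G k\<^esub> d k (psnd u)) \<in> Hom (cone G (Suc j)) (G k)"
    unfolding cone_def using Suc Hom_comp[OF Hom_psnd d_Hom[of "k"]]
    by (intro Hom_uminus module_G) auto
  show ?thesis using Hom_pair[OF 1 2] by (simp add: cone_d_def[abs_def] cone_def Suc)
qed

lemma cone_cplx: "cplx (cone G) (cone_d x G d)"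
  unfolding cplx_def
proof (intro conjI allI ballI)
  show "ffree (cone G j)" for j unfolding cone_def by (intro ffree_bsum cplxD(1)[OF G])
  show "cone_d x G d j \<in> Hom (cone G (Suc j)) (cone G j)" for j by (rule cone_d_Hom)
  show "carrier (cone G 0) = {\<zero>\<^bsub>cone G 0\<^esub>}"
  proof
    show "carrier (cone G 0) \<subseteq> {\<zero>\<^bsub>cone G 0\<^esub>}"
    proof
      fix u assume "u \<in> carrier (cone G 0)"
      then obtain a b where "a \<in> carrier (G 0)" "b \<in> carrier (G 0)" "u = pair a b"
        unfolding cone_def by (auto elim: bsumE)
      then show "u \<in> {\<zero>\<^bsub>cone G 0\<^esub>}" using G0_trivial[of a] G0_trivial[of b] by (simp add: cone_def)
    qed
    show "{\<zero>\<^bsub>cone G 0\<^esub>} \<subseteq> carrier (cone G 0)" using mzero[OF module_G[of 0]] by (simp add: cone_def)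
  qed
  fix j u assume "u \<in> carrier (cone G (Suc (Suc j)))"
  then obtain a b where u: "a \<in> carrier (G (Suc (Suc j)))" "b \<in> carrier (G (Suc j))" "u = pair a b" by (rule cone_SucE)
  show "cone_d x G d j (cone_d x G d (Suc j) u) = \<zero>\<^bsub>cone G j\<^esub>"
  proof (cases j)
    case (Suc k)
    note b = u(2)[unfolded Suc] and a = u(1)[unfolded Suc]
    note da = Hom_closed[OF d_Hom a] and db = Hom_closed[OF d_Hom b]
    note xb = msmult[OF module_G x b]
    show ?thesis using a b da db xb x module_G d_d[OF a] d_d[OF b] Hom_add[OF d_Hom da xb] Hom_smult[OF d_Hom x b]
      Hom_neg[OF d_Hom module_G module_G db]
      by (simp add: u(3) Suc cone_d_def cone_def mlin)
  qed (simp add: cone_d_def cone_def)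
qed

text \<open>Exactness of a cone at the level of elements: if the complex is exact at \<open>G (Suc (Suc j))\<close>, subtracting the boundary
  of a suitable \<open>pair 0 b'\<close> removes the second component of a cycle, and the first one is then a boundary.\<close>

lemma cone_preimage:
  assumes a: "a \<in> carrier (G (Suc (Suc j)))" and b: "b \<in> d (Suc j) ` carrier (G (Suc (Suc j)))"
    and eq: "d (Suc j) a \<oplus>\<^bsub>G (Suc j)\<^esub> x \<odot>\<^bsub>G (Suc j)\<^esub> b = \<zero>\<^bsub>G (Suc j)\<^esub>"
    and ex: "\<And>g. \<lbrakk>g \<in> carrier (G (Suc (Suc j))); d (Suc j) g = \<zero>\<^bsub>G (Suc j)\<^esub>\<rbrakk> \<Longrightarrow> g \<in> d (Suc (Suc j)) ` carrier (G (Suc (Suc (Suc j))))"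
  shows "pair a b \<in> cone_d x G d (Suc (Suc j)) ` carrier (cone G (Suc (Suc (Suc j))))"
proof -
  obtain b0 where b0: "b0 \<in> carrier (G (Suc (Suc j)))" "b = d (Suc j) b0" using b by auto
  note m = module_G[of "Suc (Suc j)"] module_G[of "Suc j"]
  define b' where "b' = \<ominus>\<^bsub>G (Suc (Suc j))\<^esub> b0"
  have b': "b' \<in> carrier (G (Suc (Suc j)))" using mneg[OF m(1) b0(1)] by (simp add: b'_def)
  have db': "\<ominus>\<^bsub>G (Suc j)\<^esub> d (Suc j) b' = b"
    using Hom_neg[OF d_Hom m b0(1)] Hom_closed[OF d_Hom b0(1)] m by (simp add: b'_def b0(2) mlin)
  note xb' = msmult[OF m(1) x b']
  have bG: "b \<in> carrier (G (Suc j))" using Hom_closed[OF d_Hom b0(1)] b0 by simp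
  have dxb: "d (Suc j) (\<ominus>\<^bsub>G (Suc (Suc j))\<^esub> (x \<odot>\<^bsub>G (Suc (Suc j))\<^esub> b')) = x \<odot>\<^bsub>G (Suc j)\<^esub> b"
    using Hom_neg[OF d_Hom m xb'] Hom_smult[OF d_Hom x b'] msmult_neg[OF m(2) x Hom_closed[OF d_Hom b']] db' by simp
  have "d (Suc j) (a \<oplus>\<^bsub>G (Suc (Suc j))\<^esub> \<ominus>\<^bsub>G (Suc (Suc j))\<^esub> (x \<odot>\<^bsub>G (Suc (Suc j))\<^esub> b')) = \<zero>\<^bsub>G (Suc j)\<^esub>"
    using Hom_add[OF d_Hom a mneg[OF m(1) xb']] dxb eq by simp
  then obtain a' where a': "a' \<in> carrier (G (Suc (Suc (Suc j))))"
    "a \<oplus>\<^bsub>G (Suc (Suc j))\<^esub> \<ominus>\<^bsub>G (Suc (Suc j))\<^esub> (x \<odot>\<^bsub>G (Suc (Suc j))\<^esub> b') = d (Suc (Suc j)) a'"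
    using ex[OF madd[OF m(1) a mneg[OF m(1) xb']]] by blast
  have "a = d (Suc (Suc j)) a' \<oplus>\<^bsub>G (Suc (Suc j))\<^esub> x \<odot>\<^bsub>G (Suc (Suc j))\<^esub> b'"
    unfolding a'(2)[symmetric] using a xb' m by (simp add: mlin)
  then have "pair a b = cone_d x G d (Suc (Suc j)) (pair a' b')" using db' by (simp add: cone_d_def)
  then show ?thesis using a' b' by (intro image_eqI) (auto simp: cone_def)
qed

text \<open>A homotopy on the complex acts diagonally on the cone, with a sign on the shifted copy.\<close>

lemma nullhomotopic_cone:
  assumes y: "y \<in> carrier R" and n: "nullhomotopic y G d"
  shows "nullhomotopic y (cone G) (cone_d x G d)"
proof -
  obtain h where h: "\<And>j. h j \<in> Hom (G j) (G (Suc j))"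
    "\<And>j g. g \<in> carrier (G (Suc j)) \<Longrightarrow> d (Suc j) (h (Suc j) g) \<oplus>\<^bsub>G (Suc j)\<^esub> h j (d j g) = y \<odot>\<^bsub>G (Suc j)\<^esub> g"
    using n unfolding nullhomotopic_def by blast
  define h' where "h' j u = (case j of 0 \<Rightarrow> \<zero>\<^bsub>cone G 1\<^esub> | Suc k \<Rightarrow> pair (h j (pfst u)) (\<ominus>\<^bsub>G j\<^esub> h k (psnd u)))" for j u
  have h'H: "h' j \<in> Hom (cone G j) (cone G (Suc j))" for j
  proof (cases j)
    case 0
    then show ?thesis using Hom_zero_map[OF module_bsum[OF module_G[of 1] module_G[of 0]]] by (simp add: h'_def[abs_def] cone_def)
  next
    case (Suc k)
    have "(\<lambda>u. pair (h j (pfst u)) (\<ominus>\<^bsub>G j\<^esub> h k (psnd u))) \<in> Hom (bsum (G j) (G k)) (bsum (G (Suc j)) (G j))"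
      using Hom_comp[OF Hom_pfst h(1)[of j]] Hom_comp[OF Hom_psnd h(1)[of k]] Suc
      by (intro Hom_pair Hom_uminus module_G) auto
    then show ?thesis by (simp add: h'_def[abs_def] cone_def Suc)
  qed
  have "cone_d x G d (Suc j) (h' (Suc j) u) \<oplus>\<^bsub>cone G (Suc j)\<^esub> h' j (cone_d x G d j u) = y \<odot>\<^bsub>cone G (Suc j)\<^esub> u"
    if u0: "u \<in> carrier (cone G (Suc j))" for j u
  proof -
    obtain a b where u: "a \<in> carrier (G (Suc j))" "b \<in> carrier (G j)" "u = pair a b" using cone_SucE[OF u0] .
    note ha = Hom_closed[OF h(1) u(1)] and hb = Hom_closed[OF h(1) u(2)]
    note dha = Hom_closed[OF d_Hom ha] and dhb = Hom_closed[OF d_Hom hb] and xhb = msmult[OF module_G x hb]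
    show ?thesis
    proof (cases j)
      case 0
      have b: "b = \<zero>\<^bsub>G 0\<^esub>" using u(2) G0_trivial 0 by simp
      have "h 0 b = \<zero>\<^bsub>G (Suc 0)\<^esub>" using Hom_zero[OF h(1) module_G module_G] b by simp
      moreover have "d (Suc 0) (h (Suc 0) a) = y \<odot>\<^bsub>G (Suc 0)\<^esub> a"
      proof -
        have "d 0 a = \<zero>\<^bsub>G 0\<^esub>" using G0_trivial Hom_closed[OF d_Hom] u(1) 0 by simp
        then show ?thesis using h(2)[of a 0] u(1) 0 Hom_zero[OF h(1) module_G module_G, of 0] mzero_r[OF module_G] dha[unfolded 0] by simp
      qed
      moreover have "d 0 \<zero>\<^bsub>G (Suc 0)\<^esub> = \<zero>\<^bsub>G 0\<^esub>" using Hom_zero[OF d_Hom module_G module_G] .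
      ultimately show ?thesis
        using msmult[OF module_G[of "Suc 0"] y] u(1) x y module_G[of "Suc 0"] module_G[of 0] unfolding 0
        by (simp add: u(3) b h'_def cone_d_def cone_def mlin)
    next
      case (Suc k)
      note a = u(1)[unfolded Suc] and b = u(2)[unfolded Suc]
      note da = Hom_closed[OF d_Hom a] and db = Hom_closed[OF d_Hom b] and xb = msmult[OF module_G x b]
      note hda = Hom_closed[OF h(1) da] and hdb = Hom_closed[OF h(1) db]
      have 1: "h (Suc k) (d (Suc k) a \<oplus>\<^bsub>G (Suc k)\<^esub> x \<odot>\<^bsub>G (Suc k)\<^esub> b) = h (Suc k) (d (Suc k) a) \<oplus>\<^bsub>G (Suc (Suc k))\<^esub> x \<odot>\<^bsub>G (Suc (Suc k))\<^esub> h (Suc k) b"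
        using Hom_add[OF h(1) da xb] Hom_smult[OF h(1) x b] by simp
      have 2: "d (Suc k) (\<ominus>\<^bsub>G (Suc (Suc k))\<^esub> h (Suc k) b) = \<ominus>\<^bsub>G (Suc k)\<^esub> d (Suc k) (h (Suc k) b)"
        using Hom_neg[OF d_Hom module_G module_G hb[unfolded Suc]] .
      have 3: "h k (\<ominus>\<^bsub>G k\<^esub> d k b) = \<ominus>\<^bsub>G (Suc k)\<^esub> h k (d k b)" using Hom_neg[OF h(1) module_G module_G db] .
      show ?thesis
        using h(2)[OF a, symmetric] h(2)[OF b, symmetric] ha[unfolded Suc] hb[unfolded Suc] dha[unfolded Suc] dhb[unfolded Suc] xhb[unfolded Suc] hda hdb
          module_G[of "Suc (Suc k)"] module_G[of "Suc k"] x
        by (simp add: u(3) Suc h'_def cone_d_def cone_def 1 2 3 mlin)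
    qed
  qed
  then show ?thesis using h'H unfolding nullhomotopic_def by blast
qed

text \<open>The homotopy moves the first component to the shifted copy: this is why a Koszul complex is annihilated by
  its elements up to homotopy.\<close>

lemma nullhomotopic_cone_self: "nullhomotopic x (cone G) (cone_d x G d)"
proof -
  define h' where "h' j u = (case j of 0 \<Rightarrow> \<zero>\<^bsub>cone G 1\<^esub> | Suc k \<Rightarrow> pair \<zero>\<^bsub>G (Suc j)\<^esub> (pfst u))" for j u
  have h'H: "h' j \<in> Hom (cone G j) (cone G (Suc j))" for j
  proof (cases j)
    case 0
    then show ?thesis using Hom_zero_map[OF module_bsum[OF module_G[of 1] module_G[of 0]]] by (simp add: h'_def[abs_def] cone_def)
  next
    case (Suc k)
    have "(\<lambda>u. pair \<zero>\<^bsub>G (Suc j)\<^esub> (pfst u)) \<in> Hom (bsum (G j) (G k)) (bsum (G (Suc j)) (G j))"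
      by (intro Hom_pair Hom_zero_map module_G Hom_pfst)
    then show ?thesis by (simp add: h'_def[abs_def] cone_def Suc)
  qed
  have "cone_d x G d (Suc j) (h' (Suc j) u) \<oplus>\<^bsub>cone G (Suc j)\<^esub> h' j (cone_d x G d j u) = x \<odot>\<^bsub>cone G (Suc j)\<^esub> u"
    if u0: "u \<in> carrier (cone G (Suc j))" for j u
  proof -
    obtain a b where u: "a \<in> carrier (G (Suc j))" "b \<in> carrier (G j)" "u = pair a b" using cone_SucE[OF u0] .
    have d0: "d (Suc j) \<zero>\<^bsub>G (Suc (Suc j))\<^esub> = \<zero>\<^bsub>G (Suc j)\<^esub>" for j by (rule Hom_zero[OF d_Hom module_G module_G])
    show ?thesis
    proof (cases j)
      case 0
      have b: "b = \<zero>\<^bsub>G 0\<^esub>" using u(2) G0_trivial 0 by simp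
      have "d 0 a = \<zero>\<^bsub>G 0\<^esub>" using G0_trivial Hom_closed[OF d_Hom] u(1) 0 by simp
      then show ?thesis
        using msmult[OF module_G[of "Suc 0"] x] u(1) x module_G[of "Suc 0"] module_G[of 0] d0[of 0] unfolding 0
        by (simp add: u(3) b h'_def cone_d_def cone_def mlin)
    next
      case (Suc k)
      note a = u(1)[unfolded Suc] and b = u(2)[unfolded Suc]
      note da = Hom_closed[OF d_Hom a] and xb = msmult[OF module_G x b] and xa = msmult[OF module_G x a]
      show ?thesis
        using da xb xa a b x module_G[of "Suc (Suc k)"] module_G[of "Suc k"] d0[of "Suc k"]
        by (simp add: u(3) Suc h'_def cone_d_def cone_def mlin)
    qed
  qed
  then show ?thesis using h'H unfolding nullhomotopic_def by blast
qed

end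

text \<open>Induction on the number of elements, starting with a free resolution of \<^term>\<open>M\<close>, which is exact in positive
  degrees and has cokernel \<^term>\<open>M\<close> in degree 0. If the complex is exact above degree \<^term>\<open>n\<close> and has cokernel
  \<^term>\<open>N\<close> in degree \<^term>\<open>n\<close>, then the cone of \<^term>\<open>x n\<close> is exact above degree \<^term>\<open>Suc n\<close>, and its cokernel in
  that degree is the pullback of the surjection \<open>G (Suc n) \<rightarrow> N\<close> along multiplication by \<^term>\<open>x n\<close>. An embedding
  of \<^term>\<open>M\<close> into \<^term>\<open>N\<close> followed by \<^term>\<open>x n\<close> lifts to \<^term>\<open>G (Suc n)\<close>, because \<^term>\<open>x n\<close> is a free
  factor of \<^term>\<open>M\<close>; so the embedding lifts to the pullback, and it is still split.\<close>

lemma koszul: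
  assumes M: "M \<in> fgmod R" and x: "\<And>i. i < n \<Longrightarrow> free_factor M (x i)"
  shows "\<exists>G d N q. cplx G d \<and> coker G d (Suc n) N q \<and> retr M N \<and> (\<forall>i<n. nullhomotopic (x i) G d) \<and>
    (\<forall>j>n. \<forall>g\<in>carrier (G (Suc j)). d j g = \<zero>\<^bsub>G j\<^esub> \<longrightarrow> g \<in> d (Suc j) ` carrier (G (Suc (Suc j))))"
  using x
proof (induction n)
  case 0
  obtain P d where "free_resolution R M P d" using ex_free_resolution[OF M] by blast
  then have P: "\<And>j. ffree (P j)" and d0: "d 0 \<in> Hom (P 0) M" and dS: "\<And>j. d (Suc j) \<in> Hom (P (Suc j)) (P j)"
    and s: "d 0 ` carrier (P 0) = carrier M" and k0: "d 1 ` carrier (P 1) = a_kernel (P 0) M (d 0)"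
    and kS: "\<And>j. d (Suc (Suc j)) ` carrier (P (Suc (Suc j))) = a_kernel (P (Suc j)) (P j) (d (Suc j))"
    by (auto simp: free_resolution_def ffree_def)
  obtain Z s y where Z: "Z \<in> fgmod R" "basis Z 0 s y" using ex_free_rank by blast
  note mZ = module_fgmod[OF Z(1)]
  have "m = \<zero>\<^bsub>Z\<^esub>" if "m \<in> carrier Z" for m
  proof -
    have "lc Z 0 (\<lambda>i. s i m) y = m" using Z(2) that unfolding basis_def by blast
    then show ?thesis by simp
  qed
  then have Zc: "carrier Z = {\<zero>\<^bsub>Z\<^esub>}" using mzero[OF mZ] by blast
  have fZ: "ffree Z" unfolding ffree_def using Z(1) basis_free[OF mZ Z(2)] by simp
  define G where "G j = (case j of 0 \<Rightarrow> Z | Suc k \<Rightarrow> P k)" for j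
  define e where "e j = (case j of 0 \<Rightarrow> (\<lambda>_. \<zero>\<^bsub>Z\<^esub>) | Suc k \<Rightarrow> d (Suc k))" for j
  have Gs: "G 0 = Z" "G (Suc k) = P k" "e 0 = (\<lambda>_. \<zero>\<^bsub>Z\<^esub>)" "e (Suc k) = d (Suc k)" for k by (simp_all add: G_def e_def)
  have img: "d (Suc (Suc j)) g \<in> carrier (P (Suc j)) \<and> d (Suc j) (d (Suc (Suc j)) g) = \<zero>\<^bsub>P j\<^esub>"
    if "g \<in> carrier (P (Suc (Suc j)))" for g j
    using kS[of j] that unfolding a_kernel_eq by blast
  have "cplx G e" unfolding cplx_def
  proof (intro conjI allI ballI)
    show "ffree (G j)" for j using fZ P by (cases j) (auto simp: Gs)
    show "e j \<in> Hom (G (Suc j)) (G j)" for j using Hom_zero_map[OF mZ] dS by (cases j) (auto simp: Gs)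
    show "carrier (G 0) = {\<zero>\<^bsub>G 0\<^esub>}" using Zc by (simp add: Gs)
    show "e j (e (Suc j) g) = \<zero>\<^bsub>G j\<^esub>" if "g \<in> carrier (G (Suc (Suc j)))" for j g
      using that img by (cases j) (auto simp: Gs)
  qed
  moreover have "coker G e (Suc 0) M (d 0)"
    using M d0 s k0 by (auto simp: coker_def Gs epi_def a_kernel_eq)
  moreover have "g \<in> e (Suc j) ` carrier (G (Suc (Suc j)))"
    if j: "j > 0" and g: "g \<in> carrier (G (Suc j))" "e j g = \<zero>\<^bsub>G j\<^esub>" for j g
  proof -
    obtain k where k: "j = Suc k" using j by (cases j) auto
    show ?thesis using g kS[of k] by (auto simp: k Gs a_kernel_eq)
  qed
  ultimately show ?case using retr_refl by blast
next
  case (Suc n)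
  then obtain G d N q where G: "cplx G d" and C: "coker G d (Suc n) N q" and r: "retr M N"
    and nh: "\<forall>i<n. nullhomotopic (x i) G d"
    and ex: "\<forall>j>n. \<forall>g\<in>carrier (G (Suc j)). d j g = \<zero>\<^bsub>G j\<^esub> \<longrightarrow> g \<in> d (Suc j) ` carrier (G (Suc (Suc j)))"
    by (metis less_SucI)
  define z where "z = x n"
  have zf: "free_factor M z" using Suc.prems by (simp add: z_def)
  have z: "z \<in> carrier R" using free_factor_carrier[OF zf] .
  note mG = cplxD(2)[OF G] and dH = cplxD(3)[OF G] and dd = cplxD(4)[OF G]
  have Nf: "N \<in> fgmod R" and q: "epi (G (Suc n)) N q"
    and qker: "\<And>g. g \<in> carrier (G (Suc n)) \<Longrightarrow> q g = \<zero>\<^bsub>N\<^esub> \<longleftrightarrow> g \<in> d (Suc n) ` carrier (G (Suc (Suc n)))"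
    using C by (auto simp: coker_def)
  note mN = module_fgmod[OF Nf] and mM = module_fgmod[OF M] and qH = epi_Hom[OF q]
  \<comment> \<open>The pullback \<^term>\<open>W\<close> of \<^term>\<open>q\<close> along multiplication by \<^term>\<open>z\<close>.\<close>
  define T where "T = bsum (G (Suc n)) N"
  have Tf: "T \<in> fgmod R" unfolding T_def by (rule bsum_fgmod[OF ffreeD(1)[OF cplxD(1)[OF G]] Nf])
  note mT = module_fgmod[OF Tf]
  define W where "W = {u \<in> carrier T. q (pfst u) \<oplus>\<^bsub>N\<^esub> \<ominus>\<^bsub>N\<^esub> (z \<odot>\<^bsub>N\<^esub> psnd u) = \<zero>\<^bsub>N\<^esub>}"
  have Ws: "submodule W R T" unfolding W_def T_def
    by (rule submod_ker[OF _ mT[unfolded T_def] mN])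
      (intro Hom_plus Hom_uminus Hom_scale Hom_comp[OF Hom_pfst qH] Hom_psnd mN z)
  define N' where "N' = sub T W"
  have N'f: "N' \<in> fgmod R" unfolding N'_def by (rule fgmod_sub[OF Tf Ws])
  have Wiff: "pair a b \<in> W \<longleftrightarrow> a \<in> carrier (G (Suc n)) \<and> b \<in> carrier N \<and> q a = z \<odot>\<^bsub>N\<^esub> b" for a b
    using mdiff_zero[OF mN] Hom_closed[OF qH, of a] msmult[OF mN z, of b] by (auto simp: W_def T_def)
  define q' where "q' u = pair (d (Suc n) (pfst u) \<oplus>\<^bsub>G (Suc n)\<^esub> z \<odot>\<^bsub>G (Suc n)\<^esub> psnd u) (q (psnd u))" for u
  have cS: "cone G (Suc (Suc n)) = bsum (G (Suc (Suc n))) (G (Suc n))" by (simp add: cone_def)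
  have q'T: "q' \<in> Hom (cone G (Suc (Suc n))) T"
    unfolding q'_def cS T_def
    by (intro Hom_pair Hom_plus Hom_scale Hom_comp[OF Hom_pfst dH] Hom_psnd Hom_comp[OF Hom_psnd qH] mG z)
  have qd: "q (d (Suc n) a) = \<zero>\<^bsub>N\<^esub>" if "a \<in> carrier (G (Suc (Suc n)))" for a
    using qker[OF Hom_closed[OF dH that]] that by blast
  have q'W: "q' (pair a b) \<in> W" if ab: "a \<in> carrier (G (Suc (Suc n)))" "b \<in> carrier (G (Suc n))" for a b
  proof -
    note da = Hom_closed[OF dH ab(1)] and zb = msmult[OF mG z ab(2)] and qb = Hom_closed[OF qH ab(2)]
    show ?thesis using Hom_add[OF qH da zb] Hom_smult[OF qH z ab(2)] qd[OF ab(1)] mN msmult[OF mN z qb] qb madd[OF mG da zb]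
      by (simp add: q'_def Wiff mlin)
  qed
  have q'H: "q' \<in> Hom (cone G (Suc (Suc n))) N'"
    using q'T q'W by (auto simp: mod_hom_def N'_def cS elim!: bsumE)
  have q'e: "epi (cone G (Suc (Suc n))) N' q'"
  proof (rule epiI[OF q'H])
    fix u assume "u \<in> carrier N'"
    then have uW: "u \<in> W" by (simp add: N'_def)
    then have "u \<in> carrier (bsum (G (Suc n)) N)" by (simp add: W_def T_def)
    then obtain g \<nu> where u: "u = pair g \<nu>" by (rule bsumE)
    have g: "g \<in> carrier (G (Suc n))" "\<nu> \<in> carrier N" "q g = z \<odot>\<^bsub>N\<^esub> \<nu>" using uW by (auto simp: u Wiff)
    obtain b where b: "b \<in> carrier (G (Suc n))" "q b = \<nu>" using epiE[OF q g(2)] .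
    note zb = msmult[OF mG z b(1)]
    have "q (g \<oplus>\<^bsub>G (Suc n)\<^esub> \<ominus>\<^bsub>G (Suc n)\<^esub> (z \<odot>\<^bsub>G (Suc n)\<^esub> b)) = \<zero>\<^bsub>N\<^esub>"
      using Hom_add[OF qH g(1) mneg[OF mG zb]] Hom_neg[OF qH mG mN zb] Hom_smult[OF qH z b(1)] b(2) g(3) mneg_r[OF mN msmult[OF mN z g(2)]] by simp
    then obtain a where a: "a \<in> carrier (G (Suc (Suc n)))" "g \<oplus>\<^bsub>G (Suc n)\<^esub> \<ominus>\<^bsub>G (Suc n)\<^esub> (z \<odot>\<^bsub>G (Suc n)\<^esub> b) = d (Suc n) a"
      using qker[OF madd[OF mG g(1) mneg[OF mG zb]]] by blast
    have "d (Suc n) a \<oplus>\<^bsub>G (Suc n)\<^esub> z \<odot>\<^bsub>G (Suc n)\<^esub> b = g"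
      unfolding a(2)[symmetric] using g(1) zb mG[of "Suc n"] by (simp add: mlin)
    then show "\<exists>v\<in>carrier (cone G (Suc (Suc n))). q' v = u"
      using a b by (intro bexI[of _ "pair a b"]) (auto simp: q'_def u cS)
  qed
  have exn: "g \<in> d (Suc (Suc n)) ` carrier (G (Suc (Suc (Suc n))))"
    if "g \<in> carrier (G (Suc (Suc n)))" "d (Suc n) g = \<zero>\<^bsub>G (Suc n)\<^esub>" for g using ex that by auto
  have ker': "q' v = \<zero>\<^bsub>N'\<^esub> \<longleftrightarrow> v \<in> cone_d z G d (Suc (Suc n)) ` carrier (cone G (Suc (Suc (Suc n))))"
    if v: "v \<in> carrier (cone G (Suc (Suc n)))" for v
  proof
    obtain a b where ab: "a \<in> carrier (G (Suc (Suc n)))" "b \<in> carrier (G (Suc n))" "v = pair a b"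
      using v unfolding cS by (rule bsumE)
    assume "q' v = \<zero>\<^bsub>N'\<^esub>"
    then have "d (Suc n) a \<oplus>\<^bsub>G (Suc n)\<^esub> z \<odot>\<^bsub>G (Suc n)\<^esub> b = \<zero>\<^bsub>G (Suc n)\<^esub>" "q b = \<zero>\<^bsub>N\<^esub>"
      by (simp_all add: ab q'_def N'_def T_def)
    then show "v \<in> cone_d z G d (Suc (Suc n)) ` carrier (cone G (Suc (Suc (Suc n))))"
      unfolding ab(3) using cone_preimage[OF G z ab(1) _ _ exn] qker[OF ab(2)] by blast
  next
    assume "v \<in> cone_d z G d (Suc (Suc n)) ` carrier (cone G (Suc (Suc (Suc n))))"
    then obtain a b where ab: "a \<in> carrier (G (Suc (Suc (Suc n))))" "b \<in> carrier (G (Suc (Suc n)))"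
      and vab: "v = cone_d z G d (Suc (Suc n)) (pair a b)"
      by (auto simp: cone_def elim!: bsumE)
    note da = Hom_closed[OF dH ab(1)] and zb = msmult[OF mG z ab(2)] and db = Hom_closed[OF dH ab(2)]
    have "d (Suc n) (d (Suc (Suc n)) a \<oplus>\<^bsub>G (Suc (Suc n))\<^esub> z \<odot>\<^bsub>G (Suc (Suc n))\<^esub> b) = z \<odot>\<^bsub>G (Suc n)\<^esub> d (Suc n) b"
      using Hom_add[OF dH da zb] dd[OF ab(1)] Hom_smult[OF dH z ab(2)] mzero_l[OF mG msmult[OF mG z db]] by simp
    moreover have "q (\<ominus>\<^bsub>G (Suc n)\<^esub> d (Suc n) b) = \<zero>\<^bsub>N\<^esub>"
      using Hom_neg[OF qH mG mN db] qd[OF ab(2)] mneg_zero[OF mN] by simp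
    ultimately show "q' v = \<zero>\<^bsub>N'\<^esub>"
      using msmult_neg[OF mG z db] mneg_r[OF mG msmult[OF mG z db]]
      by (simp add: vab cone_d_def q'_def N'_def T_def)
  qed
  have C': "coker (cone G) (cone_d z G d) (Suc (Suc n)) N' q'"
    using N'f q'e ker' by (auto simp: coker_def)
  obtain i s where i: "i \<in> Hom M N" and s: "s \<in> Hom N M" and si: "\<And>m. m \<in> carrier M \<Longrightarrow> s (i m) = m"
    using r by (auto simp: retr_def)
  obtain l where l: "l \<in> Hom M (G (Suc n))" "\<forall>m\<in>carrier M. q (l m) = z \<odot>\<^bsub>N\<^esub> i m"
    using free_factor_lift[OF zf q i mM mG mN] by blast
  have "(\<lambda>m. pair (l m) (i m)) \<in> Hom M N'"
    using Hom_pair[OF l(1) i] l(2) Hom_closed[OF l(1)] Hom_closed[OF i]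
    by (auto simp: mod_hom_def N'_def T_def Wiff)
  moreover have "(\<lambda>u. s (psnd u)) \<in> Hom N' M"
    using Hom_comp[OF Hom_psnd s] submod_sub[OF Ws mT] unfolding N'_def T_def by (intro Hom_restrict) auto
  ultimately have "retr M N'" by (rule retrI) (simp add: si)
  moreover have "nullhomotopic (x i) (cone G) (cone_d z G d)" if "i < Suc n" for i
  proof (cases "i = n")
    case True
    then show ?thesis using nullhomotopic_cone_self[OF G z] by (simp add: z_def)
  next
    case False
    then show ?thesis using nullhomotopic_cone[OF G z free_factor_carrier[OF Suc.prems[OF that]]] nh that by simp
  qed
  moreover have "v \<in> cone_d z G d (Suc j) ` carrier (cone G (Suc (Suc j)))"
    if j: "j > Suc n" and v: "v \<in> carrier (cone G (Suc j))" "cone_d z G d j v = \<zero>\<^bsub>cone G j\<^esub>" for j v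
  proof -
    obtain k where k: "j = Suc k" "k > n" using j by (cases j) auto
    obtain a b where ab: "a \<in> carrier (G (Suc j))" "b \<in> carrier (G j)" "v = pair a b" using cone_SucE[OF G z v(1)] .
    note a = ab(1)[unfolded k] and b = ab(2)[unfolded k]
    have 0: "d (Suc k) a \<oplus>\<^bsub>G (Suc k)\<^esub> z \<odot>\<^bsub>G (Suc k)\<^esub> b = \<zero>\<^bsub>G (Suc k)\<^esub>" "\<ominus>\<^bsub>G k\<^esub> d k b = \<zero>\<^bsub>G k\<^esub>"
      using v(2) by (simp_all add: ab(3) k cone_d_def cone_def)
    have "d k b = \<zero>\<^bsub>G k\<^esub>" using 0(2) Hom_closed[OF dH b] mneg_neg[OF mG, of "d k b" k] mneg_zero[OF mG, of k] by simp
    then have b': "b \<in> d (Suc k) ` carrier (G (Suc (Suc k)))" using ex k(2) b by blast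
    have "g \<in> d (Suc (Suc k)) ` carrier (G (Suc (Suc (Suc k))))"
      if "g \<in> carrier (G (Suc (Suc k)))" "d (Suc k) g = \<zero>\<^bsub>G (Suc k)\<^esub>" for g using ex k(2) that by auto
    then show ?thesis unfolding ab(3) k(1) by (rule cone_preimage[OF G z a b' 0(1)])
  qed
  ultimately show ?case using cone_cplx[OF G z] C' by blast
qed

end

section \<open>Localization\<close>

context cring
begin

lemma lc_submod:
  assumes "module R M" "submodule N R M" "\<And>i. i < r \<Longrightarrow> c i \<in> carrier R" "\<And>i. i < r \<Longrightarrow> y i \<in> N"
  shows "lc M r c y \<in> N"
  using assms(3-) by (induction r) (simp_all add: submod[OF assms(2,1)])

lemma submod_equalizer: "module R M \<Longrightarrow> f \<in> Hom M A \<Longrightarrow> g \<in> Hom M A \<Longrightarrow> module R A \<Longrightarrow>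
   submodule {m \<in> carrier M. f m = g m} R M"
  by (rule submodI) (auto simp: mclosed Hom_simps)

text \<open>Gaussian elimination with the last pivot: since the off-diagonal entries lie in the prime \<^term>\<open>p\<close> and the pivot does not,
  the reduced matrix has the same shape. Each step multiplies the rows by the pivot, and the pivots are collected in
  the multiplier.\<close>

lemma diagonal_mod_prime_injective:
  assumes p: "primeideal p R"
    and S: "\<And>i j. \<lbrakk>i < n; j < n\<rbrakk> \<Longrightarrow> S i j \<in> carrier R" "\<And>i. i < n \<Longrightarrow> S i i \<notin> p"
      "\<And>i j. \<lbrakk>i < n; j < n; i \<noteq> j\<rbrakk> \<Longrightarrow> S i j \<in> p"
    and c: "\<And>j. j < n \<Longrightarrow> c j \<in> carrier R" and eq: "\<And>i. i < n \<Longrightarrow> lc (ring_mod R) n (S i) c = \<zero>"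
  shows "\<exists>w\<in>carrier R - p. \<forall>j<n. w \<otimes> c j = \<zero>"
  using S c eq
proof (induction n arbitrary: S)
  case 0
  interpret p: primeideal p R by (rule p)
  have "\<one> \<notin> p" using p.I_notcarr p.one_imp_carrier by auto
  then show ?case by auto
next
  case (Suc n)
  interpret p: primeideal p R by (rule p)
  note m = module_ring_mod
  let ?a = "S n n"
  define T where "T i j = ?a \<otimes> S i j \<oplus> \<ominus> (S i n \<otimes> S n j)" for i j
  have aR: "?a \<in> carrier R" "?a \<notin> p" using Suc.prems by auto
  have SR: "S i j \<in> carrier R" if "i < Suc n" "j < Suc n" for i j using Suc.prems that by auto
  have cR: "c j \<in> carrier R" if "j < Suc n" for j using Suc.prems that by auto
  have T: "T i j \<in> carrier R" if "i < n" "j < n" for i j using SR that aR by (auto simp: T_def)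
  have off: "S i n \<otimes> S n j \<in> p" if "i < n" "j < n" for i j
    using Suc.prems(3)[of i n] SR[of n j] that by (auto intro: p.I_r_closed)
  have diag: "T i i \<notin> p" if i: "i < n" for i
  proof
    assume "T i i \<in> p"
    then have "T i i \<oplus> S i n \<otimes> S n i \<in> p" using off[OF i i] by (rule p.a_closed)
    moreover have "T i i \<oplus> S i n \<otimes> S n i = ?a \<otimes> S i i" using i SR[of i i] SR[of i n] SR[of n i] aR by (simp add: T_def a_assoc l_neg)
    ultimately have "?a \<in> p \<or> S i i \<in> p" using p.I_prime[of ?a "S i i"] aR SR[of i i] i by simp
    then show False using aR Suc.prems(2)[of i] i by simp
  qed
  have offd: "T i j \<in> p" if "i < n" "j < n" "i \<noteq> j" for i j
    unfolding T_def using off[of i j] Suc.prems(3)[of i j] aR that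
    by (auto intro!: p.a_closed p.I_l_closed p.a_inv_closed)
  have row: "lc (ring_mod R) n (S i) c \<oplus> S i n \<otimes> c n = \<zero>" if "i < Suc n" for i
    using Suc.prems(5)[OF that] by simp
  have lcR: "lc (ring_mod R) n (S i) c \<in> carrier R" if "i < Suc n" for i
    using lc_closed[OF m, of n "S i" c] SR cR that by auto
  have lcS: "lc (ring_mod R) n (S i) c = \<ominus> (S i n \<otimes> c n)" if "i < Suc n" for i
    using row[OF that] madd_zero[OF m, of "lc (ring_mod R) n (S i) c" "S i n \<otimes> c n"] lcR[OF that] SR[OF that] cR[of n] by simp
  have "lc (ring_mod R) n (T i) c = \<zero>" if i: "i < n" for i
  proof -
    have "lc (ring_mod R) n (T i) c = lc (ring_mod R) n (\<lambda>j. ?a \<otimes> S i j) c \<oplus> lc (ring_mod R) n (\<lambda>j. \<ominus> (S i n \<otimes> S n j)) c"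
      unfolding T_def using i SR cR aR lc_plus[OF m, of n "\<lambda>j. ?a \<otimes> S i j" "\<lambda>j. \<ominus> (S i n \<otimes> S n j)" c] by auto
    also have "lc (ring_mod R) n (\<lambda>j. ?a \<otimes> S i j) c = ?a \<otimes> lc (ring_mod R) n (S i) c"
      using i SR cR aR lc_smult[OF m, of ?a n "S i" c] by auto
    also have "lc (ring_mod R) n (\<lambda>j. \<ominus> (S i n \<otimes> S n j)) c = \<ominus> lc (ring_mod R) n (\<lambda>j. S i n \<otimes> S n j) c"
      using i SR cR aR lc_uminus[OF m, of n "\<lambda>j. S i n \<otimes> S n j" c] by auto
    also have "lc (ring_mod R) n (\<lambda>j. S i n \<otimes> S n j) c = S i n \<otimes> lc (ring_mod R) n (S n) c"
      using i SR cR aR lc_smult[OF m, of "S i n" n "S n" c] by auto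
    also have "?a \<otimes> lc (ring_mod R) n (S i) c \<oplus> \<ominus> (S i n \<otimes> lc (ring_mod R) n (S n) c) = \<zero>"
      using lcS[of i] lcS[of n] i aR SR[of i n] cR[of n] by (simp add: r_minus m_ac r_neg l_neg)
    finally show ?thesis .
  qed
  then obtain w where w: "w \<in> carrier R - p" "\<forall>j<n. w \<otimes> c j = \<zero>"
    using Suc.IH[of T] T diag offd cR by auto
  have "w \<otimes> lc (ring_mod R) n (S n) c = lc (ring_mod R) n (S n) (\<lambda>j. w \<otimes> c j)"
    using lc_Hom[OF Hom_scale[OF Hom_id m, of w] m m, of n "S n" c] SR cR w by auto
  also have "\<dots> = lc (ring_mod R) n (\<lambda>j. w \<otimes> c j) (S n)" using SR cR w by (intro lc_ring_comm) auto
  also have "\<dots> = \<zero>" using lc_null[OF m, of n "\<lambda>j. w \<otimes> c j" "S n"] w SR by auto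
  finally have "w \<otimes> (?a \<otimes> c n) = \<zero>"
    using lcS[of n] w aR cR[of n] by (metis (no_types, lifting) DiffD1 add.inv_eq_1_iff lessI m_closed r_minus)
  then have "(w \<otimes> ?a) \<otimes> c j = \<zero>" if "j < Suc n" for j
  proof (cases "j = n")
    case False
    then have "w \<otimes> c j = \<zero>" using w that by auto
    then have "?a \<otimes> (w \<otimes> c j) = \<zero>" using aR by simp
    then show ?thesis using w aR cR[OF that] by (simp add: m_ac)
  qed (use w aR cR[of n] in \<open>simp add: m_assoc\<close>)
  moreover have "w \<otimes> ?a \<in> carrier R - p" using w aR p.I_prime[of w ?a] by auto
  ultimately show ?case by blast
qed

end

locale mult_subset = cring R for R (structure) +
  fixes S
  assumes S_carr: "S \<subseteq> carrier R" and S_one: "\<one> \<in> S" and S_mult: "\<And>s t. \<lbrakk>s \<in> S; t \<in> S\<rbrakk> \<Longrightarrow> s \<otimes> t \<in> S"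
begin

abbreviation frac where "frac M \<equiv> fraction R S M"

lemma S_R: "s \<in> S \<Longrightarrow> s \<in> carrier R" using S_carr by auto

text \<open>Localization turns each of finitely many facts into one that holds up to a multiplier in \<^term>\<open>S\<close>; the product of
  the multipliers serves all of them.\<close>

lemma common_multiplier:
  assumes "finite X" and "\<And>x. x \<in> X \<Longrightarrow> \<exists>v\<in>S. Q x v" and "\<And>x v w. \<lbrakk>x \<in> X; v \<in> S; w \<in> S; Q x v\<rbrakk> \<Longrightarrow> Q x (w \<otimes> v)"
  shows "\<exists>v\<in>S. \<forall>x\<in>X. Q x v"
  using assms
proof (induction X)
  case empty
  then show ?case using S_one by auto
next
  case (insert x X)
  then obtain v where v: "v \<in> S" "\<forall>x\<in>X. Q x v" by auto
  obtain w where w: "w \<in> S" "Q x w" using insert.prems(1)[of x] by blast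
  have "Q x (v \<otimes> w)" using insert v w by auto
  moreover have "Q y (w \<otimes> v)" if "y \<in> X" for y using insert v w that by auto
  ultimately show ?case using v w S_mult[OF v(1) w(1)] m_comm[OF S_R[OF v(1)] S_R[OF w(1)]]
    by (intro bexI[of _ "v \<otimes> w"]) auto
qed

lemma frac_mem:
  assumes "module R M" "m \<in> carrier M" "s \<in> S"
  shows "(m', s') \<in> frac M m s \<longleftrightarrow> m' \<in> carrier M \<and> s' \<in> S \<and> (\<exists>u\<in>S. u \<odot>\<^bsub>M\<^esub> (s' \<odot>\<^bsub>M\<^esub> m) = u \<odot>\<^bsub>M\<^esub> (s \<odot>\<^bsub>M\<^esub> m'))"
proof -
  have "u \<odot>\<^bsub>M\<^esub> ((s' \<odot>\<^bsub>M\<^esub> m) \<ominus>\<^bsub>M\<^esub> (s \<odot>\<^bsub>M\<^esub> m')) = \<zero>\<^bsub>M\<^esub> \<longleftrightarrow> u \<odot>\<^bsub>M\<^esub> (s' \<odot>\<^bsub>M\<^esub> m) = u \<odot>\<^bsub>M\<^esub> (s \<odot>\<^bsub>M\<^esub> m')"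
    if "u \<in> S" "s' \<in> S" "m' \<in> carrier M" for u
  proof -
    note * = S_R[OF that(1)] S_R[OF that(2)] S_R[OF assms(3)] that(3) assms(1,2)
    have "u \<odot>\<^bsub>M\<^esub> ((s' \<odot>\<^bsub>M\<^esub> m) \<ominus>\<^bsub>M\<^esub> (s \<odot>\<^bsub>M\<^esub> m')) = u \<odot>\<^bsub>M\<^esub> (s' \<odot>\<^bsub>M\<^esub> m) \<oplus>\<^bsub>M\<^esub> \<ominus>\<^bsub>M\<^esub> (u \<odot>\<^bsub>M\<^esub> (s \<odot>\<^bsub>M\<^esub> m'))"
      using * by (simp add: a_minus_def mclosed msmult_add msmult_neg)
    then show ?thesis using mdiff_zero[OF assms(1)] * by (simp add: mclosed)
  qed
  then show ?thesis by (auto simp: fraction_def)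
qed

lemma frac_self: "\<lbrakk>module R M; m \<in> carrier M; s \<in> S\<rbrakk> \<Longrightarrow> (m, s) \<in> frac M m s"
  using S_one by (auto simp: frac_mem)

lemma frac_rel_trans:
  assumes M: "module R M" and m: "m \<in> carrier M" "m' \<in> carrier M" "m'' \<in> carrier M" and s: "s \<in> S" "s' \<in> S" "s'' \<in> S"
    and 1: "u \<in> S" "u \<odot>\<^bsub>M\<^esub> (s' \<odot>\<^bsub>M\<^esub> m) = u \<odot>\<^bsub>M\<^esub> (s \<odot>\<^bsub>M\<^esub> m')" and 2: "v \<in> S" "v \<odot>\<^bsub>M\<^esub> (s'' \<odot>\<^bsub>M\<^esub> m') = v \<odot>\<^bsub>M\<^esub> (s' \<odot>\<^bsub>M\<^esub> m'')"
  shows "\<exists>w\<in>S. w \<odot>\<^bsub>M\<^esub> (s'' \<odot>\<^bsub>M\<^esub> m) = w \<odot>\<^bsub>M\<^esub> (s \<odot>\<^bsub>M\<^esub> m'')"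
proof (rule bexI[of _ "u \<otimes> v \<otimes> s'"])
  note R = S_R[OF s(1)] S_R[OF s(2)] S_R[OF s(3)] S_R[OF 1(1)] S_R[OF 2(1)]
  have "(u \<otimes> v \<otimes> s') \<odot>\<^bsub>M\<^esub> (s'' \<odot>\<^bsub>M\<^esub> m) = v \<odot>\<^bsub>M\<^esub> (s'' \<odot>\<^bsub>M\<^esub> (u \<odot>\<^bsub>M\<^esub> (s' \<odot>\<^bsub>M\<^esub> m)))"
    using R m M by (simp add: mclosed msmult_smult msmult_comm)
  also have "\<dots> = v \<odot>\<^bsub>M\<^esub> (s'' \<odot>\<^bsub>M\<^esub> (u \<odot>\<^bsub>M\<^esub> (s \<odot>\<^bsub>M\<^esub> m')))" using 1 by simp
  also have "\<dots> = u \<odot>\<^bsub>M\<^esub> (s \<odot>\<^bsub>M\<^esub> (v \<odot>\<^bsub>M\<^esub> (s'' \<odot>\<^bsub>M\<^esub> m')))"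
    using R m M by (simp add: mclosed msmult_comm)
  also have "\<dots> = u \<odot>\<^bsub>M\<^esub> (s \<odot>\<^bsub>M\<^esub> (v \<odot>\<^bsub>M\<^esub> (s' \<odot>\<^bsub>M\<^esub> m'')))" using 2 by simp
  also have "\<dots> = (u \<otimes> v \<otimes> s') \<odot>\<^bsub>M\<^esub> (s \<odot>\<^bsub>M\<^esub> m'')"
    using R m M by (simp add: mclosed msmult_smult msmult_comm)
  finally show "(u \<otimes> v \<otimes> s') \<odot>\<^bsub>M\<^esub> (s'' \<odot>\<^bsub>M\<^esub> m) = (u \<otimes> v \<otimes> s') \<odot>\<^bsub>M\<^esub> (s \<odot>\<^bsub>M\<^esub> m'')" .
qed (use 1 2 s S_mult in auto)

lemma frac_eq:
  assumes M: "module R M" and m: "m \<in> carrier M" "s \<in> S" "m' \<in> carrier M" "s' \<in> S"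
  shows "frac M m s = frac M m' s' \<longleftrightarrow> (\<exists>u\<in>S. u \<odot>\<^bsub>M\<^esub> (s' \<odot>\<^bsub>M\<^esub> m) = u \<odot>\<^bsub>M\<^esub> (s \<odot>\<^bsub>M\<^esub> m'))"
proof
  assume "frac M m s = frac M m' s'"
  then have "(m', s') \<in> frac M m s" using frac_self[OF M m(3,4)] by simp
  then show "\<exists>u\<in>S. u \<odot>\<^bsub>M\<^esub> (s' \<odot>\<^bsub>M\<^esub> m) = u \<odot>\<^bsub>M\<^esub> (s \<odot>\<^bsub>M\<^esub> m')" using frac_mem[OF M m(1,2)] by blast
next
  assume "\<exists>u\<in>S. u \<odot>\<^bsub>M\<^esub> (s' \<odot>\<^bsub>M\<^esub> m) = u \<odot>\<^bsub>M\<^esub> (s \<odot>\<^bsub>M\<^esub> m')"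
  then obtain u where u: "u \<in> S" "u \<odot>\<^bsub>M\<^esub> (s' \<odot>\<^bsub>M\<^esub> m) = u \<odot>\<^bsub>M\<^esub> (s \<odot>\<^bsub>M\<^esub> m')" by blast
  have "(m'', s'') \<in> frac M m s \<longleftrightarrow> (m'', s'') \<in> frac M m' s'" for m'' s''
  proof (cases "m'' \<in> carrier M \<and> s'' \<in> S")
    case True
    then show ?thesis unfolding frac_mem[OF M m(1,2)] frac_mem[OF M m(3,4)]
      using frac_rel_trans[OF M m(1,3) _ m(2,4) _ u, of m'' s'']
        frac_rel_trans[OF M m(3,1) _ m(4,2) _ u(1) u(2)[symmetric], of m'' s''] by blast
  qed (auto simp: frac_mem[OF M m(1,2)] frac_mem[OF M m(3,4)])
  then show "frac M m s = frac M m' s'" by auto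
qed

lemma frac_eqI:
  "\<lbrakk>module R M; m \<in> carrier M; s \<in> S; m' \<in> carrier M; s' \<in> S; s' \<odot>\<^bsub>M\<^esub> m = s \<odot>\<^bsub>M\<^esub> m'\<rbrakk> \<Longrightarrow> frac M m s = frac M m' s'"
  using S_one by (subst frac_eq) auto

abbreviation locR where "locR \<equiv> loc_ring R S"
abbreviation locM where "locM M \<equiv> loc_mod R S M"
abbreviation fracR where "fracR \<equiv> fraction R S (ring_mod R)"

lemma locM_carrier: "carrier (locM M) = {frac M m s |m s. m \<in> carrier M \<and> s \<in> S}"
  "\<zero>\<^bsub>locM M\<^esub> = frac M \<zero>\<^bsub>M\<^esub> \<one>"
  by (simp_all add: loc_mod_def)

lemma locR_sel: "carrier locR = {fracR a s |a s. a \<in> carrier R \<and> s \<in> S}"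
  "\<zero>\<^bsub>locR\<^esub> = fracR \<zero> \<one>" "\<one>\<^bsub>locR\<^esub> = fracR \<one> \<one>"
  "X \<oplus>\<^bsub>locR\<^esub> Y = X \<oplus>\<^bsub>locM (ring_mod R)\<^esub> Y" "X \<otimes>\<^bsub>locR\<^esub> Y = X \<odot>\<^bsub>locM (ring_mod R)\<^esub> Y"
  by (simp_all add: loc_ring_def loc_mod_def)

lemma locM_add:
  assumes M: "module R M" and m: "m \<in> carrier M" "s \<in> S" "n \<in> carrier M" "t \<in> S"
  shows "frac M m s \<oplus>\<^bsub>locM M\<^esub> frac M n t = frac M (t \<odot>\<^bsub>M\<^esub> m \<oplus>\<^bsub>M\<^esub> s \<odot>\<^bsub>M\<^esub> n) (s \<otimes> t)"
proof -
  have "frac M (t' \<odot>\<^bsub>M\<^esub> m' \<oplus>\<^bsub>M\<^esub> s' \<odot>\<^bsub>M\<^esub> n') (s' \<otimes> t') = frac M (t \<odot>\<^bsub>M\<^esub> m \<oplus>\<^bsub>M\<^esub> s \<odot>\<^bsub>M\<^esub> n) (s \<otimes> t)"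
    if a: "(m', s') \<in> frac M m s" and b: "(n', t') \<in> frac M n t" for m' s' n' t'
  proof -
    obtain u where u: "m' \<in> carrier M" "s' \<in> S" "u \<in> S" "u \<odot>\<^bsub>M\<^esub> (s' \<odot>\<^bsub>M\<^esub> m) = u \<odot>\<^bsub>M\<^esub> (s \<odot>\<^bsub>M\<^esub> m')"
      using a frac_mem[OF M m(1,2)] by blast
    obtain v where v: "n' \<in> carrier M" "t' \<in> S" "v \<in> S" "v \<odot>\<^bsub>M\<^esub> (t' \<odot>\<^bsub>M\<^esub> n) = v \<odot>\<^bsub>M\<^esub> (t \<odot>\<^bsub>M\<^esub> n')"
      using b frac_mem[OF M m(3,4)] by blast
    note R = S_R[OF m(2)] S_R[OF m(4)] S_R[OF u(2)] S_R[OF u(3)] S_R[OF v(2)] S_R[OF v(3)]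
    have 1: "v \<odot>\<^bsub>M\<^esub> (t \<odot>\<^bsub>M\<^esub> (t' \<odot>\<^bsub>M\<^esub> (u \<odot>\<^bsub>M\<^esub> (s' \<odot>\<^bsub>M\<^esub> m)))) = v \<odot>\<^bsub>M\<^esub> (t \<odot>\<^bsub>M\<^esub> (t' \<odot>\<^bsub>M\<^esub> (u \<odot>\<^bsub>M\<^esub> (s \<odot>\<^bsub>M\<^esub> m'))))" using u(4) by simp
    have 2: "u \<odot>\<^bsub>M\<^esub> (s \<odot>\<^bsub>M\<^esub> (s' \<odot>\<^bsub>M\<^esub> (v \<odot>\<^bsub>M\<^esub> (t' \<odot>\<^bsub>M\<^esub> n)))) = u \<odot>\<^bsub>M\<^esub> (s \<odot>\<^bsub>M\<^esub> (s' \<odot>\<^bsub>M\<^esub> (v \<odot>\<^bsub>M\<^esub> (t \<odot>\<^bsub>M\<^esub> n'))))" using v(4) by simp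
    have "(u \<otimes> v) \<odot>\<^bsub>M\<^esub> ((s \<otimes> t) \<odot>\<^bsub>M\<^esub> (t' \<odot>\<^bsub>M\<^esub> m' \<oplus>\<^bsub>M\<^esub> s' \<odot>\<^bsub>M\<^esub> n')) =
      v \<odot>\<^bsub>M\<^esub> (t \<odot>\<^bsub>M\<^esub> (t' \<odot>\<^bsub>M\<^esub> (u \<odot>\<^bsub>M\<^esub> (s \<odot>\<^bsub>M\<^esub> m')))) \<oplus>\<^bsub>M\<^esub> u \<odot>\<^bsub>M\<^esub> (s \<odot>\<^bsub>M\<^esub> (s' \<odot>\<^bsub>M\<^esub> (v \<odot>\<^bsub>M\<^esub> (t \<odot>\<^bsub>M\<^esub> n'))))"
      using R u(1) v(1) M by (simp add: mclosed msmult_smult msmult_comm msmult_add)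
    also have "\<dots> = v \<odot>\<^bsub>M\<^esub> (t \<odot>\<^bsub>M\<^esub> (t' \<odot>\<^bsub>M\<^esub> (u \<odot>\<^bsub>M\<^esub> (s' \<odot>\<^bsub>M\<^esub> m)))) \<oplus>\<^bsub>M\<^esub> u \<odot>\<^bsub>M\<^esub> (s \<odot>\<^bsub>M\<^esub> (s' \<odot>\<^bsub>M\<^esub> (v \<odot>\<^bsub>M\<^esub> (t' \<odot>\<^bsub>M\<^esub> n))))"
      using 1 2 by simp
    also have "\<dots> = (u \<otimes> v) \<odot>\<^bsub>M\<^esub> ((s' \<otimes> t') \<odot>\<^bsub>M\<^esub> (t \<odot>\<^bsub>M\<^esub> m \<oplus>\<^bsub>M\<^esub> s \<odot>\<^bsub>M\<^esub> n))"
      using R m(1,3) M by (simp add: mclosed msmult_smult msmult_comm msmult_add)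
    finally show ?thesis
      using u v m R M S_mult by (subst frac_eq) (auto simp: mclosed)
  qed
  moreover have "frac M m s \<noteq> {}" "frac M n t \<noteq> {}" using frac_self[OF M m(1,2)] frac_self[OF M m(3,4)] by auto
  ultimately show ?thesis unfolding loc_mod_def by (simp add: case_prod_unfold)
qed

lemma locM_smult:
  assumes M: "module R M" and m: "m \<in> carrier M" "t \<in> S" "a \<in> carrier R" "s \<in> S"
  shows "fracR a s \<odot>\<^bsub>locM M\<^esub> frac M m t = frac M (a \<odot>\<^bsub>M\<^esub> m) (s \<otimes> t)"
proof -
  have "frac M (a' \<odot>\<^bsub>M\<^esub> m') (s' \<otimes> t') = frac M (a \<odot>\<^bsub>M\<^esub> m) (s \<otimes> t)"
    if x: "(a', s') \<in> fracR a s" and y: "(m', t') \<in> frac M m t" for m' s' a' t'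
  proof -
    obtain u where u: "a' \<in> carrier R" "s' \<in> S" "u \<in> S" "u \<otimes> (s' \<otimes> a) = u \<otimes> (s \<otimes> a')"
      using x frac_mem[OF module_ring_mod, of a s] m by auto
    obtain v where v: "m' \<in> carrier M" "t' \<in> S" "v \<in> S" "v \<odot>\<^bsub>M\<^esub> (t' \<odot>\<^bsub>M\<^esub> m) = v \<odot>\<^bsub>M\<^esub> (t \<odot>\<^bsub>M\<^esub> m')"
      using y frac_mem[OF M m(1,2)] by blast
    note R = S_R[OF m(2)] m(3) S_R[OF m(4)] S_R[OF u(2)] S_R[OF u(3)] S_R[OF v(2)] S_R[OF v(3)] u(1)
    have "(u \<otimes> v) \<odot>\<^bsub>M\<^esub> ((s \<otimes> t) \<odot>\<^bsub>M\<^esub> (a' \<odot>\<^bsub>M\<^esub> m')) = (u \<otimes> (s \<otimes> a')) \<odot>\<^bsub>M\<^esub> (v \<odot>\<^bsub>M\<^esub> (t \<odot>\<^bsub>M\<^esub> m'))"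
      using R v(1) M by (simp add: mclosed msmult_smult msmult_comm)
    also have "\<dots> = (u \<otimes> (s' \<otimes> a)) \<odot>\<^bsub>M\<^esub> (v \<odot>\<^bsub>M\<^esub> (t' \<odot>\<^bsub>M\<^esub> m))" using u(4) v(4) by simp
    also have "\<dots> = (u \<otimes> v) \<odot>\<^bsub>M\<^esub> ((s' \<otimes> t') \<odot>\<^bsub>M\<^esub> (a \<odot>\<^bsub>M\<^esub> m))"
      using R m(1) M by (simp add: mclosed msmult_smult msmult_comm)
    finally show ?thesis
      using u v m R M S_mult by (subst frac_eq) (auto simp: mclosed)
  qed
  moreover have "fracR a s \<noteq> {}" "frac M m t \<noteq> {}" using frac_self[OF M m(1,2)] frac_self[OF module_ring_mod, of a s] m by auto
  ultimately show ?thesis unfolding loc_mod_def by (simp add: case_prod_unfold)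
qed

lemma locM_closed: "\<lbrakk>m \<in> carrier M; s \<in> S\<rbrakk> \<Longrightarrow> frac M m s \<in> carrier (locM M)"
  by (auto simp: locM_carrier)

lemma locR_closed: "\<lbrakk>a \<in> carrier R; s \<in> S\<rbrakk> \<Longrightarrow> fracR a s \<in> carrier locR"
  by (auto simp: locR_sel)

lemma locME: "X \<in> carrier (locM M) \<Longrightarrow> (\<And>m s. \<lbrakk>m \<in> carrier M; s \<in> S; X = frac M m s\<rbrakk> \<Longrightarrow> thesis) \<Longrightarrow> thesis"
  by (auto simp: locM_carrier)

lemma locRE: "X \<in> carrier locR \<Longrightarrow> (\<And>m s. \<lbrakk>m \<in> carrier R; s \<in> S; X = fracR m s\<rbrakk> \<Longrightarrow> thesis) \<Longrightarrow> thesis"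
  by (auto simp: locR_sel)

lemma locR_add: "\<lbrakk>a \<in> carrier R; s \<in> S; b \<in> carrier R; t \<in> S\<rbrakk> \<Longrightarrow> fracR a s \<oplus>\<^bsub>locR\<^esub> fracR b t = fracR (t \<otimes> a \<oplus> s \<otimes> b) (s \<otimes> t)"
  using locM_add[OF module_ring_mod, of a s b t] by (simp add: locR_sel)

lemma locR_mult: "\<lbrakk>a \<in> carrier R; s \<in> S; b \<in> carrier R; t \<in> S\<rbrakk> \<Longrightarrow> fracR a s \<otimes>\<^bsub>locR\<^esub> fracR b t = fracR (a \<otimes> b) (s \<otimes> t)"
  using locM_smult[OF module_ring_mod, of b t a s] by (simp add: locR_sel)

lemma locM_abelian_group:
  assumes M: "module R M" shows "abelian_group (locM M)"
proof (rule abelian_groupI)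
  note c = mclosed[OF M] S_R S_mult
  fix X assume X: "X \<in> carrier (locM M)"
  then obtain m s where m: "m \<in> carrier M" "s \<in> S" "X = frac M m s" by (rule locME)
  note sR = S_R[OF m(2)]
  show "\<zero>\<^bsub>locM M\<^esub> \<oplus>\<^bsub>locM M\<^esub> X = X"
    using m sR M S_one by (simp add: locM_carrier(2) locM_add mlin)
  show "\<exists>Y\<in>carrier (locM M). Y \<oplus>\<^bsub>locM M\<^esub> X = \<zero>\<^bsub>locM M\<^esub>"
  proof (rule bexI[of _ "frac M (\<ominus>\<^bsub>M\<^esub> m) s"])
    have "frac M \<zero>\<^bsub>M\<^esub> (s \<otimes> s) = frac M \<zero>\<^bsub>M\<^esub> \<one>"
      using m sR M S_one S_mult by (intro frac_eqI) (auto simp: mlin)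
    then show "frac M (\<ominus>\<^bsub>M\<^esub> m) s \<oplus>\<^bsub>locM M\<^esub> X = \<zero>\<^bsub>locM M\<^esub>"
      using m sR M by (simp add: locM_add locM_carrier(2) mlin)
  qed (use m M in \<open>simp add: locM_closed mclosed\<close>)
  fix Y assume Y: "Y \<in> carrier (locM M)"
  then obtain n t where n: "n \<in> carrier M" "t \<in> S" "Y = frac M n t" by (rule locME)
  note tR = S_R[OF n(2)]
  show "X \<oplus>\<^bsub>locM M\<^esub> Y \<in> carrier (locM M)"
    using m n sR tR M S_mult by (simp add: locM_add locM_closed mclosed)
  show "X \<oplus>\<^bsub>locM M\<^esub> Y = Y \<oplus>\<^bsub>locM M\<^esub> X"
    using m n sR tR M by (simp add: locM_add m_comm madd_comm mclosed)
  fix Z assume Z: "Z \<in> carrier (locM M)"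
  then obtain k r where k: "k \<in> carrier M" "r \<in> S" "Z = frac M k r" by (rule locME)
  note rR = S_R[OF k(2)]
  show "(X \<oplus>\<^bsub>locM M\<^esub> Y) \<oplus>\<^bsub>locM M\<^esub> Z = X \<oplus>\<^bsub>locM M\<^esub> (Y \<oplus>\<^bsub>locM M\<^esub> Z)"
    using m n k sR tR rR M S_mult
    by (simp add: locM_add mlin msmult_smult msmult_comm m_assoc)
qed (simp add: locM_carrier S_one mzero[OF M], use S_one mzero[OF M] in blast)

lemma locM_laws:
  assumes M: "module R M" and A: "A \<in> carrier locR" and B: "B \<in> carrier locR" and X: "X \<in> carrier (locM M)" and Y: "Y \<in> carrier (locM M)"
  shows "A \<odot>\<^bsub>locM M\<^esub> X \<in> carrier (locM M)"
    and "(A \<oplus>\<^bsub>locR\<^esub> B) \<odot>\<^bsub>locM M\<^esub> X = A \<odot>\<^bsub>locM M\<^esub> X \<oplus>\<^bsub>locM M\<^esub> B \<odot>\<^bsub>locM M\<^esub> X"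
    and "A \<odot>\<^bsub>locM M\<^esub> (X \<oplus>\<^bsub>locM M\<^esub> Y) = A \<odot>\<^bsub>locM M\<^esub> X \<oplus>\<^bsub>locM M\<^esub> A \<odot>\<^bsub>locM M\<^esub> Y"
    and "(A \<otimes>\<^bsub>locR\<^esub> B) \<odot>\<^bsub>locM M\<^esub> X = A \<odot>\<^bsub>locM M\<^esub> (B \<odot>\<^bsub>locM M\<^esub> X)"
    and "\<one>\<^bsub>locR\<^esub> \<odot>\<^bsub>locM M\<^esub> X = X"
proof -
  obtain a s where a: "a \<in> carrier R" "s \<in> S" "A = fracR a s" using A by (rule locRE)
  obtain b t where b: "b \<in> carrier R" "t \<in> S" "B = fracR b t" using B by (rule locRE)
  obtain m r where m: "m \<in> carrier M" "r \<in> S" "X = frac M m r" using X by (rule locME)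
  obtain n q where n: "n \<in> carrier M" "q \<in> S" "Y = frac M n q" using Y by (rule locME)
  note R = S_R[OF a(2)] S_R[OF b(2)] S_R[OF m(2)] S_R[OF n(2)]
  show "A \<odot>\<^bsub>locM M\<^esub> X \<in> carrier (locM M)"
    using a m R M S_mult by (simp add: locM_smult locM_closed mclosed)
  show "(A \<oplus>\<^bsub>locR\<^esub> B) \<odot>\<^bsub>locM M\<^esub> X = A \<odot>\<^bsub>locM M\<^esub> X \<oplus>\<^bsub>locM M\<^esub> B \<odot>\<^bsub>locM M\<^esub> X"
    using a b m R M S_mult
    by (simp add: locM_smult locM_add locR_add mclosed, intro frac_eqI)
      (simp_all add: mlin msmult_smult msmult_comm madd_smult)
  show "A \<odot>\<^bsub>locM M\<^esub> (X \<oplus>\<^bsub>locM M\<^esub> Y) = A \<odot>\<^bsub>locM M\<^esub> X \<oplus>\<^bsub>locM M\<^esub> A \<odot>\<^bsub>locM M\<^esub> Y"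
    using a n m R M S_mult
    by (simp add: locM_smult locM_add mclosed, intro frac_eqI)
      (simp_all add: mlin msmult_smult msmult_comm madd_smult)
  show "(A \<otimes>\<^bsub>locR\<^esub> B) \<odot>\<^bsub>locM M\<^esub> X = A \<odot>\<^bsub>locM M\<^esub> (B \<odot>\<^bsub>locM M\<^esub> X)"
    using a b m R M S_mult by (simp add: locM_smult locR_mult mclosed msmult_smult m_assoc)
  show "\<one>\<^bsub>locR\<^esub> \<odot>\<^bsub>locM M\<^esub> X = X"
    using m R M S_one by (simp add: locM_smult locR_sel(3) mone_smult)
qed

lemma cring_locR: "cring locR"
proof (rule cringI)
  note m = module_ring_mod
  have ce: "carrier locR = carrier (locM (ring_mod R))" by (simp add: loc_ring_def)
  interpret A: abelian_group "locM (ring_mod R)" by (rule locM_abelian_group[OF m])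
  have z: "\<zero>\<^bsub>locR\<^esub> = \<zero>\<^bsub>locM (ring_mod R)\<^esub>" by (simp add: locR_sel locM_carrier)
  show "abelian_group locR"
  proof (rule abelian_groupI)
    show "\<exists>y\<in>carrier locR. y \<oplus>\<^bsub>locR\<^esub> x = \<zero>\<^bsub>locR\<^esub>" if "x \<in> carrier locR" for x
      using that A.l_neg[of x] A.a_inv_closed[of x] unfolding ce z locR_sel(4) by blast
  qed (simp_all add: ce z locR_sel(4) A.a_ac)
  show "Group.comm_monoid locR"
  proof (rule comm_monoidI)
    show "\<one>\<^bsub>locR\<^esub> \<in> carrier locR" using S_one by (auto simp: locR_sel)
    fix X Y assume X: "X \<in> carrier locR" and Y: "Y \<in> carrier locR"
    show "X \<otimes>\<^bsub>locR\<^esub> Y \<in> carrier locR" "\<one>\<^bsub>locR\<^esub> \<otimes>\<^bsub>locR\<^esub> X = X"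
      using locM_laws(1,5)[OF m X Y, of Y Y] locM_laws(5)[OF m X X, of X X] X Y unfolding ce locR_sel(5) by auto
    obtain a s where a: "a \<in> carrier R" "s \<in> S" "X = fracR a s" using X by (rule locRE)
    obtain b t where b: "b \<in> carrier R" "t \<in> S" "Y = fracR b t" using Y by (rule locRE)
    show "X \<otimes>\<^bsub>locR\<^esub> Y = Y \<otimes>\<^bsub>locR\<^esub> X"
      using a b S_R[OF a(2)] S_R[OF b(2)] by (simp add: locR_mult m_comm)
    fix Z assume Z: "Z \<in> carrier locR"
    show "X \<otimes>\<^bsub>locR\<^esub> Y \<otimes>\<^bsub>locR\<^esub> Z = X \<otimes>\<^bsub>locR\<^esub> (Y \<otimes>\<^bsub>locR\<^esub> Z)"
      using locM_laws(4)[OF m X Y, of Z Z] Z unfolding ce by (simp add: locR_sel(5))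
  qed
  fix X Y Z assume X: "X \<in> carrier locR" and Y: "Y \<in> carrier locR" and Z: "Z \<in> carrier locR"
  show "(X \<oplus>\<^bsub>locR\<^esub> Y) \<otimes>\<^bsub>locR\<^esub> Z = X \<otimes>\<^bsub>locR\<^esub> Z \<oplus>\<^bsub>locR\<^esub> Y \<otimes>\<^bsub>locR\<^esub> Z"
    using locM_laws(2)[OF m X Y, of Z Z] Z unfolding ce by (simp add: locR_sel(4,5))
qed

lemma module_locM: "module R M \<Longrightarrow> module locR (locM M)"
proof (rule moduleI[OF cring_locR locM_abelian_group])
  assume M: "module R M"
  have one: "\<one>\<^bsub>locR\<^esub> \<in> carrier locR" using S_one by (auto simp: locR_sel)
  show "\<one>\<^bsub>locR\<^esub> \<odot>\<^bsub>locM M\<^esub> X = X" if "X \<in> carrier (locM M)" for X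
    by (rule locM_laws(5)[OF M one one that that])
qed (auto simp: locM_laws)



lemma loc_map_add: "\<lbrakk>module R M; m \<in> carrier M; n \<in> carrier M\<rbrakk> \<Longrightarrow> frac M (m \<oplus>\<^bsub>M\<^esub> n) \<one> = frac M m \<one> \<oplus>\<^bsub>locM M\<^esub> frac M n \<one>"
  using S_one by (simp add: locM_add mlin)

lemma loc_map_smult: "\<lbrakk>module R M; m \<in> carrier M; a \<in> carrier R\<rbrakk> \<Longrightarrow> frac M (a \<odot>\<^bsub>M\<^esub> m) \<one> = fracR a \<one> \<odot>\<^bsub>locM M\<^esub> frac M m \<one>"
  using S_one by (simp add: locM_smult)

lemma loc_map_eq: "\<lbrakk>module R M; m \<in> carrier M; n \<in> carrier M\<rbrakk> \<Longrightarrow> frac M m \<one> = frac M n \<one> \<longleftrightarrow> (\<exists>u\<in>S. u \<odot>\<^bsub>M\<^esub> m = u \<odot>\<^bsub>M\<^esub> n)"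
  using S_one by (simp add: frac_eq mlin)

lemma loc_map_lc:
  assumes M: "module R M" "\<And>i. i < r \<Longrightarrow> c i \<in> carrier R" "\<And>i. i < r \<Longrightarrow> y i \<in> carrier M"
  shows "frac M (lc M r c y) \<one> = lc (locM M) r (\<lambda>i. fracR (c i) \<one>) (\<lambda>i. frac M (y i) \<one>)"
  using M(2-)
proof (induction r)
  case (Suc r)
  have "lc M r c y \<in> carrier M" using Suc.prems by (intro lc_closed M(1)) auto
  then show ?case using Suc M(1) by (simp add: loc_map_add loc_map_smult mclosed)
qed (simp add: locM_carrier)

lemma frac_split: "\<lbrakk>module R M; m \<in> carrier M; s \<in> S\<rbrakk> \<Longrightarrow> frac M m s = fracR \<one> s \<odot>\<^bsub>locM M\<^esub> frac M m \<one>"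
  using S_one S_R by (simp add: locM_smult mone_smult)

lemma clear_denominator:
  assumes M: "module R M" and X: "X \<in> carrier (locM M)"
  shows "\<exists>t\<in>S. \<exists>m\<in>carrier M. fracR t \<one> \<odot>\<^bsub>locM M\<^esub> X = frac M m \<one>"
proof -
  obtain m s where m: "m \<in> carrier M" "s \<in> S" "X = frac M m s" using X by (rule locME)
  have "frac M (s \<odot>\<^bsub>M\<^esub> m) (\<one> \<otimes> s) = frac M m \<one>"
    using m S_R[OF m(2)] S_one M by (intro frac_eqI) (simp_all add: mlin)
  then have "fracR s \<one> \<odot>\<^bsub>locM M\<^esub> X = frac M m \<one>" using m S_R[OF m(2)] M S_one by (simp add: locM_smult)
  then show ?thesis using m by blast
qed

lemma common_denominator:
  assumes M: "module R M" and X: "\<forall>i<r::nat. X i \<in> carrier (locM M)"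
  shows "\<exists>t\<in>S. \<exists>m. \<forall>i<r. m i \<in> carrier M \<and> fracR t \<one> \<odot>\<^bsub>locM M\<^esub> X i = frac M (m i) \<one>"
proof -
  interpret L: cring locR by (rule cring_locR)
  note mL = module_locM[OF M]
  have "\<exists>t\<in>S. \<forall>i\<in>{..<r}. \<exists>m\<in>carrier M. fracR t \<one> \<odot>\<^bsub>locM M\<^esub> X i = frac M m \<one>"
  proof (rule common_multiplier)
    show "\<exists>t\<in>S. \<exists>m\<in>carrier M. fracR t \<one> \<odot>\<^bsub>locM M\<^esub> X i = frac M m \<one>" if "i \<in> {..<r}" for i
      using clear_denominator[OF M] X that by simp
    fix i v w assume i: "i \<in> {..<r}" "v \<in> S" "w \<in> S" and "\<exists>m\<in>carrier M. fracR v \<one> \<odot>\<^bsub>locM M\<^esub> X i = frac M m \<one>"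
    then obtain m where m: "m \<in> carrier M" "fracR v \<one> \<odot>\<^bsub>locM M\<^esub> X i = frac M m \<one>" by blast
    note R = S_R[OF i(2)] S_R[OF i(3)]
    have "fracR (w \<otimes> v) \<one> \<odot>\<^bsub>locM M\<^esub> X i = fracR w \<one> \<odot>\<^bsub>locM M\<^esub> (fracR v \<one> \<odot>\<^bsub>locM M\<^esub> X i)"
      using L.msmult_smult[OF mL locR_closed[OF R(2) S_one] locR_closed[OF R(1) S_one], of "X i"] X i R S_one
      by (simp add: locR_mult)
    also have "\<dots> = frac M (w \<odot>\<^bsub>M\<^esub> m) \<one>" using m R M by (simp add: loc_map_smult)
    finally show "\<exists>m\<in>carrier M. fracR (w \<otimes> v) \<one> \<odot>\<^bsub>locM M\<^esub> X i = frac M m \<one>"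
      using msmult[OF M R(2) m(1)] by blast
  qed simp
  then obtain t where t: "t \<in> S" and ex: "\<forall>i. \<exists>m. i < r \<longrightarrow> m \<in> carrier M \<and> fracR t \<one> \<odot>\<^bsub>locM M\<^esub> X i = frac M m \<one>"
    by (auto simp: Bex_def)
  from choice[OF ex] have "\<exists>m. \<forall>i<r. m i \<in> carrier M \<and> fracR t \<one> \<odot>\<^bsub>locM M\<^esub> X i = frac M (m i) \<one>" .
  with t show ?thesis by (rule bexI[rotated])
qed

lemma common_denominator_ring:
  assumes c: "\<forall>i<r::nat. c i \<in> carrier locR"
  shows "\<exists>t\<in>S. \<exists>a. \<forall>i<r. a i \<in> carrier R \<and> fracR t \<one> \<otimes>\<^bsub>locR\<^esub> c i = fracR (a i) \<one>"
proof -
  have "\<forall>i<r. c i \<in> carrier (locM (ring_mod R))" using c by (simp add: loc_ring_def)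
  from common_denominator[OF module_ring_mod this] show ?thesis
    unfolding locR_sel(5) ring_mod_simps(1) .
qed

lemma fracR_unit: "s \<in> S \<Longrightarrow> fracR \<one> s \<otimes>\<^bsub>locR\<^esub> fracR s \<one> = \<one>\<^bsub>locR\<^esub>"
proof -
  assume s: "s \<in> S"
  then have "fracR s s = fracR \<one> \<one>" using S_one S_R[OF s] by (intro frac_eqI module_ring_mod) simp_all
  then show ?thesis using s S_one S_R[OF s] by (simp add: locR_mult locR_sel(3))
qed

text \<open>A submodule of the localization pulls back to \<^term>\<open>M\<close>; if it contains the images of generators, it contains
  all \<^term>\<open>frac M m \<one>\<close>, hence all fractions.\<close>

lemma locM_fin_gen:
  assumes M: "module R M" and fg: "fin_gen R M"
  shows "fin_gen locR (locM M)"
proof -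
  obtain A where A: "finite A" "A \<subseteq> carrier M" "span M A = carrier M"
    using fg fin_gen_span[OF M] by blast
  let ?i = "\<lambda>m. frac M m \<one>"
  note mL = module_locM[OF M]
  have "X \<in> N" if N: "submodule N locR (locM M)" "?i ` A \<subseteq> N" and X: "X \<in> carrier (locM M)" for N X
  proof -
    note Ns = cring.submod[OF cring_locR N(1) mL]
    have "submodule {m \<in> carrier M. ?i m \<in> N} R M"
      using Ns locR_closed[OF _ S_one] M
      by (intro submodI[OF M]) (auto simp: mclosed loc_map_add loc_map_smult locM_carrier(2))
    then have "span M A \<subseteq> {m \<in> carrier M. ?i m \<in> N}" using A N by (intro span_minimal) auto
    then have i: "?i m \<in> N" if "m \<in> carrier M" for m using A(3) that by auto
    obtain m s where m: "m \<in> carrier M" "s \<in> S" "X = frac M m s" using X by (rule locME)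
    then show "X \<in> N" using frac_split[OF M m(1,2)] Ns(5)[OF locR_closed[OF one_closed m(2)] i[OF m(1)]] by simp
  qed
  then have "cring.span locR (locM M) (?i ` A) = carrier (locM M)"
    unfolding cring.span_def[OF cring_locR] by auto
  then show ?thesis
    using cring.fin_gen_span[OF cring_locR mL] A S_one by (auto simp: locM_closed intro!: exI[of _ "?i ` A"])
qed

end

locale noetherian_mult_subset = mult_subset R S + noetherian_cring R for R (structure) and S
begin

text \<open>Numerators for the values of \<^term>\<open>\<psi>\<close> on generators define a functional on a free cover of \<^term>\<open>M\<close>. It
  vanishes on the finitely many generators of the kernel after multiplication by an element of \<^term>\<open>S\<close>, and then
  descends to \<^term>\<open>M\<close>.\<close>

lemma clear_functional:
  assumes M: "M \<in> fgmod R" and \<psi>: "\<psi> \<in> mod_hom locR (locM M) (ring_mod locR)"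
  shows "\<exists>v\<in>S. \<exists>\<tau>\<in>Dual M. \<forall>m\<in>carrier M. fracR (\<tau> m) \<one> = fracR v \<one> \<otimes>\<^bsub>locR\<^esub> \<psi> (frac M m \<one>)"
proof -
  note mM = module_fgmod[OF M] and mR = module_ring_mod
  note mL = module_locM[OF mM] and mLR = cring.module_ring_mod[OF cring_locR]
  interpret L: cring locR by (rule cring_locR)
  obtain P q where P: "ffree P" "epi P M q" using free_cover[OF M] by blast
  note mP = ffreeD(2)[OF P(1)] and qH = epi_Hom[OF P(2)]
  obtain r s y where b: "basis P r s y" using ffree_basis[OF P(1)] by blast
  have s: "s i \<in> Dual P" "y i \<in> carrier P" if "i < r" for i using b that by (auto simp: basis_def)
  define f where "f p = \<psi> (frac M (q p) \<one>)" for p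
  have fc: "f p \<in> carrier locR" if "p \<in> carrier P" for p
    unfolding f_def using L.Hom_closed[OF \<psi> locM_closed[OF Hom_closed[OF qH that] S_one]] by simp
  have fadd: "f (x \<oplus>\<^bsub>P\<^esub> z) = f x \<oplus>\<^bsub>locR\<^esub> f z" if "x \<in> carrier P" "z \<in> carrier P" for x z
    unfolding f_def
    using Hom_add[OF qH that] loc_map_add[OF mM Hom_closed[OF qH that(1)] Hom_closed[OF qH that(2)]]
      L.Hom_add[OF \<psi> locM_closed[OF Hom_closed[OF qH that(1)] S_one] locM_closed[OF Hom_closed[OF qH that(2)] S_one]] by simp
  have fsm: "f (a \<odot>\<^bsub>P\<^esub> x) = fracR a \<one> \<otimes>\<^bsub>locR\<^esub> f x" if "a \<in> carrier R" "x \<in> carrier P" for a x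
    unfolding f_def
    using Hom_smult[OF qH that] loc_map_smult[OF mM Hom_closed[OF qH that(2)] that(1)]
      L.Hom_smult[OF \<psi> locR_closed[OF that(1) S_one] locM_closed[OF Hom_closed[OF qH that(2)] S_one]] by simp
  have f0: "f \<zero>\<^bsub>P\<^esub> = \<zero>\<^bsub>locR\<^esub>"
    using L.Hom_zero[OF \<psi> mL mLR] Hom_zero[OF qH mP mM] by (simp add: f_def locM_carrier(2))
  have "\<forall>i<r. f (y i) \<in> carrier locR" using fc s(2) by blast
  from common_denominator_ring[OF this] obtain t c where t: "t \<in> S"
    and "\<forall>i<r. c i \<in> carrier R \<and> fracR t \<one> \<otimes>\<^bsub>locR\<^esub> f (y i) = fracR (c i) \<one>"
    by (elim bexE exE)
  then have c: "\<And>i. i < r \<Longrightarrow> c i \<in> carrier R" "\<And>i. i < r \<Longrightarrow> fracR t \<one> \<otimes>\<^bsub>locR\<^esub> f (y i) = fracR (c i) \<one>"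
    by simp_all
  note tR = S_R[OF t]
  note tL = locR_closed[OF tR S_one]
  define g where "g p = lc (ring_mod R) r (\<lambda>i. s i p) c" for p
  have g: "g \<in> Dual P" unfolding g_def using s c by (intro Hom_lc mP mR) auto
  have gR: "g p \<in> carrier R" if "p \<in> carrier P" for p using Hom_closed[OF g that] by simp
  have gy: "g (y j) = c j" if "j < r" for j
  proof -
    have "g (y j) = lc (ring_mod R) r (\<lambda>i. if i = j then \<one> else \<zero>) c"
      unfolding g_def using b that by (intro lc_cong) (auto simp: basis_def)
    then show ?thesis using lc_delta[OF mR that, of c] c by simp
  qed
  let ?N = "{p \<in> carrier P. fracR (g p) \<one> = fracR t \<one> \<otimes>\<^bsub>locR\<^esub> f p}"
  have "submodule ?N R P"
  proof (rule submodI[OF mP])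
    show "\<zero>\<^bsub>P\<^esub> \<in> ?N" using mzero[OF mP] f0 Hom_zero[OF g mP mR] tL by (simp add: locR_sel(2)[symmetric])
    show "x \<oplus>\<^bsub>P\<^esub> z \<in> ?N" if "x \<in> ?N" "z \<in> ?N" for x z
      using that madd[OF mP, of x z] Hom_add[OF g, of x z] fadd[of x z] fc[of x] fc[of z] tL
        loc_map_add[OF mR, of "g x" "g z"] gR[of x] gR[of z] by (simp add: L.r_distr locR_sel(4)[symmetric])
    show "a \<odot>\<^bsub>P\<^esub> x \<in> ?N" if "a \<in> carrier R" "x \<in> ?N" for a x
      using that msmult[OF mP, of a x] Hom_smult[OF g, of a x] fsm[of a x] fc[of x] tL
        loc_map_smult[OF mR, of "g x" a] gR[of x] locR_closed[OF _ S_one, of a] by (simp add: L.m_lcomm locR_sel(5)[symmetric])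
  qed auto
  moreover have "y i \<in> ?N" if "i < r" for i using that s c gy by simp
  ultimately have gf: "fracR (g p) \<one> = fracR t \<one> \<otimes>\<^bsub>locR\<^esub> f p" if "p \<in> carrier P" for p
  proof -
    have "lc P r (\<lambda>i. s i p) y \<in> ?N"
      using \<open>submodule ?N R P\<close> \<open>\<And>i. i < r \<Longrightarrow> y i \<in> ?N\<close> Hom_closed[OF s(1) that] by (intro lc_submod[OF mP]) auto
    moreover have "lc P r (\<lambda>i. s i p) y = p" using b that unfolding basis_def by blast
    ultimately show ?thesis by simp
  qed
  let ?K = "{p \<in> carrier P. q p = \<zero>\<^bsub>M\<^esub>}"
  obtain X where X: "finite X" "X \<subseteq> ?K" "span P X = ?K"
    using fin_gen_submodule[OF mP _ submod_ker[OF qH mP mM]] ffreeD(1)[OF P(1)] by (auto simp: fgmod_def)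
  have "\<exists>w\<in>S. \<forall>p\<in>X. w \<otimes> g p = \<zero>"
  proof (rule common_multiplier[OF X(1)])
    fix p assume "p \<in> X"
    then have p: "p \<in> carrier P" "q p = \<zero>\<^bsub>M\<^esub>" using X by auto
    have "f p = \<zero>\<^bsub>locR\<^esub>" using p(2) L.Hom_zero[OF \<psi> mL mLR] by (simp add: f_def locM_carrier(2))
    then have "fracR (g p) \<one> = fracR \<zero> \<one>" using gf[OF p(1)] tL by (simp add: locR_sel(2)[symmetric])
    then have "\<exists>w\<in>S. w \<otimes> g p = w \<otimes> \<zero>" using loc_map_eq[OF mR, of "g p" \<zero>] gR[OF p(1)] by simp
    then show "\<exists>w\<in>S. w \<otimes> g p = \<zero>" using S_R by auto
  next
    fix p v w assume "p \<in> X" "v \<in> S" "w \<in> S" "v \<otimes> g p = \<zero>"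
    then show "w \<otimes> v \<otimes> g p = \<zero>" using X gR S_R by (auto simp: m_assoc)
  qed
  then obtain w where w: "w \<in> S" "\<And>p. p \<in> X \<Longrightarrow> w \<otimes> g p = \<zero>" by blast
  note wR = S_R[OF w(1)]
  have wg: "(\<lambda>p. w \<otimes> g p) \<in> Dual P" using Hom_scale[OF g mR wR] by simp
  have "span P X \<subseteq> {p \<in> carrier P. w \<otimes> g p = \<zero>}"
    using submod_ker[OF wg mP mR] w(2) X(2) by (intro span_minimal) auto
  then have "w \<otimes> g p = \<zero>" if "p \<in> carrier P" "q p = \<zero>\<^bsub>M\<^esub>" for p using that X(3) by auto
  then obtain \<tau> where \<tau>: "\<tau> \<in> Dual M" "\<And>p. p \<in> carrier P \<Longrightarrow> \<tau> (q p) = w \<otimes> g p"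
    using Hom_descend[OF P(2) wg mP mR mM] by auto
  have "fracR (\<tau> m) \<one> = fracR (w \<otimes> t) \<one> \<otimes>\<^bsub>locR\<^esub> \<psi> (frac M m \<one>)" if m: "m \<in> carrier M" for m
  proof -
    obtain p where p: "p \<in> carrier P" "q p = m" using epiE[OF P(2) m] .
    have "fracR (\<tau> m) \<one> = fracR w \<one> \<otimes>\<^bsub>locR\<^esub> fracR (g p) \<one>"
      using \<tau>(2)[OF p(1)] p wR gR[OF p(1)] S_one by (simp add: locR_mult)
    also have "\<dots> = fracR w \<one> \<otimes>\<^bsub>locR\<^esub> (fracR t \<one> \<otimes>\<^bsub>locR\<^esub> f p)" using gf[OF p(1)] by simp
    also have "\<dots> = fracR (w \<otimes> t) \<one> \<otimes>\<^bsub>locR\<^esub> f p"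
      using fc[OF p(1)] tL locR_closed[OF wR S_one] wR tR S_one by (simp add: L.m_assoc[symmetric] locR_mult)
    finally show ?thesis using p by (simp add: f_def)
  qed
  then show ?thesis using S_mult[OF w(1) t] \<tau>(1) by blast
qed

text \<open>Clear denominators in the coordinate functionals and in the vectors of a basis of the localization. The
  expansion of an element in the basis then becomes an identity in \<^term>\<open>M\<close> up to a multiplier, one for all
  members of a finite generating set.\<close>

lemma loc_free_imp_free_factor:
  assumes M: "M \<in> fgmod R" and free: "free_module locR (locM M)"
  shows "\<exists>u\<in>S. free_factor M u"
proof -
  note mM = module_fgmod[OF M] and mR = module_ring_mod
  note mL = module_locM[OF mM] and mLR = cring.module_ring_mod[OF cring_locR]
  interpret L: cring locR by (rule cring_locR)
  obtain r s y where b: "L.basis (locM M) r s y"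
    using L.free_fg_basis[OF mL locM_fin_gen[OF mM] free] M by (auto simp: fgmod_def)
  have s: "s i \<in> mod_hom locR (locM M) (ring_mod locR)" "y i \<in> carrier (locM M)" if "i < r" for i
    using b that by (auto simp: L.basis_def)
  have sum: "lc (locM M) r (\<lambda>i. s i X) y = X" if "X \<in> carrier (locM M)" for X
    using b that unfolding L.basis_def by blast
  have sL: "s i X \<in> carrier locR" if "i < r" "X \<in> carrier (locM M)" for i X
    using L.Hom_closed[OF s(1)[OF that(1)] that(2)] by simp
  have "\<exists>v\<in>S. \<forall>i\<in>{..<r}. \<exists>\<tau>\<in>Dual M. \<forall>m\<in>carrier M. fracR (\<tau> m) \<one> = fracR v \<one> \<otimes>\<^bsub>locR\<^esub> s i (frac M m \<one>)"
  proof (rule common_multiplier)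
    show "\<exists>v\<in>S. \<exists>\<tau>\<in>Dual M. \<forall>m\<in>carrier M. fracR (\<tau> m) \<one> = fracR v \<one> \<otimes>\<^bsub>locR\<^esub> s i (frac M m \<one>)" if "i \<in> {..<r}" for i
      using clear_functional[OF M s(1)] that by simp
    fix i v w assume i: "i \<in> {..<r}" "v \<in> S" "w \<in> S"
      and "\<exists>\<tau>\<in>Dual M. \<forall>m\<in>carrier M. fracR (\<tau> m) \<one> = fracR v \<one> \<otimes>\<^bsub>locR\<^esub> s i (frac M m \<one>)"
    then obtain \<tau> where \<tau>: "\<tau> \<in> Dual M" "\<forall>m\<in>carrier M. fracR (\<tau> m) \<one> = fracR v \<one> \<otimes>\<^bsub>locR\<^esub> s i (frac M m \<one>)" by blast
    note R = S_R[OF i(2)] S_R[OF i(3)]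
    have "fracR (w \<otimes> \<tau> m) \<one> = fracR (w \<otimes> v) \<one> \<otimes>\<^bsub>locR\<^esub> s i (frac M m \<one>)" if m: "m \<in> carrier M" for m
    proof -
      have sm: "s i (frac M m \<one>) \<in> carrier locR" using sL[of i] i locM_closed[OF m S_one] by simp
      have "\<tau> m \<in> carrier R" using Hom_closed[OF \<tau>(1) m] by simp
      then have "fracR (w \<otimes> \<tau> m) \<one> = fracR w \<one> \<otimes>\<^bsub>locR\<^esub> fracR (\<tau> m) \<one>" using R S_one by (simp add: locR_mult)
      also have "\<dots> = fracR w \<one> \<otimes>\<^bsub>locR\<^esub> (fracR v \<one> \<otimes>\<^bsub>locR\<^esub> s i (frac M m \<one>))" using \<tau>(2) m by simp
      also have "\<dots> = fracR (w \<otimes> v) \<one> \<otimes>\<^bsub>locR\<^esub> s i (frac M m \<one>)"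
        using sm locR_closed[OF R(1) S_one] locR_closed[OF R(2) S_one] R S_one by (simp add: L.m_assoc[symmetric] locR_mult)
      finally show ?thesis .
    qed
    then show "\<exists>\<tau>\<in>Dual M. \<forall>m\<in>carrier M. fracR (\<tau> m) \<one> = fracR (w \<otimes> v) \<one> \<otimes>\<^bsub>locR\<^esub> s i (frac M m \<one>)"
      using Hom_scale[OF \<tau>(1) mR R(2)] by (intro bexI[of _ "\<lambda>m. w \<otimes> \<tau> m"]) simp_all
  qed simp
  then obtain v where v: "v \<in> S" and ex: "\<forall>i. \<exists>\<tau>. i < r \<longrightarrow> \<tau> \<in> Dual M \<and>
      (\<forall>m\<in>carrier M. fracR (\<tau> m) \<one> = fracR v \<one> \<otimes>\<^bsub>locR\<^esub> s i (frac M m \<one>))"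
    by (auto simp: Bex_def)
  obtain \<tau> where "\<forall>i. i < r \<longrightarrow> \<tau> i \<in> Dual M \<and>
      (\<forall>m\<in>carrier M. fracR (\<tau> i m) \<one> = fracR v \<one> \<otimes>\<^bsub>locR\<^esub> s i (frac M m \<one>))"
    using choice[OF ex] by (rule exE)
  then have \<tau>: "\<And>i. i < r \<Longrightarrow> \<tau> i \<in> Dual M"
    "\<And>i m. \<lbrakk>i < r; m \<in> carrier M\<rbrakk> \<Longrightarrow> fracR (\<tau> i m) \<one> = fracR v \<one> \<otimes>\<^bsub>locR\<^esub> s i (frac M m \<one>)" by blast+
  have "\<forall>i<r. y i \<in> carrier (locM M)" using s(2) by blast
  from common_denominator[OF mM this] obtain t z where t: "t \<in> S"
    and "\<forall>i<r. z i \<in> carrier M \<and> fracR t \<one> \<odot>\<^bsub>locM M\<^esub> y i = frac M (z i) \<one>"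
    by (elim bexE exE)
  then have z: "\<And>i. i < r \<Longrightarrow> z i \<in> carrier M" "\<And>i. i < r \<Longrightarrow> fracR t \<one> \<odot>\<^bsub>locM M\<^esub> y i = frac M (z i) \<one>"
    by simp_all
  note vR = S_R[OF v] and tR = S_R[OF t]
  note vL = locR_closed[OF vR S_one] and tL = locR_closed[OF tR S_one]
  define g where "g m = lc M r (\<lambda>i. \<tau> i m) z" for m
  have gH: "g \<in> Hom M M" unfolding g_def by (rule Hom_lc[OF mM mM \<tau>(1) z(1)])
  have \<tau>R: "\<tau> i m \<in> carrier R" if "i < r" "m \<in> carrier M" for i m using Hom_closed[OF \<tau>(1) that(2)] that by simp
  have "frac M (g m) \<one> = frac M ((t \<otimes> v) \<odot>\<^bsub>M\<^esub> m) \<one>" if m: "m \<in> carrier M" for m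
  proof -
    let ?X = "frac M m \<one>"
    note X = locM_closed[OF m S_one]
    have "frac M (g m) \<one> = lc (locM M) r (\<lambda>i. fracR (\<tau> i m) \<one>) (\<lambda>i. frac M (z i) \<one>)"
      unfolding g_def using \<tau>R m z by (intro loc_map_lc mM) auto
    also have "\<dots> = lc (locM M) r (\<lambda>i. fracR v \<one> \<otimes>\<^bsub>locR\<^esub> s i ?X) (\<lambda>i. fracR t \<one> \<odot>\<^bsub>locM M\<^esub> y i)"
      using \<tau>(2) z(2) m by (intro lc_cong) auto
    also have "\<dots> = fracR t \<one> \<odot>\<^bsub>locM M\<^esub> lc (locM M) r (\<lambda>i. fracR v \<one> \<otimes>\<^bsub>locR\<^esub> s i ?X) y"
      using s(2) sL X vL by (intro L.lc_Hom[OF L.Hom_scale[OF L.Hom_id mL tL] mL mL, symmetric]) auto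
    also have "lc (locM M) r (\<lambda>i. fracR v \<one> \<otimes>\<^bsub>locR\<^esub> s i ?X) y = fracR v \<one> \<odot>\<^bsub>locM M\<^esub> ?X"
      using L.lc_smult[OF mL vL, of r "\<lambda>i. s i ?X" y] s(2) sL X sum[OF X] by simp
    also have "fracR t \<one> \<odot>\<^bsub>locM M\<^esub> (fracR v \<one> \<odot>\<^bsub>locM M\<^esub> ?X) = frac M ((t \<otimes> v) \<odot>\<^bsub>M\<^esub> m) \<one>"
      using m vR tR mM by (simp add: loc_map_smult[symmetric] msmult_smult mclosed)
    finally show ?thesis .
  qed
  then have ex: "\<exists>w\<in>S. w \<odot>\<^bsub>M\<^esub> g m = w \<odot>\<^bsub>M\<^esub> ((t \<otimes> v) \<odot>\<^bsub>M\<^esub> m)" if m: "m \<in> carrier M" for m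
    using loc_map_eq[OF mM Hom_closed[OF gH m], of "(t \<otimes> v) \<odot>\<^bsub>M\<^esub> m"] m vR tR mM by (simp add: mclosed)
  obtain A where A: "finite A" "A \<subseteq> carrier M" "span M A = carrier M"
    using M fin_gen_span[OF mM] by (auto simp: fgmod_def)
  have tv: "t \<otimes> v \<in> carrier R" using tR vR by simp
  have "\<exists>w\<in>S. \<forall>m\<in>A. w \<odot>\<^bsub>M\<^esub> g m = w \<odot>\<^bsub>M\<^esub> ((t \<otimes> v) \<odot>\<^bsub>M\<^esub> m)"
  proof (rule common_multiplier[OF A(1)])
    show "\<exists>w\<in>S. w \<odot>\<^bsub>M\<^esub> g m = w \<odot>\<^bsub>M\<^esub> ((t \<otimes> v) \<odot>\<^bsub>M\<^esub> m)" if "m \<in> A" for m using ex A that by auto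
    fix m v' w assume m: "m \<in> A" "v' \<in> S" "w \<in> S" "v' \<odot>\<^bsub>M\<^esub> g m = v' \<odot>\<^bsub>M\<^esub> ((t \<otimes> v) \<odot>\<^bsub>M\<^esub> m)"
    have mc: "m \<in> carrier M" using m A by auto
    show "(w \<otimes> v') \<odot>\<^bsub>M\<^esub> g m = (w \<otimes> v') \<odot>\<^bsub>M\<^esub> ((t \<otimes> v) \<odot>\<^bsub>M\<^esub> m)"
      using m(4) msmult_smult[OF mM S_R[OF m(3)] S_R[OF m(2)] Hom_closed[OF gH mc]]
        msmult_smult[OF mM S_R[OF m(3)] S_R[OF m(2)] msmult[OF mM tv mc]] by simp
  qed
  then obtain w where w: "w \<in> S" "\<And>m. m \<in> A \<Longrightarrow> w \<odot>\<^bsub>M\<^esub> g m = w \<odot>\<^bsub>M\<^esub> ((t \<otimes> v) \<odot>\<^bsub>M\<^esub> m)" by blast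
  note wR = S_R[OF w(1)]
  have "span M A \<subseteq> {m \<in> carrier M. w \<odot>\<^bsub>M\<^esub> g m = w \<odot>\<^bsub>M\<^esub> ((t \<otimes> v) \<odot>\<^bsub>M\<^esub> m)}"
    using submod_equalizer[OF mM Hom_scale[OF gH mM wR] Hom_scale[OF Hom_scale[OF Hom_id mM tv] mM wR] mM] w(2) A(2)
    by (intro span_minimal) auto
  then have all: "w \<odot>\<^bsub>M\<^esub> g m = w \<odot>\<^bsub>M\<^esub> ((t \<otimes> v) \<odot>\<^bsub>M\<^esub> m)" if "m \<in> carrier M" for m using that A(3) by auto
  have "lc M r (\<lambda>i. w \<otimes> \<tau> i m) z = (w \<otimes> (t \<otimes> v)) \<odot>\<^bsub>M\<^esub> m" if m: "m \<in> carrier M" for m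
    using lc_smult[OF mM wR, of r "\<lambda>i. \<tau> i m" z] \<tau>R[OF _ m] z(1) all[OF m] msmult_smult[OF mM wR tv m] by (simp add: g_def)
  then have "dual_family M (w \<otimes> (t \<otimes> v)) r (\<lambda>i m. w \<otimes> \<tau> i m) z"
    unfolding dual_family_def using z(1) Hom_scale[OF \<tau>(1) mR wR] by simp
  moreover have "w \<otimes> (t \<otimes> v) \<in> S" using S_mult w v t by blast
  ultimately show ?thesis using S_R unfolding free_factor_def by blast
qed

end

context cring
begin

text \<open>A relation among the vectors expresses \<^term>\<open>e k\<close> times \<^term>\<open>y k\<close> by the others; substituting it
  in \<^term>\<open>e k\<close> times the dual family removes \<^term>\<open>y k\<close>. The transposition moves \<^term>\<open>y k\<close> to the end, where
  the recursion for \<^const>\<open>lc\<close> can drop it.\<close>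

lemma dual_family_eliminate:
  assumes M: "module R M" and D: "dual_family M u (Suc r) s y" and u: "u \<in> carrier R"
    and e: "\<And>i. i < Suc r \<Longrightarrow> e i \<in> carrier R" "lc M (Suc r) e y = \<zero>\<^bsub>M\<^esub>" and k: "k < Suc r"
  shows "\<exists>s' y'. dual_family M (e k \<otimes> u) r s' y'"
proof -
  define t where "t = Transposition.transpose k r"
  have tb: "bij_betw t {..<Suc r} {..<Suc r}"
    unfolding t_def using k by (intro bij_betw_byWitness[of _ "Transposition.transpose k r"]) (auto simp: Transposition.transpose_def)
  have tlt: "t i < Suc r" if "i < Suc r" for i using that k by (auto simp: t_def Transposition.transpose_def)
  have tr: "t r = k" by (simp add: t_def Transposition.transpose_def)
  have D': "s i \<in> Dual M" "y i \<in> carrier M" if "i < Suc r" for i using D that by (auto simp: dual_family_def)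
  define S Y E where "S i = s (t i)" and "Y i = y (t i)" and "E i = e (t i)" for i
  have S: "S i \<in> Dual M" "Y i \<in> carrier M" "E i \<in> carrier R" if "i < Suc r" for i
    using D' e(1) tlt that by (auto simp: S_def Y_def E_def)
  have SR: "S i m \<in> carrier R" if "i < Suc r" "m \<in> carrier M" for i m using Hom_closed[OF S(1) that(2)] that by simp
  have sR: "s i m \<in> carrier R" if "i < Suc r" "m \<in> carrier M" for i m using Hom_closed[OF D'(1) that(2)] that by simp
  have sumS: "lc M (Suc r) (\<lambda>i. S i m) Y = u \<odot>\<^bsub>M\<^esub> m" if m: "m \<in> carrier M" for m
    using lc_permute[OF M _ _ tb, of "\<lambda>i. s i m" y] sR[OF _ m] D' D m by (simp add: S_def[abs_def] Y_def[abs_def] dual_family_def del: lc.simps)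
  have sumE: "lc M (Suc r) E Y = \<zero>\<^bsub>M\<^esub>"
    using lc_permute[OF M _ _ tb, of e y] e D' by (simp add: E_def[abs_def] Y_def[abs_def] del: lc.simps)
  have Ek: "E r = e k" by (simp add: E_def tr)
  note a = S(3)[of r, simplified] and Yr = S(2)[of r, simplified]
  have lE: "lc M r E Y \<in> carrier M" using S by (intro lc_closed M) auto
  have lE': "lc M r E Y = \<ominus>\<^bsub>M\<^esub> (E r \<odot>\<^bsub>M\<^esub> Y r)"
    using sumE madd_zero[OF M lE msmult[OF M a Yr]] by simp
  define s' where "s' i m = E r \<otimes> S i m \<oplus> \<ominus> (S r m \<otimes> E i)" for i m
  have "s' i \<in> Dual M" if i: "i < r" for i
  proof -
    have "(\<lambda>m. E r \<otimes> S i m \<oplus> \<ominus> (E i \<otimes> S r m)) \<in> Dual M"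
      using Hom_plus[OF Hom_scale[OF S(1)[of i] module_ring_mod a] Hom_uminus[OF Hom_scale[OF S(1)[of r] module_ring_mod S(3)[of i]] module_ring_mod] module_ring_mod] i by simp
    then show ?thesis
      by (rule Hom_cong[OF _ M]) (use SR[of r] S(3)[of i] i in \<open>simp add: s'_def m_comm\<close>)
  qed
  moreover have "lc M r (\<lambda>i. s' i m) Y = (e k \<otimes> u) \<odot>\<^bsub>M\<^esub> m" if m: "m \<in> carrier M" for m
  proof -
    note Sm = SR[OF _ m]
    have lS: "lc M r (\<lambda>i. S i m) Y \<in> carrier M" using S Sm by (intro lc_closed M) auto
    note ySm = msmult[OF M Sm[of r, simplified] Yr]
    have "lc M r (\<lambda>i. s' i m) Y = lc M r (\<lambda>i. E r \<otimes> S i m) Y \<oplus>\<^bsub>M\<^esub> lc M r (\<lambda>i. \<ominus> (S r m \<otimes> E i)) Y"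
      unfolding s'_def using S Sm a by (intro lc_plus M) auto
    also have "lc M r (\<lambda>i. \<ominus> (S r m \<otimes> E i)) Y = \<ominus>\<^bsub>M\<^esub> lc M r (\<lambda>i. S r m \<otimes> E i) Y"
      using S Sm by (intro lc_uminus M) auto
    also have "lc M r (\<lambda>i. E r \<otimes> S i m) Y = E r \<odot>\<^bsub>M\<^esub> lc M r (\<lambda>i. S i m) Y"
      using S Sm a by (intro lc_smult M) auto
    also have "lc M r (\<lambda>i. S r m \<otimes> E i) Y = S r m \<odot>\<^bsub>M\<^esub> lc M r E Y"
      using S Sm by (intro lc_smult M) auto
    also have "E r \<odot>\<^bsub>M\<^esub> lc M r (\<lambda>i. S i m) Y \<oplus>\<^bsub>M\<^esub> \<ominus>\<^bsub>M\<^esub> (S r m \<odot>\<^bsub>M\<^esub> lc M r E Y)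
       = E r \<odot>\<^bsub>M\<^esub> (lc M r (\<lambda>i. S i m) Y \<oplus>\<^bsub>M\<^esub> S r m \<odot>\<^bsub>M\<^esub> Y r)"
      unfolding lE' using lS ySm a Yr Sm[of r] M by (simp add: mlin msmult_comm)
    also have "\<dots> = E r \<odot>\<^bsub>M\<^esub> (u \<odot>\<^bsub>M\<^esub> m)" using sumS[OF m] by simp
    finally show ?thesis using a u m M by (simp add: msmult_smult Ek)
  qed
  ultimately have "dual_family M (e k \<otimes> u) r s' Y" using S(2) by (auto simp: dual_family_def)
  then show ?thesis by blast
qed

lemma mult_subset_prime: "primeideal p R \<Longrightarrow> mult_subset R (carrier R - p)"
proof -
  assume p: "primeideal p R"
  interpret p: primeideal p R by (rule p)
  show ?thesis
    by unfold_locales (use p.I_notcarr p.one_imp_carrier p.I_prime in auto)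
qed

text \<open>Choose a dual family of minimal length with multiplier \<^term>\<open>v\<close> outside \<^term>\<open>p\<close>. Each \<^term>\<open>y j\<close> gives a
  relation with coefficients \<open>s i (y j)\<close> minus \<^term>\<open>v\<close> times the Kronecker symbol; by minimality these coefficients
  lie in \<^term>\<open>p\<close>. So the matrix of the \<open>s i (y j)\<close> is diagonal modulo \<^term>\<open>p\<close> with diagonal outside
  \<^term>\<open>p\<close>, and the \<^term>\<open>y j\<close> are linearly independent at \<^term>\<open>p\<close>.\<close>

lemma free_factor_imp_loc_free:
  assumes p: "primeideal p R" and M: "module R M" and u: "u \<in> carrier R - p" "free_factor M u"
  shows "free_module (loc_ring R (carrier R - p)) (loc_mod R (carrier R - p) M)"
proof -
  let ?S = "carrier R - p"
  interpret p: primeideal p R by (rule p)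
  interpret S: mult_subset R ?S by (rule mult_subset_prime[OF p])
  interpret L: cring S.locR by (rule S.cring_locR)
  note mL = S.module_locM[OF M] and mR = module_ring_mod
  let ?P = "\<lambda>r. \<exists>u s y. u \<in> ?S \<and> dual_family M u r s y"
  define r where "r = (LEAST r. ?P r)"
  have "?P r" unfolding r_def using u by (intro LeastI_ex[of ?P]) (auto simp: free_factor_def)
  then obtain v s y where v: "v \<in> ?S" and D: "dual_family M v r s y" by blast
  have vR: "v \<in> carrier R" using v by simp
  have s: "s i \<in> Dual M" "y i \<in> carrier M" if "i < r" for i using D that by (auto simp: dual_family_def)
  have sum: "lc M r (\<lambda>i. s i m) y = v \<odot>\<^bsub>M\<^esub> m" if "m \<in> carrier M" for m using D that by (auto simp: dual_family_def)
  have sR: "s i m \<in> carrier R" if "i < r" "m \<in> carrier M" for i m using Hom_closed[OF s(1) that(2)] that by simp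
  have mat: "s i (y j) \<oplus> \<ominus> (v \<otimes> (if i = j then \<one> else \<zero>)) \<in> p" if ij: "i < r" "j < r" for i j
  proof (rule ccontr)
    define e where "e i = s i (y j) \<oplus> \<ominus> (v \<otimes> (if i = j then \<one> else \<zero>))" for i
    assume "s i (y j) \<oplus> \<ominus> (v \<otimes> (if i = j then \<one> else \<zero>)) \<notin> p"
    then have ei: "e i \<in> ?S" using sR[OF ij(1) s(2)[OF ij(2)]] vR by (simp add: e_def)
    obtain r' where r': "r = Suc r'" using ij by (cases r) auto
    have eR: "e i \<in> carrier R" if "i < r" for i using sR[OF that s(2)[OF ij(2)]] vR by (simp add: e_def)
    have "lc M r e y = lc M r (\<lambda>i. s i (y j)) y \<oplus>\<^bsub>M\<^esub> lc M r (\<lambda>i. \<ominus> (v \<otimes> (if i = j then \<one> else \<zero>))) y"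
      unfolding e_def[abs_def] using sR s ij vR by (intro lc_plus M) auto
    also have "lc M r (\<lambda>i. \<ominus> (v \<otimes> (if i = j then \<one> else \<zero>))) y = \<ominus>\<^bsub>M\<^esub> lc M r (\<lambda>i. v \<otimes> (if i = j then \<one> else \<zero>)) y"
      using s vR by (intro lc_uminus M) auto
    also have "lc M r (\<lambda>i. v \<otimes> (if i = j then \<one> else \<zero>)) y = v \<odot>\<^bsub>M\<^esub> lc M r (\<lambda>i. if i = j then \<one> else \<zero>) y"
      using s vR by (intro lc_smult M) auto
    also have "lc M r (\<lambda>i. if i = j then \<one> else \<zero>) y = y j" using s ij by (intro lc_delta M) auto
    also have "lc M r (\<lambda>i. s i (y j)) y = v \<odot>\<^bsub>M\<^esub> y j" using sum s(2)[OF ij(2)] .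
    finally have "lc M r e y = \<zero>\<^bsub>M\<^esub>" using M s(2)[OF ij(2)] vR by (simp add: mlin)
    then obtain s' y' where "dual_family M (e i \<otimes> v) r' s' y'"
      using dual_family_eliminate[OF M D[unfolded r'] vR, of e i] eR ij r' by blast
    moreover have "e i \<otimes> v \<in> ?S" using ei v by (rule S.S_mult)
    ultimately have "?P r'" by blast
    then have "r \<le> r'" unfolding r_def by (rule Least_le)
    then show False using r' by simp
  qed
  have off: "s i (y j) \<in> p" if "i < r" "j < r" "i \<noteq> j" for i j
    using mat[OF that(1,2)] that sR[OF that(1) s(2)[OF that(2)]] vR by simp
  have diag: "s i (y i) \<notin> p" if i: "i < r" for i
  proof
    assume si: "s i (y i) \<in> p"
    note sc = sR[OF i s(2)[OF i]]
    have "s i (y i) \<oplus> \<ominus> v \<in> p" using mat[OF i i] vR by simp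
    then have vp: "s i (y i) \<oplus> \<ominus> (s i (y i) \<oplus> \<ominus> v) \<in> p" by (rule p.a_closed[OF si p.a_inv_closed])
    have "s i (y i) \<oplus> \<ominus> (s i (y i) \<oplus> \<ominus> v) = v" using sc vR by (simp add: minus_add r_neg2)
    from vp[unfolded this] show False using v by simp
  qed
  let ?Y = "\<lambda>i. S.frac M (y i) \<one>"
  show ?thesis
  proof (rule L.free_moduleI[OF mL, of r ?Y])
    show "?Y i \<in> carrier (S.locM M)" if "i < r" for i using S.locM_closed[OF s(2)[OF that] S.S_one] .
  next
    fix X assume "X \<in> carrier (S.locM M)"
    then obtain m t where m: "m \<in> carrier M" "t \<in> ?S" "X = S.frac M m t" by (rule S.locME)
    note tR = S.S_R[OF m(2)] and vt = S.S_mult[OF v m(2)]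
    note c = S.locR_closed[OF one_closed vt] and si = S.locR_closed[OF sR[OF _ m(1)] S.S_one]
    have "lc (S.locM M) r (\<lambda>i. S.fracR \<one> (v \<otimes> t) \<otimes>\<^bsub>S.locR\<^esub> S.fracR (s i m) \<one>) ?Y
        = S.fracR \<one> (v \<otimes> t) \<odot>\<^bsub>S.locM M\<^esub> lc (S.locM M) r (\<lambda>i. S.fracR (s i m) \<one>) ?Y"
      using c si S.locM_closed[OF s(2) S.S_one] by (intro L.lc_smult[OF mL]) auto
    also have "lc (S.locM M) r (\<lambda>i. S.fracR (s i m) \<one>) ?Y = S.frac M (v \<odot>\<^bsub>M\<^esub> m) \<one>"
      using S.loc_map_lc[OF M, of r "\<lambda>i. s i m" y] sR[OF _ m(1)] s(2) sum[OF m(1)] by simp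
    also have "S.fracR \<one> (v \<otimes> t) \<odot>\<^bsub>S.locM M\<^esub> S.frac M (v \<odot>\<^bsub>M\<^esub> m) \<one> = S.frac M (v \<odot>\<^bsub>M\<^esub> m) (v \<otimes> t)"
      using M m vR tR vt by (intro S.frac_split[symmetric]) (auto simp: mclosed)
    also have "\<dots> = X" unfolding m(3)
      using M m vR tR vt by (intro S.frac_eqI) (auto simp: mclosed msmult_smult msmult_comm)
    finally show "\<exists>c. (\<forall>i<r. c i \<in> carrier S.locR) \<and> X = lc (S.locM M) r c ?Y"
      using c si by (intro exI[of _ "\<lambda>i. S.fracR \<one> (v \<otimes> t) \<otimes>\<^bsub>S.locR\<^esub> S.fracR (s i m) \<one>"]) auto
  next
    fix c i assume c: "\<And>j. j < r \<Longrightarrow> c j \<in> carrier S.locR" and z: "lc (S.locM M) r c ?Y = \<zero>\<^bsub>S.locM M\<^esub>" and i: "i < r"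
    have "\<forall>i<r. c i \<in> carrier S.locR" using c by blast
    from S.common_denominator_ring[OF this] obtain t a where t: "t \<in> ?S"
      and "\<forall>i<r. a i \<in> carrier R \<and> S.fracR t \<one> \<otimes>\<^bsub>S.locR\<^esub> c i = S.fracR (a i) \<one>"
      by (elim bexE exE)
    then have a: "\<And>i. i < r \<Longrightarrow> a i \<in> carrier R" "\<And>i. i < r \<Longrightarrow> S.fracR t \<one> \<otimes>\<^bsub>S.locR\<^esub> c i = S.fracR (a i) \<one>"
      by simp_all
    note tR = S.S_R[OF t]
    note tL = S.locR_closed[OF tR S.S_one]
    have "S.frac M (lc M r a y) \<one> = lc (S.locM M) r (\<lambda>i. S.fracR (a i) \<one>) ?Y"
      using a s by (intro S.loc_map_lc M) auto
    also have "\<dots> = lc (S.locM M) r (\<lambda>i. S.fracR t \<one> \<otimes>\<^bsub>S.locR\<^esub> c i) ?Y" using a by (intro lc_cong) auto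
    also have "\<dots> = S.fracR t \<one> \<odot>\<^bsub>S.locM M\<^esub> lc (S.locM M) r c ?Y"
      using c tL S.locM_closed[OF s(2) S.S_one] by (intro L.lc_smult[OF mL]) auto
    also have "\<dots> = S.frac M \<zero>\<^bsub>M\<^esub> \<one>" using z L.msmult_zero[OF mL tL] by (simp add: S.locM_carrier(2))
    finally obtain w where w: "w \<in> ?S" "w \<odot>\<^bsub>M\<^esub> lc M r a y = w \<odot>\<^bsub>M\<^esub> \<zero>\<^bsub>M\<^esub>"
      using S.loc_map_eq[OF M lc_closed[OF M, of r a y] mzero[OF M]] a s by auto
    note wR = S.S_R[OF w(1)]
    define \<gamma> where "\<gamma> i = w \<otimes> a i" for i
    have \<gamma>R: "\<gamma> i \<in> carrier R" if "i < r" for i using a wR that by (simp add: \<gamma>_def)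
    have \<gamma>0: "lc M r \<gamma> y = \<zero>\<^bsub>M\<^esub>"
      using lc_smult[OF M wR, of r a y] a s w msmult_zero[OF M wR] by (simp add: \<gamma>_def[abs_def])
    have "lc (ring_mod R) r (\<lambda>j. s i (y j)) \<gamma> = \<zero>" if i: "i < r" for i
    proof -
      have "lc (ring_mod R) r (\<lambda>j. s i (y j)) \<gamma> = lc (ring_mod R) r \<gamma> (\<lambda>j. s i (y j))"
        using sR s \<gamma>R i by (intro lc_ring_comm) auto
      also have "\<dots> = s i (lc M r \<gamma> y)" using s \<gamma>R i by (intro lc_Hom[OF s(1)[OF i] M mR, symmetric]) auto
      also have "\<dots> = \<zero>" using \<gamma>0 Hom_zero[OF s(1)[OF i] M mR] by simp
      finally show ?thesis .
    qed
    then obtain w' where w': "w' \<in> ?S" "\<forall>j<r. w' \<otimes> \<gamma> j = \<zero>"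
      using diagonal_mod_prime_injective[OF p, of r "\<lambda>i j. s i (y j)" \<gamma>] sR s(2) diag off \<gamma>R by blast
    have "(w' \<otimes> w) \<otimes> a i = (w' \<otimes> w) \<otimes> \<zero>" using w' wR a(1)[OF i] i by (simp add: \<gamma>_def m_assoc)
    then have "S.fracR (a i) \<one> = S.fracR \<zero> \<one>"
      using S.loc_map_eq[OF mR, of "a i" \<zero>] a(1)[OF i] S.S_mult[OF w'(1) w(1)] by auto
    then have 0: "S.fracR t \<one> \<otimes>\<^bsub>S.locR\<^esub> c i = \<zero>\<^bsub>S.locR\<^esub>" using a(2)[OF i] by (simp add: S.locR_sel(2))
    have tc: "S.fracR \<one> t \<in> carrier S.locR" using S.locR_closed[OF one_closed t] .
    have "c i = (S.fracR \<one> t \<otimes>\<^bsub>S.locR\<^esub> S.fracR t \<one>) \<otimes>\<^bsub>S.locR\<^esub> c i" using S.fracR_unit[OF t] c[OF i] by simp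
    also have "\<dots> = \<zero>\<^bsub>S.locR\<^esub>" using 0 L.m_assoc[OF tc tL c[OF i]] tc by simp
    finally show "c i = \<zero>\<^bsub>S.locR\<^esub>" .
  qed
qed

end

context noetherian_cring
begin

lemma NF_iff:
  assumes p: "primeideal p R" and M: "M \<in> fgmod R"
  shows "p \<in> NF R M \<longleftrightarrow> \<not> free_off p M"
proof -
  interpret S: mult_subset R "carrier R - p" by (rule mult_subset_prime[OF p])
  interpret S: noetherian_mult_subset R "carrier R - p" by unfold_locales
  show ?thesis
    using S.loc_free_imp_free_factor[OF M] free_factor_imp_loc_free[OF p module_fgmod[OF M]] p
    unfolding NF_def free_off_def by blast
qed

section \<open>Primes avoiding a power, and prime filtrations\<close>

lemma maximal_ideal_in:
  assumes "\<A> \<noteq> {}" "\<And>A. A \<in> \<A> \<Longrightarrow> ideal A R"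
  shows "\<exists>A\<in>\<A>. \<forall>B\<in>\<A>. A \<subseteq> B \<longrightarrow> B = A"
proof (rule subset_Zorn_nonempty[OF assms(1)])
  fix C assume "C \<noteq> {}" and C: "subset.chain \<A> C"
  then have "subset.chain {I. ideal I R} C" using assms(2) by (auto simp: subset.chain_def)
  then have "\<Union>C \<in> C" using ideal_chain_is_trivial \<open>C \<noteq> {}\<close> by blast
  then show "\<Union>C \<in> \<A>" using C by (auto simp: subset.chain_def)
qed

text \<open>An ideal maximal among those that contain \<^term>\<open>J\<close> and no power of \<^term>\<open>x\<close> is prime.\<close>

lemma prime_avoiding_powers:
  assumes J: "ideal J R" and x: "x \<in> carrier R" and n: "\<And>e::nat. x [^] e \<notin> J"
  shows "\<exists>p. primeideal p R \<and> J \<subseteq> p \<and> x \<notin> p"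
proof -
  define \<A> where "\<A> = {A. ideal A R \<and> J \<subseteq> A \<and> (\<forall>e::nat. x [^] e \<notin> A)}"
  have A: "A \<in> \<A> \<longleftrightarrow> ideal A R \<and> J \<subseteq> A \<and> (\<forall>e::nat. x [^] e \<notin> A)" for A by (simp add: \<A>_def)
  have "J \<in> \<A>" using J n by (simp add: A)
  then have "\<A> \<noteq> {}" by auto
  then have "\<exists>A\<in>\<A>. \<forall>B\<in>\<A>. A \<subseteq> B \<longrightarrow> B = A" by (rule maximal_ideal_in) (simp add: A)
  then obtain p where pA: "p \<in> \<A>" and max: "\<And>B. \<lbrakk>B \<in> \<A>; p \<subseteq> B\<rbrakk> \<Longrightarrow> B = p" by blast
  have p: "ideal p R" "J \<subseteq> p" "\<And>e::nat. x [^] e \<notin> p" using pA by (auto simp: A)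
  interpret p: ideal p R by (rule p)
  have pR: "p \<subseteq> carrier R" by (rule p.a_subset)
  have colon: "ideal {r \<in> carrier R. r \<otimes> b \<in> p} R" if b: "b \<in> carrier R" for b
  proof (rule idealI[OF ring_axioms])
    show "subgroup {r \<in> carrier R. r \<otimes> b \<in> p} (add_monoid R)"
      using b by (intro add.subgroupI) (auto simp: l_minus l_distr intro: exI[of _ \<zero>] p.a_inv_closed p.a_closed)
    fix a c assume a: "a \<in> {r \<in> carrier R. r \<otimes> b \<in> p}" and c: "c \<in> carrier R"
    then have "c \<otimes> (a \<otimes> b) \<in> p" by (auto intro: p.I_l_closed)
    then show "c \<otimes> a \<in> {r \<in> carrier R. r \<otimes> b \<in> p}" "a \<otimes> c \<in> {r \<in> carrier R. r \<otimes> b \<in> p}"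
      using a b c by (auto simp: m_ac)
  qed
  \<comment> \<open>The ideal quotient of \<^term>\<open>p\<close> by \<^term>\<open>b\<close> is strictly larger than \<^term>\<open>p\<close>, so by maximality it contains a
    power of \<^term>\<open>x\<close>.\<close>
  have pow: "\<exists>e::nat. x [^] e \<otimes> b \<in> p" if a: "a \<in> carrier R" "a \<notin> p" and b: "b \<in> carrier R" "a \<otimes> b \<in> p" for a b
  proof (rule ccontr)
    assume n: "\<not> ?thesis"
    have "p \<subseteq> {r \<in> carrier R. r \<otimes> b \<in> p}" using pR b by (auto intro: p.I_r_closed)
    moreover from this have "{r \<in> carrier R. r \<otimes> b \<in> p} \<in> \<A>" using colon[OF b(1)] p(2) n by (auto simp: A)
    ultimately have "{r \<in> carrier R. r \<otimes> b \<in> p} = p" using max by blast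
    then show False using a b by blast
  qed
  have "primeideal p R"
  proof (rule primeidealI[OF p.is_ideal is_cring])
    have "x [^] (0::nat) \<notin> p" by (rule p)
    then show "carrier R \<noteq> p" using x by auto
    fix a b assume a: "a \<in> carrier R" and b: "b \<in> carrier R" and ab: "a \<otimes> b \<in> p"
    show "a \<in> p \<or> b \<in> p"
    proof (rule ccontr)
      assume "\<not> ?thesis"
      then have na: "a \<notin> p" and nb: "b \<notin> p" by auto
      obtain e :: nat where e: "x [^] e \<otimes> b \<in> p" using pow[OF a na b ab] by blast
      then have "b \<otimes> x [^] e \<in> p" using b x by (simp add: m_comm)
      then obtain f :: nat where "x [^] f \<otimes> x [^] e \<in> p" using pow[OF b nb] x by blast
      then have "x [^] (f + e) \<in> p" using x by (simp add: nat_pow_mult)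
      then show False using p(3) by blast
    qed
  qed
  moreover have "x \<notin> p" using p(3)[of 1] x by simp
  ultimately show ?thesis using p(2) by blast
qed

text \<open>If no power of \<^term>\<open>x\<close> were a free factor, some prime would contain the ideal of free factors and avoid
  \<^term>\<open>x\<close>.\<close>

lemma power_free_factor:
  assumes M: "M \<in> fgmod R" and x: "x \<in> carrier R"
    and off: "\<And>p. \<lbrakk>primeideal p R; x \<notin> p\<rbrakk> \<Longrightarrow> free_off p M"
  shows "\<exists>e::nat. free_factor M (x [^] e)"
proof (rule ccontr)
  assume "\<not> ?thesis"
  then obtain p where p: "primeideal p R" "{u. free_factor M u} \<subseteq> p" "x \<notin> p"
    using prime_avoiding_powers[OF free_factor_ideal[OF M] x] by auto
  then show False using off[OF p(1,3)] by (auto simp: free_off_def)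
qed

lemma proper_ideal_prime: "\<lbrakk>ideal I R; I \<noteq> carrier R\<rbrakk> \<Longrightarrow> \<exists>p. primeideal p R \<and> I \<subseteq> p"
proof -
  assume I: "ideal I R" "I \<noteq> carrier R"
  interpret I: ideal I R by (rule I)
  have "\<one> \<notin> I" using I(2) I.one_imp_carrier by auto
  then show ?thesis using prime_avoiding_powers[OF I(1) one_closed] by auto
qed

text \<open>The zero map factors through the zero module.\<close>

lemma free_factor_annihilator:
  "\<lbrakk>M \<in> fgmod R; a \<in> carrier R; \<And>m. m \<in> carrier M \<Longrightarrow> a \<odot>\<^bsub>M\<^esub> m = \<zero>\<^bsub>M\<^esub>\<rbrakk> \<Longrightarrow> free_factor M a"
  unfolding free_factor_def dual_family_def by (intro conjI exI[of _ 0]) auto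

lemma annihilator_ideal:
  assumes M: "module R M" and A: "A \<subseteq> carrier M"
  shows "ideal {a \<in> carrier R. \<forall>m\<in>A. a \<odot>\<^bsub>M\<^esub> m = \<zero>\<^bsub>M\<^esub>} R"
proof (rule idealI[OF ring_axioms])
  have A: "m \<in> carrier M" if "m \<in> A" for m using A that by auto
  show "subgroup {a \<in> carrier R. \<forall>m\<in>A. a \<odot>\<^bsub>M\<^esub> m = \<zero>\<^bsub>M\<^esub>} (add_monoid R)"
  proof (rule add.subgroupI)
    show "{a \<in> carrier R. \<forall>m\<in>A. a \<odot>\<^bsub>M\<^esub> m = \<zero>\<^bsub>M\<^esub>} \<noteq> {}" using M A by (auto intro!: exI[of _ \<zero>] simp: mzero_smult)
  qed (use M A in \<open>auto simp: mneg_smult madd_smult mneg_zero mzero_l mzero\<close>)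
  fix a x assume a: "a \<in> {a \<in> carrier R. \<forall>m\<in>A. a \<odot>\<^bsub>M\<^esub> m = \<zero>\<^bsub>M\<^esub>}" and x: "x \<in> carrier R"
  show "x \<otimes> a \<in> {a \<in> carrier R. \<forall>m\<in>A. a \<odot>\<^bsub>M\<^esub> m = \<zero>\<^bsub>M\<^esub>}"
    using a x M A by (auto simp: msmult_smult msmult_zero)
  then show "a \<otimes> x \<in> {a \<in> carrier R. \<forall>m\<in>A. a \<odot>\<^bsub>M\<^esub> m = \<zero>\<^bsub>M\<^esub>}"
    using a x by (simp add: m_comm)
qed

lemma annihilates_Idl:
  assumes M: "module R M" and X: "X \<subseteq> carrier R" "\<And>x m. \<lbrakk>x \<in> X; m \<in> carrier M\<rbrakk> \<Longrightarrow> x \<odot>\<^bsub>M\<^esub> m = \<zero>\<^bsub>M\<^esub>"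
  shows "annihilates (Idl X) M"
  using genideal_minimal[OF annihilator_ideal[OF M subset_refl], of X] X by (auto simp: annihilates_def)

text \<open>A maximal one among the annihilators of nonzero elements is prime; the element then generates a copy of
  \<open>R/p\<close>.\<close>

lemma associated_prime:
  assumes Q: "module R Q" and n: "carrier Q \<noteq> {\<zero>\<^bsub>Q\<^esub>}"
  shows "\<exists>m\<in>carrier Q. m \<noteq> \<zero>\<^bsub>Q\<^esub> \<and> primeideal {a \<in> carrier R. a \<odot>\<^bsub>Q\<^esub> m = \<zero>\<^bsub>Q\<^esub>} R"
proof -
  define an where "an m = {a \<in> carrier R. a \<odot>\<^bsub>Q\<^esub> m = \<zero>\<^bsub>Q\<^esub>}" for m
  have id: "ideal (an m) R" if "m \<in> carrier Q" for m
    using annihilator_ideal[OF Q, of "{m}"] that by (simp add: an_def)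
  let ?A = "an ` {m \<in> carrier Q. m \<noteq> \<zero>\<^bsub>Q\<^esub>}"
  have "?A \<noteq> {}" using n mzero[OF Q] by blast
  then have "\<exists>A\<in>?A. \<forall>B\<in>?A. A \<subseteq> B \<longrightarrow> B = A" by (rule maximal_ideal_in) (use id in blast)
  then obtain m where m: "m \<in> carrier Q" "m \<noteq> \<zero>\<^bsub>Q\<^esub>"
    and max: "\<And>k. \<lbrakk>k \<in> carrier Q; k \<noteq> \<zero>\<^bsub>Q\<^esub>; an m \<subseteq> an k\<rbrakk> \<Longrightarrow> an k = an m" by blast
  have "primeideal (an m) R"
  proof (rule primeidealI[OF id[OF m(1)] is_cring])
    have "\<one> \<notin> an m" using m Q by (simp add: an_def mone_smult)
    then show "carrier R \<noteq> an m" by auto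
    fix a b assume a: "a \<in> carrier R" and b: "b \<in> carrier R" and ab: "a \<otimes> b \<in> an m"
    have abm: "a \<odot>\<^bsub>Q\<^esub> (b \<odot>\<^bsub>Q\<^esub> m) = \<zero>\<^bsub>Q\<^esub>" using ab a b m Q by (simp add: an_def msmult_smult)
    show "a \<in> an m \<or> b \<in> an m"
    proof (cases "b \<odot>\<^bsub>Q\<^esub> m = \<zero>\<^bsub>Q\<^esub>")
      case True
      then show ?thesis using b by (simp add: an_def)
    next
      case False
      have "an m \<subseteq> an (b \<odot>\<^bsub>Q\<^esub> m)"
      proof
        fix c assume "c \<in> an m"
        then have c: "c \<in> carrier R" "c \<odot>\<^bsub>Q\<^esub> m = \<zero>\<^bsub>Q\<^esub>" by (auto simp: an_def)
        then show "c \<in> an (b \<odot>\<^bsub>Q\<^esub> m)"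
          using msmult_comm[OF Q c(1) b m(1)] msmult_zero[OF Q b] by (simp add: an_def)
      qed
      then have "an (b \<odot>\<^bsub>Q\<^esub> m) = an m" using max[OF msmult[OF Q b m(1)] False] by blast
      then show ?thesis using abm a by (auto simp: an_def)
    qed
  qed
  then show ?thesis using m unfolding an_def by blast
qed

lemma prime_quot_exists:
  assumes p: "primeideal p R"
  shows "\<exists>M\<in>fgmod R. mod_iso R M (quot_mod R (ring_mod R) p)"
proof -
  interpret p: primeideal p R by (rule p)
  note m = module_ring_mod
  note q = quot_proj[OF m submodule_ring_mod[OF p.is_ideal]]
  have "a \<in> span (ring_mod R) {\<one>}" if a: "a \<in> carrier R" for a
  proof -
    have "\<one> \<in> span (ring_mod R) {\<one>}" using span_incl[of "{\<one>}" "ring_mod R"] by auto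
    from submod_smult[OF span_submodule[OF m] m a this] show ?thesis using a by simp
  qed
  then have "carrier R \<subseteq> span (ring_mod R) {\<one>}" by blast
  moreover have "span (ring_mod R) {\<one>} \<subseteq> carrier R" by (auto simp: span_def)
  ultimately have "span (ring_mod R) {\<one>} = carrier (ring_mod R)" by simp
  then have "fin_gen R (ring_mod R)" using fin_gen_span[OF m] by (intro iffD2[OF fin_gen_span[OF m]] exI[of _ "{\<one>}"]) simp
  then have "fin_gen R (quot_mod R (ring_mod R) p)" using fin_gen_image[OF m q(1,2)] by blast
  then obtain M where "M \<in> fgmod R" "mod_iso R (quot_mod R (ring_mod R) p) M"
    using fgmod_representative[OF q(1)] by blast
  then show ?thesis using mod_iso_sym[OF _ q(1)] by blast
qed

lemma ext_cat_retr: "\<lbrakk>N \<in> ext_cat R \<X>; retr M N; M \<in> fgmod R; N \<in> fgmod R\<rbrakk> \<Longrightarrow> M \<in> ext_cat R \<X>"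
  by (rule ext_cat.summand) (auto simp: summand_iff)

lemma ext_cat_mono: "\<lbrakk>M \<in> ext_cat R \<X>; \<X> \<subseteq> \<Y>\<rbrakk> \<Longrightarrow> M \<in> ext_cat R \<Y>"
  by (induction rule: ext_cat.induct) (auto intro: ext_cat.intros)

lemma ext_cat_fgmod: "M \<in> ext_cat R \<X> \<Longrightarrow> M \<in> fgmod R"
  by (induction rule: ext_cat.induct) (auto simp: summand_def)

text \<open>Take a maximal submodule that lies in the extension closure; if it were proper, it could be enlarged by a copy of
  \<open>R/p\<close> in the quotient, whose prime contains \<^term>\<open>J\<close> because \<^term>\<open>J\<close> annihilates the quotient. The
  assumption that some prime contains \<^term>\<open>J\<close> provides the start: the zero module is a direct summand of
  \<open>R/p\<close>.\<close>

lemma prime_filtration: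
  assumes H: "H \<in> fgmod R" and J: "annihilates J H" "J \<subseteq> carrier R" and ne: "primes_over R J \<noteq> {}"
  shows "H \<in> ext_cat R (cyclic_quots R (primes_over R J))"
proof -
  define \<C> where "\<C> = cyclic_quots R (primes_over R J)"
  have C\<C>: "M \<in> \<C> \<longleftrightarrow> M \<in> fgmod R \<and> (\<exists>p\<in>primes_over R J. \<exists>q. epi (ring_mod R) M q \<and> (\<forall>a\<in>carrier R. q a = \<zero>\<^bsub>M\<^esub> \<longleftrightarrow> a \<in> p))" for M
    unfolding \<C>_def by (rule cyclic_quots_iff) (auto simp: primes_over_def intro: primeideal.axioms(1))
  note mH = module_fgmod[OF H]
  let ?A = "{K. submodule K R H \<and> sub H K \<in> ext_cat R \<C>}"
  have s0: "submodule {\<zero>\<^bsub>H\<^esub>} R H" by (rule submodI[OF mH]) (simp_all add: mlin[OF mH])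
  have "sub H {\<zero>\<^bsub>H\<^esub>} \<in> ext_cat R \<C>"
  proof -
    obtain p where p: "p \<in> primes_over R J" using ne by blast
    then obtain Z where Z: "Z \<in> fgmod R" "mod_iso R Z (quot_mod R (ring_mod R) p)"
      using prime_quot_exists by (auto simp: primes_over_def)
    then have "Z \<in> ext_cat R \<C>" using p by (intro ext_cat.base) (auto simp: \<C>_def cyclic_quots_def)
    moreover have "retr (sub H {\<zero>\<^bsub>H\<^esub>}) Z"
      using Hom_zero_map[OF module_fgmod[OF Z(1)], of "sub H {\<zero>\<^bsub>H\<^esub>}"] Hom_zero_map[OF module_sub[OF s0 mH], of Z]
      by (intro retrI[of "\<lambda>_. \<zero>\<^bsub>Z\<^esub>" _ _ "\<lambda>_. \<zero>\<^bsub>H\<^esub>"]) auto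
    ultimately show ?thesis using fgmod_sub[OF H s0] Z(1) by (rule ext_cat_retr)
  qed
  then have ne: "?A \<noteq> {}" using s0 by blast
  \<comment> \<open>A chain of submodules has its union as a member, because the union is finitely generated.\<close>
  have "\<exists>K\<in>?A. \<forall>L\<in>?A. K \<subseteq> L \<longrightarrow> L = K"
  proof (rule subset_Zorn_nonempty[OF ne])
    fix C assume Cne: "C \<noteq> {}" and C: "subset.chain ?A C"
    have CA: "K \<in> ?A" if "K \<in> C" for K using C that by (auto simp: subset.chain_def)
    have comp: "K \<subseteq> L \<or> L \<subseteq> K" if "K \<in> C" "L \<in> C" for K L using C that by (auto simp: subset.chain_def)
    have Us: "submodule (\<Union>C) R H"
    proof (rule submodI[OF mH])
      show "\<Union>C \<subseteq> carrier H" using CA submod_sub[OF _ mH] by blast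
      show "\<zero>\<^bsub>H\<^esub> \<in> \<Union>C" using Cne CA submod_zero[OF _ mH] by blast
      show "a \<odot>\<^bsub>H\<^esub> x \<in> \<Union>C" if "a \<in> carrier R" "x \<in> \<Union>C" for a x
        using that CA submod_smult[OF _ mH] by blast
      fix x y assume "x \<in> \<Union>C" "y \<in> \<Union>C"
      then obtain K L where K: "K \<in> C" "x \<in> K" "L \<in> C" "y \<in> L" by blast
      then obtain N where "N \<in> C" "x \<in> N" "y \<in> N" using comp[OF K(1,3)] by blast
      then show "x \<oplus>\<^bsub>H\<^esub> y \<in> \<Union>C" using CA submod_add[OF _ mH] by blast
    qed
    obtain S where S: "finite S" "S \<subseteq> \<Union>C" "span H S = \<Union>C"
      using fin_gen_submodule[OF mH _ Us] H by (auto simp: fgmod_def)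
    obtain K where K: "K \<in> C" "S \<subseteq> K" using finite_subset_Union_chain[OF S(1,2) Cne C] .
    have "\<Union>C \<subseteq> K" unfolding S(3)[symmetric] using CA[OF K(1)] K(2) by (intro span_minimal) auto
    then have "\<Union>C = K" using K(1) by blast
    then show "\<Union>C \<in> ?A" using CA[OF K(1)] by simp
  qed
  then obtain K where K: "submodule K R H" "sub H K \<in> ext_cat R \<C>"
    and max: "\<And>L. \<lbrakk>submodule L R H; sub H L \<in> ext_cat R \<C>; K \<subseteq> L\<rbrakk> \<Longrightarrow> L = K" by blast
  have "K = carrier H"
  proof (rule ccontr)
    assume KH: "K \<noteq> carrier H"
    obtain Q q where Q: "Q \<in> fgmod R" "epi H Q q" "\<And>x. x \<in> carrier H \<Longrightarrow> q x = \<zero>\<^bsub>Q\<^esub> \<longleftrightarrow> x \<in> K"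
      using quotient_exists[OF H K(1)] by blast
    note mQ = module_fgmod[OF Q(1)] and qH = epi_Hom[OF Q(2)]
    obtain h where h: "h \<in> carrier H" "h \<notin> K" using KH submod_sub[OF K(1) mH] by blast
    have "q h \<in> carrier Q" "q h \<noteq> \<zero>\<^bsub>Q\<^esub>" using Q(3)[OF h(1)] h Hom_closed[OF qH h(1)] by auto
    then obtain m where m: "m \<in> carrier Q" "m \<noteq> \<zero>\<^bsub>Q\<^esub>" and p: "primeideal {a \<in> carrier R. a \<odot>\<^bsub>Q\<^esub> m = \<zero>\<^bsub>Q\<^esub>} R"
      using associated_prime[OF mQ] by blast
    define p where "p = {a \<in> carrier R. a \<odot>\<^bsub>Q\<^esub> m = \<zero>\<^bsub>Q\<^esub>}"
    obtain k where k: "k \<in> carrier H" "q k = m" using epiE[OF Q(2) m(1)] .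
    have "J \<subseteq> p"
    proof
      fix a assume a: "a \<in> J"
      then have aR: "a \<in> carrier R" using J by auto
      have "a \<odot>\<^bsub>H\<^esub> k = \<zero>\<^bsub>H\<^esub>" using J a k by (auto simp: annihilates_def)
      then have "a \<odot>\<^bsub>Q\<^esub> m = \<zero>\<^bsub>Q\<^esub>" using Hom_smult[OF qH aR k(1)] Hom_zero[OF qH mH mQ] k(2) by simp
      then show "a \<in> p" using aR by (simp add: p_def)
    qed
    then have pV: "p \<in> primes_over R J" using p by (simp add: primes_over_def p_def)
    define f where "f a = a \<odot>\<^bsub>Q\<^esub> m" for a
    have f: "f \<in> Hom (ring_mod R) Q"
      using m mQ by (intro HomI) (auto simp: f_def mclosed madd_smult msmult_smult)
    define T where "T = f ` carrier R"
    have T: "submodule T R Q"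
      using submod_image[OF f module_ring_mod mQ submod_carrier[OF module_ring_mod]] by (simp add: T_def)
    have Tf: "sub Q T \<in> fgmod R" by (rule fgmod_sub[OF Q(1) T])
    have "epi (ring_mod R) (sub Q T) f" using f by (auto simp: epi_def mod_hom_def T_def)
    then have TC: "sub Q T \<in> \<C>" unfolding C\<C> using Tf pV by (auto simp: f_def p_def intro!: bexI[of _ p])
    define L where "L = {x \<in> carrier H. q x \<in> T}"
    have L: "submodule L R H" unfolding L_def by (rule submod_vimage[OF qH mH mQ T])
    have KL: "K \<subseteq> L"
    proof
      fix x assume x: "x \<in> K"
      then have "x \<in> carrier H" using submod_sub[OF K(1) mH] by auto
      then show "x \<in> L" using Q(3)[of x] x submod_zero[OF T mQ] by (simp add: L_def)
    qed
    have "epi (sub H L) (sub Q T) q"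
    proof (rule epiI)
      show "q \<in> Hom (sub H L) (sub Q T)" using qH by (auto simp: mod_hom_def L_def)
      fix y assume y: "y \<in> carrier (sub Q T)"
      then have "y \<in> carrier Q" using submod_sub[OF T mQ] by auto
      then obtain x where "x \<in> carrier H" "q x = y" by (rule epiE[OF Q(2)])
      then show "\<exists>x\<in>carrier (sub H L). q x = y" using y by (auto simp: L_def)
    qed
    then have "exact3 (sub H K) (sub H L) (sub Q T) (\<lambda>x. x) q"
      using KL Q(3) by (auto simp: exact3_def mod_hom_def L_def)
    then have "short_exact R (sub H K) (sub H L) (sub Q T)" by (auto simp: short_exact_iff)
    from ext_cat.extension[OF K(2) ext_cat.base[OF TC Tf] fgmod_sub[OF H L] this]
    have "sub H L \<in> ext_cat R \<C>" .
    then have "L = K" using max[OF L _ KL] by blast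
    moreover have "f \<one> = m" using m mQ by (simp add: f_def mone_smult)
    then have "k \<in> L" using k by (auto simp: L_def T_def)
    ultimately show False using Q(3)[OF k(1)] k(2) m(2) by simp
  qed
  then show ?thesis using K(2) by (simp add: \<C>_def)
qed

section \<open>Syzygies of extension-closed classes\<close>

text \<open>Every closure operation commutes with syzygies up to summands, so induction over the generation
  of the extension closure applies.\<close>

lemma ext_cat_syz1:
  assumes W: "\<W> \<subseteq> fgmod R" and X: "X \<in> ext_cat R (syz R i \<W>)"
  shows "syz1 S X \<Longrightarrow> S \<in> ext_cat R (syz R (Suc i) \<W>)"
  using X
proof (induction arbitrary: S rule: ext_cat.induct)
  case (base M)
  then obtain V where V: "V \<in> \<W>" "M \<in> syz R i {V}" by (auto simp: syz_def)
  then have "S \<in> syz R (Suc i) {V}" using syz_SucI base W by blast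
  then show ?case using V syz1D[OF base(3)] by (intro ext_cat.base) (auto simp: syz_def)
next
  case (summand N M)
  then have r: "retr M N" "M \<in> fgmod R" "N \<in> fgmod R" by (auto simp: summand_iff)
  obtain K where K: "syz1 K N" "retr S K" using syz1_retr[OF r(1,3) summand(4)] by blast
  show ?case by (rule ext_cat_retr[OF summand(3)[OF K(1)] K(2) syz1D(1)[OF summand(4)] syz1D(1)[OF K(1)]])
next
  case (extension A C B)
  obtain A' U S' where s: "syz1 A' A" "syz1 U C" "short_exact R A' S' U" "S' \<in> fgmod R" "retr S S'"
    using syz1_extension[OF extension(4) ext_cat_fgmod[OF extension(1)] ext_cat_fgmod[OF extension(2)] extension(7)] by blast
  have "S' \<in> ext_cat R (syz R (Suc i) \<W>)"
    by (rule ext_cat.extension[OF extension(5)[OF s(1)] extension(6)[OF s(2)] s(4,3)])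
  then show ?case using ext_cat_retr s syz1D(1)[OF extension(7)] by blast
qed

lemma ext_cat_syz:
  assumes W: "\<W> \<subseteq> fgmod R" and X: "X \<in> ext_cat R \<W>"
  shows "S \<in> syz R i {X} \<Longrightarrow> S \<in> ext_cat R (syz R i \<W>)"
proof (induction i arbitrary: S)
  case 0
  note Xf = ext_cat_fgmod[OF X]
  have iso: "S \<in> fgmod R" "mod_iso R S X" using syz_0[OF Xf] 0 by auto
  have "\<W> \<subseteq> syz R 0 \<W>"
  proof
    fix V assume V: "V \<in> \<W>"
    then have "V \<in> syz R 0 {V}" using syz_0 W mod_iso_refl by blast
    then show "V \<in> syz R 0 \<W>" using V by (auto simp: syz_def)
  qed
  then have "X \<in> ext_cat R (syz R 0 \<W>)" using ext_cat_mono[OF X] by blast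
  then show ?case using ext_cat_retr[OF _ retr_iso[OF iso(2) module_fgmod[OF iso(1)]] iso(1) Xf] by blast
next
  case (Suc i)
  then obtain X1 where "X1 \<in> syz R i {X}" "syz1 S X1" using syz_SucD ext_cat_fgmod[OF X] by blast
  then show ?case using Suc ext_cat_syz1[OF W] by blast
qed

lemma syz_retr:
  assumes r: "retr H L" "H \<in> fgmod R" "L \<in> fgmod R"
  shows "X \<in> syz R i {H} \<Longrightarrow> \<exists>S\<in>syz R i {L}. retr X S"
proof (induction i arbitrary: X)
  case 0
  then have "X \<in> fgmod R" "mod_iso R X H" using syz_0[OF r(2)] by auto
  then show ?case using retr_trans[OF retr_iso r(1)] module_fgmod syz_0[OF r(3)] r(3) mod_iso_refl by blast
next
  case (Suc i)
  then obtain X1 where X1: "X1 \<in> syz R i {H}" "syz1 X X1" using syz_SucD r(2) by blast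
  then obtain S1 where S1: "S1 \<in> syz R i {L}" "retr X1 S1" using Suc.IH by blast
  obtain K where "syz1 K S1" "retr X K" using syz1_retr[OF S1(2) syz_fgmod[OF S1(1)] X1(2)] by blast
  then show ?case using syz_SucI[OF r(3) S1(1)] by blast
qed

section \<open>Vanishing of extensions\<close>

lemma syz1_iso:
  assumes S: "syz1 S X" and iso: "mod_iso R X M" and M: "M \<in> fgmod R"
  shows "syz1 S M"
proof -
  obtain P i q where P: "ffree P" "exact3 S P X i q" using S by (auto simp: syz1_def)
  note fS = syz1D[OF S] and e = exact3D[OF P(2)]
  note m = fS[THEN module_fgmod] module_fgmod[OF M]
  obtain f g where f: "f \<in> Hom X M" "g \<in> Hom M X" "\<And>x. x \<in> carrier X \<Longrightarrow> g (f x) = x" "\<And>y. y \<in> carrier M \<Longrightarrow> f (g y) = y"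
    using mod_iso_maps[OF iso m(2)] by metis
  have fe: "epi X M f" using f Hom_closed[OF f(2)] by (intro epiI) auto
  have f0: "f x = \<zero>\<^bsub>M\<^esub> \<longleftrightarrow> x = \<zero>\<^bsub>X\<^esub>" if "x \<in> carrier X" for x
    using f(3)[OF that] Hom_zero[OF f(2) m(3,2)] Hom_zero[OF f(1) m(2,3)] by auto
  have "exact3 S P M i (\<lambda>p. f (q p))"
    using P(2) epi_comp[OF e(3) fe] f0 Hom_closed[OF e(4)] by (auto simp: exact3_def)
  then show ?thesis using P(1) fS M by (auto simp: syz1_def)
qed

text \<open>The extension \<open>0 \<rightarrow> \<Omega> \<rightarrow> F \<rightarrow> M \<rightarrow> 0\<close> is classified by the cocycle \<^term>\<open>k\<close> obtained by comparing the chosen free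
  resolution of \<^term>\<open>M\<close> with \<open>F \<rightarrow> M\<close>. If \<^term>\<open>a\<close> kills its class, then \<^term>\<open>a\<close> times the cocycle is the
  coboundary of some \<^term>\<open>g\<close>, and \<^term>\<open>a\<close> times the comparison map \<open>P 0 \<rightarrow> F\<close> minus \<^term>\<open>g\<close> vanishes on the kernel of
  \<open>P 0 \<rightarrow> M\<close>. So it descends to a lift of multiplication by \<^term>\<open>a\<close> to \<open>F\<close>.\<close>

lemma Ext_annihilator_free_factor:
  assumes M: "M \<in> fgmod R" and S: "\<Omega> \<in> syz R 1 {M}" and ann: "annihilates I (Ext R 1 M \<Omega>)"
    and a: "a \<in> I" "a \<in> carrier R"
  shows "free_factor M a"
proof -
  have S': "\<Omega> \<in> syz R (Suc 0) {M}" using S by simp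
  obtain X1 where X1: "X1 \<in> syz R 0 {M}" "syz1 \<Omega> X1" using syz_SucD[OF S' M] by blast
  then have "syz1 \<Omega> M" using syz1_iso[OF X1(2) _ M] syz_0[OF M] by blast
  then obtain F \<iota> \<pi> where F: "ffree F" and "exact3 \<Omega> F M \<iota> \<pi>" by (auto simp: syz1_def)
  note e = exact3D[OF this(2)]
  note mF = ffreeD(2)[OF F] and mM = module_fgmod[OF M] and mO = module_fgmod[OF syz_fgmod[OF S]]
  obtain P d where PdS: "(P, d) = (SOME (P, d). free_resolution R M P d)" by (metis surj_pair)
  have "case (P, d) of (P, d) \<Rightarrow> free_resolution R M P d"
    unfolding PdS using ex_free_resolution[OF M] by (metis (mono_tags, lifting) case_prodI someI_ex)
  then have Pd: "free_resolution R M P d" by simp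
  have P: "ffree (P j)" and d0: "d 0 \<in> Hom (P 0) M" and dS: "d (Suc j) \<in> Hom (P (Suc j)) (P j)"
    and s0: "d 0 ` carrier (P 0) = carrier M" and k0: "d 1 ` carrier (P 1) = a_kernel (P 0) M (d 0)"
    and k1: "d (Suc (Suc 0)) ` carrier (P (Suc (Suc 0))) = a_kernel (P (Suc 0)) (P 0) (d (Suc 0))" for j
    using Pd by (auto simp: free_resolution_def ffree_def)
  have d1: "d 1 \<in> Hom (P 1) (P 0)" and d2: "d 2 \<in> Hom (P 2) (P 1)"
    using dS[of 0] dS[of 1] by (simp_all add: numeral_2_eq_2)
  note mP = ffreeD(2)[OF P]
  have d0e: "epi (P 0) M (d 0)" using d0 s0 by (simp add: epi_def)
  have d01: "d 0 (d 1 x) = \<zero>\<^bsub>M\<^esub>" if "x \<in> carrier (P 1)" for x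
    using k0 that unfolding a_kernel_eq by blast
  have d12: "d 1 (d 2 x) = \<zero>\<^bsub>P 0\<^esub>" if "x \<in> carrier (P 2)" for x
    using k1 that unfolding a_kernel_eq One_nat_def numeral_2_eq_2 by blast
  obtain \<phi> where \<phi>: "\<phi> \<in> Hom (P 0) F" "\<forall>p\<in>carrier (P 0). \<pi> (\<phi> p) = d 0 p"
    using ffree_lift[OF P e(3) d0 mF mM] by blast
  have pd: "(\<lambda>x. \<phi> (d 1 x)) \<in> Hom (P 1) F" by (rule Hom_comp[OF d1 \<phi>(1)])
  have im: "\<phi> (d 1 x) \<in> \<iota> ` carrier \<Omega>" if x: "x \<in> carrier (P 1)" for x
    using e(5)[OF Hom_closed[OF pd x]] \<phi>(2) Hom_closed[OF d1 x] d01[OF x] by simp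
  obtain k where k: "k \<in> Hom (P 1) \<Omega>" "\<And>x. x \<in> carrier (P 1) \<Longrightarrow> \<iota> (k x) = \<phi> (d 1 x)"
    using Hom_corestrict[OF e(1,2) pd mP mF mO im] by blast
  define f where "f = restrict k (carrier (P 1))"
  have fH: "f \<in> carrier (hom_mod R (P 1) \<Omega>)"
    using Hom_cong[OF k(1) mP, of f] by (simp add: hom_mod_def f_def)
  have kd2: "k (d 2 x) = \<zero>\<^bsub>\<Omega>\<^esub>" if x: "x \<in> carrier (P 2)" for x
  proof (rule inj_on_ker[OF e(2,1) mO mF])
    show "k (d 2 x) \<in> carrier \<Omega>" using Hom_closed[OF Hom_comp[OF d2 k(1)] x] .
    show "\<iota> (k (d 2 x)) = \<zero>\<^bsub>F\<^esub>"
      using k(2)[OF Hom_closed[OF d2 x]] d12[OF x] Hom_zero[OF \<phi>(1) mP mF] by simp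
  qed
  define Z where "Z = a_kernel (hom_mod R (P 1) \<Omega>) (hom_mod R (P (Suc 1)) \<Omega>) (\<lambda>f. compose (carrier (P (Suc 1))) f (d (Suc 1)))"
  define B where "B = (\<lambda>f. compose (carrier (P 1)) f (d 1)) ` carrier (hom_mod R (P 0) \<Omega>)"
  define H where "H = (hom_mod R (P 1) \<Omega>)\<lparr>carrier := Z\<rparr>"
  have fZ: "f \<in> Z"
    using fH kd2 Hom_closed[OF d2] unfolding Z_def a_kernel_eq
    by (auto simp: compose_def f_def hom_mod_def numeral_2_eq_2 intro!: ext)
  have E: "Ext R 1 M \<Omega> = quot_mod R H B"
    unfolding Ext_def PdS[symmetric] by (simp add: hom_cohomology_def H_def Z_def B_def)
  have coset: "B +>\<^bsub>H\<^esub> g = (\<Union>b\<in>B. {\<lambda>x\<in>carrier (P 1). b x \<oplus>\<^bsub>\<Omega>\<^esub> g x})" for g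
    by (simp add: a_r_coset_def' H_def hom_mod_def)
  have zero: "(\<lambda>x\<in>carrier (P 1). \<zero>\<^bsub>\<Omega>\<^esub>) \<in> B"
  proof -
    have "(\<lambda>x\<in>carrier (P 0). \<zero>\<^bsub>\<Omega>\<^esub>) \<in> carrier (hom_mod R (P 0) \<Omega>)"
      using Hom_cong[OF Hom_zero_map[OF mO] mP[of 0], of "\<lambda>x\<in>carrier (P 0). \<zero>\<^bsub>\<Omega>\<^esub>"] by (simp add: hom_mod_def)
    moreover have "compose (carrier (P 1)) (\<lambda>x\<in>carrier (P 0). \<zero>\<^bsub>\<Omega>\<^esub>) (d 1) = (\<lambda>x\<in>carrier (P 1). \<zero>\<^bsub>\<Omega>\<^esub>)"
      using Hom_closed[OF d1] by (auto simp: compose_def)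
    ultimately show ?thesis unfolding B_def by (metis image_eqI)
  qed
  have self: "g \<in> B +>\<^bsub>H\<^esub> g" if g: "g \<in> Hom (P 1) \<Omega>" "g \<in> extensional (carrier (P 1))" for g
  proof -
    have eq: "(\<lambda>x\<in>carrier (P 1). (\<lambda>x\<in>carrier (P 1). \<zero>\<^bsub>\<Omega>\<^esub>) x \<oplus>\<^bsub>\<Omega>\<^esub> g x) = g"
    proof (rule extensionalityI[OF restrict_extensional g(2)])
      fix x assume x: "x \<in> carrier (P 1)"
      then show "(\<lambda>x\<in>carrier (P 1). (\<lambda>x\<in>carrier (P 1). \<zero>\<^bsub>\<Omega>\<^esub>) x \<oplus>\<^bsub>\<Omega>\<^esub> g x) x = g x"
        using mzero_l[OF mO Hom_closed[OF g(1) x]] by simp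
    qed
    show ?thesis unfolding coset by (rule UN_I[OF zero]) (simp only: eq singleton_iff)
  qed
  have f': "f \<in> Hom (P 1) \<Omega>" "f \<in> extensional (carrier (P 1))" using fH by (auto simp: hom_mod_def)
  have af: "(\<lambda>x\<in>carrier (P 1). a \<odot>\<^bsub>\<Omega>\<^esub> f x) \<in> Hom (P 1) \<Omega>"
    by (rule Hom_cong[OF Hom_scale[OF f'(1) mO a(2)] mP]) simp
  have "B +>\<^bsub>H\<^esub> f \<in> carrier (Ext R 1 M \<Omega>)"
    unfolding E quot_mod_def A_RCOSETS_def' using fZ by (auto simp: H_def)
  then have "a \<odot>\<^bsub>Ext R 1 M \<Omega>\<^esub> (B +>\<^bsub>H\<^esub> f) = \<zero>\<^bsub>Ext R 1 M \<Omega>\<^esub>" using ann a(1) unfolding annihilates_def by blast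
  then have "(\<Union>g\<in>B +>\<^bsub>H\<^esub> f. B +>\<^bsub>H\<^esub> (a \<odot>\<^bsub>H\<^esub> g)) = B" unfolding E by (simp add: quot_mod_def)
  then have "B +>\<^bsub>H\<^esub> (a \<odot>\<^bsub>H\<^esub> f) \<subseteq> B" using self[OF f'] by blast
  moreover have "a \<odot>\<^bsub>H\<^esub> f = (\<lambda>x\<in>carrier (P 1). a \<odot>\<^bsub>\<Omega>\<^esub> f x)" by (simp add: H_def hom_mod_def)
  ultimately have "(\<lambda>x\<in>carrier (P 1). a \<odot>\<^bsub>\<Omega>\<^esub> f x) \<in> B" using self[OF af restrict_extensional] by auto
  then obtain g where g: "g \<in> Hom (P 0) \<Omega>" "(\<lambda>x\<in>carrier (P 1). a \<odot>\<^bsub>\<Omega>\<^esub> f x) = compose (carrier (P 1)) g (d 1)"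
    unfolding B_def by (auto simp: hom_mod_def)
  have gd: "g (d 1 x) = a \<odot>\<^bsub>\<Omega>\<^esub> k x" if x: "x \<in> carrier (P 1)" for x
    using fun_cong[OF g(2), of x] x by (simp add: compose_def f_def)
  note ig = Hom_comp[OF g(1) e(1)]
  define \<psi> where "\<psi> p = a \<odot>\<^bsub>F\<^esub> \<phi> p \<oplus>\<^bsub>F\<^esub> \<ominus>\<^bsub>F\<^esub> \<iota> (g p)" for p
  have \<psi>: "\<psi> \<in> Hom (P 0) F" unfolding \<psi>_def by (intro Hom_plus Hom_scale Hom_uminus \<phi>(1) ig mF a(2))
  have "\<psi> p = \<zero>\<^bsub>F\<^esub>" if p: "p \<in> carrier (P 0)" "d 0 p = \<zero>\<^bsub>M\<^esub>" for p
  proof -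
    have "p \<in> d 1 ` carrier (P 1)" using k0 p by (simp add: a_kernel_eq)
    then obtain x where x: "x \<in> carrier (P 1)" "p = d 1 x" by blast
    note kx = Hom_closed[OF k(1) x(1)]
    have "\<iota> (g p) = a \<odot>\<^bsub>F\<^esub> \<phi> p" using gd[OF x(1)] Hom_smult[OF e(1) a(2) kx] k(2)[OF x(1)] x(2) by simp
    then show ?thesis using Hom_closed[OF \<phi>(1) p(1)] mF a(2) by (simp add: \<psi>_def mlin)
  qed
  then obtain s where s: "s \<in> Hom M F" "\<And>p. p \<in> carrier (P 0) \<Longrightarrow> s (d 0 p) = \<psi> p"
    using Hom_descend[OF d0e \<psi> mP mF mM] by blast
  have "\<pi> (s m) = a \<odot>\<^bsub>M\<^esub> m" if m: "m \<in> carrier M" for m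
  proof -
    obtain p where p: "p \<in> carrier (P 0)" "d 0 p = m" using epiE[OF d0e m] .
    note fp = Hom_closed[OF \<phi>(1) p(1)] and gp = Hom_closed[OF g(1) p(1)] and igp = Hom_closed[OF ig p(1)]
    have "\<pi> (s m) = a \<odot>\<^bsub>M\<^esub> \<pi> (\<phi> p) \<oplus>\<^bsub>M\<^esub> \<ominus>\<^bsub>M\<^esub> \<pi> (\<iota> (g p))"
      using s(2)[OF p(1)] p(2) fp igp mF mM a(2) by (simp add: \<psi>_def Hom_simps[OF e(4)] mclosed)
    then show ?thesis using bspec[OF \<phi>(2) p(1)] p(2) e(6)[OF gp] m mM a(2) by (simp add: mlin)
  qed
  then show ?thesis using free_factorI[OF F s(1) e(4) a(2) mM] by blast
qed

section \<open>Modules that are free off a closed set\<close>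

text \<open>The Koszul construction provides the cokernel in degree \<^term>\<open>n\<close>, of which \<^term>\<open>M\<close> is a summand; together with
  arbitrary cokernels in the other degrees it is decomposed into syzygies of homology modules, which the
  null-homotopic elements annihilate.\<close>

lemma built_from_Koszul_homology:
  assumes M: "M \<in> fgmod R" and x: "\<And>i. i \<in> {1..n::nat} \<Longrightarrow> free_factor M (x i)"
  shows "\<exists>H Zs. (\<forall>j. H j \<in> fgmod_quot R (Idl (x ` {1..n}))) \<and> length Zs = Suc n \<and>
    (\<forall>i\<le>n. Zs ! i \<in> syz R i {H (n - i)}) \<and> built Zs M"
proof -
  have xR: "x ` {1..n} \<subseteq> carrier R" using free_factor_carrier[OF x] by blast
  have "\<exists>G d N q. cplx G d \<and> coker G d (Suc n) N q \<and> retr M N \<and> (\<forall>i<n. nullhomotopic (x (Suc i)) G d) \<and>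
    (\<forall>j>n. \<forall>g\<in>carrier (G (Suc j)). d j g = \<zero>\<^bsub>G j\<^esub> \<longrightarrow> g \<in> d (Suc j) ` carrier (G (Suc (Suc j))))"
    using koszul[OF M, of n "\<lambda>i. x (Suc i)"] x by auto
  then obtain G d N q where G: "cplx G d" and N: "coker G d (Suc n) N q" "retr M N"
    and nh: "\<And>i. i < n \<Longrightarrow> nullhomotopic (x (Suc i)) G d" by blast
  have "\<exists>C q. coker G d (Suc j) C q" for j
  proof -
    have "submodule (d (Suc j) ` carrier (G (Suc (Suc j)))) R (G (Suc j))"
      by (rule submod_image[OF cplxD(3)[OF G] cplxD(2)[OF G] cplxD(2)[OF G] submod_carrier[OF cplxD(2)[OF G]]])
    from quotient_exists[OF ffreeD(1)[OF cplxD(1)[OF G]] this]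
    show ?thesis unfolding coker_def by metis
  qed
  then obtain C0 q0 where C0: "\<And>j. coker G d (Suc j) (C0 j) (q0 j)" by metis
  define C where "C j = (if j = n then N else C0 j)" for j
  define r where "r j = (if j = n then q else q0 j)" for j
  have "coker G d (Suc j) (C j) (r j)" for j using C0 N(1) by (simp add: C_def r_def)
  from coker_built[OF G this] obtain H where H: "\<forall>j. H j \<in> fgmod R"
    and ann: "\<forall>j x. x \<in> carrier R \<longrightarrow> nullhomotopic x G d \<longrightarrow> (\<forall>m\<in>carrier (H j). x \<odot>\<^bsub>H j\<^esub> m = \<zero>\<^bsub>H j\<^esub>)"
    and bl: "\<forall>k. \<exists>Zs. length Zs = Suc k \<and> (\<forall>i\<le>k. Zs ! i \<in> syz R i {H (k - i)}) \<and> built Zs (C k)" by blast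
  have "x i \<odot>\<^bsub>H j\<^esub> m = \<zero>\<^bsub>H j\<^esub>" if "i \<in> {1..n}" "m \<in> carrier (H j)" for i j m
    using nh[of "i - 1"] that ann free_factor_carrier[OF x[OF that(1)]] by auto
  then have "annihilates (Idl (x ` {1..n})) (H j)" for j
    using H module_fgmod xR by (intro annihilates_Idl) auto
  then have "H j \<in> fgmod_quot R (Idl (x ` {1..n}))" for j
    using fgmod_quot_iff[OF genideal_ideal[OF xR]] H by blast
  moreover obtain Zs where "length Zs = Suc n" "\<forall>i\<le>n. Zs ! i \<in> syz R i {H (n - i)}" "built Zs (C n)" using bl by blast
  ultimately show ?thesis using built_retr[OF _ N(2), of Zs] by (auto simp: C_def)
qed

text \<open>Each piece is a summand of the corresponding \<^term>\<open>S i\<close>, hence of their direct sum, so a single module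
  accounts for all subquotients.\<close>

lemma filt_cat_sum:
  assumes b: "built Zs M" and M: "M \<in> fgmod R" and l: "length Zs = Suc n"
    and S: "\<And>i. i \<le> n \<Longrightarrow> S i \<in> \<X> i" "\<And>i. i \<le> n \<Longrightarrow> S i \<in> fgmod R" "\<And>i. i \<le> n \<Longrightarrow> retr (Zs ! i) (S i)"
      "\<And>i. i \<le> n \<Longrightarrow> Zs ! i \<in> fgmod R"
  shows "\<exists>Y\<in>sum_cat R n \<X>. M \<in> filt_cat R {Y} (n + 1)"
proof -
  obtain Y where Y: "Y \<in> fgmod R" "mod_iso R Y (dir_sum {..<Suc n} S)"
    using ex_dir_sum[of "Suc n" S] S(2) by (auto simp: less_Suc_eq_le)
  then have "Y \<in> sum_cat R n \<X>" using S(1) by (auto simp: sum_cat_def lessThan_Suc_atMost)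
  moreover have "Zs ! i \<in> add_cat R {Y}" if i: "i \<le> n" for i
  proof -
    have "retr (S i) Y"
      using dir_sum_retr[OF Y(2) module_fgmod[OF Y(1)], of i] module_fgmod[OF S(2)] i by (auto simp: less_Suc_eq_le)
    then have "retr (Zs ! i) Y" using retr_trans[OF S(3)[OF i]] by blast
    then show ?thesis using add_cat_retr[of Y "{Y}"] add_cat.base[of Y "{Y}" R] Y(1) S(4)[OF i] by blast
  qed
  then have "set Zs \<subseteq> add_cat R {Y}" using l by (auto simp: in_set_conv_nth less_Suc_eq_le)
  then have "M \<in> filt_cat R {Y} (n + 1)" using built_filt_cat[OF b _ M] l by simp
  ultimately show ?thesis by blast
qed

text \<open>The direct sum \<^term>\<open>L\<close> of the homology modules replaces all of them at once: a syzygy of a summand is a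
  summand of a syzygy of \<^term>\<open>L\<close>.\<close>

lemma filt_cat_of_free_factors:
  assumes M: "M \<in> fgmod R" and x: "\<And>i. i \<in> {1..n::nat} \<Longrightarrow> free_factor M (x i)"
  shows "\<exists>L\<in>fgmod_quot R (Idl (x ` {1..n})). \<exists>Y\<in>sum_cat R n (\<lambda>i. syz R i {L}). M \<in> filt_cat R {Y} (n + 1)"
proof -
  have xR: "x ` {1..n} \<subseteq> carrier R" using free_factor_carrier[OF x] by blast
  note I = genideal_ideal[OF xR]
  obtain H Zs where H: "\<And>j. H j \<in> fgmod_quot R (Idl (x ` {1..n}))" and l: "length Zs = Suc n"
    and Zs: "\<And>i. i \<le> n \<Longrightarrow> Zs ! i \<in> syz R i {H (n - i)}" and b: "built Zs M"
    using built_from_Koszul_homology[of M n x, OF M x] by blast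
  have Hf: "H j \<in> fgmod R" "annihilates (Idl (x ` {1..n})) (H j)" for j using H[of j] fgmod_quot_iff[OF I] by auto
  obtain L where L: "L \<in> fgmod R" "mod_iso R L (dir_sum {..<Suc n} H)" using ex_dir_sum Hf(1) by blast
  have "annihilates (Idl (x ` {1..n})) L"
    using annihilates_dir_sum[OF L(2) module_fgmod[OF L(1)] module_fgmod[OF Hf(1)]] Hf(2) ideal.axioms(1)[OF I, THEN additive_subgroup.a_subset] by blast
  then have LI: "L \<in> fgmod_quot R (Idl (x ` {1..n}))" using fgmod_quot_iff[OF I] L(1) by blast
  have "\<exists>S\<in>syz R i {L}. retr (Zs ! i) S" if i: "i \<le> n" for i
  proof -
    have "retr (H (n - i)) L" using dir_sum_retr[OF L(2) module_fgmod[OF L(1)] module_fgmod[OF Hf(1)], of "n - i"] by auto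
    then show ?thesis using syz_retr[OF _ Hf(1) L(1) Zs[OF i]] by blast
  qed
  then have ex: "\<forall>i. \<exists>S. i \<le> n \<longrightarrow> S \<in> syz R i {L} \<and> retr (Zs ! i) S" by blast
  obtain S where S: "\<forall>i. i \<le> n \<longrightarrow> S i \<in> syz R i {L} \<and> retr (Zs ! i) (S i)"
    using choice[OF ex] by (rule exE)
  have "\<exists>Y\<in>sum_cat R n (\<lambda>i. syz R i {L}). M \<in> filt_cat R {Y} (n + 1)"
    using S syz_fgmod Zs by (intro filt_cat_sum[OF b M l, of S]) blast+
  then show ?thesis using LI by blast
qed

lemma NF_inv_iff: "M \<in> NF_inv R (primes_over R I) \<longleftrightarrow> M \<in> fgmod R \<and> (\<forall>p. primeideal p R \<longrightarrow> \<not> I \<subseteq> p \<longrightarrow> free_off p M)"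
  using NF_iff by (auto simp: NF_inv_def NF_def primes_over_def)

text \<open>Annihilators are free factors, so the nonfree locus of a module lies in its support.\<close>

lemma free_off_annihilated:
  assumes M: "M \<in> fgmod R" and J: "annihilates J M" "J \<subseteq> carrier R" "\<not> J \<subseteq> p"
  shows "free_off p M"
proof -
  obtain a where a: "a \<in> J" "a \<notin> p" using J(3) by blast
  then have "free_factor M a" using free_factor_annihilator[OF M, of a] J(1,2) by (auto simp: annihilates_def)
  then show ?thesis using a J(2) by (auto simp: free_off_def)
qed

lemma prime_power: "\<lbrakk>primeideal p R; x \<in> carrier R; x [^] (e::nat) \<in> p\<rbrakk> \<Longrightarrow> x \<in> p"
proof (induction e)
  case 0
  interpret p: primeideal p R by (rule 0)
  show ?case using p.I_l_closed[of "x [^] (0::nat)" x] 0 by simp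
next
  case (Suc e)
  interpret p: primeideal p R by (rule Suc)
  show ?case using Suc p.I_prime[of "x [^] e" x] by auto
qed

context
  fixes I x n
  assumes x: "x \<in> {1..n::nat} \<rightarrow> carrier R" and I: "I = Idl (x ` {1..n})"
begin

lemma generator_carrier: "i \<in> {1..n} \<Longrightarrow> x i \<in> carrier R" using x by auto

lemma ideal_I: "ideal I R"
  unfolding I using generator_carrier by (intro genideal_ideal) auto

lemma generator_in_ideal: "i \<in> {1..n} \<Longrightarrow> x i \<in> I"
proof -
  have "x ` {1..n} \<subseteq> I" unfolding I using generator_carrier by (intro genideal_self) auto
  then show "i \<in> {1..n} \<Longrightarrow> x i \<in> I" by blast
qed

lemma ideal_power: "ideal (gen_power_ideal R n x e) R"
  unfolding gen_power_ideal_def using generator_carrier by (intro genideal_ideal) auto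

lemma power_ideal_carrier: "gen_power_ideal R n x e \<subseteq> carrier R"
  using ideal_power[of e] additive_subgroup.a_subset ideal.axioms(1) by blast

lemma power_ideal_prime:
  assumes p: "primeideal p R" and s: "gen_power_ideal R n x e \<subseteq> p"
  shows "I \<subseteq> p"
  unfolding I
proof (rule genideal_minimal[OF primeideal.axioms(1)[OF p]], rule image_subsetI)
  fix i assume i: "i \<in> {1..n}"
  have "(\<lambda>i. x i [^] e) ` {1..n} \<subseteq> gen_power_ideal R n x e"
    unfolding gen_power_ideal_def using generator_carrier by (intro genideal_self) auto
  then have "x i [^] e \<in> p" using i s by blast
  then show "x i \<in> p" using prime_power[OF p generator_carrier[OF i]] by blast
qed

lemma power_ideal_sub: "e > 0 \<Longrightarrow> gen_power_ideal R n x e \<subseteq> I"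
  unfolding gen_power_ideal_def
proof (rule genideal_minimal[OF ideal_I], rule image_subsetI)
  fix i assume e: "e > 0" and i: "i \<in> {1..n}"
  obtain k where "e = Suc k" using e by (cases e) auto
  then show "x i [^] e \<in> I" using ideal.I_l_closed[OF ideal_I generator_in_ideal[OF i], of "x i [^] k"] generator_carrier[OF i] by simp
qed

lemma primes_over_power: "e > 0 \<Longrightarrow> primes_over R (gen_power_ideal R n x e) = primes_over R I"
  using power_ideal_prime[of _ e] power_ideal_sub[of e] by (auto simp: primes_over_def)

text \<open>The open sets where some \<^term>\<open>x i\<close> is invertible cover the complement of \<open>V(I)\<close>, so each generator has a power
  that is a free factor. A common exponent is the sum of the exponents, increased by one to be positive.\<close>

lemma NF_inv_powers:
  assumes M: "M \<in> NF_inv R (primes_over R I)"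
  shows "\<exists>e>0. \<forall>i\<in>{1..n}. free_factor M (x i [^] (e::nat))"
proof -
  have Mf: "M \<in> fgmod R" and off: "\<And>p. \<lbrakk>primeideal p R; \<not> I \<subseteq> p\<rbrakk> \<Longrightarrow> free_off p M"
    using M NF_inv_iff by auto
  have "\<exists>e::nat. free_factor M (x i [^] e)" if i: "i \<in> {1..n}" for i
  proof (rule power_free_factor[OF Mf generator_carrier[OF i]])
    fix p assume p: "primeideal p R" "x i \<notin> p"
    then have "\<not> I \<subseteq> p" using generator_in_ideal[OF i] by auto
    then show "free_off p M" using off[OF p(1)] by blast
  qed
  then obtain e where e: "\<And>i. i \<in> {1..n} \<Longrightarrow> free_factor M (x i [^] (e i :: nat))" by metis
  let ?E = "Suc (\<Sum>i\<in>{1..n}. e i)"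
  have "free_factor M (x i [^] ?E)" if i: "i \<in> {1..n}" for i
  proof -
    have "e i \<le> (\<Sum>i\<in>{1..n}. e i)" using i by (intro member_le_sum) auto
    then have "?E = (?E - e i) + e i" by simp
    then have "x i [^] ?E = x i [^] (?E - e i) \<otimes> x i [^] e i" using generator_carrier[OF i] by (metis nat_pow_mult)
    then show ?thesis using free_factor_times[OF module_fgmod[OF Mf] e[OF i], of "x i [^] (?E - e i)"] generator_carrier[OF i] by simp
  qed
  then show ?thesis by blast
qed

lemma filt_cat_fgmod: "M \<in> filt_cat R \<X> r \<Longrightarrow> M \<in> fgmod R"
  by (auto simp: filt_cat_iff summand_iff)

lemma add_cat_mono: "\<lbrakk>M \<in> add_cat R \<X>; \<X> \<subseteq> \<Y>\<rbrakk> \<Longrightarrow> M \<in> add_cat R \<Y>"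
  by (induction rule: add_cat.induct) (auto intro: add_cat.intros)

lemma filt_cat_mono: "\<X> \<subseteq> \<Y> \<Longrightarrow> filt_cat R \<X> r \<subseteq> filt_cat R \<Y> r"
  using add_cat_mono[of _ \<X> \<Y>] unfolding filt_cat_def by (intro Collect_mono) (meson subset_trans)

lemma free_off_power_quot:
  assumes p: "primeideal p R" "\<not> I \<subseteq> p" and S: "S \<in> syz R i (fgmod_quot R (gen_power_ideal R n x e))"
  shows "free_off p S"
proof -
  obtain X where X: "X \<in> fgmod_quot R (gen_power_ideal R n x e)" "S \<in> syz R i {X}" using S by (auto simp: syz_def)
  then have Xf: "X \<in> fgmod R" "annihilates (gen_power_ideal R n x e) X" using fgmod_quot_iff[OF ideal_power] by auto
  have "\<not> gen_power_ideal R n x e \<subseteq> p" using power_ideal_prime[OF p(1)] p(2) by blast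
  then have "free_off p X" by (rule free_off_annihilated[OF Xf power_ideal_carrier])
  then show ?thesis using free_off_syz[OF p(1) X(2) Xf(1)] by blast
qed

lemma free_off_sum_cat:
  assumes p: "primeideal p R" and Y: "Y \<in> sum_cat R n \<X>"
    and X: "\<And>i S. \<lbrakk>i \<le> n; S \<in> \<X> i\<rbrakk> \<Longrightarrow> S \<in> fgmod R \<and> free_off p S"
  shows "free_off p Y"
proof -
  obtain S where S: "\<And>i. i \<le> n \<Longrightarrow> S i \<in> \<X> i" and Y: "Y \<in> fgmod R" "mod_iso R Y (dir_sum {..n} S)"
    using Y by (auto simp: sum_cat_def)
  have "S i \<in> fgmod R \<and> free_off p (S i)" if "i < Suc n" for i using X[of i "S i"] S[of i] that by simp
  then show ?thesis using Y by (intro free_off_dir_sum[OF p, of Y "Suc n" S]) (auto simp: lessThan_Suc_atMost)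
qed

lemma cyclic_quot_free_off:
  assumes p: "primeideal p R" "\<not> I \<subseteq> p" and S: "S \<in> syz R i (cyclic_quots R (primes_over R I))"
  shows "free_off p S"
proof -
  obtain X where X: "X \<in> cyclic_quots R (primes_over R I)" "S \<in> syz R i {X}" using S by (auto simp: syz_def)
  have "X \<in> fgmod R \<and> (\<exists>p\<in>primes_over R I. \<exists>q. epi (ring_mod R) X q \<and> (\<forall>a\<in>carrier R. q a = \<zero>\<^bsub>X\<^esub> \<longleftrightarrow> a \<in> p))"
    using X(1) by (subst (asm) cyclic_quots_iff) (auto simp: primes_over_def intro: primeideal.axioms(1))
  then obtain P q where Xf: "X \<in> fgmod R" and P: "primeideal P R" "I \<subseteq> P" and q: "epi (ring_mod R) X q"
    "\<And>a. a \<in> carrier R \<Longrightarrow> q a = \<zero>\<^bsub>X\<^esub> \<longleftrightarrow> a \<in> P" by (auto simp: primes_over_def)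
  interpret P: primeideal P R by (rule P)
  have "annihilates P X" unfolding annihilates_def
  proof (intro ballI)
    fix a m assume a: "a \<in> P" and m: "m \<in> carrier X"
    obtain b where b: "b \<in> carrier (ring_mod R)" "q b = m" using epiE[OF q(1) m] .
    have aR: "a \<in> carrier R" using a P.a_subset by auto
    have "a \<odot>\<^bsub>X\<^esub> m = q (a \<otimes> b)" using Hom_smult[OF epi_Hom[OF q(1)] aR b(1)] b(2) by simp
    also have "\<dots> = \<zero>\<^bsub>X\<^esub>" using q(2)[of "a \<otimes> b"] aR a b P.I_r_closed by simp
    finally show "a \<odot>\<^bsub>X\<^esub> m = \<zero>\<^bsub>X\<^esub>" .
  qed
  moreover have "\<not> P \<subseteq> p" using P p by blast
  ultimately have "free_off p X" using free_off_annihilated[OF Xf _ P.a_subset] by blast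
  then show ?thesis using free_off_syz[OF p(1) X(2) Xf] by blast
qed

lemma NF_inv_eq_filt_union:
  "NF_inv R (primes_over R I) =
    filt_cat R (\<Union>e\<in>{0<..}. \<Union>i\<in>{0..n}. syz R i (fgmod_quot R (gen_power_ideal R n x e))) (n + 1)" (is "?L = filt_cat R ?X _")
proof (intro equalityI subsetI)
  fix M assume M: "M \<in> ?L"
  then have Mf: "M \<in> fgmod R" by (simp add: NF_inv_iff)
  obtain e where e: "e > 0" "\<And>i. i \<in> {1..n} \<Longrightarrow> free_factor M (x i [^] (e::nat))" using NF_inv_powers[OF M] by blast
  obtain H Zs where H: "\<And>j. H j \<in> fgmod_quot R (gen_power_ideal R n x e)" and l: "length Zs = Suc n"
    and Zs: "\<And>i. i \<le> n \<Longrightarrow> Zs ! i \<in> syz R i {H (n - i)}" and b: "built Zs M"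
    using built_from_Koszul_homology[of M n "\<lambda>i. x i [^] e", OF Mf e(2)] unfolding gen_power_ideal_def[symmetric] by blast
  have "Zs ! i \<in> add_cat R ?X" if i: "i \<le> n" for i
  proof (rule add_cat.base[OF _ syz_fgmod[OF Zs[OF i]]])
    have "Zs ! i \<in> syz R i (fgmod_quot R (gen_power_ideal R n x e))" using Zs[OF i] H by (auto simp: syz_def)
    then show "Zs ! i \<in> ?X" using e(1) i by (intro UN_I[of e] UN_I[of i]) auto
  qed
  then have "set Zs \<subseteq> add_cat R ?X" using l by (auto simp: in_set_conv_nth less_Suc_eq_le)
  then show "M \<in> filt_cat R ?X (n + 1)" using built_filt_cat[OF b _ Mf] l by simp
next
  fix M assume M: "M \<in> filt_cat R ?X (n + 1)"
  have "free_off p M" if p: "primeideal p R" "\<not> I \<subseteq> p" for p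
    using M free_off_power_quot[OF p] by (intro free_off_filt_cat[OF p(1), of M ?X n]) auto
  then show "M \<in> ?L" using filt_cat_fgmod[OF M] by (simp add: NF_inv_iff)
qed

lemma NF_inv_eq_union_filt:
  "NF_inv R (primes_over R I) =
    (\<Union>e\<in>{0<..}. \<Union>Y\<in>sum_cat R n (\<lambda>i. syz R i (fgmod_quot R (gen_power_ideal R n x e))). filt_cat R {Y} (n + 1))"
  (is "?L = ?R")
proof (intro equalityI subsetI)
  fix M assume M: "M \<in> ?L"
  then have Mf: "M \<in> fgmod R" by (simp add: NF_inv_iff)
  obtain e where e: "e > 0" "\<And>i. i \<in> {1..n} \<Longrightarrow> free_factor M (x i [^] (e::nat))" using NF_inv_powers[OF M] by blast
  obtain L Y where L: "L \<in> fgmod_quot R (gen_power_ideal R n x e)" and Y: "Y \<in> sum_cat R n (\<lambda>i. syz R i {L})"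
    and MY: "M \<in> filt_cat R {Y} (n + 1)"
    using filt_cat_of_free_factors[of M n "\<lambda>i. x i [^] e", OF Mf e(2)] unfolding gen_power_ideal_def[symmetric] by blast
  have "syz R i {L} \<subseteq> syz R i (fgmod_quot R (gen_power_ideal R n x e))" for i using L by (auto simp: syz_def)
  then have "Y \<in> sum_cat R n (\<lambda>i. syz R i (fgmod_quot R (gen_power_ideal R n x e)))"
    using Y unfolding sum_cat_def by blast
  then show "M \<in> ?R" using e(1) MY by auto
next
  fix M assume "M \<in> ?R"
  then obtain e Y where Y: "Y \<in> sum_cat R n (\<lambda>i. syz R i (fgmod_quot R (gen_power_ideal R n x e)))"
    and M: "M \<in> filt_cat R {Y} (n + 1)" by auto
  have "free_off p M" if p: "primeideal p R" "\<not> I \<subseteq> p" for p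
  proof -
    have "free_off p Y" using free_off_power_quot[OF p] syz_fgmod by (intro free_off_sum_cat[OF p(1) Y]) blast
    then show ?thesis using M by (intro free_off_filt_cat[OF p(1), of M "{Y}" n]) auto
  qed
  then show "M \<in> ?L" using filt_cat_fgmod[OF M] by (simp add: NF_inv_iff)
qed

text \<open>The homology modules are annihilated by powers of generators of \<^term>\<open>I\<close>, hence filtered by modules \<open>R/p\<close>
  with \<^term>\<open>p\<close> in \<open>V(I)\<close>; then their syzygies are in the extension closure of the syzygies of these.\<close>

lemma built_from_prime_syzygies:
  assumes M: "M \<in> NF_inv R (primes_over R I)" and ne: "I \<noteq> carrier R"
  shows "\<exists>Zs. built Zs M \<and> length Zs = Suc n \<and>
    (\<forall>i\<le>n. Zs ! i \<in> ext_cat R (syz R i (cyclic_quots R (primes_over R I))))"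
proof -
  have Mf: "M \<in> fgmod R" using M by (simp add: NF_inv_iff)
  obtain e where e: "e > 0" "\<And>i. i \<in> {1..n} \<Longrightarrow> free_factor M (x i [^] (e::nat))" using NF_inv_powers[OF M] by blast
  obtain H Zs where H: "\<And>j. H j \<in> fgmod_quot R (gen_power_ideal R n x e)" and l: "length Zs = Suc n"
    and Zs: "\<And>i. i \<le> n \<Longrightarrow> Zs ! i \<in> syz R i {H (n - i)}" and b: "built Zs M"
    using built_from_Koszul_homology[of M n "\<lambda>i. x i [^] e", OF Mf e(2)] unfolding gen_power_ideal_def[symmetric] by blast
  have V: "primes_over R (gen_power_ideal R n x e) = primes_over R I" by (rule primes_over_power[OF e(1)])
  have Vne: "primes_over R I \<noteq> {}" using proper_ideal_prime[OF ideal_I ne] by (auto simp: primes_over_def)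
  have "H j \<in> ext_cat R (cyclic_quots R (primes_over R I))" for j
    using prime_filtration[OF _ _ power_ideal_carrier, of "H j" e] H[of j] Vne V fgmod_quot_iff[OF ideal_power] by auto
  moreover have "cyclic_quots R (primes_over R I) \<subseteq> fgmod R" by (auto simp: cyclic_quots_def)
  ultimately have "Zs ! i \<in> ext_cat R (syz R i (cyclic_quots R (primes_over R I)))" if "i \<le> n" for i
    using ext_cat_syz Zs[OF that] by blast
  then show ?thesis using b l by blast
qed

lemma NF_inv_eq_ext:
  assumes ne: "I \<noteq> carrier R"
  shows "NF_inv R (primes_over R I) = ext_cat R (\<Union>i\<in>{0..n}. syz R i (cyclic_quots R (primes_over R I)))"
    (is "?L = ext_cat R ?X")
proof (intro equalityI subsetI)
  fix M assume M: "M \<in> ?L"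
  then have Mf: "M \<in> fgmod R" by (simp add: NF_inv_iff)
  obtain Zs where b: "built Zs M" and l: "length Zs = Suc n"
    and Zs: "\<And>i. i \<le> n \<Longrightarrow> Zs ! i \<in> ext_cat R (syz R i (cyclic_quots R (primes_over R I)))"
    using built_from_prime_syzygies[OF M ne] by blast
  have "Zs ! i \<in> ext_cat R ?X" if "i \<le> n" for i
    by (rule ext_cat_mono[OF Zs[OF that]]) (use that in auto)
  then have "set Zs \<subseteq> ext_cat R ?X" using l by (auto simp: in_set_conv_nth less_Suc_eq_le)
  then show "M \<in> ext_cat R ?X" using built_ext_cat[OF b _ _ Mf] ext_cat_fgmod by blast
next
  fix M assume M: "M \<in> ext_cat R ?X"
  have "free_off p M" if p: "primeideal p R" "\<not> I \<subseteq> p" for p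
    using free_off_ext_cat[OF p(1) M] cyclic_quot_free_off[OF p] by blast
  then show "M \<in> ?L" using ext_cat_fgmod[OF M] by (simp add: NF_inv_iff)
qed

lemma NF_inv_eq_filt_ext:
  assumes ne: "I \<noteq> carrier R"
  shows "NF_inv R (primes_over R I) =
    filt_cat R (sum_cat R n (\<lambda>i. ext_cat R (syz R i (cyclic_quots R (primes_over R I))))) (n + 1)" (is "?L = filt_cat R ?X _")
proof (intro equalityI subsetI)
  fix M assume M: "M \<in> ?L"
  then have Mf: "M \<in> fgmod R" by (simp add: NF_inv_iff)
  obtain Zs where b: "built Zs M" and l: "length Zs = Suc n"
    and Zs: "\<And>i. i \<le> n \<Longrightarrow> Zs ! i \<in> ext_cat R (syz R i (cyclic_quots R (primes_over R I)))"
    using built_from_prime_syzygies[OF M ne] by blast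
  obtain Y where Y: "Y \<in> ?X" "M \<in> filt_cat R {Y} (n + 1)"
    using filt_cat_sum[OF b Mf l, of "\<lambda>i. Zs ! i" "\<lambda>i. ext_cat R (syz R i (cyclic_quots R (primes_over R I)))"]
      Zs ext_cat_fgmod retr_refl by blast
  then show "M \<in> filt_cat R ?X (n + 1)" using filt_cat_mono[of "{Y}" ?X] by blast
next
  fix M assume M: "M \<in> filt_cat R ?X (n + 1)"
  have "free_off p M" if p: "primeideal p R" "\<not> I \<subseteq> p" for p
  proof -
    have "free_off p Y" if Y: "Y \<in> ?X" for Y
      using free_off_ext_cat[OF p(1)] cyclic_quot_free_off[OF p] by (intro free_off_sum_cat[OF p(1) Y]) blast
    then show ?thesis using M by (intro free_off_filt_cat[OF p(1), of M ?X n]) auto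
  qed
  then show "M \<in> ?L" using filt_cat_fgmod[OF M] by (simp add: NF_inv_iff)
qed

end

end

theorem theorem3p1:
  fixes R :: "('a, 'r) ring_scheme" and I :: "'a set" and x :: "nat \<Rightarrow> 'a" and n :: nat
  assumes "cring R" and "noetherian_ring R"
    and "ideal I R"
    and "x \<in> {1..n} \<rightarrow> carrier R" and "I = Idl\<^bsub>R\<^esub> (x ` {1..n})"
  shows "(\<forall>M\<in>fgmod R. \<forall>\<Omega>\<in>syz R 1 {M}. annihilates I (Ext R 1 M \<Omega>) \<longrightarrow>
            (\<exists>L\<in>fgmod_quot R I. \<exists>Y\<in>sum_cat R n (\<lambda>i. syz R i {L}). M \<in> filt_cat R {Y} (n + 1)))
       \<and> (I \<noteq> carrier R \<longrightarrow>
            NF_inv R (primes_over R I) = ext_cat R (\<Union>i\<in>{0..n}. syz R i (cyclic_quots R (primes_over R I))) \<and>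
            NF_inv R (primes_over R I) =
              filt_cat R (sum_cat R n (\<lambda>i. ext_cat R (syz R i (cyclic_quots R (primes_over R I))))) (n + 1))
       \<and> NF_inv R (primes_over R I) =
            filt_cat R (\<Union>e\<in>{0<..}. \<Union>i\<in>{0..n}. syz R i (fgmod_quot R (gen_power_ideal R n x e)))
              (n + 1)
       \<and> NF_inv R (primes_over R I) =
            (\<Union>e\<in>{0<..}. \<Union>Y\<in>sum_cat R n (\<lambda>i. syz R i (fgmod_quot R (gen_power_ideal R n x e))).
               filt_cat R {Y} (n + 1))"
proof -
  interpret noetherian_cring R by (rule noetherian_cring.intro[OF assms(1,2)])
  note x = assms(4,5)
  have "\<exists>L\<in>fgmod_quot R I. \<exists>Y\<in>sum_cat R n (\<lambda>i. syz R i {L}). M \<in> filt_cat R {Y} (n + 1)"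
    if M: "M \<in> fgmod R" and \<Omega>: "\<Omega> \<in> syz R 1 {M}" and ann: "annihilates I (Ext R 1 M \<Omega>)" for M \<Omega>
    unfolding x(2)
    by (rule filt_cat_of_free_factors[OF M Ext_annihilator_free_factor[OF M \<Omega> ann generator_in_ideal[OF x] generator_carrier[OF x]]])
  then show ?thesis
    using NF_inv_eq_ext[OF x] NF_inv_eq_filt_ext[OF x] NF_inv_eq_filt_union[OF x] NF_inv_eq_union_filt[OF x] by blast
qed

end
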